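(* Let $(\Delta,\pi:N\to N',R)$ be an enriched fan with partial compactification. There is an isomorphism of pro-algebraic groups over $\mathbb{C}$ $$\pi_1^{\mathrm{un}}((\Delta,N\to N',R),\omega_0)\cong\mathrm{Spec}\,H^0(B),$$ where $B$ is the bar construction on the tropical de Rham complex of $\Delta$ and $\mathrm{Spec}\,H^0(B)$ is a group scheme via the Hopf algebra structure on $H^0(B)$.
   Context: An enriched fan with partial compactification $(\Delta,\pi:N\to N',R)$ consists of a surjection $\pi:N\to N'$ of finitely generated free abelian groups (with dual inclusion $M'\hookrightarrow M$), a rational polyhedral fan $\Delta$ in $N'_{\mathbb{R}}$ having the origin as a cone, and a finite set $R$ of rational rays in $N_{\mathbb{R}}$. Tropical forms. The space of global tropical $1$-forms is $$\Omega^1(\Delta)=\{m\in M_{\mathbb{C}}: m \text{ vanishes on every }\rho\in R\text{ with }\pi(\rho)\subseteq|\Delta|\}\,/\,(\mathrm{Span}_{\mathbb{R}}(\Delta)^{\perp})_{\mathbb{C}},$$ with $\perp$ taken in $M'_{\mathbb{R}}\subseteq M_{\mathbb{R}}$. For $p\ge 1$, $\Omega^p(\Delta)$ is the image of $\bigwedge^p\Omega^1(\Delta)$ in $\prod_\sigma\bigwedge^p\big(M_{\mathbb{C}}/(\mathrm{Span}_{\mathbb{R}}(\sigma)^\perp)_{\mathbb{C}}\big)$, the product over maximal cones $\sigma$ of $\Delta$ ($\perp$ in $M'_{\mathbb{R}}$); wedge product makes $\Omega^\bullet(\Delta)$ a graded algebra with $\Omega^0(\Delta)=\mathbb{C}$,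 regarded as a differential graded algebra with zero differential (the tropical de Rham complex). Tropical bundles. A tropical vector bundle on the fan $\Delta$ is a constant sheaf (in the poset topology), i.e. a finite-dimensional $\mathbb{C}$-vector space $E_0$; an integrable connection is $\theta\in\Omega^1(\Delta)\otimes\mathrm{End}(E_0)$ with $\theta\wedge\theta=0$ in $\Omega^2(\Delta)\otimes\mathrm{End}(E_0)$. Morphisms are linear maps $T$ with $\theta_2T=T\theta_1$; tensor product is $(E_1\otimes E_2,\theta_1\otimes1+1\otimes\theta_2)$; the unit $\mathbf{1}$ is $(\mathbb{C},0)$. An object is unipotent if it has a finite filtration whose gradeds are direct sums of $\mathbf{1}$. The unipotent objects form a neutral Tannakian category with fiber functor $\omega_0(E)=E_0$, and $\pi_1^{\mathrm{un}}$ denotes the group of tensor automorphisms of $\omega_0$. Bar construction. Let $I\Omega=\Omega^{\ge1}(\Delta)$ and $B=\bigoplus_{s\ge0}(I\Omega)^{\otimes s}$, writing $\eta_1\otimes\cdots\otimes\eta_s$ as $[\eta_1|\cdots|\eta_s]$, graded by $\deg[\eta_1|\cdots|\eta_s]=\sum_i\deg(\eta_i)-s$. The differential is $$d[\eta_1|\cdots|\eta_s]=\sum_{i=1}^{s-1}(-1)^{i+1}[J\eta_1|\cdots|J\eta_{i-1}|J\eta_i\wedge\eta_{i+1}|\eta_{i+2}|\cdots|\eta_s],\qquad J\eta=(-1)^{\deg\eta}\eta.$$ The coproduct is deconcatenation $[\eta_1|\cdots|\eta_s]\mapsto\sum_{i=0}^s[\eta_1|\cdots|\eta_i]\otimes[\eta_{i+1}|\cdots|\eta_s]$,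 and the multiplication is the shuffle product $[\eta_1|\cdots|\eta_r]\cdot[\eta_{r+1}|\cdots|\eta_{r+s}]=\sum_\sigma\mathrm{sgn}(\sigma)[\eta_{\sigma(1)}|\cdots|\eta_{\sigma(r+s)}]$ over permutations with $\sigma^{-1}(1)<\dots<\sigma^{-1}(r)$ and $\sigma^{-1}(r+1)<\dots<\sigma^{-1}(r+s)$, the sign being the graded sign where $\eta_i$ has weight $\deg(\eta_i)-1$. $H^0(B)=\ker(d:B^0\to B^1)$. *)

theory Defs
  imports "HOL-Analysis.Polytope" "HOL-Algebra.Module" "HOL-Algebra.QuotRing" "HOL-Library.Poly_Mapping"
    "HOL-Combinatorics.Permutations"
begin

section \<open>Complex vector spaces and algebras on carrier sets\<close>

definition CC :: "complex ring" where
  "CC = \<lparr>carrier = UNIV, monoid.mult = (*), one = 1, ring.zero = 0, add = (+)\<rparr>"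

text \<open>Complex vector spaces are HOL-Algebra modules over \<open>CC\<close>. Where a module carries no product,
  the fields \<open>mult\<close> and \<open>one\<close> of the record are left unspecified.\<close>

type_synonym 'a cmod = "(complex, 'a) module"

definition complex_line :: "complex cmod" where
  "complex_line = \<lparr>carrier = UNIV, monoid.mult = (*), one = 1, ring.zero = 0, add = (+), module.smult = (*)\<rparr>"

definition gen_submodule :: "'a cmod \<Rightarrow> 'a set \<Rightarrow> 'a set" where
  "gen_submodule V S = \<Inter>{W. submodule W CC V \<and> S \<subseteq> W}"

definition finite_dim :: "'a cmod \<Rightarrow> bool" where
  "finite_dim V \<longleftrightarrow> (\<exists>S. finite S \<and> S \<subseteq> carrier V \<and> gen_submodule V S = carrier V)"

definition quot_module :: "'a cmod \<Rightarrow> 'a set \<Rightarrow> 'a set cmod" where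
  "quot_module V W = \<lparr>carrier = a_rcosets\<^bsub>V\<^esub> W, monoid.mult = undefined, one = undefined,
     ring.zero = W, add = (<+>\<^bsub>V\<^esub>), module.smult = (\<lambda>c X. \<Union>x\<in>X. W +>\<^bsub>V\<^esub> (c \<odot>\<^bsub>V\<^esub> x))\<rparr>"

definition product_module :: "'i set \<Rightarrow> ('i \<Rightarrow> 'a cmod) \<Rightarrow> ('i \<Rightarrow> 'a) cmod" where
  "product_module I V = \<lparr>carrier = (\<Pi>\<^sub>E i\<in>I. carrier (V i)),
     monoid.mult = (\<lambda>x y. \<lambda>i\<in>I. x i \<otimes>\<^bsub>V i\<^esub> y i), one = (\<lambda>i\<in>I. \<one>\<^bsub>V i\<^esub>),
     ring.zero = (\<lambda>i\<in>I. \<zero>\<^bsub>V i\<^esub>), add = (\<lambda>x y. \<lambda>i\<in>I. x i \<oplus>\<^bsub>V i\<^esub> y i),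
     module.smult = (\<lambda>c x. \<lambda>i\<in>I. c \<odot>\<^bsub>V i\<^esub> x i)\<rparr>"

text \<open>Maps between carriers are taken extensional, so that equality of maps is equality of
  functions.\<close>

definition lin_hom :: "'a cmod \<Rightarrow> 'b cmod \<Rightarrow> ('a \<Rightarrow> 'b) set" where
  "lin_hom V W = {f \<in> carrier V \<rightarrow>\<^sub>E carrier W.
     (\<forall>x\<in>carrier V. \<forall>y\<in>carrier V. f (x \<oplus>\<^bsub>V\<^esub> y) = f x \<oplus>\<^bsub>W\<^esub> f y) \<and>
     (\<forall>c. \<forall>x\<in>carrier V. f (c \<odot>\<^bsub>V\<^esub> x) = c \<odot>\<^bsub>W\<^esub> f x)}"

definition Hom_module :: "'a cmod \<Rightarrow> 'b cmod \<Rightarrow> ('a \<Rightarrow> 'b) cmod" where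
  "Hom_module V W = \<lparr>carrier = lin_hom V W, monoid.mult = undefined, one = undefined,
     ring.zero = (\<lambda>x\<in>carrier V. \<zero>\<^bsub>W\<^esub>), add = (\<lambda>f g. \<lambda>x\<in>carrier V. f x \<oplus>\<^bsub>W\<^esub> g x),
     module.smult = (\<lambda>c f. \<lambda>x\<in>carrier V. c \<odot>\<^bsub>W\<^esub> f x)\<rparr>"

abbreviation End_module :: "'a cmod \<Rightarrow> ('a \<Rightarrow> 'a) cmod" where
  "End_module V \<equiv> Hom_module V V"

definition alg_hom :: "'a cmod \<Rightarrow> 'b cmod \<Rightarrow> ('a \<Rightarrow> 'b) set" where
  "alg_hom A B = lin_hom A B \<inter> ring_hom A B"

subsection \<open>Spaces presented by generators and relations\<close>

definition free_module :: "'w set \<Rightarrow> ('w \<Rightarrow>\<^sub>0 complex) cmod" where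
  "free_module S = \<lparr>carrier = {x. Poly_Mapping.keys x \<subseteq> S}, monoid.mult = undefined, one = undefined,
     ring.zero = 0, add = (+), module.smult = (\<lambda>c. Poly_Mapping.map ((*) c))\<rparr>"

definition presented :: "'w set \<Rightarrow> ('w \<Rightarrow>\<^sub>0 complex) set \<Rightarrow> ('w \<Rightarrow>\<^sub>0 complex) set cmod" where
  "presented S Rel = quot_module (free_module S) (gen_submodule (free_module S) Rel)"

definition pclass :: "'w set \<Rightarrow> ('w \<Rightarrow>\<^sub>0 complex) set \<Rightarrow> ('w \<Rightarrow>\<^sub>0 complex) \<Rightarrow> ('w \<Rightarrow>\<^sub>0 complex) set" where
  "pclass S Rel x = gen_submodule (free_module S) Rel +>\<^bsub>free_module S\<^esub> x"

text \<open>\<open>lin_ext M \<phi>\<close> is the linear map into \<open>M\<close>, out of a presented space, with value \<open>\<phi> w\<close> on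
  the class of the generator \<open>w\<close>. Every use below has a \<open>\<phi>\<close> that respects the relations, so the
  choice of representative does not matter.\<close>

definition lin_ext :: "'a cmod \<Rightarrow> ('w \<Rightarrow> 'a) \<Rightarrow> ('w \<Rightarrow>\<^sub>0 complex) set \<Rightarrow> 'a" where
  "lin_ext M \<phi> X = (let x = (SOME x. x \<in> X) in
     \<Oplus>\<^bsub>M\<^esub>w\<in>Poly_Mapping.keys x. Poly_Mapping.lookup x w \<odot>\<^bsub>M\<^esub> \<phi> w)"

subsection \<open>Tensor products\<close>

definition tensor_rels :: "'a cmod \<Rightarrow> 'b cmod \<Rightarrow> ('a \<times> 'b \<Rightarrow>\<^sub>0 complex) set" where
  "tensor_rels V W =
     {Poly_Mapping.single (v \<oplus>\<^bsub>V\<^esub> v', w) 1 - Poly_Mapping.single (v, w) 1 - Poly_Mapping.single (v', w) 1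
       | v v' w. v \<in> carrier V \<and> v' \<in> carrier V \<and> w \<in> carrier W} \<union>
     {Poly_Mapping.single (v, w \<oplus>\<^bsub>W\<^esub> w') 1 - Poly_Mapping.single (v, w) 1 - Poly_Mapping.single (v, w') 1
       | v w w'. v \<in> carrier V \<and> w \<in> carrier W \<and> w' \<in> carrier W} \<union>
     {Poly_Mapping.single (c \<odot>\<^bsub>V\<^esub> v, w) 1 - Poly_Mapping.single (v, w) c
       | c v w. v \<in> carrier V \<and> w \<in> carrier W} \<union>
     {Poly_Mapping.single (v, c \<odot>\<^bsub>W\<^esub> w) 1 - Poly_Mapping.single (v, w) c
       | c v w. v \<in> carrier V \<and> w \<in> carrier W}"

definition tensor :: "'a cmod \<Rightarrow> 'b cmod \<Rightarrow> ('a \<times> 'b \<Rightarrow>\<^sub>0 complex) set cmod" where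
  "tensor V W = presented (carrier V \<times> carrier W) (tensor_rels V W)"

definition tens :: "'a cmod \<Rightarrow> 'b cmod \<Rightarrow> 'a \<Rightarrow> 'b \<Rightarrow> ('a \<times> 'b \<Rightarrow>\<^sub>0 complex) set" where
  "tens V W v w = pclass (carrier V \<times> carrier W) (tensor_rels V W) (Poly_Mapping.single (v, w) 1)"

definition tensor_map ::
  "'a cmod \<Rightarrow> 'b cmod \<Rightarrow> 'c cmod \<Rightarrow> 'd cmod \<Rightarrow> ('a \<Rightarrow> 'c) \<Rightarrow> ('b \<Rightarrow> 'd)
     \<Rightarrow> ('a \<times> 'b \<Rightarrow>\<^sub>0 complex) set \<Rightarrow> ('c \<times> 'd \<Rightarrow>\<^sub>0 complex) set" where
  "tensor_map V W V' W' f g =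
     (\<lambda>X\<in>carrier (tensor V W). lin_ext (tensor V' W') (\<lambda>(v, w). tens V' W' (f v) (g w)) X)"

subsection \<open>Exterior algebra\<close>

text \<open>The tensor algebra of \<open>V\<close> (words in elements of \<open>V\<close> modulo multilinearity) modulo the
  two-sided ideal generated by the squares \<open>v \<otimes> v\<close>.\<close>

definition ext_rels :: "'a cmod \<Rightarrow> ('a list \<Rightarrow>\<^sub>0 complex) set" where
  "ext_rels V =
     {Poly_Mapping.single (u @ [a \<oplus>\<^bsub>V\<^esub> b] @ v) 1 - Poly_Mapping.single (u @ [a] @ v) 1
        - Poly_Mapping.single (u @ [b] @ v) 1
       | u v a b. u \<in> lists (carrier V) \<and> v \<in> lists (carrier V) \<and> a \<in> carrier V \<and> b \<in> carrier V} \<union>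
     {Poly_Mapping.single (u @ [c \<odot>\<^bsub>V\<^esub> a] @ v) 1 - Poly_Mapping.single (u @ [a] @ v) c
       | u v a c. u \<in> lists (carrier V) \<and> v \<in> lists (carrier V) \<and> a \<in> carrier V} \<union>
     {Poly_Mapping.single (u @ [a, a] @ v) 1
       | u v a. u \<in> lists (carrier V) \<and> v \<in> lists (carrier V) \<and> a \<in> carrier V}"

definition ext_class :: "'a cmod \<Rightarrow> ('a list \<Rightarrow>\<^sub>0 complex) \<Rightarrow> ('a list \<Rightarrow>\<^sub>0 complex) set" where
  "ext_class V = pclass (lists (carrier V)) (ext_rels V)"

definition ext_algebra :: "'a cmod \<Rightarrow> ('a list \<Rightarrow>\<^sub>0 complex) set cmod" where
  "ext_algebra V = (let L = presented (lists (carrier V)) (ext_rels V) in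
     L\<lparr>monoid.mult := (\<lambda>X Y. lin_ext L (\<lambda>u. lin_ext L (\<lambda>v. ext_class V (Poly_Mapping.single (u @ v) 1)) Y) X),
       one := ext_class V (Poly_Mapping.single [] 1)\<rparr>)"

definition ext_power :: "'a cmod \<Rightarrow> nat \<Rightarrow> ('a list \<Rightarrow>\<^sub>0 complex) set set" where
  "ext_power V p =
     ext_class V ` {x. Poly_Mapping.keys x \<subseteq> {w \<in> lists (carrier V). length w = p}}"

definition ext_map :: "'b cmod \<Rightarrow> ('a \<Rightarrow> 'b) \<Rightarrow> ('a list \<Rightarrow>\<^sub>0 complex) set \<Rightarrow> ('b list \<Rightarrow>\<^sub>0 complex) set" where
  "ext_map W f = lin_ext (ext_algebra W) (\<lambda>w. ext_class W (Poly_Mapping.single (map f w) 1))"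

section \<open>Enriched fans with partial compactification\<close>

text \<open>A finitely generated free abelian group \<open>N\<close> is given as a lattice in the real vector space
  \<open>N \<otimes> \<real>\<close>, which is the whole type (possibly of dimension zero).\<close>

definition full_lattice :: "'v::real_vector set \<Rightarrow> bool" where
  "full_lattice N \<longleftrightarrow> (\<exists>B. finite B \<and> independent B \<and> span B = UNIV \<and>
     N = {\<Sum>b\<in>B. of_int (c b) *\<^sub>R b | c :: 'v \<Rightarrow> int. True})"

definition rational_cone :: "'v::real_vector set \<Rightarrow> 'v set \<Rightarrow> bool" where
  "rational_cone N \<sigma> \<longleftrightarrow> (\<exists>S. finite S \<and> S \<subseteq> N \<and> \<sigma> = convex_cone hull S)"

text \<open>The library counts the empty set among the faces of a convex set; it is not a cone.\<close>

definition rational_fan :: "'v::real_vector set \<Rightarrow> 'v set set \<Rightarrow> bool" where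
  "rational_fan N \<Delta> \<longleftrightarrow> finite \<Delta> \<and> (\<forall>\<sigma>\<in>\<Delta>. rational_cone N \<sigma>) \<and>
     (\<forall>\<sigma>\<in>\<Delta>. \<forall>\<tau>. \<tau> face_of \<sigma> \<and> \<tau> \<noteq> {} \<longrightarrow> \<tau> \<in> \<Delta>) \<and>
     (\<forall>\<sigma>\<in>\<Delta>. \<forall>\<tau>\<in>\<Delta>. (\<sigma> \<inter> \<tau>) face_of \<sigma> \<and> (\<sigma> \<inter> \<tau>) face_of \<tau>)"

definition rational_ray :: "'v::real_vector set \<Rightarrow> 'v set \<Rightarrow> bool" where
  "rational_ray N \<rho> \<longleftrightarrow> (\<exists>v\<in>N. v \<noteq> 0 \<and> \<rho> = {t *\<^sub>R v | t. 0 \<le> t})"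

text \<open>A surjection \<open>N \<rightarrow> N'\<close> is given by its unique real-linear extension \<open>\<pi>\<close>.\<close>

definition enriched_fan ::
  "'n::real_vector set \<Rightarrow> 'm::real_vector set \<Rightarrow> ('n \<Rightarrow> 'm) \<Rightarrow> 'm set set \<Rightarrow> 'n set set \<Rightarrow> bool" where
  "enriched_fan N N' \<pi> \<Delta> R \<longleftrightarrow> full_lattice N \<and> full_lattice N' \<and> linear \<pi> \<and> \<pi> ` N = N' \<and>
     rational_fan N' \<Delta> \<and> {0} \<in> \<Delta> \<and> finite R \<and> (\<forall>\<rho>\<in>R. rational_ray N \<rho>)"

definition maximal_cones :: "'m set set \<Rightarrow> 'm set set" where
  "maximal_cones \<Delta> = {\<sigma>\<in>\<Delta>. \<forall>\<tau>\<in>\<Delta>. \<sigma> \<subseteq> \<tau> \<longrightarrow> \<tau> = \<sigma>}"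

section \<open>Tropical forms\<close>

text \<open>\<open>M \<otimes> \<complex>\<close> is the space of real-linear functions \<open>N \<otimes> \<real> \<rightarrow> \<complex>\<close>.\<close>

definition MC :: "('n::real_vector \<Rightarrow> complex) cmod" where
  "MC = \<lparr>carrier = {m. linear m}, monoid.mult = undefined, one = undefined, ring.zero = (\<lambda>_. 0),
     add = (\<lambda>m m' x. m x + m' x), module.smult = (\<lambda>c m x. c * m x)\<rparr>"

text \<open>The orthogonal of the span of \<open>S\<close> in \<open>M' \<otimes> \<real>\<close>, viewed in \<open>M \<otimes> \<real>\<close> along \<open>\<pi>\<close>.\<close>

definition span_perp :: "('n::real_vector \<Rightarrow> 'm::real_vector) \<Rightarrow> 'm set \<Rightarrow> ('n \<Rightarrow> real) set" where
  "span_perp \<pi> S = {m \<circ> \<pi> | m. linear m \<and> (\<forall>x\<in>span S. m x = 0)}"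

definition complexify :: "('n \<Rightarrow> real) set \<Rightarrow> ('n \<Rightarrow> complex) set" where
  "complexify W = {\<lambda>x. Complex (f x) (g x) | f g. f \<in> W \<and> g \<in> W}"

definition regular_covectors ::
  "('n::real_vector \<Rightarrow> 'm::real_vector) \<Rightarrow> 'm set set \<Rightarrow> 'n set set \<Rightarrow> ('n \<Rightarrow> complex) cmod" where
  "regular_covectors \<pi> \<Delta> R =
     MC\<lparr>carrier := {m. linear m \<and> (\<forall>\<rho>\<in>R. \<pi> ` \<rho> \<subseteq> \<Union>\<Delta> \<longrightarrow> (\<forall>x\<in>\<rho>. m x = 0))}\<rparr>"

definition Omega1 ::
  "('n::real_vector \<Rightarrow> 'm::real_vector) \<Rightarrow> 'm set set \<Rightarrow> 'n set set \<Rightarrow> ('n \<Rightarrow> complex) set cmod" where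
  "Omega1 \<pi> \<Delta> R = quot_module (regular_covectors \<pi> \<Delta> R) (complexify (span_perp \<pi> (\<Union>\<Delta>)))"

definition local_covectors ::
  "('n::real_vector \<Rightarrow> 'm::real_vector) \<Rightarrow> 'm set \<Rightarrow> ('n \<Rightarrow> complex) set cmod" where
  "local_covectors \<pi> \<sigma> = quot_module MC (complexify (span_perp \<pi> \<sigma>))"

text \<open>The class of \<open>m\<close> in \<open>Omega1 \<pi> \<Delta> R\<close> goes to its class in \<open>local_covectors \<pi> \<sigma>\<close>.\<close>

definition restrict_covector ::
  "('n::real_vector \<Rightarrow> 'm::real_vector) \<Rightarrow> 'm set \<Rightarrow> ('n \<Rightarrow> complex) set \<Rightarrow> ('n \<Rightarrow> complex) set" where
  "restrict_covector \<pi> \<sigma> X = (\<Union>m\<in>X. complexify (span_perp \<pi> \<sigma>) +>\<^bsub>MC\<^esub> m)"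

type_synonym ('n, 'm) trop_form = "'m set \<Rightarrow> (('n \<Rightarrow> complex) set list \<Rightarrow>\<^sub>0 complex) set"

definition trop_ambient ::
  "('n::real_vector \<Rightarrow> 'm::real_vector) \<Rightarrow> 'm set set \<Rightarrow> ('n, 'm) trop_form cmod" where
  "trop_ambient \<pi> \<Delta> = product_module (maximal_cones \<Delta>) (\<lambda>\<sigma>. ext_algebra (local_covectors \<pi> \<sigma>))"

text \<open>For \<open>p = 0\<close> this is the diagonal copy of the complex numbers. For \<open>p = 1\<close> it is the image of
  \<open>Omega1\<close>, which embeds in the product because a covector in \<open>M'\<close> that vanishes on every maximal
  cone vanishes on the span of the fan.\<close>

definition Omega ::
  "('n::real_vector \<Rightarrow> 'm::real_vector) \<Rightarrow> 'm set set \<Rightarrow> 'n set set \<Rightarrow> nat \<Rightarrow> ('n, 'm) trop_form set" where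
  "Omega \<pi> \<Delta> R p =
     (\<lambda>\<xi>. \<lambda>\<sigma>\<in>maximal_cones \<Delta>. ext_map (local_covectors \<pi> \<sigma>) (restrict_covector \<pi> \<sigma>) \<xi>)
       ` ext_power (Omega1 \<pi> \<Delta> R) p"

text \<open>A graded algebra is its underlying algebra together with its homogeneous parts. It is
  regarded as a differential graded algebra whose differential is zero.\<close>

record 'o graded_algebra =
  total :: "'o cmod"
  part :: "nat \<Rightarrow> 'o set"

definition deg_part :: "'o graded_algebra \<Rightarrow> nat \<Rightarrow> 'o cmod" where
  "deg_part \<Omega> p = (total \<Omega>)\<lparr>carrier := part \<Omega> p\<rparr>"

definition trop_deRham ::
  "('n::real_vector \<Rightarrow> 'm::real_vector) \<Rightarrow> 'm set set \<Rightarrow> 'n set set \<Rightarrow> ('n, 'm) trop_form graded_algebra" where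
  "trop_deRham \<pi> \<Delta> R =
     \<lparr>total = (trop_ambient \<pi> \<Delta>)
        \<lparr>carrier := gen_submodule (trop_ambient \<pi> \<Delta>) (\<Union>p. Omega \<pi> \<Delta> R p)\<rparr>,
      part = Omega \<pi> \<Delta> R\<rparr>"

section \<open>Bundles with integrable connection\<close>

record ('o, 'e) conn =
  fibre :: "'e cmod"
  cform :: "('o \<times> ('e \<Rightarrow> 'e) \<Rightarrow>\<^sub>0 complex) set"

abbreviation form_tensor :: "'o graded_algebra \<Rightarrow> nat \<Rightarrow> 'a cmod \<Rightarrow> ('o \<times> 'a \<Rightarrow>\<^sub>0 complex) set cmod" where
  "form_tensor \<Omega> p V \<equiv> tensor (deg_part \<Omega> p) V"

abbreviation form_tens :: "'o graded_algebra \<Rightarrow> nat \<Rightarrow> 'a cmod \<Rightarrow> 'o \<Rightarrow> 'a \<Rightarrow> ('o \<times> 'a \<Rightarrow>\<^sub>0 complex) set" where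
  "form_tens \<Omega> p V \<equiv> tens (deg_part \<Omega> p) V"

text \<open>\<open>\<theta> \<and> \<theta>\<close>, where \<open>(\<omega> \<otimes> a) \<and> (\<omega>' \<otimes> a') = (\<omega> \<and> \<omega>') \<otimes> a a'\<close>.\<close>

definition wedge_square :: "'o graded_algebra \<Rightarrow> 'e cmod \<Rightarrow> ('o \<times> ('e \<Rightarrow> 'e) \<Rightarrow>\<^sub>0 complex) set
    \<Rightarrow> ('o \<times> ('e \<Rightarrow> 'e) \<Rightarrow>\<^sub>0 complex) set" where
  "wedge_square \<Omega> V \<theta> = (let P = form_tensor \<Omega> 2 (End_module V) in
     lin_ext P (\<lambda>(\<omega>, a). lin_ext P (\<lambda>(\<omega>', a').
       form_tens \<Omega> 2 (End_module V) (\<omega> \<otimes>\<^bsub>total \<Omega>\<^esub> \<omega>') (compose (carrier V) a a')) \<theta>) \<theta>)"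

definition integrable_conn :: "'o graded_algebra \<Rightarrow> ('o, 'e) conn \<Rightarrow> bool" where
  "integrable_conn \<Omega> X \<longleftrightarrow> Module.module CC (fibre X) \<and> finite_dim (fibre X) \<and>
     cform X \<in> carrier (form_tensor \<Omega> 1 (End_module (fibre X))) \<and>
     wedge_square \<Omega> (fibre X) (cform X) = \<zero>\<^bsub>form_tensor \<Omega> 2 (End_module (fibre X))\<^esub>"

text \<open>\<open>\<theta>\<^sub>2 T = T \<theta>\<^sub>1\<close> is an equation between one-forms with values in \<open>Hom(E\<^sub>1, E\<^sub>2)\<close>. The two fibres
  may live in different types.\<close>

definition conn_hom :: "'o graded_algebra \<Rightarrow> ('o, 'e) conn \<Rightarrow> ('o, 'f) conn \<Rightarrow> ('e \<Rightarrow> 'f) set" where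
  "conn_hom \<Omega> X Y = {T \<in> lin_hom (fibre X) (fibre Y).
     (let H = Hom_module (fibre X) (fibre Y) in
       lin_ext (form_tensor \<Omega> 1 H)
         (\<lambda>(\<omega>, a). form_tens \<Omega> 1 H \<omega> (compose (carrier (fibre X)) a T)) (cform Y) =
       lin_ext (form_tensor \<Omega> 1 H)
         (\<lambda>(\<omega>, a). form_tens \<Omega> 1 H \<omega> (compose (carrier (fibre X)) T a)) (cform X))}"

definition conn_iso :: "'o graded_algebra \<Rightarrow> ('o, 'e) conn \<Rightarrow> ('o, 'f) conn \<Rightarrow> ('e \<Rightarrow> 'f) set" where
  "conn_iso \<Omega> X Y =
     {T \<in> conn_hom \<Omega> X Y. bij_betw T (carrier (fibre X)) (carrier (fibre Y))}"

definition trivial_conn :: "'o graded_algebra \<Rightarrow> 'e cmod \<Rightarrow> ('o, 'e) conn" where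
  "trivial_conn \<Omega> V = \<lparr>fibre = V, cform = \<zero>\<^bsub>form_tensor \<Omega> 1 (End_module V)\<^esub>\<rparr>"

definition unit_conn :: "'o graded_algebra \<Rightarrow> ('o, complex) conn" where
  "unit_conn \<Omega> = trivial_conn \<Omega> complex_line"

definition unit_power :: "'o graded_algebra \<Rightarrow> nat \<Rightarrow> ('o, nat \<Rightarrow> complex) conn" where
  "unit_power \<Omega> k = trivial_conn \<Omega> (product_module {..<k} (\<lambda>_. complex_line))"

definition conn_tensor :: "'o graded_algebra \<Rightarrow> ('o, 'e) conn \<Rightarrow> ('o, 'f) conn
    \<Rightarrow> ('o, ('e \<times> 'f \<Rightarrow>\<^sub>0 complex) set) conn" where
  "conn_tensor \<Omega> X Y = (let V = fibre X; W = fibre Y; P = End_module (tensor V W) in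
     \<lparr>fibre = tensor V W,
      cform =
        lin_ext (form_tensor \<Omega> 1 P)
          (\<lambda>(\<omega>, a). form_tens \<Omega> 1 P \<omega> (tensor_map V W V W a (\<lambda>y. y))) (cform X)
        \<oplus>\<^bsub>form_tensor \<Omega> 1 P\<^esub>
        lin_ext (form_tensor \<Omega> 1 P)
          (\<lambda>(\<omega>, b). form_tens \<Omega> 1 P \<omega> (tensor_map V W V W (\<lambda>x. x) b)) (cform Y)\<rparr>)"

definition subobject :: "'o graded_algebra \<Rightarrow> ('o, 'e) conn \<Rightarrow> ('o, 'e) conn \<Rightarrow> bool" where
  "subobject \<Omega> Y X \<longleftrightarrow> integrable_conn \<Omega> Y \<and> integrable_conn \<Omega> X \<and>
     submodule (carrier (fibre Y)) CC (fibre X) \<and>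
     fibre Y = (fibre X)\<lparr>carrier := carrier (fibre Y)\<rparr> \<and>
     (\<lambda>y\<in>carrier (fibre Y). y) \<in> conn_hom \<Omega> Y X"

definition quotient_object ::
  "'o graded_algebra \<Rightarrow> ('o, 'e) conn \<Rightarrow> ('o, 'e) conn \<Rightarrow> ('o, 'e set) conn \<Rightarrow> bool" where
  "quotient_object \<Omega> X Y Q \<longleftrightarrow> integrable_conn \<Omega> Q \<and>
     fibre Q = quot_module (fibre X) (carrier (fibre Y)) \<and>
     (\<lambda>x\<in>carrier (fibre X). carrier (fibre Y) +>\<^bsub>fibre X\<^esub> x) \<in> conn_hom \<Omega> X Q"

definition unipotent :: "'o graded_algebra \<Rightarrow> ('o, 'e) conn \<Rightarrow> bool" where
  "unipotent \<Omega> X \<longleftrightarrow> (\<exists>n F. F n = X \<and> carrier (fibre (F 0)) = {\<zero>\<^bsub>fibre X\<^esub>} \<and>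
     (\<forall>i<n. subobject \<Omega> (F i) (F (Suc i)) \<and>
       (\<exists>Q k. quotient_object \<Omega> (F (Suc i)) (F i) Q \<and> conn_iso \<Omega> (unit_power \<Omega> k) Q \<noteq> {})))"

text \<open>The fibres of the objects range over all finite-dimensional complex vector spaces whose
  elements, with arbitrary operations, are taken from the type \<open>nat \<Rightarrow> complex\<close>. Every
  finite-dimensional complex vector space is isomorphic to one of these, so this is an
  essentially small model of the whole category.\<close>

type_synonym 'o object = "('o, nat \<Rightarrow> complex) conn"

definition unipotent_objects :: "'o graded_algebra \<Rightarrow> 'o object set" where
  "unipotent_objects \<Omega> = {X. integrable_conn \<Omega> X \<and> unipotent \<Omega> X}"

section \<open>Tensor automorphisms of the fiber functor\<close>

text \<open>For a commutative algebra \<open>A\<close>, the \<open>A\<close>-points are the families of \<open>A\<close>-linear automorphisms of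
  the scalar extensions \<open>E\<^sub>0 \<otimes> A\<close> that are natural and compatible with tensor products and the unit.\<close>

abbreviation scalar_ext :: "('o, 'e) conn \<Rightarrow> 'u cmod \<Rightarrow> ('e \<times> 'u \<Rightarrow>\<^sub>0 complex) set cmod" where
  "scalar_ext X A \<equiv> tensor (fibre X) A"

abbreviation scalar_ext_map :: "('o, 'e) conn \<Rightarrow> ('o, 'f) conn \<Rightarrow> 'u cmod \<Rightarrow> ('e \<Rightarrow> 'f)
    \<Rightarrow> ('e \<times> 'u \<Rightarrow>\<^sub>0 complex) set \<Rightarrow> ('f \<times> 'u \<Rightarrow>\<^sub>0 complex) set" where
  "scalar_ext_map X Y A T \<equiv> tensor_map (fibre X) A (fibre Y) A T (\<lambda>a. a)"

definition scalar_aut :: "'e cmod \<Rightarrow> 'u cmod \<Rightarrow> (('e \<times> 'u \<Rightarrow>\<^sub>0 complex) set \<Rightarrow> ('e \<times> 'u \<Rightarrow>\<^sub>0 complex) set) set" where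
  "scalar_aut V A = {l \<in> lin_hom (tensor V A) (tensor V A).
     bij_betw l (carrier (tensor V A)) (carrier (tensor V A)) \<and>
     (\<forall>a\<in>carrier A. \<forall>u\<in>carrier (tensor V A).
        l (tensor_map V A V A (\<lambda>v. v) (\<lambda>b. a \<otimes>\<^bsub>A\<^esub> b) u) =
        tensor_map V A V A (\<lambda>v. v) (\<lambda>b. a \<otimes>\<^bsub>A\<^esub> b) (l u))}"

text \<open>The canonical pairing \<open>(V \<otimes> A) \<times> (W \<otimes> A) \<rightarrow> (V \<otimes> W) \<otimes> A\<close>, which identifies
  \<open>(V \<otimes> A) \<otimes>\<^sub>A (W \<otimes> A)\<close> with \<open>(V \<otimes> W) \<otimes> A\<close>.\<close>

definition scalar_pairing :: "'e cmod \<Rightarrow> 'f cmod \<Rightarrow> 'u cmod \<Rightarrow> ('e \<times> 'u \<Rightarrow>\<^sub>0 complex) set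
    \<Rightarrow> ('f \<times> 'u \<Rightarrow>\<^sub>0 complex) set \<Rightarrow> (('e \<times> 'f \<Rightarrow>\<^sub>0 complex) set \<times> 'u \<Rightarrow>\<^sub>0 complex) set" where
  "scalar_pairing V W A u v = (let P = tensor (tensor V W) A in
     lin_ext P (\<lambda>(x, a). lin_ext P (\<lambda>(y, b).
       tens (tensor V W) A (tens V W x y) (a \<otimes>\<^bsub>A\<^esub> b)) v) u)"

type_synonym ('o, 'u) aut_family =
  "'o object \<Rightarrow> ((nat \<Rightarrow> complex) \<times> 'u \<Rightarrow>\<^sub>0 complex) set \<Rightarrow> ((nat \<Rightarrow> complex) \<times> 'u \<Rightarrow>\<^sub>0 complex) set"

text \<open>Tensor products and the unit object are used through isomorphisms \<open>T\<close> onto objects of the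
  model, since their own fibres have other types.\<close>

definition tensor_auts :: "'o graded_algebra \<Rightarrow> 'u cmod \<Rightarrow> ('o, 'u) aut_family set" where
  "tensor_auts \<Omega> A = {l \<in> (\<Pi>\<^sub>E X\<in>unipotent_objects \<Omega>. scalar_aut (fibre X) A).
     (\<forall>X\<in>unipotent_objects \<Omega>. \<forall>Y\<in>unipotent_objects \<Omega>. \<forall>T\<in>conn_hom \<Omega> X Y.
        \<forall>u\<in>carrier (scalar_ext X A).
          l Y (scalar_ext_map X Y A T u) = scalar_ext_map X Y A T (l X u)) \<and>
     (\<forall>X\<in>unipotent_objects \<Omega>. \<forall>Y\<in>unipotent_objects \<Omega>. \<forall>Z\<in>unipotent_objects \<Omega>.
        \<forall>T\<in>conn_iso \<Omega> (conn_tensor \<Omega> X Y) Z.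
        \<forall>u\<in>carrier (scalar_ext X A). \<forall>v\<in>carrier (scalar_ext Y A).
          l Z (scalar_ext_map (conn_tensor \<Omega> X Y) Z A T (scalar_pairing (fibre X) (fibre Y) A u v)) =
          scalar_ext_map (conn_tensor \<Omega> X Y) Z A T
            (scalar_pairing (fibre X) (fibre Y) A (l X u) (l Y v))) \<and>
     (\<forall>Z\<in>unipotent_objects \<Omega>. \<forall>T\<in>conn_iso \<Omega> (unit_conn \<Omega>) Z.
        \<forall>u\<in>carrier (scalar_ext (unit_conn \<Omega>) A).
          l Z (scalar_ext_map (unit_conn \<Omega>) Z A T u) = scalar_ext_map (unit_conn \<Omega>) Z A T u)}"

definition pi1_un :: "'o graded_algebra \<Rightarrow> 'u cmod \<Rightarrow> ('o, 'u) aut_family monoid" where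
  "pi1_un \<Omega> A = \<lparr>carrier = tensor_auts \<Omega> A,
     monoid.mult = (\<lambda>l l'. \<lambda>X\<in>unipotent_objects \<Omega>. compose (carrier (scalar_ext X A)) (l X) (l' X)),
     one = (\<lambda>X\<in>unipotent_objects \<Omega>. \<lambda>u\<in>carrier (scalar_ext X A). u)\<rparr>"

text \<open>Base change along \<open>f : A \<rightarrow> A'\<close>: the unique \<open>A'\<close>-linear family that restricts to the given
  one.\<close>

definition pi1_un_map :: "'o graded_algebra \<Rightarrow> 'u cmod \<Rightarrow> 'u cmod \<Rightarrow> ('u \<Rightarrow> 'u)
    \<Rightarrow> ('o, 'u) aut_family \<Rightarrow> ('o, 'u) aut_family" where
  "pi1_un_map \<Omega> A A' f l = (THE l'. l' \<in> tensor_auts \<Omega> A' \<and>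
     (\<forall>X\<in>unipotent_objects \<Omega>. \<forall>u\<in>carrier (scalar_ext X A).
        l' X (tensor_map (fibre X) A (fibre X) A' (\<lambda>e. e) f u) =
        tensor_map (fibre X) A (fibre X) A' (\<lambda>e. e) f (l X u)))"

section \<open>Bar construction\<close>

text \<open>The sum of all tensor powers of \<open>I\<Omega>\<close> is spanned by words \<open>[\<eta>\<^sub>1|\<dots>|\<eta>\<^sub>s]\<close> in homogeneous
  elements of positive degree, modulo linearity in each letter. A letter \<open>(p, \<eta>)\<close> is a form \<open>\<eta>\<close>
  together with its degree \<open>p\<close>.\<close>

type_synonym 'o bar_word = "(nat \<times> 'o) list"

definition bar_words :: "'o graded_algebra \<Rightarrow> 'o bar_word set" where
  "bar_words \<Omega> = lists {(p, \<eta>). 1 \<le> p \<and> \<eta> \<in> part \<Omega> p}"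

definition bar_rels :: "'o graded_algebra \<Rightarrow> ('o bar_word \<Rightarrow>\<^sub>0 complex) set" where
  "bar_rels \<Omega> =
     {Poly_Mapping.single (u @ [(p, \<eta> \<oplus>\<^bsub>total \<Omega>\<^esub> \<zeta>)] @ v) 1
        - Poly_Mapping.single (u @ [(p, \<eta>)] @ v) 1 - Poly_Mapping.single (u @ [(p, \<zeta>)] @ v) 1
       | u v p \<eta> \<zeta>. u \<in> bar_words \<Omega> \<and> v \<in> bar_words \<Omega> \<and> 1 \<le> p \<and> \<eta> \<in> part \<Omega> p \<and> \<zeta> \<in> part \<Omega> p} \<union>
     {Poly_Mapping.single (u @ [(p, c \<odot>\<^bsub>total \<Omega>\<^esub> \<eta>)] @ v) 1 - Poly_Mapping.single (u @ [(p, \<eta>)] @ v) c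
       | u v p \<eta> c. u \<in> bar_words \<Omega> \<and> v \<in> bar_words \<Omega> \<and> 1 \<le> p \<and> \<eta> \<in> part \<Omega> p}"

definition bar_class :: "'o graded_algebra \<Rightarrow> ('o bar_word \<Rightarrow>\<^sub>0 complex) \<Rightarrow> ('o bar_word \<Rightarrow>\<^sub>0 complex) set" where
  "bar_class \<Omega> = pclass (bar_words \<Omega>) (bar_rels \<Omega>)"

text \<open>The permutations \<open>\<sigma>\<close> of the formula for the shuffle product, acting on positions counted
  from zero, and the Koszul sign for letters of weight \<open>deg \<eta> - 1\<close>: each pair of letters whose
  order is reversed contributes \<open>-1\<close> to the product of its weights.\<close>

definition shuffle_perms :: "nat \<Rightarrow> nat \<Rightarrow> (nat \<Rightarrow> nat) set" where
  "shuffle_perms r s = {\<sigma>. \<sigma> permutes {..<r + s} \<and>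
     strict_mono_on {..<r} (inv_into UNIV \<sigma>) \<and> strict_mono_on {r..<r + s} (inv_into UNIV \<sigma>)}"

definition shuffle_sign :: "'o bar_word \<Rightarrow> (nat \<Rightarrow> nat) \<Rightarrow> complex" where
  "shuffle_sign w \<sigma> = (\<Prod>(i, j)\<in>{(i, j). i < j \<and> j < length w \<and> inv_into UNIV \<sigma> j < inv_into UNIV \<sigma> i}.
     (-1) ^ ((fst (w ! i) - 1) * (fst (w ! j) - 1)))"

definition shuffle :: "'o bar_word \<Rightarrow> 'o bar_word \<Rightarrow> ('o bar_word \<Rightarrow>\<^sub>0 complex)" where
  "shuffle u v = (\<Sum>\<sigma>\<in>shuffle_perms (length u) (length v).
     Poly_Mapping.single (map (\<lambda>i. (u @ v) ! \<sigma> i) [0..<length u + length v]) (shuffle_sign (u @ v) \<sigma>))"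

definition bar :: "'o graded_algebra \<Rightarrow> ('o bar_word \<Rightarrow>\<^sub>0 complex) set cmod" where
  "bar \<Omega> = (let B = presented (bar_words \<Omega>) (bar_rels \<Omega>) in
     B\<lparr>monoid.mult := (\<lambda>X Y. lin_ext B (\<lambda>u. lin_ext B (\<lambda>v. bar_class \<Omega> (shuffle u v)) Y) X),
       one := bar_class \<Omega> (Poly_Mapping.single [] 1)\<rparr>)"

definition bar_deg :: "'o bar_word \<Rightarrow> int" where
  "bar_deg w = int (sum_list (map fst w)) - int (length w)"

definition bar_part :: "'o graded_algebra \<Rightarrow> int \<Rightarrow> ('o bar_word \<Rightarrow>\<^sub>0 complex) set set" where
  "bar_part \<Omega> k = bar_class \<Omega> ` {x. Poly_Mapping.keys x \<subseteq> {w \<in> bar_words \<Omega>. bar_deg w = k}}"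

definition bar_J :: "'o graded_algebra \<Rightarrow> nat \<times> 'o \<Rightarrow> nat \<times> 'o" where
  "bar_J \<Omega> = (\<lambda>(p, \<eta>). (p, ((-1) ^ p) \<odot>\<^bsub>total \<Omega>\<^esub> \<eta>))"

definition letter_wedge :: "'o graded_algebra \<Rightarrow> nat \<times> 'o \<Rightarrow> nat \<times> 'o \<Rightarrow> nat \<times> 'o" where
  "letter_wedge \<Omega> = (\<lambda>(p, \<eta>) (q, \<zeta>). (p + q, \<eta> \<otimes>\<^bsub>total \<Omega>\<^esub> \<zeta>))"

text \<open>The summation index counts letters from one, so the \<open>i\<close>-th letter is \<open>w ! (i - 1)\<close>.\<close>

definition bar_d_word :: "'o graded_algebra \<Rightarrow> 'o bar_word \<Rightarrow> ('o bar_word \<Rightarrow>\<^sub>0 complex)" where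
  "bar_d_word \<Omega> w = (\<Sum>i\<in>{1..<length w}.
     Poly_Mapping.single
       (map (bar_J \<Omega>) (take (i - 1) w) @ [letter_wedge \<Omega> (bar_J \<Omega> (w ! (i - 1))) (w ! i)]
          @ drop (i + 1) w)
       ((-1) ^ (i + 1)))"

definition bar_d :: "'o graded_algebra \<Rightarrow> ('o bar_word \<Rightarrow>\<^sub>0 complex) set \<Rightarrow> ('o bar_word \<Rightarrow>\<^sub>0 complex) set" where
  "bar_d \<Omega> = lin_ext (bar \<Omega>) (\<lambda>w. bar_class \<Omega> (bar_d_word \<Omega> w))"

definition bar_comult :: "'o graded_algebra \<Rightarrow> ('o bar_word \<Rightarrow>\<^sub>0 complex) set
    \<Rightarrow> (('o bar_word \<Rightarrow>\<^sub>0 complex) set \<times> ('o bar_word \<Rightarrow>\<^sub>0 complex) set \<Rightarrow>\<^sub>0 complex) set" where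
  "bar_comult \<Omega> = lin_ext (tensor (bar \<Omega>) (bar \<Omega>)) (\<lambda>w.
     \<Oplus>\<^bsub>tensor (bar \<Omega>) (bar \<Omega>)\<^esub>i\<in>{..length w}.
       tens (bar \<Omega>) (bar \<Omega>) (bar_class \<Omega> (Poly_Mapping.single (take i w) 1))
         (bar_class \<Omega> (Poly_Mapping.single (drop i w) 1)))"

definition bar_counit :: "('o bar_word \<Rightarrow>\<^sub>0 complex) set \<Rightarrow> complex" where
  "bar_counit = lin_ext complex_line (\<lambda>w. if w = [] then 1 else 0)"

definition H0_bar :: "'o graded_algebra \<Rightarrow> ('o bar_word \<Rightarrow>\<^sub>0 complex) set cmod" where
  "H0_bar \<Omega> = (bar \<Omega>)\<lparr>carrier := {X \<in> bar_part \<Omega> 0. bar_d \<Omega> X = \<zero>\<^bsub>bar \<Omega>\<^esub>}\<rparr>"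

text \<open>The deconcatenation of an element of \<open>H\<^sup>0\<close>, as an element of the subspace \<open>H\<^sup>0 \<otimes> H\<^sup>0\<close> of
  \<open>B \<otimes> B\<close>.\<close>

definition H0_comult :: "'o graded_algebra \<Rightarrow> ('o bar_word \<Rightarrow>\<^sub>0 complex) set
    \<Rightarrow> (('o bar_word \<Rightarrow>\<^sub>0 complex) set \<times> ('o bar_word \<Rightarrow>\<^sub>0 complex) set \<Rightarrow>\<^sub>0 complex) set" where
  "H0_comult \<Omega> X = (THE t. t \<in> carrier (tensor (H0_bar \<Omega>) (H0_bar \<Omega>)) \<and>
     tensor_map (H0_bar \<Omega>) (H0_bar \<Omega>) (bar \<Omega>) (bar \<Omega>) (\<lambda>x. x) (\<lambda>x. x) t = bar_comult \<Omega> X)"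

section \<open>Group schemes as functors of points\<close>

definition Spec_group :: "'h cmod \<Rightarrow> ('h \<Rightarrow> ('h \<times> 'h \<Rightarrow>\<^sub>0 complex) set) \<Rightarrow> ('h \<Rightarrow> complex)
    \<Rightarrow> 'u cmod \<Rightarrow> ('h \<Rightarrow> 'u) monoid" where
  "Spec_group H comul counit A = \<lparr>carrier = alg_hom H A,
     monoid.mult = (\<lambda>f g. \<lambda>x\<in>carrier H.
       lin_ext A (\<lambda>(a, b). a \<otimes>\<^bsub>A\<^esub> b) (tensor_map H H A A f g (comul x))),
     one = (\<lambda>x\<in>carrier H. counit x \<odot>\<^bsub>A\<^esub> \<one>\<^bsub>A\<^esub>)\<rparr>"

definition Spec_map :: "'h cmod \<Rightarrow> 'u cmod \<Rightarrow> 'u cmod \<Rightarrow> ('u \<Rightarrow> 'u) \<Rightarrow> ('h \<Rightarrow> 'u) \<Rightarrow> ('h \<Rightarrow> 'u)" where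
  "Spec_map H A A' f g = compose (carrier H) f g"

text \<open>Isomorphism of group-valued functors on the commutative complex algebras whose elements are
  taken from the type \<open>'u\<close>. The type is arbitrary; as soon as it is large enough to contain the
  coordinate algebra of the representing scheme, this is isomorphism of affine group schemes by
  the Yoneda lemma.\<close>

definition isomorphic_group_functors ::
  "('u cmod \<Rightarrow> 'g monoid) \<Rightarrow> ('u cmod \<Rightarrow> 'u cmod \<Rightarrow> ('u \<Rightarrow> 'u) \<Rightarrow> 'g \<Rightarrow> 'g) \<Rightarrow>
   ('u cmod \<Rightarrow> 'h monoid) \<Rightarrow> ('u cmod \<Rightarrow> 'u cmod \<Rightarrow> ('u \<Rightarrow> 'u) \<Rightarrow> 'h \<Rightarrow> 'h) \<Rightarrow> bool" where
  "isomorphic_group_functors F Fmap G Gmap \<longleftrightarrow> (\<exists>\<Phi>.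
     (\<forall>A. Module.algebra CC A \<longrightarrow> group (F A) \<and> group (G A) \<and> \<Phi> A \<in> iso (F A) (G A)) \<and>
     (\<forall>A A' f. Module.algebra CC A \<and> Module.algebra CC A' \<and> f \<in> alg_hom A A' \<longrightarrow>
        (\<forall>x\<in>carrier (F A). \<Phi> A' (Fmap A A' f x) = Gmap A A' f (\<Phi> A x))))"

end

theory Submission
 imports Defs
begin

text \<open>Choose a basis \<open>D\<close> of the space of one-forms. A connection on \<open>E\<close> becomes a family of
  endomorphisms \<open>a i\<close>, \<open>i \<in> D\<close>; integrability is a system of quadratic relations dual to the wedge
  product, and unipotence says that all products \<open>a I\<close> along words \<open>I\<close> of some length vanish. An
  element of degree zero of the bar construction is a finitely supported function on words, and it is
  a cocycle iff it satisfies the same quadratic relations. Hence the matrix coefficients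
  \<open>I \<mapsto> \<mu> (a I e)\<close> of unipotent connections are exactly the elements of \<open>H\<^sup>0\<close>, because the
  truncations of \<open>H\<^sup>0\<close> are themselves unipotent connections.

  By naturality a tensor automorphism over \<open>A\<close> is determined by its matrix coefficients, that is, by
  a linear map \<open>g\<close> from \<open>H\<^sup>0\<close> to \<open>A\<close>. A word acts on a tensor product through all ways to
  distribute its letters, which is the shuffle product, so compatibility with tensor products means
  that \<open>g\<close> is multiplicative; composition corresponds to deconcatenation. Conversely, extend a
  character \<open>g\<close> linearly to all words, with values \<open>\<gamma> I\<close>. Then \<open>\<Sum>I. a I \<otimes> \<gamma> I\<close> is the automorphism
  attached to \<open>g\<close>; it is invertible because \<open>\<gamma>\<close> is, for convolution, as \<open>\<gamma> [] = 1\<close>.\<close>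

section \<open>Linear algebra on carrier sets\<close>

text \<open>A word in \<open>D\<close> is rarely a cocycle, so the values \<gamma> I rest on a
  chosen retraction of the bar construction onto \<open>H0\<close>, and \<gamma> need not respect
  shuffles word by word. Every identity is therefore tested on matrix coefficients, which are
  cocycles and on which the choice drops out. The same device proves facts about \<open>H0\<close>
  itself: its closure under products follows from the unipotence of tensor products, with no
  computation of the differential of a shuffle, and the group axioms of the spectrum are transported
  from the automorphisms instead of being derived from an antipode.

  An automorphism sees only objects with fibres in one fixed type, while tensor products, the unit
  and the universal objects have fibres elsewhere; these are used through isomorphic model objects.
  The value of an automorphism at a matrix coefficient depends on the coefficient alone because two
  objects sharing it map to the same universal object.

  The fibres and \<open>A\<close> are carrier sets, and \<open>A\<close> may be
  infinite-dimensional; equations in tensor products are checked after contraction with linear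
  functionals, which separate points.\<close>

abbreviation vadd ("_ \<oplus>[_] _" [65, 0, 66] 65) where "x \<oplus>[V] y \<equiv> x \<oplus>\<^bsub>V\<^esub> y"
abbreviation vmult ("_ \<otimes>[_] _" [70, 0, 71] 70) where "x \<otimes>[V] y \<equiv> x \<otimes>\<^bsub>V\<^esub> y"
abbreviation vsmult ("_ \<odot>[_] _" [70, 0, 71] 70) where "c \<odot>[V] x \<equiv> c \<odot>\<^bsub>V\<^esub> x"
abbreviation vzero ("\<zero>[_]") where "\<zero>[V] \<equiv> \<zero>\<^bsub>V\<^esub>"
abbreviation vone ("\<one>[_]") where "\<one>[V] \<equiv> \<one>\<^bsub>V\<^esub>"

abbreviation vs :: "'a cmod => bool" where
 "vs \<equiv> Module.module CC"

lemma CC_simps [simp]: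
 "carrier CC = UNIV" "x \<otimes>[CC] y = x * y" "\<one>[CC] = 1" "\<zero>[CC] = 0" "x \<oplus>[CC] y = x + y"
 by (simp_all add: CC_def)

lemma CC_cring: "cring CC"
proof (rule cringI)
 show "abelian_group CC"
 proof (rule abelian_groupI)
  fix x :: complex
  show "\<exists>y\<in>carrier CC. y \<oplus>[CC] x = \<zero>[CC]"
   by (rule bexI[of _ "- x"]) auto
 qed auto
 show "Group.comm_monoid CC"
  by (rule comm_monoidI) auto
qed (auto simp: algebra_simps)

lemma CC_minus [simp]: "\<ominus>\<^bsub>CC\<^esub> x = - x"
proof -
 interpret cring CC by (rule CC_cring)
 show ?thesis using minus_equality[of "- x" x] by simp
qed

text \<open>No inverse has to be supplied: since \<open>0\<close> times \<open>x\<close> is zero,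
  \<open>-1\<close> times \<open>x\<close> is an inverse of \<open>x\<close>.\<close>

lemma vsI:
 assumes "\<zero>[V] : carrier V"
  and "\<And>x y. x : carrier V ==> y : carrier V ==> x \<oplus>[V] y : carrier V"
  and "\<And>c x. x : carrier V ==> c \<odot>[V] x : carrier V"
  and "\<And>x y z. x : carrier V ==> y : carrier V ==> z : carrier V ==>
      (x \<oplus>[V] y) \<oplus>[V] z = x \<oplus>[V] (y \<oplus>[V] z)"
  and "\<And>x y. x : carrier V ==> y : carrier V ==> x \<oplus>[V] y = y \<oplus>[V] x"
  and "\<And>x. x : carrier V ==> \<zero>[V] \<oplus>[V] x = x"
  and "\<And>c d x. x : carrier V ==> (c + d) \<odot>[V] x = c \<odot>[V] x \<oplus>[V] d \<odot>[V] x"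
  and "\<And>c x y. x : carrier V ==> y : carrier V ==> c \<odot>[V] (x \<oplus>[V] y) = c \<odot>[V] x \<oplus>[V] c \<odot>[V] y"
  and "\<And>c d x. x : carrier V ==> (c * d) \<odot>[V] x = c \<odot>[V] (d \<odot>[V] x)"
  and "\<And>x. x : carrier V ==> 1 \<odot>[V] x = x"
  and "\<And>x. x : carrier V ==> 0 \<odot>[V] x = \<zero>[V]"
 shows "vs V"
proof (rule Module.moduleI[OF CC_cring])
 show "abelian_group V"
 proof (rule abelian_groupI)
  fix x assume x: "x : carrier V"
  have "(-1) \<odot>[V] x \<oplus>[V] x = \<zero>[V]"
   using assms(7)[of x "-1" 1] assms(10,11) x by simp
  then show "\<exists>y\<in>carrier V. y \<oplus>[V] x = \<zero>[V]" using assms(3) x by blast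
 qed (use assms in auto)
qed (use assms in auto)

lemma vs_abelian_group: "vs V ==> abelian_group V"
 by (simp add: Module.module_def)

lemma vs_abelian_monoid: "vs V ==> abelian_monoid V"
 using vs_abelian_group abelian_group_def by blast

lemma vs_zero [simp, intro]: "vs V ==> \<zero>[V] : carrier V"
 by (simp add: abelian_monoid.zero_closed vs_abelian_monoid)

lemma vs_add [simp, intro]: "vs V ==> x : carrier V ==> y : carrier V ==> x \<oplus>[V] y : carrier V"
 by (simp add: abelian_monoid.a_closed vs_abelian_monoid)

lemma vs_smult [simp, intro]: "vs V ==> x : carrier V ==> c \<odot>[V] x : carrier V"
 by (simp add: Module.module.smult_closed)

lemma vs_assoc: "vs V ==> x : carrier V ==> y : carrier V ==> z : carrier V ==>
  (x \<oplus>[V] y) \<oplus>[V] z = x \<oplus>[V] (y \<oplus>[V] z)"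
 by (simp add: abelian_monoid.a_assoc vs_abelian_monoid)

lemma vs_comm: "vs V ==> x : carrier V ==> y : carrier V ==> x \<oplus>[V] y = y \<oplus>[V] x"
 by (simp add: abelian_monoid.a_comm vs_abelian_monoid)

lemma vs_lcomm: "vs V ==> x : carrier V ==> y : carrier V ==> z : carrier V ==>
  x \<oplus>[V] (y \<oplus>[V] z) = y \<oplus>[V] (x \<oplus>[V] z)"
 by (simp add: abelian_monoid.a_lcomm vs_abelian_monoid)

lemmas vs_ac = vs_assoc vs_comm vs_lcomm

lemma vs_l_zero [simp]: "vs V ==> x : carrier V ==> \<zero>[V] \<oplus>[V] x = x"
 by (simp add: abelian_monoid.l_zero vs_abelian_monoid)

lemma vs_r_zero [simp]: "vs V ==> x : carrier V ==> x \<oplus>[V] \<zero>[V] = x"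
 by (simp add: abelian_monoid.r_zero vs_abelian_monoid)

lemma vs_l_distr: "vs V ==> x : carrier V ==> (c + d) \<odot>[V] x = c \<odot>[V] x \<oplus>[V] d \<odot>[V] x"
 using Module.module.smult_l_distr[of CC V c d x] by simp

lemma vs_r_distr: "vs V ==> x : carrier V ==> y : carrier V ==>
  c \<odot>[V] (x \<oplus>[V] y) = c \<odot>[V] x \<oplus>[V] c \<odot>[V] y"
 using Module.module.smult_r_distr[of CC V c x y] by simp

lemma vs_smult_smult: "vs V ==> x : carrier V ==> c \<odot>[V] (d \<odot>[V] x) = (c * d) \<odot>[V] x"
 using Module.module.smult_assoc1[of CC V c d x] by simp

lemma vs_one [simp]: "vs V ==> x : carrier V ==> 1 \<odot>[V] x = x"
 using Module.module.smult_one[of CC V x] by simp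

lemma vs_null [simp]: "vs V ==> x : carrier V ==> 0 \<odot>[V] x = \<zero>[V]"
 using Module.module.smult_l_null[of CC V x] by simp

lemma vs_smult_zero [simp]: "vs V ==> c \<odot>[V] \<zero>[V] = \<zero>[V]"
 using Module.module.smult_r_null[of CC V c] by simp

lemma vs_neg_add: "vs V ==> x : carrier V ==> x \<oplus>[V] (-1) \<odot>[V] x = \<zero>[V]"
 using vs_l_distr[of V x 1 "-1"] by simp

lemma vs_minus: "vs V ==> x : carrier V ==> \<ominus>\<^bsub>V\<^esub> x = (-1) \<odot>[V] x"
 using Module.module.smult_l_minus[of CC V 1 x] by simp

lemma vs_eq_iff: "vs V ==> x : carrier V ==> y : carrier V ==>
  x = y \<longleftrightarrow> x \<oplus>[V] (-1) \<odot>[V] y = \<zero>[V]"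
proof
 assume V: "vs V" "x : carrier V" "y : carrier V"
 assume *: "x \<oplus>[V] (-1) \<odot>[V] y = \<zero>[V]"
 have "x = x \<oplus>[V] ((-1) \<odot>[V] y \<oplus>[V] y)"
  using V vs_neg_add[OF V(1,3)] by (simp add: vs_comm)
 also have "... = y" using V * by (simp add: vs_assoc[symmetric])
 finally show "x = y" .
qed (simp add: vs_neg_add)

subsection \<open>Finite sums\<close>

lemma vs_finsum [simp, intro]:
 "vs V ==> (\<And>i. i : S ==> f i : carrier V) ==> finsum V f S : carrier V"
 by (rule abelian_monoid.finsum_closed[OF vs_abelian_monoid]) auto

lemma vs_finsum_empty [simp]: "vs V ==> finsum V f {} = \<zero>[V]"
 by (simp add: abelian_monoid.finsum_empty vs_abelian_monoid)

lemma vs_finsum_insert [simp]: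
 "vs V ==> finite S ==> i \<notin> S ==> (\<And>i. i : S ==> f i : carrier V) ==> f i : carrier V ==>
  finsum V f (insert i S) = f i \<oplus>[V] finsum V f S"
 by (rule abelian_monoid.finsum_insert[OF vs_abelian_monoid]) auto

lemma vs_finsum_infinite [simp]: "vs V ==> infinite S ==> finsum V f S = \<zero>[V]"
 by (simp add: abelian_monoid.finsum_infinite vs_abelian_monoid)

lemma vs_finsum_cong:
 "vs V ==> S = S' ==> (\<And>i. i : S' ==> g i : carrier V) ==> (\<And>i. i : S' ==> f i = g i) ==>
  finsum V f S = finsum V g S'"
 by (rule abelian_monoid.finsum_cong'[OF vs_abelian_monoid]) auto

lemma vs_finsum_zero: "vs V ==> (\<And>i. i : S ==> f i = \<zero>[V]) ==> finsum V f S = \<zero>[V]"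
 using vs_finsum_cong[of V S S "%_. \<zero>[V]" f]
 by (simp add: abelian_monoid.finsum_zero vs_abelian_monoid)

lemma vs_finsum_add:
 "vs V ==> (\<And>i. i : S ==> f i : carrier V) ==> (\<And>i. i : S ==> g i : carrier V) ==>
  finsum V (%i. f i \<oplus>[V] g i) S = finsum V f S \<oplus>[V] finsum V g S"
 by (rule abelian_monoid.finsum_addf[OF vs_abelian_monoid]) auto

subsection \<open>Linear maps\<close>

text \<open>Unlike \<open>lin_hom\<close> this does not ask for extensionality, so linear maps can
  be composed and abstracted freely; \<open>lin_restrict\<close> leads back to
  \<open>lin_hom\<close>.\<close>

definition lin :: "'a cmod => 'b cmod => ('a => 'b) => bool" where
 "lin V W f \<longleftrightarrow> (\<forall>x\<in>carrier V. f x : carrier W) \<and>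
   (\<forall>x\<in>carrier V. \<forall>y\<in>carrier V. f (x \<oplus>[V] y) = f x \<oplus>[W] f y) \<and>
   (\<forall>c. \<forall>x\<in>carrier V. f (c \<odot>[V] x) = c \<odot>[W] f x)"

lemma linI:
 assumes "\<And>x. x : carrier V ==> f x : carrier W"
  and "\<And>x y. x : carrier V ==> y : carrier V ==> f (x \<oplus>[V] y) = f x \<oplus>[W] f y"
  and "\<And>c x. x : carrier V ==> f (c \<odot>[V] x) = c \<odot>[W] f x"
 shows "lin V W f"
 using assms by (simp add: lin_def)

lemma lin_closed: "lin V W f ==> x : carrier V ==> f x : carrier W"
 by (simp add: lin_def)

lemma lin_add: "lin V W f ==> x : carrier V ==> y : carrier V ==> f (x \<oplus>[V] y) = f x \<oplus>[W] f y"
 by (simp add: lin_def)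

lemma lin_smult: "lin V W f ==> x : carrier V ==> f (c \<odot>[V] x) = c \<odot>[W] f x"
 by (simp add: lin_def)

lemma lin_zero: "lin V W f ==> vs V ==> vs W ==> f \<zero>[V] = \<zero>[W]"
 using lin_smult[of V W f "\<zero>[V]" 0] lin_closed[of V W f "\<zero>[V]"] by simp

lemma lin_finsum:
 assumes "lin V W f" "vs V" "vs W" "\<And>i. i : S ==> g i : carrier V"
 shows "f (finsum V g S) = finsum W (%i. f (g i)) S"
proof (cases "finite S")
 case True
 then show ?thesis using assms(4)
 proof (induction S)
  case (insert i S)
  then show ?case using assms(2-3) by (simp add: lin_add[OF assms(1)] lin_closed[OF assms(1)])
 qed (simp add: assms lin_zero[OF assms(1)])
qed (simp add: assms lin_zero[OF assms(1)])

lemmas linD = lin_closed lin_add lin_smult lin_zero lin_finsum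

lemma lin_comp: "lin U V f ==> lin V W g ==> lin U W (%x. g (f x))"
 by (simp add: lin_def)

lemma lin_cong: "(\<And>x. x : carrier V ==> f x = g x) ==> vs V ==> lin V W f \<longleftrightarrow> lin V W g"
 by (auto simp: lin_def)

lemma lin_addf:
 assumes "vs W" "lin V W f" "lin V W g"
 shows "lin V W (%x. f x \<oplus>[W] g x)"
 using assms(1) by (intro linI)
  (auto simp: linD[OF assms(2)] linD[OF assms(3)] vs_r_distr vs_ac)

lemma lin_smultf:
 assumes "vs W" "lin V W f"
 shows "lin V W (%x. c \<odot>[W] f x)"
 using assms(1) by (intro linI)
  (auto simp: linD[OF assms(2)] vs_r_distr vs_smult_smult mult.commute)

lemma lin_zerof: "vs W ==> lin V W (%x. \<zero>[W])"
 by (rule linI) auto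

lemma lin_finsumf:
 assumes "vs V" "vs W" "\<And>i. i : S ==> lin V W (f i)"
 shows "lin V W (%x. finsum W (%i. f i x) S)"
proof (cases "finite S")
 case True
 then show ?thesis using assms(3)
 proof (induction S)
  case (insert i S)
  have 1: "lin V W (%x. f i x \<oplus>[W] finsum W (%i. f i x) S)"
   by (rule lin_addf[OF assms(2) insert.prems insert.IH[OF insert.prems]]) auto
  have 2: "f j x : carrier W" if "j : insert i S" "x : carrier V" for j x
   using insert.prems[OF that(1)] that(2) by (rule lin_closed)
  have 3: "finsum W (%i. f i x) (insert i S) = f i x \<oplus>[W] finsum W (%i. f i x) S"
   if "x : carrier V" for x
   using insert.hyps 2 that assms(2) by simp
  show ?case using 1 lin_cong[OF 3 assms(1)] by simp
 qed (simp add: assms lin_zerof)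
qed (simp add: assms lin_zerof)

lemma lin_id: "lin V V (%x. x)"
 by (simp add: lin_def)

lemma lin_hom_iff: "f : lin_hom V W \<longleftrightarrow> lin V W f \<and> f : extensional (carrier V)"
 by (auto simp: lin_hom_def lin_def PiE_def)

lemma lin_homD: "f : lin_hom V W ==> lin V W f"
 by (simp add: lin_hom_iff)

lemma lin_restrict: "vs V ==> lin V W f ==> restrict f (carrier V) : lin_hom V W"
 by (auto simp: lin_hom_iff lin_def)

lemma lin_hom_eqI: "f : lin_hom V W ==> g : lin_hom V W ==> (\<And>x. x : carrier V ==> f x = g x) ==> f = g"
 by (meson extensionalityI lin_hom_iff)

lemma lin_hom_compose: "vs U ==> f : lin_hom U V ==> g : lin_hom V W ==> compose (carrier U) g f : lin_hom U W"
 by (auto simp: lin_hom_iff lin_def compose_def)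

lemma complex_line_simps [simp]:
 "carrier complex_line = UNIV" "\<zero>[complex_line] = 0" "x \<oplus>[complex_line] y = x + y"
 "c \<odot>[complex_line] x = c * x"
 by (simp_all add: complex_line_def)

lemma vs_complex_line [simp]: "vs complex_line"
 by (rule vsI) (auto simp: algebra_simps)

lemma finsum_complex_line [simp]: "finsum complex_line f S = sum f S"
proof (cases "finite S")
 case True
 then show ?thesis by induction (auto simp: vs_finsum_insert[OF vs_complex_line])
qed simp

abbreviation lf :: "'a cmod => ('a => complex) => bool" where
 "lf V \<equiv> lin V complex_line"

lemma lf_add: "lf V f ==> x : carrier V ==> y : carrier V ==> f (x \<oplus>[V] y) = f x + f y"
 using lin_add[of V complex_line f x y] by simp

lemma lf_smult: "lf V f ==> x : carrier V ==> f (c \<odot>[V] x) = c * f x"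
 using lin_smult[of V complex_line f x c] by simp

lemma lf_zero: "lf V f ==> vs V ==> f \<zero>[V] = 0"
 using lin_zero[of V complex_line f] by simp

lemma lf_finsum: "lf V f ==> vs V ==> (\<And>i. i : S ==> g i : carrier V) ==> f (finsum V g S) = (\<Sum>i\<in>S. f (g i))"
 using lin_finsum[of V complex_line f S g] by simp

lemmas lfD = lf_add lf_smult lf_zero lf_finsum

subsection \<open>Subspaces and quotients\<close>

lemma submodule_iff:
 assumes V: "vs V"
 shows "submodule U CC V \<longleftrightarrow> U \<subseteq> carrier V \<and> \<zero>[V] : U \<and> (\<forall>x\<in>U. \<forall>y\<in>U. x \<oplus>[V] y : U) \<and>
  (\<forall>c. \<forall>x\<in>U. c \<odot>[V] x : U)"
proof
 assume "submodule U CC V"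
 then interpret submodule U CC V .
 show "U \<subseteq> carrier V \<and> \<zero>[V] : U \<and> (\<forall>x\<in>U. \<forall>y\<in>U. x \<oplus>[V] y : U) \<and> (\<forall>c. \<forall>x\<in>U. c \<odot>[V] x : U)"
  using subset one_closed m_closed by auto
next
 assume *: "U \<subseteq> carrier V \<and> \<zero>[V] : U \<and> (\<forall>x\<in>U. \<forall>y\<in>U. x \<oplus>[V] y : U) \<and> (\<forall>c. \<forall>x\<in>U. c \<odot>[V] x : U)"
 show "submodule U CC V"
 proof (rule Module.module.submoduleI[OF V])
  fix a assume "a : U"
  then have "a : carrier V" "(-1) \<odot>[V] a : U" using * by auto
  then show "\<ominus>\<^bsub>V\<^esub> a : U" using vs_minus[OF V] by simp
 qed (use * in auto)
qed

lemma subspace_vs: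
 assumes V: "vs V" and U: "submodule U CC V"
 shows "vs (V\<lparr>carrier := U\<rparr>)"
 using assms(2) unfolding submodule_iff[OF V]
 by (intro vsI) (auto simp: V subset_iff vs_ac vs_l_distr vs_r_distr vs_smult_smult)

lemma lin_incl: "U \<subseteq> carrier V ==> lin (V\<lparr>carrier := U\<rparr>) V (%x. x)"
 by (auto simp: lin_def)

text \<open>A finite sum depends on the record in which it is formed. The inclusion of a subspace is
  linear, hence it commutes with finite sums.\<close>

lemma finsum_carrier_update [simp]:
 assumes "vs V" "submodule U CC V" "\<And>i. i : S ==> f i : U"
 shows "finsum (V\<lparr>carrier := U\<rparr>) f S = finsum V f S"
 using lin_finsum[OF lin_incl subspace_vs[OF assms(1,2)] assms(1), of S f] assms
 by (simp add: submodule_iff)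

lemma gen_submodule:
 assumes V: "vs V" and S: "S \<subseteq> carrier V"
 shows "submodule (gen_submodule V S) CC V" "S \<subseteq> gen_submodule V S"
  "submodule W CC V ==> S \<subseteq> W ==> gen_submodule V S \<subseteq> W"
proof -
 have "submodule (carrier V) CC V" using V by (simp add: submodule_iff)
 then have "gen_submodule V S \<subseteq> carrier V" using S by (auto simp: gen_submodule_def)
 then show "submodule (gen_submodule V S) CC V"
  unfolding submodule_iff[OF V] by (auto simp: gen_submodule_def submodule_iff[OF V])
 show "S \<subseteq> gen_submodule V S" by (auto simp: gen_submodule_def)
 show "submodule W CC V ==> S \<subseteq> W ==> gen_submodule V S \<subseteq> W" by (auto simp: gen_submodule_def)
qed

lemma lin_eq_submodule:
 assumes "vs V" "vs W" "lin V W f" "lin V W g"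
 shows "submodule {x : carrier V. f x = g x} CC V"
 using assms(1,2) by (auto simp: submodule_iff linD[OF assms(3)] linD[OF assms(4)])

lemma lin_image_submodule:
 assumes "vs V" "vs W" "lin V W f" "submodule U CC V"
 shows "submodule (f ` U) CC W"
proof -
 have U: "U \<subseteq> carrier V" "\<zero>[V] : U" "\<And>x y. x\<in>U ==> y\<in>U ==> x \<oplus>[V] y : U" "\<And>c x. x\<in>U ==> c \<odot>[V] x : U"
  using assms by (auto simp: submodule_iff)
 show ?thesis unfolding submodule_iff[OF assms(2)]
 proof (intro conjI ballI allI)
  show "f ` U \<subseteq> carrier W" using U(1) lin_closed[OF assms(3)] by auto
  show "\<zero>[W] : f ` U" using U(2) lin_zero[OF assms(3,1,2)] by force
  fix y assume "y : f ` U"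
  then obtain x where x: "x : U" "y = f x" by auto
  show "c \<odot>[W] y : f ` U" for c
   using x U(4) lin_smult[OF assms(3), of x c] subsetD[OF U(1)] by (auto intro!: image_eqI[of _ _ "c \<odot>[V] x"])
  fix y' assume "y' : f ` U"
  then obtain x' where x': "x' : U" "y' = f x'" by auto
  show "y \<oplus>[W] y' : f ` U"
   using x x' U(3) lin_add[OF assms(3), of x x'] subsetD[OF U(1)] by (auto intro!: image_eqI[of _ _ "x \<oplus>[V] x'"])
 qed
qed

locale quot =
 fixes V :: "'a cmod" and U :: "'a set"
 assumes V: "vs V" and U: "submodule U CC V"
begin

lemma asub: "abelian_subgroup U V"
proof (rule abelian_subgroupI3)
 show "additive_subgroup U V"
  using U by (simp add: additive_subgroup_def submodule_def)
 show "abelian_group V" by (rule vs_abelian_group[OF V])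
qed

lemma U_facts: "U \<subseteq> carrier V" "\<zero>[V] : U" "x\<in>U ==> y\<in>U ==> x \<oplus>[V] y : U" "x\<in>U ==> c \<odot>[V] x : U"
 using U V by (auto simp: submodule_iff)

lemma coset_eq_iff:
 assumes "x : carrier V" "y : carrier V"
 shows "U +>\<^bsub>V\<^esub> x = U +>\<^bsub>V\<^esub> y \<longleftrightarrow> x \<oplus>[V] (-1) \<odot>[V] y : U"
proof -
 interpret abelian_subgroup U V by (rule asub)
 have "U +>\<^bsub>V\<^esub> x = U +>\<^bsub>V\<^esub> y \<longleftrightarrow> x : U +>\<^bsub>V\<^esub> y"
  using a_rcos_self[OF assms(1)] a_repr_independence[OF _ assms(2) a_subgroup, of x] by auto
 also have "... \<longleftrightarrow> x \<oplus>[V] (-1) \<odot>[V] y : U"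
  using a_rcos_module[of y x] assms V
  by (simp add: vs_minus)
 finally show ?thesis .
qed

lemma carrier_quot: "carrier (quot_module V U) = (%x. U +>\<^bsub>V\<^esub> x) ` carrier V"
 by (auto simp: quot_module_def A_RCOSETS_def')

lemma add_quot: "x : carrier V ==> y : carrier V ==>
  (U +>\<^bsub>V\<^esub> x) \<oplus>[quot_module V U] (U +>\<^bsub>V\<^esub> y) = U +>\<^bsub>V\<^esub> (x \<oplus>[V] y)"
 by (simp add: quot_module_def abelian_subgroup.a_rcos_sum[OF asub])

text \<open>In the record, scaling a coset is a union of cosets over all representatives. These
  cosets coincide and there is at least one, so the union is a single coset.\<close>

lemma smult_quot: "x : carrier V ==> c \<odot>[quot_module V U] (U +>\<^bsub>V\<^esub> x) = U +>\<^bsub>V\<^esub> (c \<odot>[V] x)"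
proof -
 assume x: "x : carrier V"
 have "U +>\<^bsub>V\<^esub> (c \<odot>[V] y) = U +>\<^bsub>V\<^esub> (c \<odot>[V] x)" if "y : U +>\<^bsub>V\<^esub> x" for y
 proof -
  from that obtain u where u: "u : U" "y = u \<oplus>[V] x" by (auto simp: a_r_coset_def')
  have [simp]: "u : carrier V" using u U_facts by auto
  have "c \<odot>[V] y \<oplus>[V] (-1) \<odot>[V] (c \<odot>[V] x) = c \<odot>[V] u"
   using x V vs_neg_add[OF V, of "c \<odot>[V] x"] u(2) by (simp add: vs_r_distr vs_assoc)
  then show ?thesis using u V x U_facts by (subst coset_eq_iff) auto
 qed
 moreover have "x : U +>\<^bsub>V\<^esub> x" using x by (rule abelian_subgroup.a_rcos_self[OF asub])
 then have "U +>\<^bsub>V\<^esub> x \<noteq> {}" by auto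
 ultimately have "(\<Union>y\<in>U +>\<^bsub>V\<^esub> x. U +>\<^bsub>V\<^esub> (c \<odot>[V] y)) = U +>\<^bsub>V\<^esub> (c \<odot>[V] x)"
  by (intro SUP_eq_const)
 then show ?thesis by (simp add: quot_module_def)
qed

lemma zero_quot: "\<zero>[quot_module V U] = U +>\<^bsub>V\<^esub> \<zero>[V]"
 using abelian_group.a_coset_add_zero[OF vs_abelian_group[OF V]] U_facts by (simp add: quot_module_def)

lemma vs_quot: "vs (quot_module V U)"
proof (rule vsI)
 show "\<zero>[quot_module V U] : carrier (quot_module V U)"
  using V by (auto simp: carrier_quot zero_quot)
 show "x \<oplus>[quot_module V U] y = y \<oplus>[quot_module V U] x"
  if "x : carrier (quot_module V U)" "y : carrier (quot_module V U)" for x y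
  using that V by (auto simp: carrier_quot add_quot vs_comm)
qed (auto simp: carrier_quot add_quot smult_quot zero_quot V vs_l_distr vs_r_distr vs_smult_smult vs_assoc)

lemma lin_coset: "lin V (quot_module V U) (%x. U +>\<^bsub>V\<^esub> x)"
 by (rule linI) (auto simp: carrier_quot add_quot smult_quot)

lemma coset_zero_iff: "x : carrier V ==> U +>\<^bsub>V\<^esub> x = \<zero>[quot_module V U] \<longleftrightarrow> x : U"
 using coset_eq_iff[of x "\<zero>[V]"] V by (simp add: zero_quot)

text \<open>Needed because \<open>lin_ext\<close> evaluates at a chosen element of a coset: that
  element lies in the carrier and represents the same coset.\<close>

lemma some_rep:
 assumes "X : carrier (quot_module V U)"
 shows "(SOME x. x : X) : carrier V" "U +>\<^bsub>V\<^esub> (SOME x. x : X) = X"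
proof -
 interpret abelian_subgroup U V by (rule asub)
 obtain x where x: "x : carrier V" "X = U +>\<^bsub>V\<^esub> x" using assms by (auto simp: carrier_quot)
 let ?y = "SOME x. x : X"
 have "?y : X" by (rule someI[of _ x]) (use x a_rcos_self in auto)
 then show "?y : carrier V" "U +>\<^bsub>V\<^esub> ?y = X"
  using x a_repr_independence[OF _ x(1) a_subgroup, of ?y] a_r_coset_subset_G[OF U_facts(1) x(1)]
  by auto
qed

end

subsection \<open>Bases, functionals and retractions\<close>

abbreviation "lookup \<equiv> Poly_Mapping.lookup"
abbreviation "single \<equiv> Poly_Mapping.single"
abbreviation "keys \<equiv> Poly_Mapping.keys"

section \<open>Free spaces on a set of generators\<close>

abbreviation pscale :: "complex => ('w \<Rightarrow>\<^sub>0 complex) => ('w \<Rightarrow>\<^sub>0 complex)" where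
 "pscale c \<equiv> Poly_Mapping.map ((*) c)"

lemma lookup_pscale [simp]: "lookup (pscale c x) w = c * lookup x w"
 by (simp add: Poly_Mapping.map.rep_eq when_def)

lemma keys_pscale: "keys (pscale c x) \<subseteq> keys x"
 by (auto simp: in_keys_iff)

lemma pscale_single [simp]: "pscale c (single w a) = single w (c * a)"
 by (rule poly_mapping_eqI) (simp add: lookup_single when_def)

lemma vector_space_pscale: "vector_space (pscale :: complex => ('w \<Rightarrow>\<^sub>0 complex) => _)"
 by standard (auto intro!: poly_mapping_eqI simp: lookup_add algebra_simps)

lemma free_module_simps [simp]:
 "carrier (free_module S) = {x. keys x \<subseteq> S}" "\<zero>[free_module S] = 0"
 "x \<oplus>[free_module S] y = x + y" "c \<odot>[free_module S] x = pscale c x"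
 by (simp_all add: free_module_def)

lemma vs_free_module [simp]: "vs (free_module S)"
proof (rule vsI)
 show "x \<oplus>[free_module S] y : carrier (free_module S)"
  if "x : carrier (free_module S)" "y : carrier (free_module S)" for x y
  using that keys_add[of x y] by auto
 show "c \<odot>[free_module S] x : carrier (free_module S)" if "x : carrier (free_module S)" for c x
  using that keys_pscale[of c x] by auto
qed (auto intro!: poly_mapping_eqI simp: lookup_add algebra_simps)

lemma vs_finsum_neutral:
 assumes V: "vs V" and "finite B" "A \<subseteq> B" "\<And>i. i : B - A ==> f i = \<zero>[V]" "\<And>i. i : A ==> f i : carrier V"
 shows "finsum V f B = finsum V f A"
proof -
 interpret abelian_monoid V by (rule vs_abelian_monoid[OF V])
 have "f i : carrier V" if "i : B" for i using assms(4,5)[of i] that V by (cases "i : A") auto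
 then show ?thesis using assms(2-4) by (intro add.finprod_mono_neutral_cong_right) auto
qed

lemma poly_mapping_sum_single: "(\<Sum>w\<in>keys x. single w (lookup x w)) = x"
 by (rule poly_mapping_eqI) (auto simp: lookup_sum lookup_single when_def in_keys_iff if_distrib cong: if_cong)

lemma finsum_free_module:
 assumes "\<And>i. i : K ==> f i : carrier (free_module S)"
 shows "finsum (free_module S) f K = sum f K"
proof (cases "finite K")
 case True
 then show ?thesis using assms
  by induction (simp_all add: vs_finsum_empty[OF vs_free_module] vs_finsum_insert[OF vs_free_module])
qed (simp add: vs_finsum_infinite[OF vs_free_module])

text \<open>The linear map out of the free module with values \<phi> on generators;
  \<open>lin_ext\<close> is this map at a chosen representative
  (\<open>lin_ext_lincomb\<close>).\<close>

definition lincomb :: "'a cmod => ('w => 'a) => ('w \<Rightarrow>\<^sub>0 complex) => 'a" where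
 "lincomb M \<phi> x = (\<Oplus>\<^bsub>M\<^esub>w\<in>keys x. lookup x w \<odot>[M] \<phi> w)"

lemma lincomb_superset:
 assumes M: "vs M" and S: "finite S" "keys x \<subseteq> S" and \<phi>: "\<And>w. w : S ==> \<phi> w : carrier M"
 shows "lincomb M \<phi> x = (\<Oplus>\<^bsub>M\<^esub>w\<in>S. lookup x w \<odot>[M] \<phi> w)"
proof -
 have "finsum M (%w. lookup x w \<odot>[M] \<phi> w) S = finsum M (%w. lookup x w \<odot>[M] \<phi> w) (keys x)"
  using M S \<phi> by (intro vs_finsum_neutral) (auto simp: in_keys_iff)
 then show ?thesis by (simp add: lincomb_def)
qed

lemma lincomb_single [simp]:
 assumes "vs M" "\<phi> w : carrier M"
 shows "lincomb M \<phi> (single w c) = c \<odot>[M] \<phi> w"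
proof -
 have "keys (single w c) \<subseteq> {w}" by simp
 then have "lincomb M \<phi> (single w c) =
   finsum M (%v. lookup (single w c) v \<odot>[M] \<phi> v) {w}"
  using assms by (intro lincomb_superset) auto
 also have "... = c \<odot>[M] \<phi> w"
  using assms by (subst vs_finsum_insert) auto
 finally show ?thesis .
qed

lemma lin_lincomb:
 assumes M: "vs M" and \<phi>: "\<And>w. w : S ==> \<phi> w : carrier M"
 shows "lin (free_module S) M (lincomb M \<phi>)"
proof (rule linI)
 fix x assume x: "x : carrier (free_module S)"
 then have x\<phi>: "\<phi> w : carrier M" if "w : keys x" for w using \<phi> that by auto
 show "lincomb M \<phi> x : carrier M" using M x\<phi> by (auto simp: lincomb_def)
 fix c
 have "lincomb M \<phi> (pscale c x) = finsum M (%w. c \<odot>[M] (lookup x w \<odot>[M] \<phi> w)) (keys x)"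
  using M x\<phi> keys_pscale[of c x]
  by (subst lincomb_superset[of _ "keys x"]) (auto intro!: vs_finsum_cong simp: vs_smult_smult)
 also have "... = c \<odot>[M] lincomb M \<phi> x" unfolding lincomb_def
  using lin_finsum[OF lin_smultf[OF M lin_id] M M, of "keys x" "%w. lookup x w \<odot>[M] \<phi> w" c] M x\<phi> by simp
 finally show "lincomb M \<phi> (c \<odot>[free_module S] x) = c \<odot>[M] lincomb M \<phi> x" by simp
next
 fix x y assume x: "x : carrier (free_module S)" and y: "y : carrier (free_module S)"
 let ?K = "keys x \<union> keys y"
 have K: "\<phi> w : carrier M" if "w : ?K" for w using \<phi> that x y by auto
 have "lincomb M \<phi> (x + y) = finsum M (%w. lookup x w \<odot>[M] \<phi> w \<oplus>[M] lookup y w \<odot>[M] \<phi> w) ?K"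
  using M K keys_add[of x y]
  by (subst lincomb_superset[of _ ?K]) (auto intro!: vs_finsum_cong simp: vs_l_distr lookup_add)
 also have "... = lincomb M \<phi> x \<oplus>[M] lincomb M \<phi> y"
  using lincomb_superset[OF M, of ?K x \<phi>] lincomb_superset[OF M, of ?K y \<phi>] M K
  by (subst vs_finsum_add) auto
 finally show "lincomb M \<phi> (x \<oplus>[free_module S] y) = lincomb M \<phi> x \<oplus>[M] lincomb M \<phi> y" by simp
qed

text \<open>Every carrier-based space is a quotient of the type of finitely supported functions on its
  elements; splitting this quotient embeds it into a type, where the library has bases.\<close>

lemma vs_embedding:
 assumes V: "vs (V :: 'a cmod)"
 shows "\<exists>j :: 'a => ('a \<Rightarrow>\<^sub>0 complex). inj_on j (carrier V) \<and>
  (\<forall>x\<in>carrier V. \<forall>y\<in>carrier V. j (x \<oplus>[V] y) = j x + j y) \<and>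
  (\<forall>c. \<forall>x\<in>carrier V. j (c \<odot>[V] x) = pscale c (j x))"
proof -
 interpret F: vector_space "pscale :: complex => ('a \<Rightarrow>\<^sub>0 complex) => _" by (rule vector_space_pscale)
 interpret FF: vector_space_pair "pscale :: complex => ('a \<Rightarrow>\<^sub>0 complex) => _"
  "pscale :: complex => ('a \<Rightarrow>\<^sub>0 complex) => _" by unfold_locales
 let ?ev = "lincomb V (%v. v)"
 have ev: "lin (free_module (carrier V)) V ?ev" by (rule lin_lincomb[OF V])
 \<comment> \<open>The kernel of the evaluation of formal combinations in \<open>V\<close>; the
   embedding will be a linear section of that evaluation.\<close>
 define K where "K = {x. keys x \<subseteq> carrier V \<and> ?ev x = \<zero>[V]}"
 have "submodule {x : carrier (free_module (carrier V)). ?ev x = \<zero>[V]} CC (free_module (carrier V))"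
  by (rule lin_eq_submodule[OF vs_free_module V ev lin_zerof[OF V]])
 then have K: "F.subspace K"
  by (auto simp: submodule_iff K_def F.subspace_def)
 obtain p where p: "range p \<subseteq> K" "Vector_Spaces.linear pscale pscale p" "\<forall>v\<in>K. p v = v"
  using FF.linear_exists_left_inverse_on[OF F.linear_id K] by auto
 interpret p: Vector_Spaces.linear pscale pscale p by (rule p(2))
 \<comment> \<open>\<open>p\<close> projects onto \<open>K\<close>. Subtracting it moves the
   generator of \<open>v\<close> into a complement of \<open>K\<close>, and there \<open>j\<close>
   becomes linear because the defects of the generators from additivity and homogeneity lie in
   \<open>K\<close>.\<close>
 define j where "j v = single v 1 - p (single v 1)" for v :: 'a
 have lin0: "x - p x = 0" if "x : K" for x using that p(3) by simp
 let ?s = "%v :: 'a. single v (1 :: complex)"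
 have sK: "?s (x \<oplus>[V] y) - ?s x - ?s y : K" if "x : carrier V" "y : carrier V" for x y
 proof -
  have 1: "?s (x \<oplus>[V] y) - ?s x - ?s y = ?s (x \<oplus>[V] y) + pscale (-1) (?s x + ?s y)"
   by (rule poly_mapping_eqI) (simp add: lookup_add lookup_minus lookup_single when_def)
  have c: "?s (x \<oplus>[V] y) : carrier (free_module (carrier V))" "?s x : carrier (free_module (carrier V))"
   "?s y : carrier (free_module (carrier V))" using that V by auto
  have c2: "?s x + ?s y : carrier (free_module (carrier V))"
   using vs_add[OF vs_free_module c(2,3)] by simp
  have c3: "pscale (-1) (?s x + ?s y) : carrier (free_module (carrier V))"
   using vs_smult[OF vs_free_module c2, of "-1"] by (simp only: free_module_simps)
  have "?ev (?s (x \<oplus>[V] y) + pscale (-1) (?s x + ?s y)) = \<zero>[V]"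
   using lin_add[OF ev c(1) c3] lin_smult[OF ev c2, of "-1"] lin_add[OF ev c(2,3)] that V
   by (simp add: vs_neg_add)
  moreover have "keys (?s (x \<oplus>[V] y) + pscale (-1) (?s x + ?s y)) \<subseteq> carrier V"
   using vs_add[OF vs_free_module c(1) c3] by (simp only: free_module_simps mem_Collect_eq)
  ultimately show ?thesis unfolding 1 K_def by blast
 qed
 have cK: "?s (c \<odot>[V] x) - pscale c (?s x) : K" if "x : carrier V" for c x
 proof -
  have 1: "?s (c \<odot>[V] x) - pscale c (?s x) = ?s (c \<odot>[V] x) + pscale (- c) (?s x)"
   by (rule poly_mapping_eqI) (simp add: lookup_add lookup_minus lookup_single when_def)
  have c: "?s (c \<odot>[V] x) : carrier (free_module (carrier V))" "?s x : carrier (free_module (carrier V))"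
   using that V by auto
  have c3: "pscale (-c) (?s x) : carrier (free_module (carrier V))"
   using vs_smult[OF vs_free_module c(2)] by simp
  have "?ev (?s (c \<odot>[V] x) + pscale (-c) (?s x)) = \<zero>[V]"
   using lin_add[OF ev c(1) c3] lin_smult[OF ev c(2), of "-c"] that V vs_neg_add[OF V, of "c \<odot>[V] x"]
   by (simp add: vs_smult_smult)
  moreover have "keys (?s (c \<odot>[V] x) + pscale (-c) (?s x)) \<subseteq> carrier V"
   using vs_add[OF vs_free_module c(1) c3] by (simp only: free_module_simps mem_Collect_eq)
  ultimately show ?thesis unfolding 1 K_def by blast
 qed
 show ?thesis
 proof (intro exI[of _ j] conjI ballI allI inj_onI)
  fix x y assume xy: "x : carrier V" "y : carrier V"
  show "j (x \<oplus>[V] y) = j x + j y"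
   using lin0[OF sK[OF xy]] by (simp add: j_def p.diff p.add algebra_simps)
  show "j (c \<odot>[V] x) = pscale c (j x)" for c
   using lin0[OF cK[OF xy(1), of c]] p.scale[of c "?s x"]
   by (simp add: j_def p.diff F.scale_right_diff_distrib algebra_simps)
  assume "j x = j y"
  then have "?s x - ?s y = p (?s x - ?s y)" by (simp add: j_def p.diff algebra_simps)
  then have "?s x - ?s y : K" using p(1) by (metis rangeI subsetD)
  moreover have 1: "?s x - ?s y = ?s x + pscale (-1) (?s y)"
   by (rule poly_mapping_eqI) (simp add: lookup_add lookup_minus lookup_single when_def)
  ultimately have "?ev (?s x + pscale (-1) (?s y)) = \<zero>[V]" by (simp add: K_def)
  then have "x \<oplus>[V] (-1) \<odot>[V] y = \<zero>[V]"
   using lin_add[OF ev, of "?s x" "pscale (-1) (?s y)"] lin_smult[OF ev, of "?s y" "-1"] xy V by simp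
  then show "x = y" using vs_eq_iff[OF V xy] by simp
 qed
qed

text \<open>A maximal independent subset of the image of the embedding pulls back to a basis, with
  its representation function as coordinates. The functional \<open>co b\<close> is linear for every
  \<open>b\<close>, in the basis or not, which spares side conditions later.\<close>

lemma vs_basis_ex:
 assumes V: "vs (V :: 'a cmod)"
 shows "\<exists>B co. B \<subseteq> carrier V \<and> (\<forall>b. lf V (co b)) \<and> (\<forall>b\<in>B. \<forall>b'\<in>B. co b b' = (if b = b' then 1 else 0)) \<and>
   (\<forall>v\<in>carrier V. finite {b\<in>B. co b v \<noteq> 0} \<and> v = (\<Oplus>\<^bsub>V\<^esub>b\<in>{b\<in>B. co b v \<noteq> 0}. co b v \<odot>[V] b)) \<and>
   (finite_dim V --> finite B)"
proof -
 interpret F: vector_space "pscale :: complex => ('a \<Rightarrow>\<^sub>0 complex) => _" by (rule vector_space_pscale)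
 obtain j :: "'a => ('a \<Rightarrow>\<^sub>0 complex)" where j: "inj_on j (carrier V)"
  "\<And>x y. x\<in>carrier V ==> y\<in>carrier V ==> j (x \<oplus>[V] y) = j x + j y"
  "\<And>c x. x\<in>carrier V ==> j (c \<odot>[V] x) = pscale c (j x)" using vs_embedding[OF V] by auto
 have j0: "j \<zero>[V] = 0" using j(2)[of "\<zero>[V]" "\<zero>[V]"] V by simp
 obtain B' where B': "B' \<subseteq> j ` carrier V" "F.independent B'" "j ` carrier V \<subseteq> F.span B'"
  using F.maximal_independent_subset[of "j ` carrier V"] by blast
 define B where "B = {v : carrier V. j v : B'}"
 have jB: "j ` B = B'" using B'(1) by (auto simp: B_def)
 have injB: "inj_on j B" using j(1) by (auto simp: B_def inj_on_def)
 define co where "co b v = F.representation B' (j v) (j b)" for b v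
 have jsum: "j (finsum V f S) = (\<Sum>i\<in>S. j (f i))" if "\<And>i. i : S ==> f i : carrier V" "finite S"
  for f :: "'a => 'a" and S
  using that(2,1) by (induction S) (auto simp: V j0 j(2))
 have jin: "j v : F.span B'" if "v : carrier V" for v using B'(3) that by auto
 show ?thesis
 proof (intro exI[of _ B] exI[of _ co] conjI allI ballI impI)
  show "B \<subseteq> carrier V" by (auto simp: B_def)
  show "lf V (co b)" for b
   by (rule linI) (auto simp: co_def j F.representation_add[OF B'(2)] F.representation_scale[OF B'(2)] jin)
  show "co b b' = (if b = b' then 1 else 0)" if "b : B" "b' : B" for b b'
   using that injB jB F.representation_basis[OF B'(2), of "j b'"] by (auto simp: co_def inj_on_eq_iff)
  fix v assume v: "v : carrier V"
  have S: "j ` {b : B. co b v \<noteq> 0} = {b'. F.representation B' (j v) b' \<noteq> 0}"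
   using jB F.representation_ne_zero[of B' "j v"] unfolding co_def by auto
  have "finite (j ` {b : B. co b v \<noteq> 0})" unfolding S by (rule F.finite_representation)
  then show fin: "finite {b : B. co b v \<noteq> 0}"
   by (rule finite_imageD) (auto intro: inj_on_subset[OF injB])
  have "j v = (\<Sum>b'\<in>j ` {b : B. co b v \<noteq> 0}. pscale (F.representation B' (j v) b') b')"
   unfolding S using F.sum_nonzero_representation_eq[OF B'(2) jin[OF v]] by simp
  also have "... = (\<Sum>b\<in>{b : B. co b v \<noteq> 0}. pscale (co b v) (j b))"
   by (subst sum.reindex) (auto intro: inj_on_subset[OF injB] simp: co_def)
  also have "... = j (\<Oplus>\<^bsub>V\<^esub>b\<in>{b\<in>B. co b v \<noteq> 0}. co b v \<odot>[V] b)"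
   using V fin by (subst jsum) (auto simp: B_def j(3))
  finally show "v = (\<Oplus>\<^bsub>V\<^esub>b\<in>{b\<in>B. co b v \<noteq> 0}. co b v \<odot>[V] b)"
   by (rule inj_onD[OF j(1)]) (use v V in \<open>auto simp: B_def\<close>)
 next
  assume "finite_dim V"
  then obtain S where S: "finite S" "S \<subseteq> carrier V" "gen_submodule V S = carrier V"
   by (auto simp: finite_dim_def)
  have sm: "submodule {v : carrier V. j v : F.span (j ` S)} CC V"
   using V by (auto simp: submodule_iff j j0 F.span_zero F.span_add F.span_scale)
  have "carrier V \<subseteq> {v : carrier V. j v : F.span (j ` S)}"
  proof -
   have "S \<subseteq> {v : carrier V. j v : F.span (j ` S)}" using S(2) F.span_base[of _ "j ` S"] by auto
   then show ?thesis using gen_submodule(3)[OF V S(2) sm] S(3) by simp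
  qed
  then have "B' \<subseteq> F.span (j ` S)" using B'(1) by auto
  then have "finite B'" using F.independent_span_bound[of "j ` S" B'] B'(2) S(1) by auto
  then show "finite B" using finite_imageD[OF _ injB] jB by auto
 qed
qed

text \<open>The coordinate functionals of a basis already suffice.\<close>

lemma vs_sep:
 assumes V: "vs V" "x : carrier V" and 0: "\<And>\<phi>. lf V \<phi> ==> \<phi> x = 0"
 shows "x = \<zero>[V]"
proof -
 obtain B co where B0: "\<forall>b. lf V (co b)" "\<forall>v\<in>carrier V. finite {b\<in>B. co b v \<noteq> 0} \<and> v = (\<Oplus>\<^bsub>V\<^esub>b\<in>{b\<in>B. co b v \<noteq> 0}. co b v \<odot>[V] b)"
  using vs_basis_ex[OF V(1)] by (elim exE conjE)
 note B = B0(1)[rule_format] B0(2)[rule_format, THEN conjunct2]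
 have "x = finsum V (%b. co b x \<odot>[V] b) {b\<in>B. co b x \<noteq> 0}" using V(2) by (rule B(2))
 also have "... = \<zero>[V]" using 0[OF B(1)] V(1) by simp
 finally show ?thesis .
qed

lemma vs_eqI:
 assumes V: "vs V" "x : carrier V" "y : carrier V" and e: "\<And>\<phi>. lf V \<phi> ==> \<phi> x = \<phi> y"
 shows "x = y"
proof -
 have "x \<oplus>[V] (-1) \<odot>[V] y = \<zero>[V]"
 proof (rule vs_sep[OF V(1)])
  fix \<phi> assume \<phi>: "lf V \<phi>"
  show "\<phi> (x \<oplus>[V] (-1) \<odot>[V] y) = 0" using V e[OF \<phi>] by (simp add: lfD[OF \<phi>])
 qed (use V in auto)
 then show ?thesis by (simp add: vs_eq_iff[OF V])
qed

text \<open>A projection onto the image of \<open>U\<close> in the ambient type, pulled back along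
  the embedding of \<open>V\<close>. Applied to \<open>H0\<close> inside the bar construction it
  yields \<open>ret\<close>.\<close>

lemma lin_retraction:
 assumes V: "vs (V :: 'a cmod)" and U: "submodule U CC V"
 obtains r where "lin V V r" "\<And>v. v : carrier V ==> r v : U" "\<And>u. u : U ==> r u = u"
proof -
 interpret F: vector_space "pscale :: complex => ('a \<Rightarrow>\<^sub>0 complex) => _" by (rule vector_space_pscale)
 interpret FF: vector_space_pair "pscale :: complex => ('a \<Rightarrow>\<^sub>0 complex) => _"
  "pscale :: complex => ('a \<Rightarrow>\<^sub>0 complex) => _" by unfold_locales
 have U': "U \<subseteq> carrier V" "\<zero>[V] : U" "\<And>x y. x\<in>U ==> y\<in>U ==> x \<oplus>[V] y : U" "\<And>c x. x\<in>U ==> c \<odot>[V] x : U"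
  using U V by (auto simp: submodule_iff)
 obtain j :: "'a => ('a \<Rightarrow>\<^sub>0 complex)" where j: "inj_on j (carrier V)"
  "\<And>x y. x\<in>carrier V ==> y\<in>carrier V ==> j (x \<oplus>[V] y) = j x + j y"
  "\<And>c x. x\<in>carrier V ==> j (c \<odot>[V] x) = pscale c (j x)" using vs_embedding[OF V] by auto
 have j0: "j \<zero>[V] = 0" using j(2)[of "\<zero>[V]" "\<zero>[V]"] V by simp
 have jU: "F.subspace (j ` U)" unfolding F.subspace_def
 proof (intro conjI ballI allI)
  show "0 : j ` U" using j0 U'(2) by force
  fix x assume "x : j ` U"
  then obtain u where u: "u : U" "x = j u" by auto
  show "pscale c x : j ` U" for c
   using u U'(4)[OF u(1), of c] subsetD[OF U'(1)] by (auto simp: j(3) intro!: image_eqI[of _ _ "c \<odot>[V] u"])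
  fix y assume "y : j ` U"
  then obtain w where w: "w : U" "y = j w" by auto
  show "x + y : j ` U"
   using u w U'(3)[OF u(1) w(1)] subsetD[OF U'(1)] by (auto simp: j(2) intro!: image_eqI[of _ _ "u \<oplus>[V] w"])
 qed
 obtain p where p: "range p \<subseteq> j ` U" "Vector_Spaces.linear pscale pscale p" "\<forall>v\<in>j ` U. p v = v"
  using FF.linear_exists_left_inverse_on[OF F.linear_id jU] by auto
 interpret p: Vector_Spaces.linear pscale pscale p by (rule p(2))
 define r where "r v = inv_into U j (p (j v))" for v
 have injU: "inj_on j U" using j(1) U'(1) by (rule inj_on_subset)
 have r: "r v : U" "j (r v) = p (j v)" for v
 proof -
  have "p (j v) : j ` U" using p(1) by blast
  then show "r v : U" "j (r v) = p (j v)" unfolding r_def by (rule inv_into_into, rule f_inv_into_f)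
 qed
 have r': "r v : carrier V" for v using r(1) U'(1) by auto
 show thesis
 proof
  show "lin V V r"
  proof (rule linI)
   fix x y assume xy: "x : carrier V" "y : carrier V"
   show "r (x \<oplus>[V] y) = r x \<oplus>[V] r y"
    by (rule inj_onD[OF j(1)]) (use V r' xy in \<open>auto simp: j r p.add\<close>)
   show "r (c \<odot>[V] x) = c \<odot>[V] r x" for c
    by (rule inj_onD[OF j(1)]) (use V r' xy in \<open>auto simp: j r p.scale\<close>)
  qed (rule r')
  show "r v : U" for v by (rule r)
  show "r u = u" if "u : U" for u using that p(3) injU by (simp add: r_def)
 qed
qed

subsection \<open>Presented spaces\<close>

lemma lin_ext_lincomb: "lin_ext M \<phi> X = lincomb M \<phi> (SOME x. x : X)"
 by (simp add: lin_ext_def lincomb_def Let_def)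

locale presentation =
 fixes S :: "'w set" and Rel :: "('w \<Rightarrow>\<^sub>0 complex) set"
 assumes Rel: "Rel \<subseteq> carrier (free_module S)"
begin

sublocale q: quot "free_module S" "gen_submodule (free_module S) Rel"
 by (rule quot.intro[OF vs_free_module gen_submodule(1)[OF vs_free_module Rel]])

lemma vs_presented: "vs (presented S Rel)"
 unfolding presented_def by (rule q.vs_quot)

lemma lin_pclass: "lin (free_module S) (presented S Rel) (pclass S Rel)"
 unfolding presented_def pclass_def by (rule q.lin_coset)

lemma pclass_rel: "r : Rel ==> pclass S Rel r = \<zero>[presented S Rel]"
 unfolding presented_def pclass_def
 using q.coset_zero_iff[of r] gen_submodule(2)[OF vs_free_module Rel] Rel by auto

lemma carrier_presented: "carrier (presented S Rel) = pclass S Rel ` carrier (free_module S)"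
 unfolding presented_def pclass_def by (rule q.carrier_quot)

text \<open>The zeros of \<open>lincomb M \<phi>\<close> form a submodule; once it contains the
  relations it contains everything they generate. Hence the representative chosen inside
  \<open>lin_ext\<close> does not matter.\<close>

lemma lin_ext_pclass:
 assumes M: "vs M" and \<phi>: "\<And>w. w : S ==> \<phi> w : carrier M"
  and rel: "\<And>r. r : Rel ==> lincomb M \<phi> r = \<zero>[M]" and x: "x : carrier (free_module S)"
 shows "lin_ext M \<phi> (pclass S Rel x) = lincomb M \<phi> x"
proof -
 let ?F = "free_module S" and ?G = "gen_submodule (free_module S) Rel"
 have L: "lin (free_module S) M (lincomb M \<phi>)" by (rule lin_lincomb[OF M \<phi>])
 have "submodule {x : carrier ?F. lincomb M \<phi> x = \<zero>[M]} CC ?F"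
  by (rule lin_eq_submodule[OF vs_free_module M L lin_zerof[OF M]])
 then have G: "?G \<subseteq> {x : carrier ?F. lincomb M \<phi> x = \<zero>[M]}"
  by (rule gen_submodule(3)[OF vs_free_module Rel]) (use Rel rel in auto)
 let ?y = "SOME y. y : pclass S Rel x"
 have X: "pclass S Rel x : carrier (quot_module ?F ?G)"
  using lin_closed[OF lin_pclass x] by (simp add: presented_def)
 note y = q.some_rep[OF X]
 have "?G +>\<^bsub>?F\<^esub> ?y = ?G +>\<^bsub>?F\<^esub> x" using y(2) by (simp add: pclass_def)
 then have "?y \<oplus>[?F] (-1) \<odot>[?F] x : ?G" using q.coset_eq_iff[OF y(1) x] by simp
 then have "lincomb M \<phi> (?y \<oplus>[?F] (-1) \<odot>[?F] x) = \<zero>[M]" using G by blast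
 then have "lincomb M \<phi> ?y \<oplus>[M] (-1) \<odot>[M] lincomb M \<phi> x = \<zero>[M]"
  using lin_add[OF L y(1) vs_smult[OF vs_free_module x]] lin_smult[OF L x, of "-1"] by simp
 then have "lincomb M \<phi> ?y = lincomb M \<phi> x"
  using vs_eq_iff[OF M lin_closed[OF L y(1)] lin_closed[OF L x]] by simp
 then show ?thesis by (simp add: lin_ext_lincomb)
qed

lemma lin_lin_ext:
 assumes M: "vs M" and \<phi>: "\<And>w. w : S ==> \<phi> w : carrier M"
  and rel: "\<And>r. r : Rel ==> lincomb M \<phi> r = \<zero>[M]"
 shows "lin (presented S Rel) M (lin_ext M \<phi>)"
proof (rule linI)
 have L: "lin (free_module S) M (lincomb M \<phi>)" by (rule lin_lincomb[OF M \<phi>])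
 have E: "lin_ext M \<phi> (pclass S Rel x) = lincomb M \<phi> x" if "x : carrier (free_module S)" for x
  by (rule lin_ext_pclass[OF M \<phi> rel that])
 fix X assume "X : carrier (presented S Rel)"
 then obtain x where x: "x : carrier (free_module S)" "X = pclass S Rel x"
  unfolding carrier_presented by blast
 show "lin_ext M \<phi> X : carrier M" using E[OF x(1)] lin_closed[OF L x(1)] x(2) by simp
 show "lin_ext M \<phi> (c \<odot>[presented S Rel] X) = c \<odot>[M] lin_ext M \<phi> X" for c
  using E[OF vs_smult[OF vs_free_module x(1)], of c] E[OF x(1)] lin_smult[OF L x(1), of c]
   lin_smult[OF lin_pclass x(1), of c] x(2) by simp
 fix Y assume "Y : carrier (presented S Rel)"
 then obtain y where y: "y : carrier (free_module S)" "Y = pclass S Rel y"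
  unfolding carrier_presented by blast
 show "lin_ext M \<phi> (X \<oplus>[presented S Rel] Y) = lin_ext M \<phi> X \<oplus>[M] lin_ext M \<phi> Y"
  using E[OF vs_add[OF vs_free_module x(1) y(1)]] E[OF x(1)] E[OF y(1)] lin_add[OF L x(1) y(1)]
   lin_add[OF lin_pclass x(1) y(1)] x(2) y(2) by simp
qed

lemma pclass_lincomb:
 assumes x: "x : carrier (free_module S)"
 shows "pclass S Rel x = lincomb (presented S Rel) (%w. pclass S Rel (single w 1)) x"
proof -
 let ?s = "%w. single w (1::complex)"
 let ?P = "presented S Rel"
 have c: "?s w : carrier (free_module S)" if "w : keys x" for w using x that by auto
 have *: "\<And>w. w : keys x ==> pscale (lookup x w) (?s w) : carrier (free_module S)"
  using vs_smult[OF vs_free_module c] by simp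
 have fin: "x = finsum (free_module S) (%w. pscale (lookup x w) (?s w)) (keys x)"
 proof -
  have "x = (\<Sum>w\<in>keys x. pscale (lookup x w) (?s w))" by (simp add: poly_mapping_sum_single)
  also have "... = finsum (free_module S) (%w. pscale (lookup x w) (?s w)) (keys x)"
   by (rule finsum_free_module[OF *, symmetric])
  finally show ?thesis .
 qed
 have "pclass S Rel x = finsum ?P (%w. pclass S Rel (pscale (lookup x w) (?s w))) (keys x)"
  using arg_cong[OF fin, of "pclass S Rel"] lin_finsum[OF lin_pclass vs_free_module vs_presented *]
  by (rule trans)
 also have "... = lincomb ?P (%w. pclass S Rel (?s w)) x"
  unfolding lincomb_def
 proof (rule vs_finsum_cong[OF vs_presented refl])
  fix w assume w: "w : keys x"
  show "lookup x w \<odot>[?P] pclass S Rel (?s w) : carrier ?P"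
   using vs_smult[OF vs_presented lin_closed[OF lin_pclass c[OF w]]] .
  show "pclass S Rel (pscale (lookup x w) (?s w)) = lookup x w \<odot>[?P] pclass S Rel (?s w)"
   using lin_smult[OF lin_pclass c[OF w], of "lookup x w"] by (simp only: free_module_simps)
 qed
 finally show ?thesis .
qed

lemma presented_eqI:
 assumes M: "vs M" "lin (presented S Rel) M f" "lin (presented S Rel) M g"
  and e: "\<And>w. w : S ==> f (pclass S Rel (single w 1)) = g (pclass S Rel (single w 1))"
  and X: "X : carrier (presented S Rel)"
 shows "f X = g X"
proof -
 obtain x where x: "x : carrier (free_module S)" "X = pclass S Rel x"
  using X unfolding carrier_presented by blast
 have c: "pclass S Rel (single w 1) : carrier (presented S Rel)" if "w : keys x" for w
  using x that by (intro lin_closed[OF lin_pclass]) auto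
 have *: "h X = finsum M (%w. lookup x w \<odot>[M] h (pclass S Rel (single w 1))) (keys x)"
  if h: "lin (presented S Rel) M h" for h
  unfolding x(2) pclass_lincomb[OF x(1)] lincomb_def using c M(1)
  by (subst lin_finsum[OF h vs_presented M(1)])
   (auto intro!: vs_finsum_cong simp: vs_presented lin_smult[OF h] lin_closed[OF h])
 show ?thesis unfolding *[OF M(2)] *[OF M(3)]
  using c x e M(1) lin_closed[OF M(3)] by (intro vs_finsum_cong) auto
qed

end

lemma pmap_diff: "(x :: 'w \<Rightarrow>\<^sub>0 complex) - y = x + pscale (-1) y"
 by (rule poly_mapping_eqI) (simp add: lookup_add lookup_minus)

lemma free_diff: "x : carrier (free_module S) ==> y : carrier (free_module S) ==>
  x - y : carrier (free_module S)"
 using vs_add[OF vs_free_module, of x S "pscale (-1) y"] vs_smult[OF vs_free_module, of y S "-1"]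
 unfolding pmap_diff by (simp only: free_module_simps)

lemma lin_diff:
 assumes "lin (free_module S) M f" "x : carrier (free_module S)" "y : carrier (free_module S)"
 shows "f (x - y) = f x \<oplus>[M] (-1) \<odot>[M] f y"
 using lin_add[OF assms(1,2) vs_smult[OF vs_free_module assms(3)], of "-1"] lin_smult[OF assms(1,3), of "-1"]
 unfolding pmap_diff by (simp only: free_module_simps)

lemma single_carrier: "w : S ==> single w c : carrier (free_module S)"
 by simp

subsection \<open>Tensor products\<close>

definition bilin :: "'a cmod => 'b cmod => 'c cmod => ('a => 'b => 'c) => bool" where
 "bilin V W M \<beta> \<longleftrightarrow> (\<forall>v\<in>carrier V. lin W M (\<beta> v)) \<and> (\<forall>w\<in>carrier W. lin V M (%v. \<beta> v w))"

lemma bilinI: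
 assumes "\<And>v. v : carrier V ==> lin W M (\<beta> v)" "\<And>w. w : carrier W ==> lin V M (%v. \<beta> v w)"
 shows "bilin V W M \<beta>"
 using assms by (simp add: bilin_def)

lemma bilin_left: "bilin V W M \<beta> ==> v : carrier V ==> lin W M (\<beta> v)"
 and bilin_right: "bilin V W M \<beta> ==> w : carrier W ==> lin V M (%v. \<beta> v w)"
 by (simp_all add: bilin_def)

lemma bilin_closed: "bilin V W M \<beta> ==> v : carrier V ==> w : carrier W ==> \<beta> v w : carrier M"
 using lin_closed[OF bilin_left] .

lemma tensor_presentation:
 assumes V: "vs V" and W: "vs W"
 shows "presentation (carrier V \<times> carrier W) (tensor_rels V W)"
proof
 show "tensor_rels V W \<subseteq> carrier (free_module (carrier V \<times> carrier W))"
  unfolding tensor_rels_def using V W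
  by (auto simp del: free_module_simps intro!: free_diff single_carrier)
qed

text \<open>The additivity relations of \<open>tensor_rels\<close>, \<open>ext_rels\<close> and
  \<open>bar_rels\<close> all have this shape; \<open>lincomb_diff2\<close> is the counterpart for
  their homogeneity relations.\<close>

lemma lincomb_diff3:
 assumes M: "vs M" and S: "a : S" "b : S" "c : S" and \<phi>: "\<And>w. w : S ==> \<phi> w : carrier M"
  and e: "\<phi> a = \<phi> b \<oplus>[M] \<phi> c"
 shows "lincomb M \<phi> (single a 1 - single b 1 - single c 1) = \<zero>[M]"
proof -
 have L: "lin (free_module S) M (lincomb M \<phi>)" by (rule lin_lincomb[OF M \<phi>])
 note s = single_carrier[OF S(1)] single_carrier[OF S(2)] single_carrier[OF S(3)]
 have [simp]: "\<phi> a : carrier M" "\<phi> b : carrier M" "\<phi> c : carrier M" using \<phi> S by auto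
 have "lincomb M \<phi> (single a 1 - single b 1 - single c 1) =
   \<phi> a \<oplus>[M] (-1) \<odot>[M] \<phi> b \<oplus>[M] (-1) \<odot>[M] \<phi> c"
  using M by (simp add: lin_diff[OF L free_diff[OF s(1,2)] s(3)] lin_diff[OF L s(1,2)])
 also have "... = (\<phi> b \<oplus>[M] (-1) \<odot>[M] \<phi> b) \<oplus>[M] (\<phi> c \<oplus>[M] (-1) \<odot>[M] \<phi> c)"
  unfolding e using M by (simp add: vs_ac)
 also have "... = \<zero>[M]" using M by (simp add: vs_neg_add)
 finally show ?thesis .
qed

lemma lincomb_diff2:
 assumes M: "vs M" and S: "a : S" "b : S" and \<phi>: "\<And>w. w : S ==> \<phi> w : carrier M"
  and e: "\<phi> a = c \<odot>[M] \<phi> b"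
 shows "lincomb M \<phi> (single a 1 - single b c) = \<zero>[M]"
proof -
 have L: "lin (free_module S) M (lincomb M \<phi>)" by (rule lin_lincomb[OF M \<phi>])
 note s = single_carrier[OF S(1)] single_carrier[OF S(2)]
 have [simp]: "\<phi> a : carrier M" "\<phi> b : carrier M" using \<phi> S by auto
 have "lincomb M \<phi> (single a 1 - single b c) = \<phi> a \<oplus>[M] (-1) \<odot>[M] (c \<odot>[M] \<phi> b)"
  using M by (simp add: lin_diff[OF L s])
 then show ?thesis using M vs_neg_add[of M "c \<odot>[M] \<phi> b"] by (simp add: e)
qed

lemma (in presentation) pclass_diff3:
 assumes "single a 1 - single b 1 - single c 1 : Rel"
  and S: "a : S" "b : S" "c : S"
 shows "pclass S Rel (single a 1) =
  pclass S Rel (single b 1) \<oplus>[presented S Rel] pclass S Rel (single c 1)"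
proof -
 let ?P = "presented S Rel" and ?c = "%w. pclass S Rel (single w 1)"
 note s = single_carrier[OF S(1)] single_carrier[OF S(2)] single_carrier[OF S(3)]
 note [simp] = vs_presented s[THEN lin_closed[OF lin_pclass]]
 have "?c a \<oplus>[?P] (-1) \<odot>[?P] ?c b \<oplus>[?P] (-1) \<odot>[?P] ?c c = \<zero>[?P]"
  using pclass_rel[OF assms(1)]
  by (simp add: lin_diff[OF lin_pclass free_diff[OF s(1,2)] s(3)] lin_diff[OF lin_pclass s(1,2)])
 then have "?c a \<oplus>[?P] (-1) \<odot>[?P] (?c b \<oplus>[?P] ?c c) = \<zero>[?P]"
  by (simp add: vs_r_distr vs_assoc)
 then show ?thesis using vs_eq_iff[of ?P "?c a" "?c b \<oplus>[?P] ?c c"] by simp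
qed

lemma (in presentation) pclass_diff2:
 assumes "single a 1 - single b c : Rel" and S: "a : S" "b : S"
 shows "pclass S Rel (single a 1) = c \<odot>[presented S Rel] pclass S Rel (single b 1)"
proof -
 let ?P = "presented S Rel" and ?c = "%w c. pclass S Rel (single w c)"
 note s = single_carrier[OF S(1), of 1] single_carrier[OF S(2)]
 note [simp] = vs_presented s[THEN lin_closed[OF lin_pclass]]
 have 1: "?c b c = c \<odot>[?P] ?c b 1" using lin_smult[OF lin_pclass s(2), of c 1] by simp
 have "?c a 1 \<oplus>[?P] (-1) \<odot>[?P] ?c b c = \<zero>[?P]"
  using pclass_rel[OF assms(1)] by (simp add: lin_diff[OF lin_pclass s])
 then show ?thesis using vs_eq_iff[of ?P "?c a 1" "?c b c"] 1 by simp
qed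

context
 fixes V :: "'a cmod" and W :: "'b cmod"
 assumes V: "vs V" and W: "vs W"
begin

interpretation presentation "carrier V \<times> carrier W" "tensor_rels V W"
 by (rule tensor_presentation[OF V W])

lemma vs_tensor [simp]: "vs (tensor V W)"
 unfolding tensor_def by (rule vs_presented)

lemma tens_closed [simp, intro]: "v : carrier V ==> w : carrier W ==> tens V W v w : carrier (tensor V W)"
 unfolding tensor_def tens_def by (rule lin_closed[OF lin_pclass]) simp

lemma bilin_tens: "bilin V W (tensor V W) (tens V W)"
proof (intro bilinI linI)
 fix v v' w c assume vw: "v : carrier V" "v' : carrier V" "w : carrier W"
 show "tens V W (v \<oplus>[V] v') w = tens V W v w \<oplus>[tensor V W] tens V W v' w"
  unfolding tensor_def tens_def
  by (rule pclass_diff3) (use vw V W in \<open>auto simp: tensor_rels_def\<close>)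
next
 fix v w w' c assume vw: "v : carrier V" "w' : carrier W" "w : carrier W"
 show "tens V W v (w \<oplus>[W] w') = tens V W v w \<oplus>[tensor V W] tens V W v w'"
  unfolding tensor_def tens_def
  by (rule pclass_diff3) (use vw V W in \<open>auto simp: tensor_rels_def\<close>)
next
 fix v w c assume vw: "v : carrier V" "w : carrier W"
 show "tens V W v (c \<odot>[W] w) = c \<odot>[tensor V W] tens V W v w"
  unfolding tensor_def tens_def
  by (rule pclass_diff2) (use vw V W in \<open>auto simp: tensor_rels_def\<close>)
 show "tens V W (c \<odot>[V] v) w = c \<odot>[tensor V W] tens V W v w"
  unfolding tensor_def tens_def
  by (rule pclass_diff2) (use vw V W in \<open>auto simp: tensor_rels_def\<close>)
qed (auto intro: tens_closed)

lemma tensor_rel_lincomb: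
 assumes M: "vs M" and \<beta>: "bilin V W M \<beta>" and r: "r : tensor_rels V W"
 shows "lincomb M (%(v, w). \<beta> v w) r = \<zero>[M]"
proof -
 let ?S = "carrier V \<times> carrier W"
 have c: "\<And>p. p : ?S ==> (case p of (v, w) => \<beta> v w) : carrier M" using bilin_closed[OF \<beta>] by auto
 note d3 = lincomb_diff3[where \<phi>="%(v, w). \<beta> v w", OF M _ _ _ c]
 note d2 = lincomb_diff2[where \<phi>="%(v, w). \<beta> v w", OF M _ _ c]
 show ?thesis using r V W unfolding tensor_rels_def
  by (elim UnE CollectE exE conjE)
   (hypsubst, (rule d3 | rule d2);
    simp add: bilin_right[OF \<beta>, THEN lin_add] bilin_left[OF \<beta>, THEN lin_add]
     bilin_right[OF \<beta>, THEN lin_smult] bilin_left[OF \<beta>, THEN lin_smult])+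
qed

lemma lin_tensor_lift:
 assumes M: "vs M" and \<beta>: "bilin V W M \<beta>"
 shows "lin (tensor V W) M (lin_ext M (%(v, w). \<beta> v w))"
 unfolding tensor_def
 by (rule lin_lin_ext[OF M _ tensor_rel_lincomb[OF M \<beta>]]) (use bilin_closed[OF \<beta>] in auto)

lemma tensor_lift_tens [simp]:
 assumes M: "vs M" and \<beta>: "bilin V W M \<beta>" and vw: "v : carrier V" "w : carrier W"
 shows "lin_ext M (%(v, w). \<beta> v w) (tens V W v w) = \<beta> v w"
 unfolding tens_def
 by (subst lin_ext_pclass[OF M _ tensor_rel_lincomb[OF M \<beta>]])
  (use bilin_closed[OF \<beta>] vw M in auto)

lemma tensor_eqI:
 assumes M: "vs M" and f: "lin (tensor V W) M f" "lin (tensor V W) M g"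
  and e: "\<And>v w. v : carrier V ==> w : carrier W ==> f (tens V W v w) = g (tens V W v w)"
  and t: "t : carrier (tensor V W)"
 shows "f t = g t"
 using presented_eqI[OF M, of f g t] f e t by (auto simp: tensor_def tens_def)

lemma tensor_finite_rep:
 assumes t: "t : carrier (tensor V W)"
 obtains x where "keys x \<subseteq> carrier V \<times> carrier W"
  "t = lincomb (tensor V W) (%(v, w). tens V W v w) x"
proof -
 obtain x where x: "x : carrier (free_module (carrier V \<times> carrier W))"
  "t = pclass (carrier V \<times> carrier W) (tensor_rels V W) x"
  using t unfolding tensor_def carrier_presented by blast
 then have "t = lincomb (tensor V W) (%(v, w). tens V W v w) x"
  using pclass_lincomb[OF x(1)] by (simp add: tensor_def tens_def case_prod_unfold)
 then show thesis using that x by auto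
qed

lemma tensor_sub:
 assumes U: "submodule U CC (tensor V W)"
  and e: "\<And>v w. v : carrier V ==> w : carrier W ==> tens V W v w : U"
 shows "carrier (tensor V W) \<subseteq> U"
proof
 fix t assume t: "t : carrier (tensor V W)"
 obtain x where x: "keys x \<subseteq> carrier V \<times> carrier W"
  "t = lincomb (tensor V W) (%(v, w). tens V W v w) x" using tensor_finite_rep[OF t] .
 have "(case p of (v, w) => tens V W v w) : U" if "p : keys x" for p using x that e by auto
 then have "lookup x p \<odot>[tensor V W] (case p of (v, w) => tens V W v w) : U" if "p : keys x" for p
  using U that by (auto simp: submodule_iff)
 then have "finsum (tensor V W\<lparr>carrier := U\<rparr>) (%p. lookup x p \<odot>[tensor V W] (case p of (v, w) => tens V W v w)) (keys x) : U"
  using vs_finsum[OF subspace_vs[OF vs_tensor U], of "keys x"] by simp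
 then show "t : U" unfolding x(2) lincomb_def
  using finsum_carrier_update[OF vs_tensor U, of "keys x"]
   \<open>\<And>p. p : keys x ==> lookup x p \<odot>[tensor V W] (case p of (v, w) => tens V W v w) : U\<close> by simp
qed

end

lemmas tens_linear =
 bilin_tens[THEN bilin_left, THEN lin_add] bilin_tens[THEN bilin_left, THEN lin_smult]
 bilin_tens[THEN bilin_right, THEN lin_add] bilin_tens[THEN bilin_right, THEN lin_smult]

lemma tens_zero:
 assumes "vs V" "vs W"
 shows "v : carrier V ==> tens V W v \<zero>[W] = \<zero>[tensor V W]"
  and "w : carrier W ==> tens V W \<zero>[V] w = \<zero>[tensor V W]"
 using bilin_tens[OF assms, THEN bilin_left, THEN lin_zero] bilin_tens[OF assms, THEN bilin_right, THEN lin_zero]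
  assms by auto

lemma bilin_compose:
 assumes "bilin V W M \<beta>" "lin V' V f" "lin W' W g" "lin M M' h"
 shows "bilin V' W' M' (%v w. h (\<beta> (f v) (g w)))"
proof (rule bilinI)
 fix v assume v: "v : carrier V'"
 show "lin W' M' (%w. h (\<beta> (f v) (g w)))"
  using lin_comp[OF lin_comp[OF assms(3) bilin_left[OF assms(1) lin_closed[OF assms(2) v]]] assms(4)] .
next
 fix w assume w: "w : carrier W'"
 show "lin V' M' (%v. h (\<beta> (f v) (g w)))"
  using lin_comp[OF lin_comp[OF assms(2) bilin_right[OF assms(1) lin_closed[OF assms(3) w]]] assms(4)] .
qed

lemma bilin_scale:
 assumes W: "vs W" and f: "lf V f"
 shows "bilin V W W (%v w. f v \<odot>[W] w)" "bilin W V W (%w v. f v \<odot>[W] w)"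
 using W by (auto intro!: bilinI linI simp: lf_add[OF f] lf_smult[OF f] vs_l_distr vs_r_distr vs_smult_smult mult.commute)

subsection \<open>Maps of tensor products\<close>

lemma tensor_map:
 assumes vs: "vs V" "vs W" "vs V'" "vs W'" and f: "lin V V' f" and g: "lin W W' g"
 shows tensor_map_hom: "tensor_map V W V' W' f g : lin_hom (tensor V W) (tensor V' W')"
  and tensor_map_tens: "v : carrier V ==> w : carrier W ==>
    tensor_map V W V' W' f g (tens V W v w) = tens V' W' (f v) (g w)"
proof -
 have b: "bilin V W (tensor V' W') (%v w. tens V' W' (f v) (g w))"
  by (rule bilin_compose[OF bilin_tens[OF vs(3,4)] f g lin_id])
 show "tensor_map V W V' W' f g : lin_hom (tensor V W) (tensor V' W')"
  unfolding tensor_map_def using vs lin_tensor_lift[OF vs(1,2) vs_tensor[OF vs(3,4)] b]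
  by (intro lin_restrict) auto
 show "v : carrier V ==> w : carrier W ==> tensor_map V W V' W' f g (tens V W v w) = tens V' W' (f v) (g w)"
  unfolding tensor_map_def using vs tensor_lift_tens[OF vs(1,2) vs_tensor[OF vs(3,4)] b]
  by simp
qed

lemmas lin_tensor_map = tensor_map_hom[THEN lin_homD]

subsection \<open>Contractions\<close>

text \<open>Contraction of one tensor factor with a functional on it. Such contractions replace
  coordinates when elements of a tensor product are compared.\<close>

definition ctr_l :: "'b cmod => ('a => complex) => ('a \<times> 'b \<Rightarrow>\<^sub>0 complex) set => 'b" where
 "ctr_l W f = lin_ext W (%(v, w). f v \<odot>[W] w)"

definition ctr_r :: "'a cmod => ('b => complex) => ('a \<times> 'b \<Rightarrow>\<^sub>0 complex) set => 'a" where
 "ctr_r V f = lin_ext V (%(v, w). f w \<odot>[V] v)"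

context
 fixes V :: "'a cmod" and W :: "'b cmod"
 assumes V: "vs V" and W: "vs W"
begin

lemma ctr_l: "lf V f ==> lin (tensor V W) W (ctr_l W f)"
 "lf V f ==> v : carrier V ==> w : carrier W ==> ctr_l W f (tens V W v w) = f v \<odot>[W] w"
 unfolding ctr_l_def
 using lin_tensor_lift[OF V W W bilin_scale(1)[OF W]] tensor_lift_tens[OF V W W bilin_scale(1)[OF W]] by blast+

lemma ctr_r: "lf W f ==> lin (tensor V W) V (ctr_r V f)"
 "lf W f ==> v : carrier V ==> w : carrier W ==> ctr_r V f (tens V W v w) = f w \<odot>[V] v"
 unfolding ctr_r_def
 using lin_tensor_lift[OF V W V bilin_scale(2)[OF V]] tensor_lift_tens[OF V W V bilin_scale(2)[OF V]] by blast+

lemma ctr_commute: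
 assumes f: "lf V f" and g: "lf W g" and t: "t : carrier (tensor V W)"
 shows "g (ctr_l W f t) = f (ctr_r V g t)"
 by (rule tensor_eqI[OF V W vs_complex_line lin_comp[OF ctr_l(1)[OF f] g] lin_comp[OF ctr_r(1)[OF g] f] _ t])
  (simp add: ctr_l(2)[OF f] ctr_r(2)[OF g] lf_smult[OF f] lf_smult[OF g])

text \<open>The basis of \<open>W\<close> may be infinite, but a given \<open>t\<close> is a
  combination of finitely many pure tensors, and their second factors involve finitely many basis
  vectors in total. The coefficients are contractions of \<open>t\<close>.\<close>

lemma tensor_basis_rep:
 assumes t: "t : carrier (tensor V W)" and B: "B \<subseteq> carrier W" "\<And>b. lf W (co b)"
   "\<And>w. w : carrier W ==> finite {b\<in>B. co b w \<noteq> 0} \<and> w = (\<Oplus>\<^bsub>W\<^esub>b\<in>{b\<in>B. co b w \<noteq> 0}. co b w \<odot>[W] b)"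
 obtains F where "finite F" "F \<subseteq> B" "t = (\<Oplus>\<^bsub>tensor V W\<^esub>b\<in>F. tens V W (ctr_r V (co b) t) b)"
proof -
 obtain x where x: "keys x \<subseteq> carrier V \<times> carrier W"
  "t = lincomb (tensor V W) (%(v, w). tens V W v w) x" using tensor_finite_rep[OF V W t] .
 define F where "F = (\<Union>p\<in>keys x. {b\<in>B. co b (snd p) \<noteq> 0})"
 have F: "finite F" "F \<subseteq> B" unfolding F_def using x(1) B(3) by auto
 let ?T = "tensor V W"
 \<comment> \<open>The expansion over \<open>F\<close> as a linear map. It is the identity only on
   the pure tensors that occur in \<open>x\<close>, since \<open>F\<close> was adapted to
   \<open>t\<close>; this is enough.\<close>
 define E where "E s = finsum ?T (%b. tens V W (ctr_r V (co b) s) b) F" for s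
 have linb: "lin ?T ?T (%s. tens V W (ctr_r V (co b) s) b)" if "b : F" for b
  using lin_comp[OF ctr_r(1)[OF B(2)] bilin_right[OF bilin_tens[OF V W]]] that F(2) B(1) by blast
 have E: "lin ?T ?T E" unfolding E_def
  by (rule lin_finsumf[OF vs_tensor[OF V W] vs_tensor[OF V W] linb])
 have 1: "E (tens V W v w) = tens V W v w" if p: "(v, w) : keys x" for v w
 proof -
  have vw: "v : carrier V" "w : carrier W" using x(1) p by auto
  let ?G = "{b\<in>B. co b w \<noteq> 0}"
  have G: "?G \<subseteq> F" using p by (force simp: F_def)
  have FW: "\<And>b. b : F ==> b : carrier W" using F(2) B(1) by auto
  have "E (tens V W v w) = finsum ?T (%b. tens V W v (co b w \<odot>[W] b)) F"
   unfolding E_def using V W vw FW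
   by (intro vs_finsum_cong) (auto simp: ctr_r(2)[OF B(2)] tens_linear[OF V W])
  also have "... = tens V W v (finsum W (%b. co b w \<odot>[W] b) F)"
   using V W FW by (intro lin_finsum[OF bilin_left[OF bilin_tens[OF V W] vw(1)] W vs_tensor[OF V W], symmetric]) auto
  also have "finsum W (%b. co b w \<odot>[W] b) F = finsum W (%b. co b w \<odot>[W] b) ?G"
   using W F G FW by (intro vs_finsum_neutral) auto
  also have "... = w" using B(3)[OF vw(2)] by simp
  finally show ?thesis .
 qed
 have "E t = t"
 proof -
  have c: "\<And>v w. (v, w) : keys x ==> tens V W v w : carrier ?T" using x(1) V W by auto
  have "E t = finsum ?T (%p. E (lookup x p \<odot>[?T] (case p of (v, w) => tens V W v w))) (keys x)"
   unfolding x(2) lincomb_def using c V W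
   by (intro lin_finsum[OF E]) auto
  also have "... = t" unfolding x(2) lincomb_def using c 1 V W
   by (intro vs_finsum_cong) (auto simp: lin_smult[OF E])
  finally show ?thesis .
 qed
 then show thesis using that[OF F] by (simp add: E_def)
qed

text \<open>A separating family on the left factor alone suffices. The coefficients of
  \<open>t\<close> along a basis of \<open>W\<close> are vectors of \<open>V\<close>, and every
  \<open>f\<close> in \<open>L\<close> kills them because contractions on the two sides
  commute.\<close>

lemma tensor_sep:
 assumes t: "t : carrier (tensor V W)" and L: "\<And>f. f : L ==> lf V f"
  and sep: "\<And>v. v : carrier V ==> (\<And>f. f : L ==> f v = 0) ==> v = \<zero>[V]"
  and 0: "\<And>f. f : L ==> ctr_l W f t = \<zero>[W]"
 shows "t = \<zero>[tensor V W]"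
proof -
 obtain B co where B0: "B \<subseteq> carrier W" "\<forall>b. lf W (co b)"
   "\<forall>w\<in>carrier W. finite {b\<in>B. co b w \<noteq> 0} \<and> w = (\<Oplus>\<^bsub>W\<^esub>b\<in>{b\<in>B. co b w \<noteq> 0}. co b w \<odot>[W] b)"
  using vs_basis_ex[OF W] by (elim exE conjE)
 note B = B0(1) B0(2)[rule_format] B0(3)[rule_format]
 obtain F where F: "finite F" "F \<subseteq> B" "t = (\<Oplus>\<^bsub>tensor V W\<^esub>b\<in>F. tens V W (ctr_r V (co b) t) b)"
  using tensor_basis_rep[OF t B] .
 have z: "ctr_r V (co b) t = \<zero>[V]" for b
 proof (rule sep)
  show "ctr_r V (co b) t : carrier V" by (rule lin_closed[OF ctr_r(1)[OF B(2)] t])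
  fix f assume f: "f : L"
  show "f (ctr_r V (co b) t) = 0"
   using ctr_commute[OF L[OF f] B(2)[of b] t] 0[OF f] lf_zero[OF B(2) W] by simp
 qed
 have "finsum (tensor V W) (%b. tens V W (ctr_r V (co b) t) b) F = \<zero>[tensor V W]"
  using F(2) B(1) V W by (intro vs_finsum_zero) (auto simp: z tens_zero)
 then show ?thesis using F(3) by simp
qed

lemma tensor_sep_eq:
 assumes t: "t : carrier (tensor V W)" "s : carrier (tensor V W)" and L: "\<And>f. f : L ==> lf V f"
  and sep: "\<And>v. v : carrier V ==> (\<And>f. f : L ==> f v = 0) ==> v = \<zero>[V]"
  and e: "\<And>f. f : L ==> ctr_l W f t = ctr_l W f s"
 shows "t = s"
proof -
 have "t \<oplus>[tensor V W] (-1) \<odot>[tensor V W] s = \<zero>[tensor V W]"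
 proof (rule tensor_sep[OF _ L sep])
  show "t \<oplus>[tensor V W] (-1) \<odot>[tensor V W] s : carrier (tensor V W)" using t V W by auto
  fix f assume f: "f : L"
  note l = ctr_l(1)[OF L[OF f]]
  show "ctr_l W f (t \<oplus>[tensor V W] (-1) \<odot>[tensor V W] s) = \<zero>[W]"
   using t V W e[OF f] by (simp add: lin_add[OF l] lin_smult[OF l] lin_closed[OF l] vs_neg_add)
 qed
 then show ?thesis using vs_eq_iff[OF vs_tensor[OF V W] t] by simp
qed

lemma tensor_eq_zero_iff:
 assumes t: "t : carrier (tensor V W)"
 shows "t = \<zero>[tensor V W] \<longleftrightarrow> (\<forall>f. lf V f --> ctr_l W f t = \<zero>[W])"
 using tensor_sep[OF t, of "{f. lf V f}"] vs_sep[OF V] lin_zero[OF ctr_l(1) vs_tensor[OF V W] W]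
 by blast

text \<open>With a finite basis on the left nothing depends on \<open>t\<close>, so the expansion is
  an identity of linear maps and may be checked on pure tensors. It is used to write a connection
  form through basis one-forms.\<close>

lemma tensor_left_basis_rep:
 assumes t: "t : carrier (tensor V W)" and B: "finite B" "B \<subseteq> carrier V" "\<And>b. lf V (co b)"
   "\<And>v. v : carrier V ==> v = (\<Oplus>\<^bsub>V\<^esub>b\<in>B. co b v \<odot>[V] b)"
 shows "t = (\<Oplus>\<^bsub>tensor V W\<^esub>b\<in>B. tens V W b (ctr_l W (co b) t))"
proof -
 let ?T = "tensor V W"
 have linb: "lin ?T ?T (%s. tens V W b (ctr_l W (co b) s))" if "b : B" for b
  using lin_comp[OF ctr_l(1)[OF B(3)] bilin_left[OF bilin_tens[OF V W]]] that B(2) by blast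
 have E: "lin ?T ?T (%s. finsum ?T (%b. tens V W b (ctr_l W (co b) s)) B)"
  by (rule lin_finsumf[OF vs_tensor[OF V W] vs_tensor[OF V W] linb])
 show ?thesis
 proof (rule tensor_eqI[OF V W vs_tensor[OF V W] lin_id E _ t], goal_cases)
  case (1 v w) note vw = 1(1-2)
  have BV: "\<And>b. b : B ==> b : carrier V" using B(2) by auto
  have "tens V W v w = tens V W (finsum V (%b. co b v \<odot>[V] b) B) w" using B(4)[OF vw(1)] by simp
  also have "... = finsum ?T (%b. tens V W (co b v \<odot>[V] b) w) B"
   using V W BV by (intro lin_finsum[OF bilin_right[OF bilin_tens[OF V W] vw(2)] V vs_tensor[OF V W]]) auto
  also have "... = finsum ?T (%b. tens V W b (ctr_l W (co b) (tens V W v w))) B"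
   using V W BV vw by (intro vs_finsum_cong) (auto simp: ctr_l(2)[OF B(3)] tens_linear[OF V W])
  finally show ?case .
 qed
qed

end

lemma submodule_finsum:
 assumes "vs V" "submodule U CC V" "\<And>i. i : S ==> f i : U"
 shows "finsum V f S : U"
proof -
 have "finsum (V\<lparr>carrier := U\<rparr>) f S = finsum V f S"
  by (rule finsum_carrier_update[OF assms(1,2)]) (rule assms(3))
 moreover have "finsum (V\<lparr>carrier := U\<rparr>) f S : carrier (V\<lparr>carrier := U\<rparr>)"
  by (rule vs_finsum[OF subspace_vs[OF assms(1,2)]]) (use assms(3) in simp)
 ultimately show ?thesis by simp
qed

subsection \<open>Finite-dimensional spaces\<close>

lemma finite_dim_image:
 assumes V: "vs V" and W: "vs W" and f: "lin V W f" "f ` carrier V = carrier W" and fd: "finite_dim V"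
 shows "finite_dim W"
proof -
 obtain S where S: "finite S" "S \<subseteq> carrier V" "gen_submodule V S = carrier V"
  using fd by (auto simp: finite_dim_def)
 have fS: "f ` S \<subseteq> carrier W" using S f by auto
 let ?G = "gen_submodule W (f ` S)"
 note G = gen_submodule(1,2)[OF W fS]
 have "submodule {v : carrier V. f v : ?G} CC V"
  using V G(1) by (auto simp: submodule_iff[OF V] submodule_iff[OF W] linD[OF f(1)] W)
 from gen_submodule(3)[OF V S(2) this] have "carrier V \<subseteq> {v : carrier V. f v : ?G}" using S G(2) by auto
 then have "f ` carrier V \<subseteq> ?G" by auto
 then have "carrier W \<subseteq> ?G" using f(2) by simp
 moreover have "?G \<subseteq> carrier W" using G(1) by (simp add: submodule_iff[OF W])
 ultimately show ?thesis using S(1) fS unfolding finite_dim_def by blast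
qed

text \<open>A subspace is the image of the whole space under a retraction.\<close>

lemma finite_dim_subspace:
 assumes V: "vs V" and U: "submodule U CC V" and fd: "finite_dim V"
 shows "finite_dim (V\<lparr>carrier := U\<rparr>)"
proof -
 obtain r where r: "lin V V r" "\<forall>v\<in>carrier V. r v : U" "\<forall>u\<in>U. r u = u"
  by (rule lin_retraction[OF V U]) blast
 have "U \<subseteq> carrier V" using U by (simp add: submodule_iff[OF V])
 then have "r ` carrier V = U" using r(2,3) by force
 moreover have "lin V (V\<lparr>carrier := U\<rparr>) r" using r(1,2) by (simp add: lin_def)
 ultimately show ?thesis by (intro finite_dim_image[OF V subspace_vs[OF V U] _ _ fd]) auto
qed

lemma finite_dimI:
 assumes V: "vs V" and S: "finite S" "S \<subseteq> carrier V"
  and span: "\<And>U v. submodule U CC V ==> S \<subseteq> U ==> v : carrier V ==> v : U"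
 shows "finite_dim V"
proof -
 have "gen_submodule V S = carrier V"
  using gen_submodule(1)[OF V S(2)] span[OF gen_submodule(1,2)[OF V S(2)]]
  unfolding submodule_iff[OF V] by blast
 then show ?thesis using S unfolding finite_dim_def by blast
qed

lemma finite_basis_ex:
 assumes V: "vs V" and fd: "finite_dim V"
 shows "\<exists>B co. finite B \<and> B \<subseteq> carrier V \<and> (\<forall>b. lf V (co b)) \<and>
   (\<forall>b\<in>B. \<forall>b'\<in>B. co b b' = (if b = b' then 1 else 0)) \<and>
   (\<forall>v\<in>carrier V. v = (\<Oplus>\<^bsub>V\<^esub>b\<in>B. co b v \<odot>[V] b))"
proof -
 obtain B co where B: "B \<subseteq> carrier V" "\<forall>b. lf V (co b)" "\<forall>b\<in>B. \<forall>b'\<in>B. co b b' = (if b = b' then 1 else 0)"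
   "\<forall>v\<in>carrier V. finite {b\<in>B. co b v \<noteq> 0} \<and> v = (\<Oplus>\<^bsub>V\<^esub>b\<in>{b\<in>B. co b v \<noteq> 0}. co b v \<odot>[V] b)"
   "finite_dim V --> finite B"
  using vs_basis_ex[OF V] by (elim exE conjE)
 have "v = (\<Oplus>\<^bsub>V\<^esub>b\<in>B. co b v \<odot>[V] b)" if v: "v : carrier V" for v
 proof -
  have "(\<Oplus>\<^bsub>V\<^esub>b\<in>B. co b v \<odot>[V] b) = (\<Oplus>\<^bsub>V\<^esub>b\<in>{b\<in>B. co b v \<noteq> 0}. co b v \<odot>[V] b)"
   using V B fd by (intro vs_finsum_neutral) auto
  also have "... = v" using B(4) v by (metis (no_types, lifting))
  finally show ?thesis by simp
 qed
 then show ?thesis using B fd by blast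
qed

lemma finite_dim_tensor:
 assumes V: "vs V" "finite_dim V" and W: "vs W" "finite_dim W"
 shows "finite_dim (tensor V W)"
proof -
 obtain B co where B: "finite B" "B \<subseteq> carrier V" "\<forall>v\<in>carrier V. v = (\<Oplus>\<^bsub>V\<^esub>b\<in>B. co b v \<odot>[V] b)"
  using finite_basis_ex[OF V] by (elim exE conjE) blast
 obtain C co' where C: "finite C" "C \<subseteq> carrier W" "\<forall>v\<in>carrier W. v = (\<Oplus>\<^bsub>W\<^esub>b\<in>C. co' b v \<odot>[W] b)"
  using finite_basis_ex[OF W] by (elim exE conjE) blast
 let ?T = "tensor V W"
 show ?thesis
 proof (rule finite_dimI[OF vs_tensor[OF V(1) W(1)]])
  let ?S = "(%(b, c). tens V W b c) ` (B \<times> C)"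
  show "finite ?S" using B C by simp
  show "?S \<subseteq> carrier ?T" using B C V W by auto
  fix U t assume U: "submodule U CC ?T" and S: "?S \<subseteq> U" and t: "t : carrier ?T"
  have sm: "c \<odot>[?T] u : U" if "u : U" for c u
   using U V W that by (simp add: submodule_iff)
  have "tens V W v w : U" if v: "v : carrier V" and w: "w : carrier W" for v w
  proof -
   have 1: "tens V W b w : U" if b: "b : B" for b
   proof -
    have bV: "b : carrier V" using b B by auto
    have "tens V W b w = tens V W b (finsum W (%c. co' c w \<odot>[W] c) C)" using C(3) w by simp
    also have "... = finsum ?T (%c. tens V W b (co' c w \<odot>[W] c)) C"
     using C(2) V W by (intro lin_finsum[OF bilin_left[OF bilin_tens[OF V(1) W(1)] bV]]) auto
    also have "... : U"
    proof (rule submodule_finsum[OF vs_tensor[OF V(1) W(1)] U])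
     fix c assume c: "c : C"
     then have cW: "c : carrier W" using C by auto
     have "tens V W b c : U" using S b c by auto
     then show "tens V W b (co' c w \<odot>[W] c) : U" using sm tens_linear(2)[OF V(1) W(1) bV cW] by simp
    qed
    finally show ?thesis .
   qed
   have "tens V W v w = tens V W (finsum V (%b. co b v \<odot>[V] b) B) w" using B(3) v by simp
   also have "... = finsum ?T (%b. tens V W (co b v \<odot>[V] b) w) B"
    using B(2) V W by (intro lin_finsum[OF bilin_right[OF bilin_tens[OF V(1) W(1)] w]]) auto
   also have "... : U"
   proof (rule submodule_finsum[OF vs_tensor[OF V(1) W(1)] U])
    fix b assume b: "b : B"
    then have bV: "b : carrier V" using B by auto
    show "tens V W (co b v \<odot>[V] b) w : U" using sm[OF 1[OF b]] tens_linear(4)[OF V(1) W(1) w bV] by simp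
   qed
   finally show ?thesis .
  qed
  then show "t : U" using tensor_sub[OF V(1) W(1) U] t by blast
 qed
qed

lemma product_line_simps [simp]:
 "carrier (product_module I (%_. complex_line)) = (\<Pi>\<^sub>E i\<in>I. UNIV)"
 "\<zero>[product_module I (%_. complex_line)] = (\<lambda>i\<in>I. 0)"
 "x \<oplus>[product_module I (%_. complex_line)] y = (\<lambda>i\<in>I. x i + y i)"
 "c \<odot>[product_module I (%_. complex_line)] x = (\<lambda>i\<in>I. c * x i)"
 by (simp_all add: product_module_def)

lemma vs_product_line [simp]: "vs (product_module I (%_. complex_line))"
 by (rule vsI) (auto simp: restrict_def PiE_def extensional_def algebra_simps fun_eq_iff)

text \<open>Coordinates are needed twice: to identify a trivial graded piece with some
  \<open>unit_power\<close>, and to move an object into the type of model fibres.\<close>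

lemma finite_dim_coordinates:
 assumes V: "vs V" and fd: "finite_dim V"
 obtains k and T where "T : lin_hom (product_module {..<k::nat} (%_. complex_line)) V"
  "bij_betw T (carrier (product_module {..<k} (%_. complex_line))) (carrier V)"
proof -
 obtain B co where B: "finite B" "B \<subseteq> carrier V" "\<forall>b. lf V (co b)"
   "\<forall>b\<in>B. \<forall>b'\<in>B. co b b' = (if b = b' then 1 else 0)"
   "\<forall>v\<in>carrier V. v = (\<Oplus>\<^bsub>V\<^esub>b\<in>B. co b v \<odot>[V] b)"
  using finite_basis_ex[OF V fd] by (elim exE conjE)
 obtain h where h: "bij_betw h {..<card B} B"
  using ex_bij_betw_nat_finite[OF B(1)] by (auto simp: atLeast0LessThan)
 let ?P = "product_module {..<card B} (%_. complex_line)"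
 have hB: "h i : B" if "i < card B" for i using h that by (auto simp: bij_betw_def)
 have hV: "h i : carrier V" if "i < card B" for i using hB[OF that] B(2) by auto
 define T where "T x = finsum V (%i. x i \<odot>[V] h i) {..<card B}" for x :: "nat => complex"
 have T: "lin ?P V T"
 proof (rule linI)
  fix x y assume "x : carrier ?P" "y : carrier ?P"
  have "T (x \<oplus>[?P] y) = finsum V (%i. x i \<odot>[V] h i \<oplus>[V] y i \<odot>[V] h i) {..<card B}"
   unfolding T_def using V hV by (intro vs_finsum_cong) (auto simp: vs_l_distr)
  also have "... = T x \<oplus>[V] T y"
   unfolding T_def using V hV by (intro vs_finsum_add) auto
  finally show "T (x \<oplus>[?P] y) = T x \<oplus>[V] T y" .
  have "T (c \<odot>[?P] x) = finsum V (%i. c \<odot>[V] (x i \<odot>[V] h i)) {..<card B}" for c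
   unfolding T_def using V hV by (intro vs_finsum_cong) (auto simp: vs_smult_smult)
  also have "... c = c \<odot>[V] T x" for c
   unfolding T_def using V hV lin_finsum[OF lin_smultf[OF V lin_id] V V, of "{..<card B}" "%i. x i \<odot>[V] h i" c]
   by auto
  finally show "T (c \<odot>[?P] x) = c \<odot>[V] T x" for c .
 qed (use V hV in \<open>auto simp: T_def\<close>)
 have coT: "co (h j) (T x) = x j" if "j < card B" for x j
 proof -
  have "co (h j) (T x) = (\<Sum>i<card B. co (h j) (x i \<odot>[V] h i))"
   unfolding T_def using V hV by (intro lf_finsum[OF B(3)[rule_format]]) auto
  also have "... = (\<Sum>i<card B. if i = j then x i else 0)"
  proof (rule sum.cong[OF refl], goal_cases)
   case (1 i)
   then have i: "i < card B" by simp
   have "h j = h i \<longleftrightarrow> j = i" using h i that by (auto simp: bij_betw_def inj_on_def)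
   then show ?case
    using B(4) hB[OF i] hB[OF that] lf_smult[OF B(3)[rule_format] hV[OF i], of "h j" "x i"] by auto
  qed
  finally show ?thesis using that by simp
 qed
 have "bij_betw T (carrier ?P) (carrier V)" unfolding bij_betw_def
 proof
  show "inj_on T (carrier ?P)"
  proof (rule inj_onI, goal_cases)
   case (1 x y) note xy = 1(1-3)
   show ?case
   proof
    fix i show "x i = y i"
     using coT[of i x] coT[of i y] xy by (cases "i < card B") (auto simp: PiE_def extensional_def)
   qed
  qed
  show "T ` carrier ?P = carrier V"
  proof
   show "T ` carrier ?P \<subseteq> carrier V" using lin_closed[OF T] by auto
   show "carrier V \<subseteq> T ` carrier ?P"
   proof
    fix v assume v: "v : carrier V"
    let ?x = "\<lambda>i\<in>{..<card B}. co (h i) v"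
    have "T ?x = finsum V (%i. co (h i) v \<odot>[V] h i) {..<card B}"
     unfolding T_def using V hV by (intro vs_finsum_cong) auto
    also have "... = finsum V (%b. co b v \<odot>[V] b) (h ` {..<card B})"
     using h subsetD[OF B(2)] V by (intro abelian_monoid.finsum_reindex[OF vs_abelian_monoid[OF V], symmetric])
      (auto simp: bij_betw_def)
    also have "... = v" using h B(5) v by (simp add: bij_betw_def)
    finally have "v = T ?x" by simp
    moreover have "?x : carrier ?P" by (simp add: PiE_def extensional_def)
    ultimately show "v : T ` carrier ?P" by (rule image_eqI)
   qed
  qed
 qed
 moreover have "bij_betw (restrict T (carrier ?P)) (carrier ?P) (carrier V) = bij_betw T (carrier ?P) (carrier V)"
  by (rule bij_betw_cong) simp
 ultimately show thesis using that[OF lin_restrict[OF vs_product_line T]] by blast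
qed

subsection \<open>Spaces of linear maps\<close>

lemma Hom_module_simps [simp]:
 "carrier (Hom_module V W) = lin_hom V W" "\<zero>[Hom_module V W] = (\<lambda>x\<in>carrier V. \<zero>[W])"
 "f \<oplus>[Hom_module V W] g = (\<lambda>x\<in>carrier V. f x \<oplus>[W] g x)"
 "c \<odot>[Hom_module V W] f = (\<lambda>x\<in>carrier V. c \<odot>[W] f x)"
 by (simp_all add: Hom_module_def)

lemma Hom_apply:
 "x : carrier V ==> (f \<oplus>[Hom_module V W] g) x = f x \<oplus>[W] g x"
 "x : carrier V ==> (c \<odot>[Hom_module V W] f) x = c \<odot>[W] f x"
 by simp_all

lemma lin_hom_closed: "f : lin_hom V W ==> x : carrier V ==> f x : carrier W"
 using lin_closed[OF lin_homD] .

lemma vs_Hom_module [simp]: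
 assumes V: "vs V" and W: "vs W"
 shows "vs (Hom_module V W)"
proof (rule vsI)
 let ?H = "Hom_module V W"
 show z: "\<zero>[?H] : carrier ?H"
  using lin_restrict[OF V lin_zerof[OF W]] by simp
 have sm: "k \<odot>[?H] f : carrier ?H" if "f : carrier ?H" for k f
  using that lin_restrict[OF V lin_smultf[OF W lin_homD]] by simp
 have ad: "f \<oplus>[?H] g : carrier ?H" if "f : carrier ?H" "g : carrier ?H" for f g
  using that lin_restrict[OF V lin_addf[OF W lin_homD lin_homD]] by simp
 have eq: "f = g" if "f : carrier ?H" "g : carrier ?H" "\<And>x. x : carrier V ==> f x = g x" for f g
  using that(1,2) unfolding Hom_module_simps by (rule lin_hom_eqI) (rule that(3))
 fix f assume f: "f : carrier ?H"
 show "k \<odot>[?H] f : carrier ?H" for k by (rule sm[OF f])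
 have c: "f x : carrier W" if "x : carrier V" for x using lin_hom_closed f that by simp
 show "(k + d) \<odot>[?H] f = k \<odot>[?H] f \<oplus>[?H] d \<odot>[?H] f" for k d
  by (rule eq[OF sm[OF f] ad[OF sm[OF f] sm[OF f]]]) (simp add: vs_l_distr W c)
 show "(k * d) \<odot>[?H] f = k \<odot>[?H] (d \<odot>[?H] f)" for k d
  by (rule eq[OF sm[OF f] sm[OF sm[OF f]]]) (simp add: vs_smult_smult W c)
 show "1 \<odot>[?H] f = f" by (rule eq[OF sm[OF f] f]) (simp add: W c)
 show "0 \<odot>[?H] f = \<zero>[?H]"
  by (rule eq[OF sm[OF f] z]) (simp add: W c)
 show "\<zero>[?H] \<oplus>[?H] f = f" by (rule eq[OF ad[OF z f] f]) (simp add: W c)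
 fix g assume g: "g : carrier ?H"
 show "f \<oplus>[?H] g : carrier ?H" by (rule ad[OF f g])
 have cg: "g x : carrier W" if "x : carrier V" for x using lin_hom_closed g that by simp
 show "f \<oplus>[?H] g = g \<oplus>[?H] f"
  by (rule eq[OF ad[OF f g] ad[OF g f]]) (simp add: W c cg vs_comm)
 show "k \<odot>[?H] (f \<oplus>[?H] g) = k \<odot>[?H] f \<oplus>[?H] k \<odot>[?H] g" for k
  by (rule eq[OF sm[OF ad[OF f g]] ad[OF sm[OF f] sm[OF g]]]) (simp add: W c cg vs_r_distr)
 fix h assume h: "h : carrier ?H"
 have ch: "h x : carrier W" if "x : carrier V" for x using lin_hom_closed h that by simp
 show "(f \<oplus>[?H] g) \<oplus>[?H] h = f \<oplus>[?H] (g \<oplus>[?H] h)"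
  by (rule eq[OF ad[OF ad[OF f g] h] ad[OF f ad[OF g h]]]) (simp add: W c cg ch vs_assoc)
qed

lemma lin_eval: "vs V ==> x : carrier V ==> lin (Hom_module V W) W (%f. f x)"
 by (rule linI) (auto simp: lin_hom_closed)

lemma lin_compose_left:
 assumes "vs U" "vs V" "vs W" and h: "h : lin_hom U V"
 shows "lin (Hom_module V W) (Hom_module U W) (%a. compose (carrier U) a h)"
proof (rule linI)
 note c = lin_hom_closed[OF h]
 show "compose (carrier U) a h : carrier (Hom_module U W)" if "a : carrier (Hom_module V W)" for a
  using lin_hom_compose[OF assms(1) h] that by simp
qed (auto simp: compose_def restrict_def fun_eq_iff lin_hom_closed[OF h])

lemma lin_compose_right:
 assumes "vs U" "vs V" "vs W" and h: "h : lin_hom V W"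
 shows "lin (Hom_module U V) (Hom_module U W) (%a. compose (carrier U) h a)"
proof (rule linI)
 note l = lin_homD[OF h]
 fix a assume a: "a : carrier (Hom_module U V)"
 show "compose (carrier U) h a : carrier (Hom_module U W)"
  using lin_hom_compose[OF assms(1) _ h] a by simp
 have c: "a x : carrier V" if "x : carrier U" for x using lin_hom_closed a that by simp
 show "compose (carrier U) h (k \<odot>[Hom_module U V] a) = k \<odot>[Hom_module U W] compose (carrier U) h a" for k
  by (auto simp: compose_def restrict_def fun_eq_iff lin_smult[OF l] c)
 fix b assume b: "b : carrier (Hom_module U V)"
 have cb: "b x : carrier V" if "x : carrier U" for x using lin_hom_closed b that by simp
 show "compose (carrier U) h (a \<oplus>[Hom_module U V] b) =
   compose (carrier U) h a \<oplus>[Hom_module U W] compose (carrier U) h b"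
  by (auto simp: compose_def restrict_def fun_eq_iff lin_add[OF l] c cb)
qed

text \<open>Linearity of \<open>a \<mapsto> a \<otimes> 1\<close>, needed to apply
  \<open>tensor_lift_snd\<close> to the two summands of \<open>conn_tensor\<close>.\<close>

lemma lin_tensor_map_l:
 assumes V: "vs V" and W: "vs W"
 shows "lin (End_module V) (End_module (tensor V W)) (%a. tensor_map V W V W a (%y. y))"
proof (rule linI)
 let ?T = "tensor V W"
 fix a assume a: "a : carrier (End_module V)"
 then have la: "lin V V a" by (simp add: lin_homD)
 note h = tensor_map_hom[OF V W V W _ lin_id]
 note t = tensor_map_tens[OF V W V W _ lin_id]
 note T = vs_tensor[OF V W]
 show c: "tensor_map V W V W a (%y. y) : carrier (End_module ?T)" using h[OF la] by simp
 show "tensor_map V W V W (k \<odot>[End_module V] a) (%y. y) = k \<odot>[End_module ?T] tensor_map V W V W a (%y. y)" for k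
 proof (rule lin_hom_eqI)
  have lka: "lin V V (k \<odot>[End_module V] a)" using vs_smult[OF vs_Hom_module[OF V V] a, of k] by (simp add: lin_homD)
  show "tensor_map V W V W (k \<odot>[End_module V] a) (%y. y) : lin_hom ?T ?T" by (rule h[OF lka])
  show 2: "k \<odot>[End_module ?T] tensor_map V W V W a (%y. y) : lin_hom ?T ?T"
   using vs_smult[OF vs_Hom_module[OF T T] c, of k] by simp
  fix x assume x: "x : carrier ?T"
  show "tensor_map V W V W (k \<odot>[End_module V] a) (%y. y) x = (k \<odot>[End_module ?T] tensor_map V W V W a (%y. y)) x"
   by (rule tensor_eqI[OF V W T lin_homD[OF h[OF lka]] lin_homD[OF 2] _ x])
    (use V W in \<open>simp del: Hom_module_simps add: Hom_apply t[OF lka] t[OF la] lin_closed[OF la] tens_linear[OF V W]\<close>)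
 qed
 fix b assume b: "b : carrier (End_module V)"
 then have lb: "lin V V b" by (simp add: lin_homD)
 have cb: "tensor_map V W V W b (%y. y) : carrier (End_module ?T)" using h[OF lb] by simp
 show "tensor_map V W V W (a \<oplus>[End_module V] b) (%y. y) =
   tensor_map V W V W a (%y. y) \<oplus>[End_module ?T] tensor_map V W V W b (%y. y)"
 proof (rule lin_hom_eqI)
  have lka: "lin V V (a \<oplus>[End_module V] b)" using vs_add[OF vs_Hom_module[OF V V] a b] by (simp add: lin_homD)
  show "tensor_map V W V W (a \<oplus>[End_module V] b) (%y. y) : lin_hom ?T ?T" by (rule h[OF lka])
  show 2: "tensor_map V W V W a (%y. y) \<oplus>[End_module ?T] tensor_map V W V W b (%y. y) : lin_hom ?T ?T"
   using vs_add[OF vs_Hom_module[OF T T] c cb] by simp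
  fix x assume x: "x : carrier ?T"
  show "tensor_map V W V W (a \<oplus>[End_module V] b) (%y. y) x =
    (tensor_map V W V W a (%y. y) \<oplus>[End_module ?T] tensor_map V W V W b (%y. y)) x"
   by (rule tensor_eqI[OF V W T lin_homD[OF h[OF lka]] lin_homD[OF 2] _ x])
    (use V W in \<open>simp del: Hom_module_simps add: Hom_apply t[OF lka] t[OF la] t[OF lb] lin_closed[OF la] lin_closed[OF lb] tens_linear[OF V W]\<close>)
 qed
qed

lemma lin_tensor_map_r:
 assumes V: "vs V" and W: "vs W"
 shows "lin (End_module W) (End_module (tensor V W)) (%a. tensor_map V W V W (%y. y) a)"
proof (rule linI)
 let ?T = "tensor V W"
 fix a assume a: "a : carrier (End_module W)"
 then have la: "lin W W a" by (simp add: lin_homD)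
 note h = tensor_map_hom[OF V W V W lin_id]
 note t = tensor_map_tens[OF V W V W lin_id]
 note T = vs_tensor[OF V W]
 show c: "tensor_map V W V W (%y. y) a : carrier (End_module ?T)" using h[OF la] by simp
 show "tensor_map V W V W (%y. y) (k \<odot>[End_module W] a) = k \<odot>[End_module ?T] tensor_map V W V W (%y. y) a" for k
 proof (rule lin_hom_eqI)
  have lka: "lin W W (k \<odot>[End_module W] a)" using vs_smult[OF vs_Hom_module[OF W W] a, of k] by (simp add: lin_homD)
  show "tensor_map V W V W (%y. y) (k \<odot>[End_module W] a) : lin_hom ?T ?T" by (rule h[OF lka])
  show 2: "k \<odot>[End_module ?T] tensor_map V W V W (%y. y) a : lin_hom ?T ?T"
   using vs_smult[OF vs_Hom_module[OF T T] c, of k] by simp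
  fix x assume x: "x : carrier ?T"
  show "tensor_map V W V W (%y. y) (k \<odot>[End_module W] a) x = (k \<odot>[End_module ?T] tensor_map V W V W (%y. y) a) x"
   by (rule tensor_eqI[OF V W T lin_homD[OF h[OF lka]] lin_homD[OF 2] _ x])
    (use V W in \<open>simp del: Hom_module_simps add: Hom_apply t[OF lka] t[OF la] lin_closed[OF la] tens_linear[OF V W]\<close>)
 qed
 fix b assume b: "b : carrier (End_module W)"
 then have lb: "lin W W b" by (simp add: lin_homD)
 have cb: "tensor_map V W V W (%y. y) b : carrier (End_module ?T)" using h[OF lb] by simp
 show "tensor_map V W V W (%y. y) (a \<oplus>[End_module W] b) =
   tensor_map V W V W (%y. y) a \<oplus>[End_module ?T] tensor_map V W V W (%y. y) b"
 proof (rule lin_hom_eqI)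
  have lka: "lin W W (a \<oplus>[End_module W] b)" using vs_add[OF vs_Hom_module[OF W W] a b] by (simp add: lin_homD)
  show "tensor_map V W V W (%y. y) (a \<oplus>[End_module W] b) : lin_hom ?T ?T" by (rule h[OF lka])
  show 2: "tensor_map V W V W (%y. y) a \<oplus>[End_module ?T] tensor_map V W V W (%y. y) b : lin_hom ?T ?T"
   using vs_add[OF vs_Hom_module[OF T T] c cb] by simp
  fix x assume x: "x : carrier ?T"
  show "tensor_map V W V W (%y. y) (a \<oplus>[End_module W] b) x =
    (tensor_map V W V W (%y. y) a \<oplus>[End_module ?T] tensor_map V W V W (%y. y) b) x"
   by (rule tensor_eqI[OF V W T lin_homD[OF h[OF lka]] lin_homD[OF 2] _ x])
    (use V W in \<open>simp del: Hom_module_simps add: Hom_apply t[OF lka] t[OF la] t[OF lb] lin_closed[OF la] lin_closed[OF lb] tens_linear[OF V W]\<close>)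
 qed
qed

text \<open>The map \<open>id \<otimes> h\<close> on forms with coefficients commutes with
  contraction of the form. Morphisms and tensor products of connections are read off in coordinates
  this way.\<close>

lemma tensor_lift_snd:
 assumes U: "vs U" and V: "vs V" and W: "vs W" and h: "lin V W h"
 shows "lin (tensor U V) (tensor U W) (lin_ext (tensor U W) (%(\<omega>, a). tens U W \<omega> (h a)))"
  and "lf U f ==> t : carrier (tensor U V) ==>
   ctr_l W f (lin_ext (tensor U W) (%(\<omega>, a). tens U W \<omega> (h a)) t) = h (ctr_l V f t)"
proof -
 have b: "bilin U V (tensor U W) (%\<omega> a. tens U W \<omega> (h a))"
  by (rule bilin_compose[OF bilin_tens[OF U W] lin_id h lin_id])
 note L = lin_tensor_lift[OF U V vs_tensor[OF U W] b]
 show "lin (tensor U V) (tensor U W) (lin_ext (tensor U W) (%(\<omega>, a). tens U W \<omega> (h a)))" by (rule L)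
 assume f: "lf U f" and t: "t : carrier (tensor U V)"
 show "ctr_l W f (lin_ext (tensor U W) (%(\<omega>, a). tens U W \<omega> (h a)) t) = h (ctr_l V f t)"
 proof (rule tensor_eqI[OF U V W lin_comp[OF L ctr_l(1)[OF U W f]] lin_comp[OF ctr_l(1)[OF U V f] h] _ t], goal_cases)
  case (1 v w) note vw = 1(1-2)
  from 1 show ?case
   using tensor_lift_tens[OF U V vs_tensor[OF U W] b vw]
   by (simp add: ctr_l(2)[OF U W f] ctr_l(2)[OF U V f] lin_closed[OF h] lin_smult[OF h])
 qed
qed

text \<open>In a nested \<open>lin_ext\<close>, as in \<open>wedge_square\<close> and
  \<open>scalar_pairing\<close>, the inner one has to depend linearly on the arguments of the outer
  one.\<close>

lemma lin_tensor_lift_param: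
 assumes V: "vs V" and W: "vs W" and M: "vs M" and U: "vs U"
  and b: "\<And>x. x : carrier U ==> bilin V W M (\<beta> x)"
  and l: "\<And>v w. v : carrier V ==> w : carrier W ==> lin U M (%x. \<beta> x v w)"
  and t: "t : carrier (tensor V W)"
 shows "lin U M (%x. lin_ext M (%(v, w). \<beta> x v w) t)"
proof (rule linI)
 note L = lin_tensor_lift[OF V W M b]
 note E = tensor_lift_tens[OF V W M b]
 fix x assume x: "x : carrier U"
 show "lin_ext M (%(v, w). \<beta> x v w) t : carrier M" by (rule lin_closed[OF L[OF x] t])
 show "lin_ext M (%(v, w). \<beta> (c \<odot>[U] x) v w) t = c \<odot>[M] lin_ext M (%(v, w). \<beta> x v w) t" for c
  by (rule tensor_eqI[OF V W M L[OF vs_smult[OF U x]] lin_smultf[OF M L[OF x]] _ t])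
   (simp add: E x U lin_smult[OF l])
 fix y assume y: "y : carrier U"
 show "lin_ext M (%(v, w). \<beta> (x \<oplus>[U] y) v w) t = lin_ext M (%(v, w). \<beta> x v w) t \<oplus>[M] lin_ext M (%(v, w). \<beta> y v w) t"
  by (rule tensor_eqI[OF V W M L[OF vs_add[OF U x y]] lin_addf[OF M L[OF x] L[OF y]] _ t])
   (simp add: E x y U lin_add[OF l])
qed

section \<open>Connections as tuples of endomorphisms\<close>

text \<open>Keeps the degree \<open>1\<close> from being rewritten to \<open>Suc 0\<close>, so that
  facts about \<open>part \<Omega> 1\<close> still match.\<close>

declare One_nat_def [simp del]

lemma Hom_zero_iff:
 assumes V: "vs V" and W: "vs W" and f: "f : lin_hom V W"
 shows "f = \<zero>[Hom_module V W] \<longleftrightarrow> (\<forall>x\<in>carrier V. f x = \<zero>[W])"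
proof
 assume "f = \<zero>[Hom_module V W]"
 then show "\<forall>x\<in>carrier V. f x = \<zero>[W]" by simp
next
 assume z: "\<forall>x\<in>carrier V. f x = \<zero>[W]"
 have "\<zero>[Hom_module V W] : lin_hom V W" using vs_zero[OF vs_Hom_module[OF V W]] by (simp only: Hom_module_simps(1))
 then show "f = \<zero>[Hom_module V W]" by (rule lin_hom_eqI[OF f]) (use z in simp)
qed

text \<open>What the argument takes from tropical forms; \<open>trop_form_algebra\<close> provides
  it. Finite dimension in degree one makes the words of bounded length a finite set, and alternation
  keeps tensor products integrable.\<close>

locale form_algebra =
 fixes \<Omega> :: "'o graded_algebra"
 assumes vs_total: "vs (total \<Omega>)"
  and part_sub: "\<And>p. submodule (part \<Omega> p) CC (total \<Omega>)"
  and wedge_bilin: "\<And>p q. bilin (deg_part \<Omega> p) (deg_part \<Omega> q) (deg_part \<Omega> (p + q)) (monoid.mult (total \<Omega>))"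
  and wedge_alt: "\<And>\<eta>. \<eta> : part \<Omega> 1 ==> \<eta> \<otimes>[total \<Omega>] \<eta> = \<zero>[total \<Omega>]"
  and fd_part1: "finite_dim (deg_part \<Omega> 1)"
begin

abbreviation "W1 \<equiv> deg_part \<Omega> 1"
abbreviation "W2 \<equiv> deg_part \<Omega> 2"
abbreviation wedge (infixl "\<cdot>" 70) where "\<eta> \<cdot> \<zeta> \<equiv> \<eta> \<otimes>[total \<Omega>] \<zeta>"

lemma deg_part_simps [simp]:
 "carrier (deg_part \<Omega> p) = part \<Omega> p" "\<zero>[deg_part \<Omega> p] = \<zero>[total \<Omega>]"
 "x \<oplus>[deg_part \<Omega> p] y = x \<oplus>[total \<Omega>] y" "c \<odot>[deg_part \<Omega> p] x = c \<odot>[total \<Omega>] x"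
 by (simp_all add: deg_part_def)

lemma vs_deg_part [simp]: "vs (deg_part \<Omega> p)"
 unfolding deg_part_def by (rule subspace_vs[OF vs_total part_sub])

lemma wedge12: "bilin W1 W1 W2 (\<cdot>)"
 using wedge_bilin[of 1 1] by (simp add: numeral_2_eq_2)

lemma wedge_part2 [simp]: "\<eta> : part \<Omega> 1 ==> \<zeta> : part \<Omega> 1 ==> \<eta> \<cdot> \<zeta> : part \<Omega> 2"
 using bilin_closed[OF wedge12] by simp

text \<open>Polarisation of \<open>wedge_alt\<close>: expand the square of the sum of
  \<open>x\<close> and \<open>y\<close>. It is stated through a functional, so that the minus sign
  is that of complex numbers.\<close>

lemma wedge_anti:
 assumes \<phi>: "lf W2 \<phi>" and x: "x : part \<Omega> 1" and y: "y : part \<Omega> 1"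
 shows "\<phi> (x \<cdot> y) = - \<phi> (y \<cdot> x)"
proof -
 have xy: "x \<oplus>[W1] y : carrier W1" using x y by (intro vs_add) auto
 have z: "\<phi> (u \<cdot> u) = 0" if "u : part \<Omega> 1" for u
  using wedge_alt[OF that] lf_zero[OF \<phi>] by simp
 note l = lin_add[OF bilin_left[OF wedge12]] lin_add[OF bilin_right[OF wedge12]]
 have "\<phi> ((x \<oplus>[W1] y) \<cdot> (x \<oplus>[W1] y)) = \<phi> (x \<cdot> (x \<oplus>[W1] y)) + \<phi> (y \<cdot> (x \<oplus>[W1] y))"
  using l(2)[OF xy, of x y] x y xy lf_add[OF \<phi>] by (simp del: deg_part_simps(3) add: deg_part_simps(3)[where p=2, symmetric])
 also have "... = \<phi> (x \<cdot> x) + \<phi> (x \<cdot> y) + (\<phi> (y \<cdot> x) + \<phi> (y \<cdot> y))"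
  using l(1)[of x x y] l(1)[of y x y] x y lf_add[OF \<phi>]
  by (simp del: deg_part_simps(3) add: deg_part_simps(3)[where p=2, symmetric])
 finally show ?thesis using z[of "x \<oplus>[W1] y"] z[OF x] z[OF y] xy by (simp add: eq_neg_iff_add_eq_0)
qed

lemma basis1_ex: "\<exists>P. finite (fst P) \<and> fst P \<subseteq> part \<Omega> 1 \<and> (\<forall>b. lf W1 (snd P b)) \<and>
   (\<forall>b\<in>fst P. \<forall>b'\<in>fst P. snd P b b' = (if b = b' then 1 else 0)) \<and>
   (\<forall>v\<in>part \<Omega> 1. v = (\<Oplus>\<^bsub>W1\<^esub>b\<in>fst P. snd P b v \<odot>[W1] b))"
 using finite_basis_ex[OF vs_deg_part fd_part1] by (auto simp del: deg_part_simps(2-4))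

text \<open>Basis and coordinates are chosen as one pair, so that \<open>D\<close> and
  \<open>co\<close> are dual to each other.\<close>

definition basis1 :: "'o set \<times> ('o => 'o => complex)" where
 "basis1 = (SOME P. finite (fst P) \<and> fst P \<subseteq> part \<Omega> 1 \<and> (\<forall>b. lf W1 (snd P b)) \<and>
   (\<forall>b\<in>fst P. \<forall>b'\<in>fst P. snd P b b' = (if b = b' then 1 else 0)) \<and>
   (\<forall>v\<in>part \<Omega> 1. v = (\<Oplus>\<^bsub>W1\<^esub>b\<in>fst P. snd P b v \<odot>[W1] b)))"

definition D :: "'o set" where "D = fst basis1"
definition co :: "'o => 'o => complex" where "co = snd basis1"

lemma finite_D [simp]: "finite D"
 and D_part: "D \<subseteq> part \<Omega> 1"
 and lf_co: "lf W1 (co b)"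
 and co_delta: "b : D ==> b' : D ==> co b b' = (if b = b' then 1 else 0)"
 and D_rep: "v : part \<Omega> 1 ==> v = (\<Oplus>\<^bsub>W1\<^esub>b\<in>D. co b v \<odot>[W1] b)"
 using someI_ex[OF basis1_ex, folded basis1_def] unfolding D_def co_def by blast+

lemma in_D [simp]: "i : D ==> i : part \<Omega> 1"
 using D_part by auto

lemma co_sep: "v : carrier W1 ==> (\<And>f. f : co ` D ==> f v = 0) ==> v = \<zero>[W1]"
proof -
 assume v: "v : carrier W1" and 0: "\<And>f. f : co ` D ==> f v = 0"
 have "v = (\<Oplus>\<^bsub>W1\<^esub>b\<in>D. co b v \<odot>[W1] b)" using D_rep v by simp
 also have "... = \<zero>[W1]"
 proof (rule vs_finsum_zero[OF vs_deg_part], goal_cases)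
  case (1 b)
  then show ?case
   using 0[of "co b"] vs_null[OF vs_deg_part, of b 1] by simp
 qed
 finally show ?thesis .
qed

abbreviation "FT E \<equiv> form_tensor \<Omega> 1 E"

text \<open>The endomorphism standing next to the basis form \<open>i\<close> when the connection
  form is expanded along \<open>D\<close> (\<open>cform_eq\<close>).\<close>

definition act :: "('o, 'e) conn => 'o => 'e => 'e" where
 "act X i = ctr_l (End_module (fibre X)) (co i) (cform X)"

text \<open>Neither integrability nor finite dimension is asked for, so that the coordinates of a
  tensor product or of a trivial connection are available before these are proved.\<close>

definition pre_conn :: "('o, 'e) conn => bool" where
 "pre_conn X \<longleftrightarrow> vs (fibre X) \<and> cform X : carrier (FT (End_module (fibre X)))"

text \<open>Integrability in coordinates. If \<theta> is the sum of the
  \<open>i \<otimes> a i\<close>, its square is the sum of the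
  \<open>(i \<cdot> j) \<otimes> a i a j\<close>, and the vanishing is tested by functionals on
  two-forms and on the fibre.\<close>

definition flat :: "'e cmod => ('o => 'e => 'e) => bool" where
 "flat E a \<longleftrightarrow> (\<forall>\<phi> \<mu>. lf W2 \<phi> --> lf E \<mu> --> (\<forall>e\<in>carrier E.
   (\<Sum>i\<in>D. \<Sum>j\<in>D. \<phi> (i \<cdot> j) * \<mu> (a i (a j e))) = 0))"

definition mk_conn :: "'e cmod => ('o => 'e => 'e) => ('o, 'e) conn" where
 "mk_conn E a = \<lparr>fibre = E, cform = (\<Oplus>\<^bsub>FT (End_module E)\<^esub>i\<in>D. form_tens \<Omega> 1 (End_module E) i (a i))\<rparr>"

lemma act_hom: "pre_conn X ==> act X i : lin_hom (fibre X) (fibre X)"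
 using lin_closed[OF ctr_l(1)[OF vs_deg_part vs_Hom_module lf_co]]
 by (fastforce simp: pre_conn_def act_def)

lemmas act_lin = act_hom[THEN lin_homD]

lemma cform_eq:
 assumes X: "pre_conn X"
 shows "cform X = (\<Oplus>\<^bsub>FT (End_module (fibre X))\<^esub>i\<in>D. form_tens \<Omega> 1 (End_module (fibre X)) i (act X i))"
 unfolding act_def using X D_part D_rep
 by (intro tensor_left_basis_rep[OF vs_deg_part vs_Hom_module _ finite_D _ lf_co]) (auto simp: pre_conn_def)

lemma mk_conn:
 assumes E: "vs E" and a: "\<And>i. i : D ==> a i : lin_hom E E"
 shows "pre_conn (mk_conn E a)" "fibre (mk_conn E a) = E" "i : D ==> act (mk_conn E a) i = a i"
proof -
 let ?H = "End_module E"
 have t: "form_tens \<Omega> 1 ?H j (a j) : carrier (FT ?H)" if "j : D" for j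
  using that a[OF that] E by (intro tens_closed) auto
 have c: "finsum (FT ?H) (%j. form_tens \<Omega> 1 ?H j (a j)) D : carrier (FT ?H)"
  using t E by (intro vs_finsum) auto
 then show "pre_conn (mk_conn E a)" using E by (simp add: pre_conn_def mk_conn_def)
 show "fibre (mk_conn E a) = E" by (simp add: mk_conn_def)
 assume i: "i : D"
 note l = ctr_l(1)[OF vs_deg_part vs_Hom_module[OF E E] lf_co]
 note l2 = ctr_l(2)[OF vs_deg_part vs_Hom_module[OF E E] lf_co]
 have vh: "vs ?H" using E by simp
 have "act (mk_conn E a) i = finsum ?H (%j. ctr_l ?H (co i) (form_tens \<Omega> 1 ?H j (a j))) D"
  unfolding act_def mk_conn_def using E t by (simp add: lin_finsum[OF l])
 also have "... = finsum ?H (%j. if j = i then a i else \<zero>[?H]) D"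
 proof (rule vs_finsum_cong[OF vh refl])
  fix j assume j: "j : D"
  show "(if j = i then a i else \<zero>[?H]) : carrier ?H" using a[OF i] vs_zero[OF vh] by (simp del: Hom_module_simps(2))
  have aj: "a j : carrier ?H" using a[OF j] by simp
  show "ctr_l ?H (co i) (form_tens \<Omega> 1 ?H j (a j)) = (if j = i then a i else \<zero>[?H])"
   using l2[of j "a j" i] aj i j vs_one[OF vh aj] vs_null[OF vh aj] co_delta[OF i j]
   by (cases "j = i") (simp_all del: Hom_module_simps(2-4))
 qed
 also have "... = finsum ?H (%j. a i) {i}"
 proof -
  have "finsum ?H (%j. if j = i then a i else \<zero>[?H]) D = finsum ?H (%j. if j = i then a i else \<zero>[?H]) {i}"
   using i a[OF i] by (intro vs_finsum_neutral[OF vh]) auto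
  also have "... = finsum ?H (%j. a i) {i}"
   using a[OF i] by (intro vs_finsum_cong[OF vh]) auto
  finally show ?thesis .
 qed
 also have "... = a i" using a[OF i] vh by (subst vs_finsum_insert) (auto simp del: Hom_module_simps(2,3))
 finally show "act (mk_conn E a) i = a i" .
qed

lemma mk_conn_act: "pre_conn X ==> mk_conn (fibre X) (act X) = X"
 using cform_eq[of X] by (simp add: mk_conn_def)

text \<open>After expansion along \<open>D\<close> the square is a double sum.
  \<open>tensor_eq_zero_iff\<close> tests it by functionals on two-forms, and the resulting
  endomorphisms are tested by vectors and functionals of \<open>E\<close>.\<close>

lemma wedge_square_zero_iff:
 assumes E: "vs E" and \<theta>: "\<theta> : carrier (FT (End_module E))"
 shows "wedge_square \<Omega> E \<theta> = \<zero>[form_tensor \<Omega> 2 (End_module E)] \<longleftrightarrow> flat E (%i. ctr_l (End_module E) (co i) \<theta>)"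
proof -
 let ?H = "End_module E" and ?P = "form_tensor \<Omega> 2 (End_module E)"
 define a where "a i = ctr_l ?H (co i) \<theta>" for i
 have H: "vs ?H" and P: "vs ?P" using E by auto
 let ?\<beta> = "%\<omega> a \<omega>' a'. form_tens \<Omega> 2 ?H (\<omega> \<cdot> \<omega>') (compose (carrier E) a a')"
 have bt: "bilin W2 ?H ?P (form_tens \<Omega> 2 ?H)" by (rule bilin_tens[OF vs_deg_part H])
 have b1: "bilin W1 ?H ?P (?\<beta> \<omega> a)" if "\<omega> : carrier W1" "a : carrier ?H" for \<omega> a
  using bilin_compose[OF bt bilin_left[OF wedge12 that(1)] lin_compose_right[OF E E E] lin_id] that by simp
 have b2: "bilin W1 ?H ?P (%\<omega> a. ?\<beta> \<omega> a \<omega>' a')" if "\<omega>' : carrier W1" "a' : carrier ?H" for \<omega>' a'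
  using bilin_compose[OF bt bilin_right[OF wedge12 that(1)] lin_compose_left[OF E E E] lin_id] that by simp
 let ?I = "%\<omega> a. lin_ext ?P (%(\<omega>', a'). ?\<beta> \<omega> a \<omega>' a') \<theta>"
 \<comment> \<open>The outer \<open>lin_ext\<close> of \<open>wedge_square\<close> can be evaluated
   only once the inner one, with \<theta> inserted in the second slot, is known to be bilinear in
   the first.\<close>
 have bI: "bilin W1 ?H ?P ?I"
 proof (rule bilinI)
  fix \<omega> assume w: "\<omega> : carrier W1"
  show "lin ?H ?P (?I \<omega>)"
   by (rule lin_tensor_lift_param[OF vs_deg_part H P H b1[OF w] bilin_left[OF b2 w] \<theta>])
 next
  fix b assume b: "b : carrier ?H"
  show "lin W1 ?P (%\<omega>. ?I \<omega> b)"
   by (rule lin_tensor_lift_param[OF vs_deg_part H P vs_deg_part b1[OF _ b] bilin_right[OF b2 b] \<theta>])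
 qed
 have a: "a i : carrier ?H" for i
  unfolding a_def by (rule lin_closed[OF ctr_l(1)[OF vs_deg_part H lf_co] \<theta>])
 have rep: "\<theta> = finsum (FT ?H) (%i. form_tens \<Omega> 1 ?H i (a i)) D"
  unfolding a_def using D_part D_rep
  by (intro tensor_left_basis_rep[OF vs_deg_part H \<theta> finite_D _ lf_co]) auto
 have lift: "lin_ext ?P (%(\<omega>, a). g \<omega> a) \<theta> = finsum ?P (%i. g i (a i)) D" if g: "bilin W1 ?H ?P g" for g
 proof -
  have "lin_ext ?P (%(\<omega>, a). g \<omega> a) \<theta> = lin_ext ?P (%(\<omega>, a). g \<omega> a) (finsum (FT ?H) (%i. form_tens \<Omega> 1 ?H i (a i)) D)"
   using rep by simp
  also have "... = finsum ?P (%i. lin_ext ?P (%(\<omega>, a). g \<omega> a) (form_tens \<Omega> 1 ?H i (a i))) D"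
   using a H by (intro lin_finsum[OF lin_tensor_lift[OF vs_deg_part H P g] _ P] vs_tensor tens_closed) auto
  also have "... = finsum ?P (%i. g i (a i)) D"
   using a bilin_closed[OF g] by (intro vs_finsum_cong[OF P]) (auto simp: tensor_lift_tens[OF vs_deg_part H P g])
  finally show ?thesis .
 qed
 have c: "compose (carrier E) (a i) (a j) : carrier ?H" for i j
  using lin_hom_compose[OF E, of "a j" E "a i" E] a by simp
 have tc: "form_tens \<Omega> 2 ?H (i \<cdot> j) (compose (carrier E) (a i) (a j)) : carrier ?P" if "i : D" "j : D" for i j
  using that c H by (intro tens_closed) auto
 have ws: "wedge_square \<Omega> E \<theta> = finsum ?P (%i. finsum ?P (%j. ?\<beta> i (a i) j (a j)) D) D"
 proof -
  have "wedge_square \<Omega> E \<theta> = finsum ?P (%i. ?I i (a i)) D"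
   unfolding wedge_square_def Let_def by (rule lift[OF bI])
  also have "... = finsum ?P (%i. finsum ?P (%j. ?\<beta> i (a i) j (a j)) D) D"
  proof (rule vs_finsum_cong[OF P refl])
   fix i assume i: "i : D"
   show "finsum ?P (%j. ?\<beta> i (a i) j (a j)) D : carrier ?P" by (rule vs_finsum[OF P tc[OF i]])
   show "?I i (a i) = finsum ?P (%j. ?\<beta> i (a i) j (a j)) D"
    by (rule lift[OF b1[OF _ a]]) (use i in simp)
  qed
  finally show ?thesis .
 qed
 have wc: "wedge_square \<Omega> E \<theta> : carrier ?P" unfolding ws using P tc by (intro vs_finsum) auto
 have ev: "\<mu> (ctr_l ?H \<phi> (wedge_square \<Omega> E \<theta>) e) = (\<Sum>i\<in>D. \<Sum>j\<in>D. \<phi> (i \<cdot> j) * \<mu> (a i (a j e)))"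
  if \<phi>: "lf W2 \<phi>" and \<mu>: "lf E \<mu>" and e: "e : carrier E" for \<phi> \<mu> e
 proof -
  have l: "lf ?P (%t. \<mu> (ctr_l ?H \<phi> t e))"
   by (rule lin_comp[OF lin_comp[OF ctr_l(1)[OF vs_deg_part H \<phi>] lin_eval[OF E e]] \<mu>])
  have "\<mu> (ctr_l ?H \<phi> (wedge_square \<Omega> E \<theta>) e) = (\<Sum>i\<in>D. \<Sum>j\<in>D. \<mu> (ctr_l ?H \<phi> (?\<beta> i (a i) j (a j)) e))"
   unfolding ws using P tc by (subst lf_finsum[OF l P], blast intro: vs_finsum, intro sum.cong refl lf_finsum[OF l P]) auto
  also have "... = (\<Sum>i\<in>D. \<Sum>j\<in>D. \<phi> (i \<cdot> j) * \<mu> (a i (a j e)))"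
  proof (intro sum.cong refl)
   fix i j assume ij: "i : D" "j : D"
   have "a i (a j e) : carrier E"
    using lin_hom_closed[of "a i" E E "a j e"] lin_hom_closed[of "a j" E E e] a e by simp
   then show "\<mu> (ctr_l ?H \<phi> (?\<beta> i (a i) j (a j)) e) = \<phi> (i \<cdot> j) * \<mu> (a i (a j e))"
    using ctr_l(2)[OF vs_deg_part H \<phi>, of "i \<cdot> j" "compose (carrier E) (a i) (a j)"] c ij e
    by (simp add: compose_eq lf_smult[OF \<mu>])
  qed
  finally show ?thesis .
 qed
 have ch: "ctr_l ?H \<phi> (wedge_square \<Omega> E \<theta>) : carrier ?H" if "lf W2 \<phi>" for \<phi>
  by (rule lin_closed[OF ctr_l(1)[OF vs_deg_part H that] wc])
 have "wedge_square \<Omega> E \<theta> = \<zero>[?P] \<longleftrightarrow> (\<forall>\<phi>. lf W2 \<phi> --> ctr_l ?H \<phi> (wedge_square \<Omega> E \<theta>) = \<zero>[?H])"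
  by (rule tensor_eq_zero_iff[OF vs_deg_part H wc])
 also have "... \<longleftrightarrow> (\<forall>\<phi>. lf W2 \<phi> --> (\<forall>e\<in>carrier E. ctr_l ?H \<phi> (wedge_square \<Omega> E \<theta>) e = \<zero>[E]))"
 proof (intro all_cong1 imp_cong refl)
  fix \<phi> assume "lf W2 \<phi>"
  from ch[OF this] show "(ctr_l ?H \<phi> (wedge_square \<Omega> E \<theta>) = \<zero>[?H]) =
    (\<forall>e\<in>carrier E. ctr_l ?H \<phi> (wedge_square \<Omega> E \<theta>) e = \<zero>[E])"
   unfolding Hom_module_simps(1) by (rule Hom_zero_iff[OF E E])
 qed
 also have "... \<longleftrightarrow> flat E a"
 proof -
  have "ctr_l ?H \<phi> (wedge_square \<Omega> E \<theta>) e = \<zero>[E] \<longleftrightarrow>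
    (\<forall>\<mu>. lf E \<mu> --> (\<Sum>i\<in>D. \<Sum>j\<in>D. \<phi> (i \<cdot> j) * \<mu> (a i (a j e))) = 0)"
   if \<phi>: "lf W2 \<phi>" and e: "e : carrier E" for \<phi> e
  proof -
   have "ctr_l ?H \<phi> (wedge_square \<Omega> E \<theta>) e : carrier E"
    using ch[OF \<phi>] e unfolding Hom_module_simps(1) by (rule lin_hom_closed)
   note c = this
   show ?thesis
   proof
    assume z: "ctr_l ?H \<phi> (wedge_square \<Omega> E \<theta>) e = \<zero>[E]"
    show "\<forall>\<mu>. lf E \<mu> --> (\<Sum>i\<in>D. \<Sum>j\<in>D. \<phi> (i \<cdot> j) * \<mu> (a i (a j e))) = 0"
     using ev[OF \<phi> _ e] lf_zero[OF _ E] z by simp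
   next
    assume z: "\<forall>\<mu>. lf E \<mu> --> (\<Sum>i\<in>D. \<Sum>j\<in>D. \<phi> (i \<cdot> j) * \<mu> (a i (a j e))) = 0"
    show "ctr_l ?H \<phi> (wedge_square \<Omega> E \<theta>) e = \<zero>[E]"
     by (rule vs_sep[OF E c]) (use z ev[OF \<phi> _ e] in auto)
   qed
  qed
  then show ?thesis unfolding flat_def by blast
 qed
 finally show ?thesis by (simp add: a_def[abs_def])
qed

lemma integrable_conn_iff:
 "integrable_conn \<Omega> X \<longleftrightarrow> pre_conn X \<and> finite_dim (fibre X) \<and> flat (fibre X) (act X)"
 unfolding integrable_conn_def pre_conn_def act_def using wedge_square_zero_iff by blast

text \<open>The defining equation is one between one-forms with values in linear maps. The
  coordinates \<open>co i\<close> separate one-forms, so it splits into one equation for each basis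
  form.\<close>

lemma conn_hom_iff:
 assumes X: "pre_conn X" and Y: "pre_conn Y"
 shows "T : conn_hom \<Omega> X Y \<longleftrightarrow> T : lin_hom (fibre X) (fibre Y) \<and>
  (\<forall>i\<in>D. \<forall>e\<in>carrier (fibre X). act Y i (T e) = T (act X i e))"
proof (cases "T : lin_hom (fibre X) (fibre Y)")
 case T: True
 have E: "vs (fibre X)" and F: "vs (fibre Y)" using X Y by (auto simp: pre_conn_def)
 let ?H = "Hom_module (fibre X) (fibre Y)"
 let ?l = "lin_ext (FT ?H) (%(\<omega>, a). form_tens \<Omega> 1 ?H \<omega> (compose (carrier (fibre X)) a T)) (cform Y)"
 let ?r = "lin_ext (FT ?H) (%(\<omega>, a). form_tens \<Omega> 1 ?H \<omega> (compose (carrier (fibre X)) T a)) (cform X)"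
 note L = tensor_lift_snd[OF vs_deg_part vs_Hom_module[OF F F] vs_Hom_module[OF E F] lin_compose_left[OF E F F T]]
 note R = tensor_lift_snd[OF vs_deg_part vs_Hom_module[OF E E] vs_Hom_module[OF E F] lin_compose_right[OF E E F T]]
 have cX: "cform X : carrier (FT (End_module (fibre X)))" and cY: "cform Y : carrier (FT (End_module (fibre Y)))"
  using X Y by (auto simp: pre_conn_def)
 have "?l = ?r \<longleftrightarrow> (\<forall>i\<in>D. ctr_l ?H (co i) ?l = ctr_l ?H (co i) ?r)"
  using tensor_sep_eq[OF vs_deg_part vs_Hom_module[OF E F] lin_closed[OF L(1) cY] lin_closed[OF R(1) cX],
   of "co ` D"] lf_co co_sep by auto
 also have "... \<longleftrightarrow> (\<forall>i\<in>D. compose (carrier (fibre X)) (act Y i) T = compose (carrier (fibre X)) T (act X i))"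
  unfolding act_def L(2)[OF lf_co cY] R(2)[OF lf_co cX] by simp
 also have "... \<longleftrightarrow> (\<forall>i\<in>D. \<forall>e\<in>carrier (fibre X). act Y i (T e) = T (act X i e))"
  by (auto simp: compose_def restrict_def fun_eq_iff)
 finally show ?thesis using T by (simp add: conn_hom_def Let_def)
qed (simp add: conn_hom_def)

text \<open>The last part is the Leibniz rule for a single letter; \<open>tensor_word\<close>
  iterates it.\<close>

lemma pre_conn_tensor:
 assumes X: "pre_conn X" and Y: "pre_conn Y"
 shows "pre_conn (conn_tensor \<Omega> X Y)" "fibre (conn_tensor \<Omega> X Y) = tensor (fibre X) (fibre Y)"
  "e : carrier (fibre X) ==> f : carrier (fibre Y) ==>
   act (conn_tensor \<Omega> X Y) i (tens (fibre X) (fibre Y) e f) =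
    tens (fibre X) (fibre Y) (act X i e) f \<oplus>[tensor (fibre X) (fibre Y)] tens (fibre X) (fibre Y) e (act Y i f)"
proof -
 have E: "vs (fibre X)" and F: "vs (fibre Y)" using X Y by (auto simp: pre_conn_def)
 let ?T = "tensor (fibre X) (fibre Y)"
 let ?P = "End_module ?T"
 have T: "vs ?T" and P: "vs ?P" using E F by auto
 have cX: "cform X : carrier (FT (End_module (fibre X)))" and cY: "cform Y : carrier (FT (End_module (fibre Y)))"
  using X Y by (auto simp: pre_conn_def)
 note L = tensor_lift_snd[OF vs_deg_part vs_Hom_module[OF E E] P lin_tensor_map_l[OF E F]]
 note R = tensor_lift_snd[OF vs_deg_part vs_Hom_module[OF F F] P lin_tensor_map_r[OF E F]]
 note cl = lin_closed[OF L(1) cX] and cr = lin_closed[OF R(1) cY]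
 show "fibre (conn_tensor \<Omega> X Y) = ?T" by (simp add: conn_tensor_def Let_def)
 show "pre_conn (conn_tensor \<Omega> X Y)"
  using vs_add[OF vs_tensor[OF vs_deg_part P] cl cr] T by (simp add: pre_conn_def conn_tensor_def Let_def)
 have "act (conn_tensor \<Omega> X Y) i =
   tensor_map (fibre X) (fibre Y) (fibre X) (fibre Y) (act X i) (%y. y) \<oplus>[?P]
   tensor_map (fibre X) (fibre Y) (fibre X) (fibre Y) (%x. x) (act Y i)"
  using lin_add[OF ctr_l(1)[OF vs_deg_part P lf_co] cl cr, of i]
  unfolding act_def L(2)[OF lf_co cX] R(2)[OF lf_co cY] by (simp add: conn_tensor_def Let_def)
 moreover assume ef: "e : carrier (fibre X)" "f : carrier (fibre Y)"
 ultimately show "act (conn_tensor \<Omega> X Y) i (tens (fibre X) (fibre Y) e f) =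
    tens (fibre X) (fibre Y) (act X i e) f \<oplus>[?T] tens (fibre X) (fibre Y) e (act Y i f)"
  using tensor_map_tens[OF E F E F act_lin[OF X] lin_id ef] tensor_map_tens[OF E F E F lin_id act_lin[OF Y] ef]
   tens_closed[OF E F ef] by (simp add: Hom_apply del: Hom_module_simps)
qed

lemma trivial_conn:
 assumes E: "vs E"
 shows "pre_conn (trivial_conn \<Omega> E)" "fibre (trivial_conn \<Omega> E) = E"
  "e : carrier E ==> act (trivial_conn \<Omega> E) i e = \<zero>[E]"
proof -
 have H: "vs (End_module E)" using E by simp
 show "pre_conn (trivial_conn \<Omega> E)" using E H by (simp add: pre_conn_def trivial_conn_def del: Hom_module_simps)
 show "fibre (trivial_conn \<Omega> E) = E" by (simp add: trivial_conn_def)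
 show "e : carrier E ==> act (trivial_conn \<Omega> E) i e = \<zero>[E]"
  using lin_zero[OF ctr_l(1)[OF vs_deg_part H lf_co] vs_tensor[OF vs_deg_part H] H]
  by (simp add: act_def trivial_conn_def)
qed

text \<open>The double sum is \<mu> of a fixed vector of \<open>E\<close>, so a separating family of
  functionals decides whether it vanishes. The families in use are evaluations on function spaces
  and restrictions to a subspace.\<close>

lemma flatI:
 assumes E: "vs E" and a: "\<And>i e. i : D ==> e : carrier E ==> a i e : carrier E"
  and L: "\<And>\<mu>. \<mu> : L ==> lf E \<mu>"
  and sep: "\<And>v. v : carrier E ==> (\<And>f. f : L ==> f v = 0) ==> v = \<zero>[E]"
  and 0: "\<And>\<phi> \<mu> e. lf W2 \<phi> ==> \<mu> : L ==> e : carrier E ==>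
   (\<Sum>i\<in>D. \<Sum>j\<in>D. \<phi> (i \<cdot> j) * \<mu> (a i (a j e))) = 0"
 shows "flat E a"
 unfolding flat_def
proof (intro allI impI ballI)
 fix \<phi> \<mu> e assume \<phi>: "lf W2 \<phi>" and \<mu>: "lf E \<mu>" and e: "e : carrier E"
 let ?s = "finsum E (%i. finsum E (%j. \<phi> (i \<cdot> j) \<odot>[E] a i (a j e)) D) D"
 have ev: "f ?s = (\<Sum>i\<in>D. \<Sum>j\<in>D. \<phi> (i \<cdot> j) * f (a i (a j e)))" if f: "lf E f" for f
  using E a e by (simp add: lf_finsum[OF f E] lf_smult[OF f])
 have "?s : carrier E" using E a e by (intro vs_finsum) auto
 then have "?s = \<zero>[E]"
  by (rule sep) (use 0[OF \<phi> _ e] ev L in auto)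
 then show "(\<Sum>i\<in>D. \<Sum>j\<in>D. \<phi> (i \<cdot> j) * \<mu> (a i (a j e))) = 0"
  using ev[OF \<mu>] lf_zero[OF \<mu> E] by simp
qed

text \<open>In the square of the Leibniz action the two pure terms vanish by integrability of the
  factors. The two mixed terms differ by exchanging \<open>i\<close> and \<open>j\<close>, and
  cancel by \<open>wedge_anti\<close>.\<close>

lemma flat_tensor:
 assumes X: "pre_conn X" "flat (fibre X) (act X)" and Y: "pre_conn Y" "flat (fibre Y) (act Y)"
 shows "flat (fibre (conn_tensor \<Omega> X Y)) (act (conn_tensor \<Omega> X Y))"
proof -
 let ?E = "fibre X" and ?F = "fibre Y" and ?a = "act X" and ?b = "act Y"
 have E: "vs ?E" and F: "vs ?F" using X Y by (auto simp: pre_conn_def)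
 let ?T = "tensor ?E ?F" and ?c = "act (conn_tensor \<Omega> X Y)"
 note XY = pre_conn_tensor[OF X(1) Y(1)]
 have T: "vs ?T" using E F by simp
 have cl: "lin ?T ?T (?c i)" for i using act_lin[OF XY(1)] XY(2) by simp
 have ca: "e : carrier ?E ==> ?a i e : carrier ?E" for i e by (rule lin_closed[OF act_lin[OF X(1)]])
 have cb: "e : carrier ?F ==> ?b i e : carrier ?F" for i e by (rule lin_closed[OF act_lin[OF Y(1)]])
 show ?thesis unfolding XY(2)
 proof (rule flatI[OF T, where L="{\<mu>. lf ?T \<mu>}"])
  show "?c i e : carrier ?T" if "e : carrier ?T" for i e using lin_closed[OF cl that] .
  show "v = \<zero>[?T]" if "v : carrier ?T" "\<And>f. f : {\<mu>. lf ?T \<mu>} ==> f v = 0" for v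
   using vs_sep[OF T that(1)] that(2) by simp
  fix \<phi> \<mu> t assume \<phi>: "lf W2 \<phi>" and "\<mu> : {\<mu>. lf ?T \<mu>}" and t: "t : carrier ?T"
  then have \<mu>: "lf ?T \<mu>" by simp
  let ?S = "%t. \<Sum>i\<in>D. \<Sum>j\<in>D. \<phi> (i \<cdot> j) * \<mu> (?c i (?c j t))"
  have l: "lf ?T ?S"
   by (rule linI) (auto simp: lin_add[OF cl] lin_smult[OF cl] lin_closed[OF cl] lf_add[OF \<mu>] lf_smult[OF \<mu>]
    sum.distrib algebra_simps sum_distrib_left)
  show "?S t = 0"
  proof (rule tensor_eqI[OF E F vs_complex_line l lin_zerof[OF vs_complex_line, simplified] _ t], goal_cases)
   case (1 v w) note vw = 1(1-2)
   let ?t = "%v w. \<mu> (tens ?E ?F v w)"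
   have 1: "\<mu> (?c i (?c j (tens ?E ?F v w))) =
     ?t (?a i (?a j v)) w + ?t (?a j v) (?b i w) + ?t (?a i v) (?b j w) + ?t v (?b i (?b j w))" for i j
    using vw E F ca cb by (simp add: XY(3) lin_add[OF cl] lf_add[OF \<mu>])
   have l1: "lf ?E (%v. ?t v w)" by (rule lin_comp[OF bilin_right[OF bilin_tens[OF E F] vw(2)] \<mu>])
   have l2: "lf ?F (%w. ?t v w)" by (rule lin_comp[OF bilin_left[OF bilin_tens[OF E F] vw(1)] \<mu>])
   have 2: "(\<Sum>i\<in>D. \<Sum>j\<in>D. \<phi> (i \<cdot> j) * ?t (?a i (?a j v)) w) = 0"
    using X(2) \<phi> l1 vw unfolding flat_def by blast
   have 3: "(\<Sum>i\<in>D. \<Sum>j\<in>D. \<phi> (i \<cdot> j) * ?t v (?b i (?b j w))) = 0"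
    using Y(2) \<phi> l2 vw unfolding flat_def by blast
   have "(\<Sum>i\<in>D. \<Sum>j\<in>D. \<phi> (i \<cdot> j) * ?t (?a j v) (?b i w)) = (\<Sum>j\<in>D. \<Sum>i\<in>D. \<phi> (i \<cdot> j) * ?t (?a j v) (?b i w))"
    by (rule sum.swap)
   also have "... = (\<Sum>i\<in>D. \<Sum>j\<in>D. - (\<phi> (i \<cdot> j) * ?t (?a i v) (?b j w)))"
    using wedge_anti[OF \<phi>] by (intro sum.cong refl) (metis in_D minus_mult_left)
   finally have 4: "(\<Sum>i\<in>D. \<Sum>j\<in>D. \<phi> (i \<cdot> j) * ?t (?a j v) (?b i w)) +
     (\<Sum>i\<in>D. \<Sum>j\<in>D. \<phi> (i \<cdot> j) * ?t (?a i v) (?b j w)) = 0"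
    by (simp add: sum_negf)
   show ?case
    unfolding 1 using 2 3 4 by (simp add: distrib_left sum.distrib)
  qed
 qed simp
qed

end

section \<open>Unipotent connections\<close>

lemma bij_lin_inverse:
 assumes V: "vs V" and W: "vs W" and T: "T : lin_hom V W" and b: "bij_betw T (carrier V) (carrier W)"
 obtains S where "S : lin_hom W V" "bij_betw S (carrier W) (carrier V)"
  "\<And>x. x : carrier V ==> S (T x) = x" "\<And>y. y : carrier W ==> T (S y) = y"
proof -
 define S0 where "S0 = inv_into (carrier V) T"
 note l = lin_homD[OF T]
 have c: "S0 y : carrier V" and TS: "T (S0 y) = y" if "y : carrier W" for y
  using that b unfolding S0_def bij_betw_def by (auto intro: inv_into_into f_inv_into_f)
 have ST: "S0 (T x) = x" if "x : carrier V" for x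
  using that b unfolding S0_def bij_betw_def by simp
 have inj: "x = y" if "x : carrier V" "y : carrier V" "T x = T y" for x y
  using b that unfolding bij_betw_def inj_on_def by blast
 have lS: "lin W V S0"
 proof (rule linI)
  fix x y assume xy: "x : carrier W" "y : carrier W"
  show "S0 (x \<oplus>[W] y) = S0 x \<oplus>[V] S0 y"
   by (rule inj) (use xy V W c in \<open>simp_all add: TS lin_add[OF l]\<close>)
  show "S0 (k \<odot>[W] x) = k \<odot>[V] S0 x" for k
   by (rule inj) (use xy V W c in \<open>simp_all add: TS lin_smult[OF l]\<close>)
 qed (rule c)
 have "bij_betw S0 (carrier W) (carrier V)"
  unfolding S0_def using b by (rule bij_betw_inv_into)
 then have "bij_betw (restrict S0 (carrier W)) (carrier W) (carrier V)"
  by (simp cong: bij_betw_cong)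
 then show thesis
  using that[OF lin_restrict[OF W lS]] ST TS lin_closed[OF l] c by simp
qed

text \<open>Functions vanishing off \<open>S\<close> instead of extensional ones: the same function
  then belongs to the space of every larger \<open>S\<close>, and truncations of different lengths
  can be compared.\<close>

definition fun_module :: "'i set => ('i => complex) cmod" where
 "fun_module S = \<lparr>carrier = {x. \<forall>i. i \<notin> S --> x i = 0}, monoid.mult = undefined, one = undefined,
   ring.zero = (%_. 0), add = (%x y i. x i + y i), module.smult = (%c x i. c * x i)\<rparr>"

lemma fun_module_simps [simp]:
 "carrier (fun_module S) = {x. \<forall>i. i \<notin> S --> x i = 0}" "\<zero>[fun_module S] = (%_. 0)"
 "x \<oplus>[fun_module S] y = (%i. x i + y i)" "c \<odot>[fun_module S] x = (%i. c * x i)"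
 by (simp_all add: fun_module_def)

lemma vs_fun_module [simp]: "vs (fun_module S)"
 by (rule vsI) (auto simp: algebra_simps)

lemma lf_fun_eval: "lf (fun_module S) (%x. x i)"
 by (rule linI) auto

lemma finite_dim_fun_module:
 assumes S: "finite S"
 shows "finite_dim (fun_module S)"
proof (rule finite_dimI[OF vs_fun_module])
 let ?d = "%i j. if j = i then 1 else 0 :: complex"
 show "finite (?d ` S)" using S by simp
 show "?d ` S \<subseteq> carrier (fun_module S)" by auto
 fix U and x :: "'a => complex"
 assume U: "submodule U CC (fun_module S)" and d: "?d ` S \<subseteq> U" and x: "x : carrier (fun_module S)"
 have c: "x i \<odot>[fun_module S] ?d i : carrier (fun_module S)" if "i : S" for i using that by auto
 have "finsum (fun_module S) (%i. x i \<odot>[fun_module S] ?d i) S = x"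
 proof
  fix j
  have "finsum (fun_module S) (%i. x i \<odot>[fun_module S] ?d i) S j = (\<Sum>i\<in>S. (x i \<odot>[fun_module S] ?d i) j)"
   by (rule lf_finsum[OF lf_fun_eval vs_fun_module c])
  also have "... = (\<Sum>i\<in>S. if i = j then x i else 0)" by (intro sum.cong) auto
  also have "... = x j" using S x by simp
  finally show "finsum (fun_module S) (%i. x i \<odot>[fun_module S] ?d i) S j = x j" .
 qed
 moreover have "finsum (fun_module S) (%i. x i \<odot>[fun_module S] ?d i) S : U"
 proof (rule submodule_finsum[OF vs_fun_module U], goal_cases)
  case (1 i)
  then have "?d i : U" using d by blast
  then show ?case using U unfolding submodule_iff[OF vs_fun_module] by blast
 qed
 ultimately show "x : U" by simp
qed

text \<open>The last letter acts first, so concatenation of words becomes composition in the same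
  order (\<open>aw_append\<close>).\<close>

definition aw :: "('i => 'e => 'e) => 'i list => 'e => 'e" where
 "aw a I e = foldr a I e"

lemma aw_simps [simp]: "aw a [] e = e" "aw a (i # I) e = a i (aw a I e)"
 by (simp_all add: aw_def)

lemma aw_append: "aw a (I @ J) e = aw a I (aw a J e)"
 by (simp add: aw_def)

section \<open>Nilpotent families of endomorphisms and unipotent objects\<close>

context form_algebra
begin

text \<open>The bound is strict: for nilpotency order \<open>n\<close> these are the words that may
  act nontrivially. In particular \<open>Wd 0\<close> is empty.\<close>

definition Wd :: "nat => 'o list set" where
 "Wd n = {I. set I \<subseteq> D \<and> length I < n}"

lemma finite_Wd [simp]: "finite (Wd n)"
proof -
 have "Wd n \<subseteq> {I. set I \<subseteq> D \<and> length I \<le> n}" by (auto simp: Wd_def)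
 then show ?thesis using finite_lists_length_le[OF finite_D, of n] by (rule finite_subset)
qed

definition nilp :: "'e cmod => ('o => 'e => 'e) => nat => bool" where
 "nilp E a n \<longleftrightarrow> (\<forall>I. set I \<subseteq> D --> length I = n --> (\<forall>e\<in>carrier E. aw a I e = \<zero>[E]))"

lemma lin_aw:
 assumes "\<And>i. i : D ==> lin E E (a i)" "set I \<subseteq> D"
 shows "lin E E (aw a I)"
 using assms(2)
proof (induction I)
 case Nil
 show ?case using lin_id by (simp add: aw_def)
next
 case (Cons i I)
 then have "lin E E (aw a I)" "lin E E (a i)" using assms(1) by auto
 from lin_comp[OF this] show ?case by (simp add: aw_def)
qed

lemma nilp_ge:
 assumes E: "vs E" and a: "\<And>i. i : D ==> lin E E (a i)" and n: "nilp E a n" and I: "set I \<subseteq> D" "n \<le> length I"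
  and e: "e : carrier E"
 shows "aw a I e = \<zero>[E]"
proof -
 have "aw a (drop n I) e : carrier E"
  using I set_drop_subset[of n I] by (intro lin_closed[OF lin_aw[OF a] e]) auto
 moreover have "set (take n I) \<subseteq> D" using I set_take_subset[of n I] by auto
 ultimately have "aw a (take n I @ drop n I) e = \<zero>[E]"
  unfolding aw_append using n I(2) by (simp add: nilp_def)
 then show ?thesis by simp
qed

lemma conn_hom_aw:
 assumes X: "pre_conn X" and Y: "pre_conn Y" and T: "T : conn_hom \<Omega> X Y" and I: "set I \<subseteq> D"
  and e: "e : carrier (fibre X)"
 shows "aw (act Y) I (T e) = T (aw (act X) I e)"
 using I
proof (induction I)
 case (Cons i I)
 have "aw (act X) I e : carrier (fibre X)"
  using Cons.prems by (intro lin_closed[OF lin_aw[OF act_lin[OF X]] e]) auto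
 then show ?case using Cons T unfolding conn_hom_iff[OF X Y] by simp
qed simp

lemma pre_conn_vs: "pre_conn X ==> vs (fibre X)"
 by (simp add: pre_conn_def)

text \<open>On a trivial graded piece every letter acts as zero, so a letter maps
  \<open>F (Suc i)\<close> into \<open>F i\<close>. Hence words of length \<open>i\<close> kill
  \<open>F i\<close>.\<close>

lemma unipotent_imp_nilp:
 assumes "unipotent \<Omega> X" "pre_conn X"
 shows "\<exists>n. nilp (fibre X) (act X) n"
proof -
 obtain n F where F: "F n = X" "carrier (fibre (F 0)) = {\<zero>[fibre X]}"
  and st: "\<And>i. i < n ==> subobject \<Omega> (F i) (F (Suc i)) \<and>
    (\<exists>Q k. quotient_object \<Omega> (F (Suc i)) (F i) Q \<and> conn_iso \<Omega> (unit_power \<Omega> k) Q \<noteq> {})"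
  using assms(1) unfolding unipotent_def by blast
 have "i \<le> n ==> nilp (fibre (F i)) (act (F i)) i" for i
 proof (induction i)
  case 0
  \<comment> \<open>For \<open>n = 0\<close> this is the assumption on \<open>X\<close>; otherwise
    it is part of the first subobject relation.\<close>
  have "pre_conn (F 0)"
   using st[of 0] F(1) assms(2) by (cases "n = 0") (auto simp: subobject_def integrable_conn_iff)
  then have "\<zero>[fibre (F 0)] : carrier (fibre (F 0))" using pre_conn_vs by blast
  then show ?case using F(2) by (simp add: nilp_def)
 next
  case (Suc i)
  let ?X = "F (Suc i)" and ?Y = "F i"
  have sub: "subobject \<Omega> ?Y ?X" using st[of i] Suc.prems by simp
  obtain Q k T where Q: "quotient_object \<Omega> ?X ?Y Q" and T: "T : conn_iso \<Omega> (unit_power \<Omega> k) Q"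
   using st[of i] Suc.prems by auto
  have pX: "pre_conn ?X" and pY: "pre_conn ?Y" and pQ: "pre_conn Q"
   using sub Q by (auto simp: subobject_def quotient_object_def integrable_conn_iff)
  note EX = pre_conn_vs[OF pX]
  let ?K = "carrier (fibre ?Y)"
  have K: "submodule ?K CC (fibre ?X)" and fY: "fibre ?Y = (fibre ?X)\<lparr>carrier := ?K\<rparr>"
   and incl: "(\<lambda>y\<in>?K. y) : conn_hom \<Omega> ?Y ?X"
   using sub by (auto simp: subobject_def)
  interpret q: quot "fibre ?X" ?K by (rule quot.intro[OF EX K])
  have fQ: "fibre Q = quot_module (fibre ?X) ?K"
   and qh: "(\<lambda>x\<in>carrier (fibre ?X). ?K +>\<^bsub>fibre ?X\<^esub> x) : conn_hom \<Omega> ?X Q"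
   using Q by (auto simp: quotient_object_def)
  note U = trivial_conn[OF vs_product_line[of "{..<k}"], folded unit_power_def]
  have Th: "T : conn_hom \<Omega> (unit_power \<Omega> k) Q"
   and Tb: "T ` carrier (fibre (unit_power \<Omega> k)) = carrier (fibre Q)"
   using T by (auto simp: conn_iso_def bij_betw_def)
  have T0: "T \<zero>[fibre (unit_power \<Omega> k)] = \<zero>[fibre Q]"
   using Th lin_zero[OF lin_homD pre_conn_vs[OF U(1)] pre_conn_vs[OF pQ]] unfolding conn_hom_iff[OF U(1) pQ] by blast
  have actQ: "act Q j y = \<zero>[fibre Q]" if j: "j : D" and y: "y : carrier (fibre Q)" for j y
  proof -
   obtain x where x: "x : carrier (fibre (unit_power \<Omega> k))" "y = T x" using y Tb by auto
   have "act Q j (T x) = T (act (unit_power \<Omega> k) j x)"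
    using Th j x(1) unfolding conn_hom_iff[OF U(1) pQ] by blast
   also have "act (unit_power \<Omega> k) j x = \<zero>[fibre (unit_power \<Omega> k)]"
    using U(3)[of x j] x(1) unfolding U(2) by simp
   finally show ?thesis using T0 x(2) by simp
  qed
  have actK: "act ?X j e : ?K" if j: "j : D" and e: "e : carrier (fibre ?X)" for j e
  proof -
   have ae: "act ?X j e : carrier (fibre ?X)" by (rule lin_closed[OF act_lin[OF pX] e])
   have "?K +>\<^bsub>fibre ?X\<^esub> e : carrier (fibre Q)" unfolding fQ by (rule lin_closed[OF q.lin_coset e])
   moreover have "act Q j ((\<lambda>x\<in>carrier (fibre ?X). ?K +>\<^bsub>fibre ?X\<^esub> x) e) =
     (\<lambda>x\<in>carrier (fibre ?X). ?K +>\<^bsub>fibre ?X\<^esub> x) (act ?X j e)"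
    using qh j e unfolding conn_hom_iff[OF pX pQ] by blast
   ultimately have "?K +>\<^bsub>fibre ?X\<^esub> (act ?X j e) = \<zero>[fibre Q]"
    using actQ[OF j] e ae by (simp only: restrict_apply' simp_thms)
   then show ?thesis using q.coset_zero_iff[OF ae] by (simp add: fQ)
  qed
  have inc: "aw (act ?X) I y = aw (act ?Y) I y" if I: "set I \<subseteq> D" and y: "y : ?K" for I y
   using conn_hom_aw[OF pY pX incl I y] y lin_closed[OF lin_aw[OF act_lin[OF pY] I] y] by simp
  show ?case unfolding nilp_def
  proof (intro allI impI ballI)
   fix J e assume J: "set J \<subseteq> D" "length J = Suc i" and e: "e : carrier (fibre ?X)"
   \<comment> \<open>The last letter acts first and lowers the filtration; the remaining
     \<open>i\<close> letters then act on \<open>F i\<close>.\<close>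
   obtain I j where Ij: "J = I @ [j]" using J(2) by (metis length_Suc_conv_rev)
   have "aw (act ?X) J e = aw (act ?X) I (act ?X j e)" by (simp add: Ij aw_append)
   also have "... = aw (act ?Y) I (act ?X j e)" using J Ij e by (intro inc actK) auto
   also have "... = \<zero>[fibre ?Y]" using Suc J Ij actK[of j e] e by (auto simp: nilp_def)
   also have "... = \<zero>[fibre ?X]" by (subst fY) simp
   finally show "aw (act ?X) J e = \<zero>[fibre ?X]" .
  qed
 qed
 from this[of n] F(1) show ?thesis by auto
qed

lemma flat_subspace:
 assumes E: "vs E" and a: "\<And>i. i : D ==> lin E E (a i)" and fl: "flat E a" and K: "submodule K CC E"
  and aK: "\<And>i e. i : D ==> e : K ==> a i e : K" and b: "\<And>i e. i : D ==> e : K ==> b i e = a i e"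
 shows "flat (E\<lparr>carrier := K\<rparr>) b"
proof (rule flatI[where L="{\<mu>. lf E \<mu>}"])
 have KE: "K \<subseteq> carrier E" using K by (simp add: submodule_iff[OF E])
 show "vs (E\<lparr>carrier := K\<rparr>)" by (rule subspace_vs[OF E K])
 show "b i e : carrier (E\<lparr>carrier := K\<rparr>)" if "i : D" "e : carrier (E\<lparr>carrier := K\<rparr>)" for i e
  using that aK b by simp
 show "lf (E\<lparr>carrier := K\<rparr>) \<mu>" if "\<mu> : {\<mu>. lf E \<mu>}" for \<mu>
  using lin_comp[OF lin_incl[OF KE], of complex_line \<mu>] that by simp
 show "v = \<zero>[E\<lparr>carrier := K\<rparr>]" if "v : carrier (E\<lparr>carrier := K\<rparr>)" "\<And>f. f : {\<mu>. lf E \<mu>} ==> f v = 0" for v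
  using vs_sep[OF E, of v] that KE by auto
 fix \<phi> \<mu> e assume \<phi>: "lf W2 \<phi>" "\<mu> : {\<mu>. lf E \<mu>}" "e : carrier (E\<lparr>carrier := K\<rparr>)"
 then have e: "e : K" "e : carrier E" using KE by auto
 have "(\<Sum>i\<in>D. \<Sum>j\<in>D. \<phi> (i \<cdot> j) * \<mu> (b i (b j e))) = (\<Sum>i\<in>D. \<Sum>j\<in>D. \<phi> (i \<cdot> j) * \<mu> (a i (a j e)))"
  using e aK b by (intro sum.cong refl) simp
 also have "... = 0" using fl \<phi> e unfolding flat_def by blast
 finally show "(\<Sum>i\<in>D. \<Sum>j\<in>D. \<phi> (i \<cdot> j) * \<mu> (b i (b j e))) = 0" .
qed

lemma lin_hom_carrier_update:
 assumes "vs E" "submodule K CC E" "lin E E a" "\<And>e. e : K ==> a e : K"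
 shows "restrict a K : lin_hom (E\<lparr>carrier := K\<rparr>) (E\<lparr>carrier := K\<rparr>)"
proof -
 have "lin (E\<lparr>carrier := K\<rparr>) (E\<lparr>carrier := K\<rparr>) a"
  using assms(2-4) by (auto simp: lin_def submodule_iff[OF assms(1)] subset_iff)
 from lin_restrict[OF subspace_vs[OF assms(1,2)] this] show ?thesis by simp
qed

text \<open>The filtration is by the vectors killed by all words of length \<open>i\<close>. Letters
  lower it by one step, so the induced connection on each graded piece is trivial.\<close>

lemma nilp_imp_unipotent:
 assumes X: "integrable_conn \<Omega> X" and n: "nilp (fibre X) (act X) n"
 shows "unipotent \<Omega> X"
proof -
 define E where "E = fibre X"
 define a where "a = act X"
 have pX: "pre_conn X" and fd: "finite_dim E" and fl: "flat E a"
  using X by (auto simp: integrable_conn_iff E_def a_def)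
 have E: "vs E" and al: "lin E E (a i)" for i
  using pre_conn_vs[OF pX] act_lin[OF pX] by (auto simp: E_def a_def)
 \<comment> \<open>\<open>K 0\<close> is zero because the empty word acts as the identity, and
   \<open>K n\<close> is everything by nilpotency.\<close>
 define K where "K i = {e : carrier E. \<forall>I. set I \<subseteq> D --> length I = i --> aw a I e = \<zero>[E]}" for i
 have KE: "K i \<subseteq> carrier E" for i by (auto simp: K_def)
 have K: "submodule (K i) CC E" for i
  unfolding submodule_iff[OF E] K_def using E
  by (auto simp: lin_zero[OF lin_aw[OF al] E E] lin_add[OF lin_aw[OF al]] lin_smult[OF lin_aw[OF al]])
 have aK: "a j e : K i" if "j : D" "e : K (Suc i)" for i j e
  unfolding K_def
 proof (intro CollectI conjI allI impI)
  show "a j e : carrier E" using that lin_closed[OF al] by (simp add: K_def)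
  fix I assume "set I \<subseteq> D" "length I = i"
  then have "set (I @ [j]) \<subseteq> D" "length (I @ [j]) = Suc i" using that(1) by auto
  then have "aw a (I @ [j]) e = \<zero>[E]" using that(2) unfolding K_def by blast
  then show "aw a I (a j e) = \<zero>[E]" by (simp add: aw_append)
 qed
 have KS: "K i \<subseteq> K (Suc i)" for i
 proof
  fix e assume e: "e : K i"
  show "e : K (Suc i)" unfolding K_def
  proof (intro CollectI conjI allI impI)
   show "e : carrier E" using e by (simp add: K_def)
   fix I assume I: "set I \<subseteq> D" "length I = Suc i"
   then obtain j J where J: "I = j # J" by (cases I) auto
   then have "aw a J e = \<zero>[E]" using e I by (simp add: K_def)
   then show "aw a I e = \<zero>[E]" by (simp add: J lin_zero[OF al E E])
  qed
 qed
 have aK': "a j e : K i" if "j : D" "e : K i" for i j e using aK KS that by blast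
 define EK where "EK i = E\<lparr>carrier := K i\<rparr>" for i
 define F where "F i = mk_conn (EK i) (%j. restrict (a j) (K i))" for i
 have vK: "vs (EK i)" for i unfolding EK_def by (rule subspace_vs[OF E K])
 have rl: "j : D ==> restrict (a j) (K i) : lin_hom (EK i) (EK i)" for i j
  unfolding EK_def by (rule lin_hom_carrier_update[OF E K al aK'])
 have F: "pre_conn (F i)" "fibre (F i) = EK i" "j : D ==> act (F i) j = restrict (a j) (K i)" for i j
  using mk_conn[where a="%j. restrict (a j) (K i)", OF vK[of i] rl] unfolding F_def by auto
 have EK [simp]: "carrier (EK i) = K i" for i by (simp add: EK_def)
 have Fint: "integrable_conn \<Omega> (F i)" for i
  unfolding integrable_conn_iff
 proof (intro conjI)
  show "pre_conn (F i)" by (rule F(1))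
  show "finite_dim (fibre (F i))" unfolding F(2) EK_def by (rule finite_dim_subspace[OF E K fd])
  show "flat (fibre (F i)) (act (F i))" unfolding F(2) EK_def
   by (rule flat_subspace[OF E al fl K aK']) (auto simp: F(3))
 qed
 have Kn: "K n = carrier E" using n by (auto simp: K_def nilp_def E_def a_def)
 have "F n = mk_conn E a"
 proof -
  have "EK n = E" by (simp add: EK_def Kn)
  moreover have "restrict (a j) (carrier E) = a j" for j
   using act_hom[OF pX, of j] by (auto simp: lin_hom_iff extensional_restrict a_def E_def)
  ultimately show ?thesis by (simp add: F_def Kn)
 qed
 then have Fn: "F n = X" using mk_conn_act[OF pX] by (simp add: E_def a_def)
 have F0: "carrier (fibre (F 0)) = {\<zero>[fibre X]}"
  unfolding F(2) using E by (auto simp: K_def E_def)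
 have "subobject \<Omega> (F i) (F (Suc i)) \<and>
    (\<exists>Q k. quotient_object \<Omega> (F (Suc i)) (F i) Q \<and> conn_iso \<Omega> (unit_power \<Omega> k) Q \<noteq> {})" for i
 proof
  have sK: "submodule (K i) CC (EK (Suc i))"
   using K[of i] K[of "Suc i"] KS[of i] unfolding submodule_iff[OF vK] submodule_iff[OF E] by (auto simp: EK_def)
  have ih: "(\<lambda>y\<in>K i. y) : lin_hom (EK i) (EK (Suc i))"
  proof -
   have "lin (EK i) (EK (Suc i)) (%y. y)" using KS[of i] by (auto simp: lin_def EK_def)
   from lin_restrict[OF vK this] show ?thesis by simp
  qed
  show "subobject \<Omega> (F i) (F (Suc i))"
   unfolding subobject_def conn_hom_iff[OF F(1) F(1)] F(2) using Fint sK ih KS aK'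
   by (auto simp: F(3) EK_def)
  interpret q: quot "EK (Suc i)" "K i" by (rule quot.intro[OF vK sK])
  let ?QE = "quot_module (EK (Suc i)) (K i)"
  let ?Q = "trivial_conn \<Omega> ?QE"
  note Q = trivial_conn[OF q.vs_quot]
  have fdQ: "finite_dim ?QE"
   using Fint[of "Suc i"] unfolding integrable_conn_iff F(2)
   by (intro finite_dim_image[OF vK q.vs_quot q.lin_coset q.carrier_quot[symmetric]]) auto
  have flQ: "flat (fibre ?Q) (act ?Q)"
   unfolding flat_def Q(2) using q.vs_quot by (auto simp: Q(3) lf_zero)
  have iQ: "integrable_conn \<Omega> ?Q" unfolding integrable_conn_iff using fdQ flQ Q by simp
  obtain k T where T: "T : lin_hom (product_module {..<k::nat} (%_. complex_line)) ?QE"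
   "bij_betw T (carrier (product_module {..<k} (%_. complex_line))) (carrier ?QE)"
   using finite_dim_coordinates[OF q.vs_quot fdQ] by blast
  note U = trivial_conn[OF vs_product_line[of "{..<k}"], folded unit_power_def]
  have "T : conn_iso \<Omega> (unit_power \<Omega> k) ?Q"
   unfolding conn_iso_def conn_hom_iff[OF U(1) Q(1)] mem_Collect_eq U(2) Q(2)
   using T lin_closed[OF lin_homD[OF T(1)]] lin_zero[OF lin_homD[OF T(1)] vs_product_line q.vs_quot]
   by (auto simp del: product_line_simps simp: Q(3) U(3))
  moreover have "quotient_object \<Omega> (F (Suc i)) (F i) ?Q"
   unfolding quotient_object_def conn_hom_iff[OF F(1) Q(1)] F(2) Q(2) EK
  proof (intro conjI iQ refl ballI)
   show "(\<lambda>x\<in>K (Suc i). K i +>\<^bsub>EK (Suc i)\<^esub> x) : lin_hom (EK (Suc i)) ?QE"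
    using lin_restrict[OF vK q.lin_coset] by simp
   fix j e assume j: "j : D" and e: "e : K (Suc i)"
   have "K i +>\<^bsub>EK (Suc i)\<^esub> (a j e) = \<zero>[?QE]" using q.coset_zero_iff[of "a j e"] aK[OF j e] KS by auto
   then show "act ?Q j ((\<lambda>x\<in>K (Suc i). K i +>\<^bsub>EK (Suc i)\<^esub> x) e) =
     (\<lambda>x\<in>K (Suc i). K i +>\<^bsub>EK (Suc i)\<^esub> x) (act (F (Suc i)) j e)"
    using Q(3)[of "K i +>\<^bsub>EK (Suc i)\<^esub> e" j] lin_closed[OF q.lin_coset, of e] e aK'[OF j e] j by (simp add: F(3))
  qed
  ultimately show "\<exists>Q k. quotient_object \<Omega> (F (Suc i)) (F i) Q \<and> conn_iso \<Omega> (unit_power \<Omega> k) Q \<noteq> {}" by blast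
 qed
 then show ?thesis unfolding unipotent_def using Fn F0 by blast
qed

lemma unipotent_objects_iff:
 "X : unipotent_objects \<Omega> \<longleftrightarrow> integrable_conn \<Omega> X \<and> (\<exists>n. nilp (fibre X) (act X) n)"
 using unipotent_imp_nilp nilp_imp_unipotent by (auto simp: unipotent_objects_def integrable_conn_iff)

lemma conn_iso_inverse:
 assumes X: "pre_conn X" and Y: "pre_conn Y" and T: "T : conn_iso \<Omega> X Y"
 obtains S where "S : conn_iso \<Omega> Y X" "\<And>x. x : carrier (fibre X) ==> S (T x) = x"
  "\<And>y. y : carrier (fibre Y) ==> T (S y) = y"
proof -
 have Tl: "T : lin_hom (fibre X) (fibre Y)" and Tb: "bij_betw T (carrier (fibre X)) (carrier (fibre Y))"
  and Ta: "\<And>i e. i : D ==> e : carrier (fibre X) ==> act Y i (T e) = T (act X i e)"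
  using T unfolding conn_iso_def mem_Collect_eq conn_hom_iff[OF X Y] by auto
 obtain S where S: "S : lin_hom (fibre Y) (fibre X)" "bij_betw S (carrier (fibre Y)) (carrier (fibre X))"
  "\<And>x. x : carrier (fibre X) ==> S (T x) = x" "\<And>y. y : carrier (fibre Y) ==> T (S y) = y"
  using bij_lin_inverse[OF pre_conn_vs[OF X] pre_conn_vs[OF Y] Tl Tb] by blast
 have "act X i (S y) = S (act Y i y)" if "i : D" "y : carrier (fibre Y)" for i y
 proof -
  have Sy: "S y : carrier (fibre X)" by (rule lin_hom_closed[OF S(1) that(2)])
  have "S (act Y i (T (S y))) = S (T (act X i (S y)))" using Ta[OF that(1) Sy] by simp
  then show ?thesis using S(3)[OF lin_closed[OF act_lin[OF X] Sy]] S(4)[OF that(2)] by simp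
 qed
 then have "S : conn_iso \<Omega> Y X" using S unfolding conn_iso_def mem_Collect_eq conn_hom_iff[OF Y X] by auto
 then show thesis using that S by blast
qed

text \<open>The action is conjugated with coordinates of the fibre. The new fibre consists of
  functions on an initial segment of \<open>nat\<close>, the type over which tensor automorphisms
  range.\<close>

lemma model_object:
 assumes X: "integrable_conn \<Omega> X" and n: "nilp (fibre X) (act X) n"
 obtains Z T where "Z : unipotent_objects \<Omega>" "T : conn_iso \<Omega> X Z"
proof -
 let ?E = "fibre X" and ?a = "act X"
 have pX: "pre_conn X" and fd: "finite_dim ?E" and fl: "flat ?E ?a"
  using X by (auto simp: integrable_conn_iff)
 note E = pre_conn_vs[OF pX] and al = act_lin[OF pX]
 obtain k :: nat and S where S: "S : lin_hom (product_module {..<k} (%_. complex_line)) ?E"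
  "bij_betw S (carrier (product_module {..<k} (%_. complex_line))) (carrier ?E)"
  using finite_dim_coordinates[OF E fd] by blast
 define P where "P = product_module {..<k} (%_. complex_line)"
 have P: "vs P" by (simp add: P_def)
 note S = S[folded P_def]
 obtain T where T: "T : lin_hom ?E P" "bij_betw T (carrier ?E) (carrier P)"
  "\<And>x. x : carrier P ==> T (S x) = x" "\<And>y. y : carrier ?E ==> S (T y) = y"
  using bij_lin_inverse[OF P E S] by blast
 note Sc = lin_hom_closed[OF S(1)] and Tc = lin_hom_closed[OF T(1)]
 define Z where "Z = mk_conn P (%i. \<lambda>x\<in>carrier P. T (?a i (S x)))"
 have h: "(\<lambda>x\<in>carrier P. T (?a i (S x))) : lin_hom P P" for i
  by (rule lin_restrict[OF P lin_comp[OF lin_comp[OF lin_homD[OF S(1)] al] lin_homD[OF T(1)]]])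
 have Z: "pre_conn Z" "fibre Z = P" "i : D ==> act Z i = (\<lambda>x\<in>carrier P. T (?a i (S x)))" for i
  using mk_conn[where a="%i. \<lambda>x\<in>carrier P. T (?a i (S x))", OF P h] unfolding Z_def by auto
 have actZ: "act Z i x = T (?a i (S x))" if "i : D" "x : carrier P" for i x using Z(3)[OF that(1)] that by simp
 have iso: "T : conn_iso \<Omega> X Z"
  unfolding conn_iso_def mem_Collect_eq conn_hom_iff[OF pX Z(1)] Z(2) using T Tc by (auto simp: actZ)
 have Th: "T : conn_hom \<Omega> X Z" using iso by (simp add: conn_iso_def)
 have "flat (fibre Z) (act Z)" unfolding Z(2) flat_def
 proof (intro allI impI ballI)
  fix \<phi> \<mu> x assume \<phi>: "lf W2 \<phi>" and \<mu>: "lf P \<mu>" and x: "x : carrier P"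
  have "(\<Sum>i\<in>D. \<Sum>j\<in>D. \<phi> (i \<cdot> j) * \<mu> (act Z i (act Z j x))) = (\<Sum>i\<in>D. \<Sum>j\<in>D. \<phi> (i \<cdot> j) * \<mu> (T (?a i (?a j (S x)))))"
   using x Tc Sc lin_closed[OF al] by (intro sum.cong refl) (simp add: actZ T(4))
  also have "... = 0" using fl \<phi> lin_comp[OF lin_homD[OF T(1)] \<mu>] Sc[OF x] unfolding flat_def by blast
  finally show "(\<Sum>i\<in>D. \<Sum>j\<in>D. \<phi> (i \<cdot> j) * \<mu> (act Z i (act Z j x))) = 0" .
 qed
 moreover have "finite_dim (fibre Z)" unfolding Z(2)
  using T(2) by (intro finite_dim_image[OF E P lin_homD[OF T(1)] _ fd]) (simp add: bij_betw_def)
 ultimately have "integrable_conn \<Omega> Z" using Z(1) by (simp add: integrable_conn_iff)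
 moreover have "nilp (fibre Z) (act Z) n" unfolding nilp_def Z(2)
 proof (intro allI impI ballI)
  fix I x assume I: "set I \<subseteq> D" "length I = n" and x: "x : carrier P"
  have "aw (act Z) I (T (S x)) = T (aw (act X) I (S x))"
   by (rule conn_hom_aw[OF pX Z(1) Th I(1) Sc[OF x]])
  also have "aw (act X) I (S x) = \<zero>[?E]" using n I Sc[OF x] by (simp add: nilp_def)
  finally show "aw (act Z) I x = \<zero>[P]" using T(3)[OF x] lin_zero[OF lin_homD[OF T(1)] E P] by simp
 qed
 ultimately have "Z : unipotent_objects \<Omega>" unfolding unipotent_objects_iff by blast
 then show thesis using that iso by blast
qed

subsection \<open>Matrix coefficients and the universal objects\<close>

text \<open>The relations dual to the wedge product. They say at once that an element of degree zero of the
  bar construction is a cocycle (\<open>bar_d_zero_iff\<close>) and that a function on words consists of matrix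
  coefficients of an integrable connection (\<open>cof_Uo\<close>).\<close>

definition Rel :: "('o list => complex) => bool" where
 "Rel x \<longleftrightarrow> (\<forall>u v \<phi>. set u \<subseteq> D --> set v \<subseteq> D --> lf W2 \<phi> -->
   (\<Sum>i\<in>D. \<Sum>j\<in>D. \<phi> (i \<cdot> j) * x (u @ [i, j] @ v)) = 0)"

definition Uo :: "nat => ('o list => complex) cmod" where
 "Uo n = (fun_module (Wd n))\<lparr>carrier := {x : carrier (fun_module (Wd n)). Rel x}\<rparr>"

text \<open>Matches the order in \<open>aw\<close>: a word \<open>I\<close> sends \<open>x\<close>
  to the function \<open>J \<mapsto> x (J @ I)\<close> (\<open>aw_Uobj\<close>).\<close>

definition strip :: "'o => ('o list => complex) => ('o list => complex)" where
 "strip i x = (%I. x (I @ [i]))"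

text \<open>The cocycles on words shorter than \<open>n\<close>, on which a letter acts by being stripped from the
  end. With the functional \<open>x \<mapsto> x []\<close> this object is universal: every matrix coefficient of an
  object of nilpotency order \<open>n\<close> is pulled back from it along \<open>cof_hom\<close>.\<close>

definition Uobj :: "nat => ('o, 'o list => complex) conn" where
 "Uobj n = mk_conn (Uo n) (%i. restrict (strip i) (carrier (Uo n)))"

text \<open>Set to zero on words with letters outside \<open>D\<close>, so that coefficients of
  different objects can be compared by plain equality of functions.\<close>

definition cof :: "('o, 'e) conn => ('e => complex) => 'e => 'o list => complex" where
 "cof X \<mu> e I = (if set I \<subseteq> D then \<mu> (aw (act X) I e) else 0)"

lemma Uo_sub: "submodule {x : carrier (fun_module (Wd n)). Rel x} CC (fun_module (Wd n))"
 unfolding submodule_iff[OF vs_fun_module] Rel_def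
 by (auto simp: distrib_left sum.distrib mult.left_commute[of _ "_ :: complex"] simp flip: sum_distrib_left)

lemma vs_Uo [simp]: "vs (Uo n)"
 unfolding Uo_def by (rule subspace_vs[OF vs_fun_module Uo_sub])

lemma carrier_Uo: "x : carrier (Uo n) \<longleftrightarrow> (\<forall>I. I \<notin> Wd n --> x I = 0) \<and> Rel x"
 by (simp add: Uo_def)

lemma Uo_simps [simp]: "\<zero>[Uo n] = (%_. 0)" "x \<oplus>[Uo n] y = (%i. x i + y i)" "c \<odot>[Uo n] x = (%i. c * x i)"
 by (simp_all add: Uo_def)

lemma lf_Uo_eval: "lf (Uo n) (%x. x I)"
 by (rule linI) auto

lemma strip_closed: "i : D ==> x : carrier (Uo n) ==> strip i x : carrier (Uo n)"
proof -
 assume i: "i : D" and x: "x : carrier (Uo n)"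
 have "x (I @ [i]) = 0" if "I \<notin> Wd n" for I
 proof -
  have "I @ [i] \<notin> Wd n" using that i by (auto simp: Wd_def)
  then show ?thesis using x unfolding carrier_Uo by blast
 qed
 moreover have "Rel (strip i x)" unfolding Rel_def
 proof (intro allI impI)
  fix u v \<phi> assume uv: "set u \<subseteq> D" "set v \<subseteq> D" "lf W2 \<phi>"
  then have "set (v @ [i]) \<subseteq> D" using i by simp
  then have "(\<Sum>k\<in>D. \<Sum>j\<in>D. \<phi> (k \<cdot> j) * x (u @ [k, j] @ (v @ [i]))) = 0"
   using x uv unfolding carrier_Uo Rel_def by blast
  then show "(\<Sum>k\<in>D. \<Sum>j\<in>D. \<phi> (k \<cdot> j) * strip i x (u @ [k, j] @ v)) = 0" by (simp add: strip_def)
 qed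
 ultimately show ?thesis by (simp add: carrier_Uo strip_def)
qed

lemma strip_hom: "i : D ==> restrict (strip i) (carrier (Uo n)) : lin_hom (Uo n) (Uo n)"
 by (intro lin_restrict linI vs_Uo strip_closed) (auto simp: strip_def)

lemma Uobj: "pre_conn (Uobj n)" "fibre (Uobj n) = Uo n"
  "i : D ==> act (Uobj n) i = restrict (strip i) (carrier (Uo n))"
 using mk_conn[where a="%i. restrict (strip i) (carrier (Uo n))", OF vs_Uo[of n] strip_hom] unfolding Uobj_def by auto

lemma act_Uobj: "i : D ==> x : carrier (Uo n) ==> act (Uobj n) i x = strip i x"
 by (simp add: Uobj(3))

lemma aw_Uobj: "set I \<subseteq> D ==> x : carrier (Uo n) ==> aw (act (Uobj n)) I x : carrier (Uo n) \<and> aw (act (Uobj n)) I x = (%J. x (J @ I))"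
proof (induction I)
 case (Cons i I)
 then have c: "aw (act (Uobj n)) I x : carrier (Uo n)" and e: "aw (act (Uobj n)) I x = (%J. x (J @ I))" by auto
 have "aw (act (Uobj n)) (i # I) x = strip i (aw (act (Uobj n)) I x)" using act_Uobj[OF _ c] Cons.prems by simp
 then show ?case using strip_closed[OF _ c, of i] Cons.prems unfolding e by (auto simp: strip_def)
qed simp

text \<open>Evaluations at words separate points. Tested on the evaluation at \<open>I\<close>,
  integrability is the instance of \<open>Rel\<close> with \<open>u = I\<close> and empty
  \<open>v\<close>.\<close>

lemma Uobj_integrable: "integrable_conn \<Omega> (Uobj n)"
 unfolding integrable_conn_iff
proof (intro conjI)
 show "pre_conn (Uobj n)" by (rule Uobj(1))
 show "finite_dim (fibre (Uobj n))"
  unfolding Uobj(2) Uo_def by (rule finite_dim_subspace[OF vs_fun_module Uo_sub finite_dim_fun_module[OF finite_Wd]])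
 show "flat (fibre (Uobj n)) (act (Uobj n))" unfolding Uobj(2)
 proof (rule flatI[OF vs_Uo, where L="range (%I (x :: 'o list => complex). x I)"])
  show "act (Uobj n) i e : carrier (Uo n)" if "i : D" "e : carrier (Uo n)" for i e
   using that by (simp add: act_Uobj strip_closed)
  show "lf (Uo n) \<mu>" if "\<mu> : range (%I (x :: 'o list => complex). x I)" for \<mu> using that lf_Uo_eval by auto
  show "v = \<zero>[Uo n]" if "v : carrier (Uo n)" "\<And>f. f : range (%I (x :: 'o list => complex). x I) ==> f v = 0" for v
   using that(2) by (auto simp: fun_eq_iff)
  fix \<phi> \<mu> x assume \<phi>: "lf W2 \<phi>" and "\<mu> : range (%I (x :: 'o list => complex). x I)" and x: "x : carrier (Uo n)"
  then obtain I where I: "\<mu> = (%x. x I)" by auto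
  have "(\<Sum>i\<in>D. \<Sum>j\<in>D. \<phi> (i \<cdot> j) * \<mu> (act (Uobj n) i (act (Uobj n) j x))) =
   (\<Sum>i\<in>D. \<Sum>j\<in>D. \<phi> (i \<cdot> j) * x (I @ [i, j] @ []))"
  proof (intro sum.cong refl)
   fix i j assume ij: "i : D" "j : D"
   have "act (Uobj n) i (act (Uobj n) j x) = strip i (strip j x)"
    using x ij by (simp add: act_Uobj strip_closed)
   then show "\<phi> (i \<cdot> j) * \<mu> (act (Uobj n) i (act (Uobj n) j x)) = \<phi> (i \<cdot> j) * x (I @ [i, j] @ [])"
    by (simp add: I strip_def)
  qed
  also have "... = 0"
  proof (cases "set I \<subseteq> D")
   case True
   have s: "set [] \<subseteq> D" by simp
   have "Rel x" using x by (simp add: carrier_Uo)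
   then show ?thesis using True s \<phi> unfolding Rel_def by blast
  next
   case False
   then have "x (I @ [i, j] @ []) = 0" for i j using x unfolding carrier_Uo Wd_def by auto
   then show ?thesis by simp
  qed
  finally show "(\<Sum>i\<in>D. \<Sum>j\<in>D. \<phi> (i \<cdot> j) * \<mu> (act (Uobj n) i (act (Uobj n) j x))) = 0" .
 qed
qed

lemma Uobj_nilp: "nilp (fibre (Uobj n)) (act (Uobj n)) n"
 unfolding nilp_def Uobj(2)
proof (intro allI impI ballI)
 fix I x assume I: "set I \<subseteq> D" "length I = n" and x: "x : carrier (Uo n)"
 have "x (J @ I) = 0" for J using x I unfolding carrier_Uo by (auto simp: Wd_def)
 then show "aw (act (Uobj n)) I x = \<zero>[Uo n]" using aw_Uobj[OF I(1) x] by auto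
qed

text \<open>The instance of \<open>Rel\<close> for \<open>u\<close> and \<open>v\<close> is
  integrability of \<open>X\<close> at the vector \<open>aw (act X) v e\<close> and the functional
  that applies the word \<open>u\<close> and then \<mu>. Nilpotency bounds the support.\<close>

lemma cof_Uo:
 assumes X: "pre_conn X" "flat (fibre X) (act X)" "nilp (fibre X) (act X) n" and \<mu>: "lf (fibre X) \<mu>"
  and e: "e : carrier (fibre X)"
 shows "cof X \<mu> e : carrier (Uo n)"
 unfolding carrier_Uo
proof (intro conjI allI impI)
 note E = pre_conn_vs[OF X(1)] and al = act_lin[OF X(1)]
 show "cof X \<mu> e I = 0" if "I \<notin> Wd n" for I
  using that nilp_ge[OF E al X(3) _ _ e, of I] lf_zero[OF \<mu> E] by (auto simp: cof_def Wd_def)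
 show "Rel (cof X \<mu> e)" unfolding Rel_def
 proof (intro allI impI)
  fix u v \<phi> assume uv: "set u \<subseteq> D" "set v \<subseteq> D" "lf W2 \<phi>"
  let ?f = "aw (act X) v e"
  have f: "?f : carrier (fibre X)" by (rule lin_closed[OF lin_aw[OF al uv(2)] e])
  have l: "lf (fibre X) (%e. \<mu> (aw (act X) u e))" by (rule lin_comp[OF lin_aw[OF al uv(1)] \<mu>])
  have "(\<Sum>i\<in>D. \<Sum>j\<in>D. \<phi> (i \<cdot> j) * cof X \<mu> e (u @ [i, j] @ v)) =
    (\<Sum>i\<in>D. \<Sum>j\<in>D. \<phi> (i \<cdot> j) * \<mu> (aw (act X) u (act X i (act X j ?f))))"
   using uv by (intro sum.cong refl) (simp add: cof_def aw_append)
  also have "... = 0" using X(2) uv(3) l f unfolding flat_def by blast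
  finally show "(\<Sum>i\<in>D. \<Sum>j\<in>D. \<phi> (i \<cdot> j) * cof X \<mu> e (u @ [i, j] @ v)) = 0" .
 qed
qed

lemma cof_hom:
 assumes X: "pre_conn X" "flat (fibre X) (act X)" "nilp (fibre X) (act X) n" and \<mu>: "lf (fibre X) \<mu>"
 shows "restrict (cof X \<mu>) (carrier (fibre X)) : conn_hom \<Omega> X (Uobj n)"
 unfolding conn_hom_iff[OF X(1) Uobj(1)] Uobj(2)
proof (intro conjI ballI)
 note E = pre_conn_vs[OF X(1)] and al = act_lin[OF X(1)]
 show "restrict (cof X \<mu>) (carrier (fibre X)) : lin_hom (fibre X) (Uo n)"
  by (intro lin_restrict[OF E] linI cof_Uo[OF X \<mu>])
   (auto simp: cof_def fun_eq_iff lin_add[OF lin_aw[OF al]] lin_smult[OF lin_aw[OF al]]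
    lin_closed[OF lin_aw[OF al]] lf_add[OF \<mu>] lf_smult[OF \<mu>])
 fix i e assume i: "i : D" and e: "e : carrier (fibre X)"
 have "strip i (cof X \<mu> e) = cof X \<mu> (act X i e)"
  using i by (auto simp: strip_def cof_def aw_append fun_eq_iff)
 then show "act (Uobj n) i (restrict (cof X \<mu>) (carrier (fibre X)) e) =
   restrict (cof X \<mu>) (carrier (fibre X)) (act X i e)"
  using act_Uobj[OF i cof_Uo[OF X \<mu> e]] e lin_closed[OF al e] by simp
qed

text \<open>The converse of \<open>cof_Uo\<close>: every truncated cocycle occurs as a matrix
  coefficient of a unipotent object.\<close>

lemma cof_Uobj:
 assumes x: "x : carrier (Uo n)"
 shows "cof (Uobj n) (%x. x []) x = x"
proof
 fix I show "cof (Uobj n) (%x. x []) x I = x I"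
  using aw_Uobj[OF _ x, of I] x unfolding carrier_Uo by (auto simp: cof_def Wd_def)
qed

end

section \<open>The bar construction in coordinates\<close>

lemma vs_update_mult:
 assumes M: "vs M"
 shows "vs (M\<lparr>monoid.mult := m, one := u\<rparr>)"
proof (rule vsI)
 show "x \<oplus>[M\<lparr>monoid.mult := m, one := u\<rparr>] y = y \<oplus>[M\<lparr>monoid.mult := m, one := u\<rparr>] x"
  if "x : carrier (M\<lparr>monoid.mult := m, one := u\<rparr>)" "y : carrier (M\<lparr>monoid.mult := m, one := u\<rparr>)" for x y
  using that vs_comm[OF M] by simp
qed (simp_all add: M vs_assoc vs_l_distr vs_r_distr vs_smult_smult)

text \<open>A word with a cut position is the same as a pair of words of bounded total length. Used
  for the coproduct and for the convolution of coefficient families.\<close>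

lemma sum_split_words:
 fixes f :: "'i list => 'i list => 'b :: comm_monoid_add" and N :: nat
 assumes "finite D"
 defines "W \<equiv> {I. set I \<subseteq> D \<and> length I < N}"
 shows "(\<Sum>I\<in>W. \<Sum>i\<le>length I. f (take i I) (drop i I)) =
  (\<Sum>I\<in>W. \<Sum>J\<in>W. if length I + length J < N then f I J else 0)"
proof -
 have finW: "finite W"
  using finite_lists_length_le[OF assms(1), of N] unfolding W_def by (rule finite_subset[rotated]) auto
 have "(\<Sum>I\<in>W. \<Sum>i\<le>length I. f (take i I) (drop i I)) = (\<Sum>(I, i)\<in>(SIGMA I:W. {..length I}). f (take i I) (drop i I))"
  using finW by (subst sum.Sigma) auto
 also have "... = (\<Sum>(I, J)\<in>{(I, J). I : W \<and> J : W \<and> length I + length J < N}. f I J)"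
  by (rule sum.reindex_bij_witness[where i="%(I, J). (I @ J, length I)" and j="%(I, i). (take i I, drop i I)"])
   (auto simp: W_def dest: in_set_takeD in_set_dropD)
 also have "... = (\<Sum>(I, J)\<in>W \<times> W. if length I + length J < N then f I J else 0)"
  using finW by (intro sum.mono_neutral_cong_left) (auto split: if_splits)
 also have "... = (\<Sum>I\<in>W. \<Sum>J\<in>W. if length I + length J < N then f I J else 0)"
  by (simp add: sum.cartesian_product)
 finally show ?thesis .
qed

section \<open>Words of forms and multilinear functions on them\<close>

context form_algebra
begin

abbreviation "\<B> \<equiv> bar \<Omega>"

abbreviation "BW \<equiv> bar_words \<Omega>"
abbreviation "bc w \<equiv> bar_class \<Omega> (single w 1)"

lemma BW_append [simp]: "u @ v : BW \<longleftrightarrow> u : BW \<and> v : BW"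
 and BW_Nil [simp]: "[] : BW"
 and BW_Cons [simp]: "x # v : BW \<longleftrightarrow> 1 \<le> fst x \<and> snd x : part \<Omega> (fst x) \<and> v : BW"
 by (auto simp: bar_words_def)

lemma BW_take [simp]: "w : BW ==> take i w : BW" and BW_drop [simp]: "w : BW ==> drop i w : BW"
 by (auto simp: bar_words_def dest: in_set_takeD in_set_dropD)

lemma BW_nth: "w : BW ==> i < length w ==> 1 \<le> fst (w ! i) \<and> snd (w ! i) : part \<Omega> (fst (w ! i))"
 unfolding bar_words_def using nth_mem[of i w] by fastforce

lemma part_closed [simp]:
 "\<eta> : part \<Omega> p ==> \<zeta> : part \<Omega> p ==> \<eta> \<oplus>[total \<Omega>] \<zeta> : part \<Omega> p"
 "\<eta> : part \<Omega> p ==> c \<odot>[total \<Omega>] \<eta> : part \<Omega> p"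
 using vs_add[OF vs_deg_part, of \<eta> p \<zeta>] vs_smult[OF vs_deg_part, of \<eta> p c] by simp_all

lemma wedge_part: "\<eta> : part \<Omega> p ==> \<zeta> : part \<Omega> q ==> \<eta> \<cdot> \<zeta> : part \<Omega> (p + q)"
 using bilin_closed[OF wedge_bilin] by simp

lemma bar_presentation: "presentation BW (bar_rels \<Omega>)"
proof
 show "bar_rels \<Omega> \<subseteq> carrier (free_module BW)"
  unfolding bar_rels_def
  by (auto simp del: free_module_simps intro!: free_diff single_carrier)
qed

interpretation bp: presentation BW "bar_rels \<Omega>" by (rule bar_presentation)

text \<open>The functions on words that factor through the bar construction
  (\<open>bar_lift\<close>). Linearity is asked in one letter of fixed degree at a time, as letters
  carry their degree.\<close>

definition wml :: "'a cmod => ('o bar_word => 'a) => bool" where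
 "wml M F \<longleftrightarrow> (\<forall>w\<in>BW. F w : carrier M) \<and>
  (\<forall>u v p. u : BW --> v : BW --> 1 \<le> p --> lin (deg_part \<Omega> p) M (%\<eta>. F (u @ [(p, \<eta>)] @ v)))"

lemma wmlI:
 assumes "\<And>w. w : BW ==> F w : carrier M"
  "\<And>u v p. u : BW ==> v : BW ==> 1 \<le> p ==> lin (deg_part \<Omega> p) M (%\<eta>. F (u @ [(p, \<eta>)] @ v))"
 shows "wml M F"
 using assms by (simp add: wml_def)

lemma wml_closed: "wml M F ==> w : BW ==> F w : carrier M"
 and wml_lin: "wml M F ==> u : BW ==> v : BW ==> 1 \<le> p ==> lin (deg_part \<Omega> p) M (%\<eta>. F (u @ [(p, \<eta>)] @ v))"
 by (simp_all add: wml_def)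

lemma wml_rels:
 assumes M: "vs M" and F: "wml M F" and r: "r : bar_rels \<Omega>"
 shows "lincomb M F r = \<zero>[M]"
proof -
 from r consider u v p \<eta> \<zeta> where "u : BW" "v : BW" "1 \<le> p" "\<eta> : part \<Omega> p" "\<zeta> : part \<Omega> p"
   "r = single (u @ [(p, \<eta> \<oplus>[total \<Omega>] \<zeta>)] @ v) 1
    - single (u @ [(p, \<eta>)] @ v) 1 - single (u @ [(p, \<zeta>)] @ v) 1"
  | u v p \<eta> c where "u : BW" "v : BW" "1 \<le> p" "\<eta> : part \<Omega> p"
   "r = single (u @ [(p, c \<odot>[total \<Omega>] \<eta>)] @ v) 1 - single (u @ [(p, \<eta>)] @ v) c"
  unfolding bar_rels_def by blast
 then show ?thesis
 proof cases
  case 1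
  note l = wml_lin[OF F 1(1-3)]
  show ?thesis unfolding 1(6)
   by (rule lincomb_diff3[OF M, where S=BW])
    (use 1(1-5) lin_add[OF l, of \<eta> \<zeta>] wml_closed[OF F] in auto)
 next
  case 2
  note l = wml_lin[OF F 2(1-3)]
  show ?thesis unfolding 2(5)
   by (rule lincomb_diff2[OF M, where S=BW])
    (use 2(1-4) lin_smult[OF l, of \<eta> c] wml_closed[OF F] in auto)
 qed
qed

lemma bar_simps [simp]:
 "carrier \<B> = carrier (presented BW (bar_rels \<Omega>))" "\<zero>[\<B>] = \<zero>[presented BW (bar_rels \<Omega>)]"
 "x \<oplus>[\<B>] y = x \<oplus>[presented BW (bar_rels \<Omega>)] y" "c \<odot>[\<B>] x = c \<odot>[presented BW (bar_rels \<Omega>)] x"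
 by (simp_all add: bar_def Let_def)

lemma vs_bar [simp]: "vs \<B>"
 unfolding bar_def Let_def by (rule vs_update_mult[OF bp.vs_presented])

lemma lin_bar_iff: "lin \<B> M f \<longleftrightarrow> lin (presented BW (bar_rels \<Omega>)) M f"
 "lin M' \<B> g \<longleftrightarrow> lin M' (presented BW (bar_rels \<Omega>)) g"
 by (simp_all add: lin_def)

lemma lin_bar_class: "lin (free_module BW) \<B> (bar_class \<Omega>)"
 unfolding lin_bar_iff bar_class_def by (rule bp.lin_pclass)

lemma bc_closed: "w : BW ==> bc w : carrier \<B>"
 using lin_closed[OF lin_bar_class single_carrier] .

lemma bar_lift:
 assumes M: "vs M" and F: "wml M F"
 shows "lin \<B> M (lin_ext M F)" "w : BW ==> lin_ext M F (bc w) = F w"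
proof -
 show "lin \<B> M (lin_ext M F)" unfolding lin_bar_iff
  by (rule bp.lin_lin_ext[OF M wml_closed[OF F] wml_rels[OF M F]])
 show "w : BW ==> lin_ext M F (bc w) = F w" unfolding bar_class_def
  using bp.lin_ext_pclass[OF M wml_closed[OF F] wml_rels[OF M F], of "single w 1"]
   wml_closed[OF F] M by simp
qed

lemma bar_eqI:
 assumes "vs M" "lin \<B> M f" "lin \<B> M g" "\<And>w. w : BW ==> f (bc w) = g (bc w)" "X : carrier \<B>"
 shows "f X = g X"
 using bp.presented_eqI[OF assms(1), of f g X] assms(2-5) by (simp add: lin_bar_iff bar_class_def)

lemma bar_class_lincomb: "x : carrier (free_module BW) ==> bar_class \<Omega> x = lincomb \<B> bc x"
 using bp.pclass_lincomb[of x] unfolding bar_class_def lincomb_def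
 by (simp add: bar_def Let_def finsum_def)

lemma wml_bc: "wml \<B> bc"
proof (intro wmlI linI)
 fix u v :: "'o bar_word" and p \<eta> assume uv: "u : BW" "v : BW" "1 \<le> p" and "\<eta> : carrier (deg_part \<Omega> p)"
 then have \<eta>: "\<eta> : part \<Omega> p" by simp
 show "bc (u @ [(p, c \<odot>[deg_part \<Omega> p] \<eta>)] @ v) = c \<odot>[\<B>] bc (u @ [(p, \<eta>)] @ v)" for c
  unfolding bar_class_def bar_simps deg_part_simps
 proof (rule bp.pclass_diff2)
  show "single (u @ [(p, c \<odot>[total \<Omega>] \<eta>)] @ v) 1 - single (u @ [(p, \<eta>)] @ v) c : bar_rels \<Omega>"
   unfolding bar_rels_def using uv \<eta> by (intro UnI2) blast
 qed (use uv \<eta> in auto)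
 fix \<zeta> assume "\<zeta> : carrier (deg_part \<Omega> p)"
 then have \<zeta>: "\<zeta> : part \<Omega> p" by simp
 show "bc (u @ [(p, \<eta> \<oplus>[deg_part \<Omega> p] \<zeta>)] @ v) = bc (u @ [(p, \<eta>)] @ v) \<oplus>[\<B>] bc (u @ [(p, \<zeta>)] @ v)"
  unfolding bar_class_def bar_simps deg_part_simps
 proof (rule bp.pclass_diff3)
  show "single (u @ [(p, \<eta> \<oplus>[total \<Omega>] \<zeta>)] @ v) 1
    - single (u @ [(p, \<eta>)] @ v) 1 - single (u @ [(p, \<zeta>)] @ v) 1 : bar_rels \<Omega>"
   unfolding bar_rels_def using uv \<eta> \<zeta> by (intro UnI1) blast
 qed (use uv \<eta> \<zeta> in auto)
next
 fix u v :: "'o bar_word" and p \<eta> assume uv: "u : BW" "v : BW" "1 \<le> p" and "\<eta> : carrier (deg_part \<Omega> p)"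
 then show "bc (u @ [(p, \<eta>)] @ v) : carrier \<B>" by (intro bc_closed) simp
qed (rule bc_closed)

lemma bc_letter_lin:
 assumes "u : BW" "v : BW" "1 \<le> q" "lin (deg_part \<Omega> p) (deg_part \<Omega> q) f"
 shows "lin (deg_part \<Omega> p) \<B> (%\<eta>. bc (u @ [(q, f \<eta>)] @ v))"
 using lin_comp[OF assms(4) wml_lin[OF wml_bc assms(1-3)]] .

text \<open>The index set may depend on the word through its length only, and the length does not
  change while one letter varies.\<close>

lemma wml_finsum:
 assumes M: "vs M" and c: "\<And>w i. w : BW ==> i : S (length w) ==> F i w : carrier M"
  and l: "\<And>i u v p. u : BW ==> v : BW ==> 1 \<le> p ==> i : S (length u + 1 + length v) ==>
   lin (deg_part \<Omega> p) M (%\<eta>. F i (u @ [(p, \<eta>)] @ v))"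
 shows "wml M (%w. finsum M (%i. F i w) (S (length w)))"
proof (rule wmlI)
 show "finsum M (%i. F i w) (S (length w)) : carrier M" if "w : BW" for w
  using M c[OF that] by (rule vs_finsum)
 fix u v :: "'o bar_word" and p :: nat assume uv: "u : BW" "v : BW" "1 \<le> p"
 have "lin (deg_part \<Omega> p) M (%\<eta>. finsum M (%i. F i (u @ [(p, \<eta>)] @ v)) (S (length u + 1 + length v)))"
  by (rule lin_finsumf[OF vs_deg_part M l[OF uv]])
 moreover have "length (u @ [(p, \<eta>)] @ v) = length u + 1 + length v" for \<eta> :: 'o by simp
 ultimately show "lin (deg_part \<Omega> p) M (%\<eta>. finsum M (%i. F i (u @ [(p, \<eta>)] @ v)) (S (length (u @ [(p, \<eta>)] @ v))))"
  by (simp only:)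
qed

subsection \<open>Coordinate functionals\<close>

text \<open>A tensor product of functionals, one for each letter, extended by zero to words of
  another length or with other degrees.\<close>

fun pf :: "(nat \<times> ('o => complex)) list => 'o bar_word => complex" where
 "pf [] [] = 1"
| "pf (f # fs) (x # w) = (if fst x = fst f then snd f (snd x) else 0) * pf fs w"
| "pf [] (x # w) = 0"
| "pf (f # fs) [] = 0"

lemma pf_append: "pf fs (u @ v) = pf (take (length u) fs) u * pf (drop (length u) fs) v"
proof (induction u arbitrary: fs)
 case (Cons x u)
 then show ?case by (cases fs) auto
qed simp

lemma pf_append': "length fs = length u ==> pf (fs @ gs) (u @ v) = pf fs u * pf gs v"
 by (simp add: pf_append)

lemma wml_pf:
 assumes "\<And>p f. (p, f) : set fs ==> lf (deg_part \<Omega> p) f"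
 shows "wml complex_line (pf fs)"
proof (rule wmlI)
 fix u v :: "'o bar_word" and p :: nat assume uv: "u : BW" "v : BW" "1 \<le> p"
 show "lf (deg_part \<Omega> p) (%\<eta>. pf fs (u @ [(p, \<eta>)] @ v))"
 proof (cases "drop (length u) fs")
  case (Cons f gs)
  then have "f : set fs" by (metis in_set_dropD list.set_intros(1))
  then have f: "lf (deg_part \<Omega> (fst f)) (snd f)" using assms by (cases f) auto
  show ?thesis
  proof (cases "p = fst f")
   case True
   then show ?thesis using f
    by (intro linI) (auto simp: pf_append Cons lf_add[OF f, simplified] lf_smult[OF f, simplified] algebra_simps)
  qed (auto intro!: linI simp: pf_append Cons)
 qed (auto intro!: linI simp: pf_append)
qed simp

definition l1 :: "'o list => (nat \<times> ('o => complex)) list" where "l1 I = map (%i. (1, co i)) I"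
text \<open>For \<open>I\<close> in letters of \<open>D\<close> this is the functional dual to the
  basis word \<open>EB I\<close> (\<open>cf_EB\<close>).\<close>

definition cf :: "'o list => ('o bar_word \<Rightarrow>\<^sub>0 complex) set => complex" where
 "cf I = lin_ext complex_line (pf (l1 I))"
definition w1 :: "'o list => 'o bar_word" where "w1 I = map (Pair 1) I"
abbreviation "EB I \<equiv> bc (w1 I)"

lemma w1_append [simp]: "w1 (I @ J) = w1 I @ w1 J" and w1_length [simp]: "length (w1 I) = length I"
 and w1_Nil [simp]: "w1 [] = []" and w1_Cons: "w1 (i # I) = (1, i) # w1 I"
 by (simp_all add: w1_def)

lemma w1_BW: "set I \<subseteq> part \<Omega> 1 ==> w1 I : BW"
 by (induction I) (auto simp: w1_def)

lemma w1_BWD [simp]: "set I \<subseteq> D ==> w1 I : BW"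
 using D_part by (intro w1_BW) auto

lemma wml_cf: "wml complex_line (pf (l1 I))"
 by (rule wml_pf) (auto simp: l1_def lf_co)

lemma lf_cf: "lf \<B> (cf I)"
 unfolding cf_def by (rule bar_lift(1)[OF vs_complex_line wml_cf])

lemma cf_bc: "w : BW ==> cf I (bc w) = pf (l1 I) w"
 unfolding cf_def by (rule bar_lift(2)[OF vs_complex_line wml_cf])

lemma pf_l1_w1: "set I \<subseteq> D ==> set J \<subseteq> D ==> pf (l1 I) (w1 J) = (if I = J then 1 else 0)"
proof (induction I arbitrary: J)
 case Nil
 then show ?case by (cases J) (auto simp: l1_def w1_def)
next
 case (Cons i I)
 then show ?case by (cases J) (auto simp: l1_def w1_def co_delta)
qed

lemma cf_EB: "set I \<subseteq> D ==> set J \<subseteq> D ==> cf I (EB J) = (if I = J then 1 else 0)"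
 by (simp add: cf_bc pf_l1_w1)

lemma EB_closed: "I : Wd N ==> EB I : carrier \<B>"
 by (rule bc_closed) (simp add: Wd_def)

text \<open>Rebuilds an element of degree zero from its coefficients. The truncation at
  \<open>N\<close> keeps the sum finite without a support condition on \<open>x\<close>.\<close>

definition el :: "nat => ('o list => complex) => ('o bar_word \<Rightarrow>\<^sub>0 complex) set" where
 "el N x = (\<Oplus>\<^bsub>\<B>\<^esub>I\<in>Wd N. x I \<odot>[\<B>] EB I)"

lemma el_closed: "el N x : carrier \<B>"
 unfolding el_def by (intro vs_finsum vs_bar vs_smult EB_closed)

lemma lin_el: "lin (fun_module S) \<B> (el N)"
 unfolding el_def
proof (rule lin_finsumf[OF vs_fun_module vs_bar], goal_cases)
 case (1 I)
 then have c: "EB I : carrier \<B>" by (rule EB_closed)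
 show ?case
 proof (rule linI)
  show "x I \<odot>[\<B>] EB I : carrier \<B>" for x using c by (rule vs_smult[OF vs_bar])
  show "(x \<oplus>[fun_module S] y) I \<odot>[\<B>] EB I = x I \<odot>[\<B>] EB I \<oplus>[\<B>] y I \<odot>[\<B>] EB I" for x y
   using vs_l_distr[OF vs_bar c] by (simp del: bar_simps)
  show "(k \<odot>[fun_module S] x) I \<odot>[\<B>] EB I = k \<odot>[\<B>] (x I \<odot>[\<B>] EB I)" for k x
   using vs_smult_smult[OF vs_bar c] by (simp del: bar_simps)
 qed
qed

lemma cf_el: "J : Wd N ==> cf J (el N x) = x J"
proof -
 assume J: "J : Wd N"
 have "cf J (el N x) = (\<Sum>I\<in>Wd N. cf J (x I \<odot>[\<B>] EB I))"
  unfolding el_def by (intro lf_finsum[OF lf_cf vs_bar] vs_smult[OF vs_bar] EB_closed)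
 also have "... = (\<Sum>I\<in>Wd N. if I = J then x I else 0)"
  using J lf_smult[OF lf_cf EB_closed] by (intro sum.cong refl) (auto simp: cf_EB Wd_def simp del: bar_simps)
 also have "... = x J" using J by simp
 finally show ?thesis .
qed

lemma cf_el_notin: "set J \<subseteq> D ==> J \<notin> Wd N ==> cf J (el N x) = 0"
proof -
 assume J: "set J \<subseteq> D" "J \<notin> Wd N"
 have "cf J (el N x) = (\<Sum>I\<in>Wd N. cf J (x I \<odot>[\<B>] EB I))"
  unfolding el_def by (intro lf_finsum[OF lf_cf vs_bar] vs_smult[OF vs_bar] EB_closed)
 also have "... = 0"
  using J lf_smult[OF lf_cf EB_closed] by (intro sum.neutral ballI) (auto simp: cf_EB Wd_def simp del: bar_simps)
 finally show ?thesis .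
qed

text \<open>The elements that equal their own expansion form a submodule, so the expansion has to be
  verified for single words only.\<close>

lemma el_rep_sub: "submodule {X : carrier \<B>. X = el N (%I. cf I X)} CC \<B>"
proof (rule lin_eq_submodule[OF vs_bar vs_bar lin_id])
 have "lin \<B> (fun_module UNIV) (%X I. cf I X)"
  by (rule linI) (auto simp: fun_eq_iff lf_add[OF lf_cf, simplified] lf_smult[OF lf_cf, simplified])
 from lin_comp[OF this lin_el] show "lin \<B> \<B> (%X. el N (%I. cf I X))" .
qed

lemma EB_rep: "I : Wd N ==> EB I = el N (%J. cf J (EB I))"
proof -
 assume I: "I : Wd N"
 note c = EB_closed[OF I]
 have "el N (%J. cf J (EB I)) = finsum \<B> (%J. cf J (EB I) \<odot>[\<B>] EB J) {I}"
  unfolding el_def using I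
  by (intro vs_finsum_neutral[OF vs_bar finite_Wd] vs_smult[OF vs_bar])
   (auto simp: cf_EB Wd_def vs_null[OF vs_bar EB_closed[of _ N]] EB_closed[of _ N] simp del: bar_simps)
 also have "... = cf I (EB I) \<odot>[\<B>] EB I"
  using vs_smult[OF vs_bar c] vs_r_zero[OF vs_bar] by (subst vs_finsum_insert[OF vs_bar]) (auto simp del: bar_simps simp: vs_finsum_empty[OF vs_bar])
 also have "... = EB I" using I vs_one[OF vs_bar c] by (simp add: cf_EB Wd_def del: bar_simps)
 finally show ?thesis by simp
qed

text \<open>Letters are expanded one by one: \<open>I\<close> holds those already replaced by basis
  forms, \<open>J\<close> the arbitrary one-forms still to come, and the total length stays the
  same.\<close>

lemma word_rep:
 assumes "set I \<subseteq> D" "set J \<subseteq> part \<Omega> 1" "length I + length J < N"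
 shows "bc (w1 I @ w1 J) : {X : carrier \<B>. X = el N (%I. cf I X)}"
 using assms
proof (induction J arbitrary: I)
 case Nil
 then have "I : Wd N" by (simp add: Wd_def)
 then show ?case using EB_rep EB_closed by (simp del: bar_simps)
next
 case (Cons \<eta> J)
 let ?U = "{X : carrier \<B>. X = el N (%I. cf I X)}"
 have I: "w1 I : BW" and J: "w1 J : BW" and \<eta>: "\<eta> : part \<Omega> 1" using Cons.prems by (auto intro: w1_BW)
 note l = wml_lin[OF wml_bc I J order_refl]
 have b: "bc (w1 I @ [(1, b)] @ w1 J) : ?U" if "b : D" for b
  using Cons.IH[of "I @ [b]"] Cons.prems that by (simp add: w1_Cons del: bar_simps)
 have sm: "c \<odot>[\<B>] X : ?U" if "X : ?U" for c X
  using el_rep_sub[of N] that unfolding submodule_iff[OF vs_bar] by blast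
 have "bc (w1 I @ w1 (\<eta> # J)) = bc (w1 I @ [(1, finsum W1 (%b. co b \<eta> \<odot>[W1] b) D)] @ w1 J)"
  using D_rep[OF \<eta>] by (simp add: w1_Cons)
 also have "... = finsum \<B> (%b. bc (w1 I @ [(1, co b \<eta> \<odot>[W1] b)] @ w1 J)) D"
  by (rule lin_finsum[OF l vs_deg_part vs_bar]) auto
 also have "... : ?U"
 proof (rule submodule_finsum[OF vs_bar el_rep_sub], goal_cases)
  case (1 i) note i = 1(1)
  show ?case
   using lin_smult[OF l, of i "co i \<eta>"] sm[OF b[OF i], of "co i \<eta>"] i by (simp del: bar_simps)
 qed
 finally show ?case .
qed

text \<open>All letters have degree at least one, so their weights \<open>p - 1\<close> are
  nonnegative and vanish as soon as their sum does.\<close>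

lemma deg0_word:
 assumes "w : BW" "bar_deg w = 0"
 shows "w = w1 (map snd w)" "set (map snd w) \<subseteq> part \<Omega> 1"
proof -
 have "int (length w) \<le> int (sum_list (map fst w)) \<and> (sum_list (map fst w) = length w --> (\<forall>x\<in>set w. fst x = 1))"
  using assms(1)
 proof (induction w)
  case (Cons x w)
  then show ?case by auto
 qed simp
 then have *: "\<forall>x\<in>set w. fst x = 1" using assms(2) by (simp add: bar_deg_def)
 then show "w = w1 (map snd w)" by (auto simp: w1_def intro!: nth_equalityI prod_eqI)
 show "set (map snd w) \<subseteq> part \<Omega> 1" using assms(1) * unfolding bar_words_def by fastforce
qed

lemma bar_part_sub: "submodule (bar_part \<Omega> 0) CC \<B>"
 unfolding bar_part_def
proof (rule lin_image_submodule[OF vs_free_module vs_bar lin_bar_class])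
 show "submodule {x. keys x \<subseteq> {w : BW. bar_deg w = 0}} CC (free_module BW)"
  unfolding submodule_iff[OF vs_free_module]
 proof (intro conjI ballI allI)
  fix x y :: "'o bar_word \<Rightarrow>\<^sub>0 complex" and c
  assume x: "x : {x. keys x \<subseteq> {w : BW. bar_deg w = 0}}"
  show "c \<odot>[free_module BW] x : {x. keys x \<subseteq> {w : BW. bar_deg w = 0}}" using x keys_pscale[of c x] by auto
  assume y: "y : {x. keys x \<subseteq> {w : BW. bar_deg w = 0}}"
  show "x \<oplus>[free_module BW] y : {x. keys x \<subseteq> {w : BW. bar_deg w = 0}}" using x y keys_add[of x y] by auto
 qed auto
qed

lemma bar_part_rep:
 assumes X: "X : bar_part \<Omega> 0"
 obtains N where "X = el N (%I. cf I X)"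
proof -
 obtain x where x: "keys x \<subseteq> {w : BW. bar_deg w = 0}" "X = bar_class \<Omega> x"
  using X by (auto simp: bar_part_def)
 obtain N where N: "\<And>w. w : keys x ==> length w < N"
 proof -
  have "finite (length ` keys x)" by simp
  then obtain N where "\<forall>n\<in>length ` keys x. n < N" unfolding finite_nat_set_iff_bounded by blast
  then show thesis using that by blast
 qed
 let ?U = "{X : carrier \<B>. X = el N (%I. cf I X)}"
 have sm: "c \<odot>[\<B>] X : ?U" if "X : ?U" for c X
  using el_rep_sub[of N] that unfolding submodule_iff[OF vs_bar] by blast
 have "bar_class \<Omega> x = lincomb \<B> bc x" using x by (intro bar_class_lincomb) auto
 also have "... : ?U" unfolding lincomb_def
 proof (intro submodule_finsum[OF vs_bar el_rep_sub] sm)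
  fix w assume w: "w : keys x"
  then have "w : BW" "bar_deg w = 0" using x by auto
  note d = deg0_word[OF this]
  have "bc (w1 [] @ w1 (map snd w)) : ?U" using d(2) N[OF w] by (intro word_rep) auto
  then show "bc w : ?U" using d(1) by simp
 qed
 finally show thesis using that x(2) by blast
qed

lemma EB_part: "set I \<subseteq> D ==> EB I : bar_part \<Omega> 0"
proof -
 assume I: "set I \<subseteq> D"
 have "bar_deg (w1 I) = 0" by (induction I) (auto simp: bar_deg_def w1_def)
 then show ?thesis unfolding bar_part_def using I by (intro imageI) auto
qed

lemma el_part: "el N x : bar_part \<Omega> 0"
 unfolding el_def
proof (rule submodule_finsum[OF vs_bar bar_part_sub], goal_cases)
 case (1 I)
 then have "EB I : bar_part \<Omega> 0" by (intro EB_part) (simp add: Wd_def)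
 then show ?case using bar_part_sub unfolding submodule_iff[OF vs_bar] by blast
qed

lemma el_cong: "(\<And>I. I : Wd N ==> x I = y I) ==> el N x = el N y"
 unfolding el_def by (intro vs_finsum_cong[OF vs_bar refl] vs_smult[OF vs_bar] EB_closed) auto

text \<open>\<open>cf I\<close> is defined for words with letters outside \<open>D\<close> as well;
  setting these values to zero makes the result comparable with \<open>cof\<close>.\<close>

definition cfs :: "('o bar_word \<Rightarrow>\<^sub>0 complex) set => 'o list => complex" where
 "cfs X I = (if set I \<subseteq> D then cf I X else 0)"

text \<open>Stated for all large bounds, so that two elements can be expanded with a common
  one.\<close>

lemma bar_part_cfs:
 assumes X: "X : bar_part \<Omega> 0"
 shows "\<exists>N. \<forall>M\<ge>N. X = el M (cfs X) \<and> (\<forall>I. I \<notin> Wd M --> cfs X I = 0)"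
proof -
 obtain N where N: "X = el N (%I. cf I X)" using bar_part_rep[OF X] .
 have 0: "cfs X I = 0" if "I \<notin> Wd N" for I
  using cf_el_notin[of I N "%I. cf I X"] that N unfolding cfs_def by auto
 have e: "X = el N (cfs X)" using N el_cong[of N "%I. cf I X" "cfs X"] by (auto simp: cfs_def Wd_def)
 have "X = el M (cfs X) \<and> (\<forall>I. I \<notin> Wd M --> cfs X I = 0)" if M: "N \<le> M" for M
 proof
  have s: "Wd N \<subseteq> Wd M" using M by (auto simp: Wd_def)
  show "\<forall>I. I \<notin> Wd M --> cfs X I = 0" using 0 s by blast
  have "el M (cfs X) = el N (cfs X)" unfolding el_def
  proof (rule vs_finsum_neutral[OF vs_bar finite_Wd s])
   show "cfs X I \<odot>[\<B>] EB I = \<zero>[\<B>]" if "I : Wd M - Wd N" for I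
    using that 0[of I] vs_null[OF vs_bar EB_closed[of I M]] by (simp del: bar_simps)
  qed (intro vs_smult[OF vs_bar] EB_closed)
  then show "X = el M (cfs X)" using e by simp
 qed
 then show ?thesis by blast
qed

lemma cfs_el: "(\<And>I. I \<notin> Wd N ==> x I = 0) ==> cfs (el N x) = x"
proof
 fix I assume 0: "\<And>I. I \<notin> Wd N ==> x I = 0"
 show "cfs (el N x) I = x I"
  using 0[of I] cf_el[of I N x] cf_el_notin[of I N x] by (cases "I : Wd N") (auto simp: cfs_def Wd_def)
qed

end

context form_algebra
begin

interpretation bp: presentation BW "bar_rels \<Omega>" by (rule bar_presentation)

lemma wml_cong: "(\<And>w. w : BW ==> F w = G w) ==> wml M F \<longleftrightarrow> wml M G"
proof -
 assume e: "\<And>w. w : BW ==> F w = G w"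
 have "lin (deg_part \<Omega> p) M (%\<eta>. F (u @ [(p, \<eta>)] @ v)) \<longleftrightarrow> lin (deg_part \<Omega> p) M (%\<eta>. G (u @ [(p, \<eta>)] @ v))"
  if "u : BW" "v : BW" "1 \<le> p" for u v p
  by (rule lin_cong[OF e vs_deg_part]) (use that in auto)
 then show ?thesis using e unfolding wml_def by auto
qed

subsection \<open>The differential\<close>

abbreviation "BJ \<equiv> bar_J \<Omega>"

lemma BJ_simp [simp]: "BJ (p, \<eta>) = (p, (-1) ^ p \<odot>[total \<Omega>] \<eta>)"
 by (simp add: bar_J_def)

lemma BJ_BW [simp]: "w : BW ==> map BJ w : BW"
 by (induction w) auto

definition wdi :: "nat => 'o bar_word => 'o bar_word" where
 "wdi i w = map BJ (take (i - 1) w) @ [letter_wedge \<Omega> (BJ (w ! (i - 1))) (w ! i)] @ drop (i + 1) w"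

lemma letter_wedge_simp [simp]: "letter_wedge \<Omega> (p, \<eta>) (q, \<zeta>) = (p + q, \<eta> \<cdot> \<zeta>)"
 by (simp add: letter_wedge_def)

lemma wdi_BW: "w : BW ==> 1 \<le> i ==> i < length w ==> wdi i w : BW"
 using BW_nth[of w "i - 1"] BW_nth[of w i]
 by (cases "w ! (i - 1)"; cases "w ! i") (auto simp: wdi_def intro!: wedge_part)

lemma bar_class_d_word:
 assumes w: "w : BW"
 shows "bar_class \<Omega> (bar_d_word \<Omega> w) = (\<Oplus>\<^bsub>\<B>\<^esub>i\<in>{1..<length w}. (-1) ^ (i + 1) \<odot>[\<B>] bc (wdi i w))"
proof -
 have c: "single (wdi i w) k : carrier (free_module BW)" if "i : {1..<length w}" for i k
  using wdi_BW[OF w] that by (intro single_carrier) auto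
 have "bar_d_word \<Omega> w = finsum (free_module BW) (%i. single (wdi i w) ((-1) ^ (i + 1))) {1..<length w}"
  unfolding bar_d_word_def wdi_def[symmetric] by (rule finsum_free_module[OF c, symmetric])
 then have "bar_class \<Omega> (bar_d_word \<Omega> w) = bar_class \<Omega> (finsum (free_module BW) (%i. single (wdi i w) ((-1) ^ (i + 1))) {1..<length w})"
  by simp
 also have "... = finsum \<B> (%i. bar_class \<Omega> (single (wdi i w) ((-1) ^ (i + 1)))) {1..<length w}"
  by (rule lin_finsum[OF lin_bar_class vs_free_module vs_bar c])
 also have "... = (\<Oplus>\<^bsub>\<B>\<^esub>i\<in>{1..<length w}. (-1) ^ (i + 1) \<odot>[\<B>] bc (wdi i w))"
 proof (rule vs_finsum_cong[OF vs_bar refl])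
  fix i assume i: "i : {1..<length w}"
  show "(-1) ^ (i + 1) \<odot>[\<B>] bc (wdi i w) : carrier \<B>"
   using i by (intro vs_smult[OF vs_bar] bc_closed wdi_BW[OF w]) auto
  show "bar_class \<Omega> (single (wdi i w) ((-1) ^ (i + 1))) = (-1) ^ (i + 1) \<odot>[\<B>] bc (wdi i w)"
   using lin_smult[OF lin_bar_class c[OF i, of 1], of "(-1) ^ (i + 1)"]
   by (simp only: free_module_simps pscale_single mult_1_right)
 qed
 finally show ?thesis .
qed

lemma lin_deg_scale: "lin (deg_part \<Omega> p) (deg_part \<Omega> p) (%\<eta>. c \<odot>[total \<Omega>] \<eta>)"
 using lin_smultf[OF vs_deg_part lin_id, of p c] by simp

text \<open>The cases locate the merged pair relative to the varying letter. It lies to the right,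
  and the letter is only scaled by \<open>bar_J\<close>; the letter is its left or its right factor,
  and bilinearity of the product applies; or it lies to the left and the letter is
  untouched.\<close>

lemma wdi_lin:
 assumes uv: "u : BW" "v : BW" "1 \<le> p" and i: "1 \<le> i" "i < length u + 1 + length v"
 shows "lin (deg_part \<Omega> p) \<B> (%\<eta>. bc (wdi i (u @ [(p, \<eta>)] @ v)))"
proof -
 consider (1) m where "i = length u + 2 + m" | (2) "i = length u + 1" | (3) "i = length u" | (4) "i < length u"
 proof (cases "length u + 2 \<le> i")
  case True
  then obtain m where "i = length u + 2 + m" using le_Suc_ex by blast
  then show thesis using that(1) by blast
 next
  case False
  then have "i = length u + 1 \<or> i = length u \<or> i < length u" by linarith
  then show thesis using that(2-4) by blast
 qed
 then show ?thesis
 proof cases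
  case 1
  have m: "m + 1 < length v" using i 1 by simp
  have "wdi i (u @ [(p, \<eta>)] @ v) = map BJ u @ [(p, (-1) ^ p \<odot>[total \<Omega>] \<eta>)] @
    (map BJ (take m v) @ [letter_wedge \<Omega> (BJ (v ! m)) (v ! (m + 1))] @ drop (m + 2) v)" for \<eta>
   using 1 by (simp add: wdi_def nth_append nth_Cons' numeral_2_eq_2 numeral_3_eq_3 One_nat_def)
  moreover have "map BJ (take m v) @ [letter_wedge \<Omega> (BJ (v ! m)) (v ! (m + 1))] @ drop (m + 2) v : BW"
   using wdi_BW[OF uv(2), of "m + 1"] m by (simp add: wdi_def One_nat_def)
  ultimately show ?thesis
   using bc_letter_lin[OF BJ_BW[OF uv(1)] _ uv(3) lin_deg_scale] by simp
 next
  case 2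
  have v: "0 < length v" using i 2 by simp
  obtain q \<zeta> where z: "v ! 0 = (q, \<zeta>)" by (cases "v ! 0")
  have q: "1 \<le> q" "\<zeta> : part \<Omega> q" using BW_nth[OF uv(2) v] z by auto
  have e: "wdi i (u @ [(p, \<eta>)] @ v) = map BJ u @ [(p + q, ((-1) ^ p \<odot>[total \<Omega>] \<eta>) \<cdot> \<zeta>)] @ drop 1 v" for \<eta>
   using 2 z by (simp add: wdi_def nth_append nth_Cons' One_nat_def)
  have l: "lin (deg_part \<Omega> p) (deg_part \<Omega> (p + q)) (%\<eta>. ((-1) ^ p \<odot>[total \<Omega>] \<eta>) \<cdot> \<zeta>)"
   using lin_comp[OF lin_deg_scale bilin_right[OF wedge_bilin, of \<zeta> q p]] q by simp
  show ?thesis unfolding e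
   by (rule bc_letter_lin[OF BJ_BW[OF uv(1)] BW_drop[OF uv(2)] _ l]) (use uv in simp)
 next
  case 3
  have u: "length u - 1 < length u" using i 3 by simp
  obtain q \<zeta> where z: "u ! (length u - 1) = (q, \<zeta>)" by (cases "u ! (length u - 1)")
  have q: "1 \<le> q" "\<zeta> : part \<Omega> q" using BW_nth[OF uv(1) u] z by auto
  have e: "wdi i (u @ [(p, \<eta>)] @ v) = map BJ (take (length u - 1) u) @ [(q + p, ((-1) ^ q \<odot>[total \<Omega>] \<zeta>) \<cdot> \<eta>)] @ v" for \<eta>
   using 3 z u by (simp add: wdi_def nth_append drop_Cons')
  have l: "lin (deg_part \<Omega> p) (deg_part \<Omega> (q + p)) (%\<eta>. ((-1) ^ q \<odot>[total \<Omega>] \<zeta>) \<cdot> \<eta>)"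
   using bilin_left[OF wedge_bilin, of "(-1) ^ q \<odot>[total \<Omega>] \<zeta>" q p] q by simp
  show ?thesis unfolding e
   by (rule bc_letter_lin[OF BJ_BW[OF BW_take[OF uv(1)]] uv(2) _ l]) (use uv in simp)
 next
  case 4
  have e: "wdi i (u @ [(p, \<eta>)] @ v) = (map BJ (take (i - 1) u) @ [letter_wedge \<Omega> (BJ (u ! (i - 1))) (u ! i)] @ drop (i + 1) u) @ [(p, \<eta>)] @ v" for \<eta>
   using 4 i less_imp_diff_less[OF 4, of 1] by (simp add: wdi_def nth_append)
  have "map BJ (take (i - 1) u) @ [letter_wedge \<Omega> (BJ (u ! (i - 1))) (u ! i)] @ drop (i + 1) u : BW"
   using wdi_BW[OF uv(1) i(1) 4] by (simp add: wdi_def)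
  from bc_letter_lin[OF this uv(2,3) lin_id] show ?thesis unfolding e .
 qed
qed

lemma wml_d: "wml \<B> (%w. bar_class \<Omega> (bar_d_word \<Omega> w))"
proof (rule iffD2[OF wml_cong], erule bar_class_d_word, rule wml_finsum[where S="%n. {1..<n}", OF vs_bar])
 show "(-1) ^ (i + 1) \<odot>[\<B>] bc (wdi i w) : carrier \<B>" if "w : BW" "i : {1..<length w}" for w i
  using that by (intro vs_smult[OF vs_bar] bc_closed wdi_BW) auto
 show "lin (deg_part \<Omega> p) \<B> (%\<eta>. (-1) ^ (i + 1) \<odot>[\<B>] bc (wdi i (u @ [(p, \<eta>)] @ v)))"
  if "u : BW" "v : BW" "1 \<le> p" "i : {1..<length u + 1 + length v}" for i u v p
  by (rule lin_smultf[OF vs_bar wdi_lin[OF that(1-3)]]) (use that(4) in auto)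
qed

lemma lin_bar_d: "lin \<B> \<B> (bar_d \<Omega>)"
 unfolding bar_d_def by (rule bar_lift(1)[OF vs_bar wml_d])

lemma bar_d_bc: "w : BW ==> bar_d \<Omega> (bc w) = bar_class \<Omega> (bar_d_word \<Omega> w)"
 unfolding bar_d_def by (rule bar_lift(2)[OF vs_bar wml_d])

text \<open>The term of the differential in which a neighbouring pair with product \<omega> stands
  between \<open>A\<close> and \<open>B\<close>. The merging has index \<open>length A + 1\<close>,
  whence the sign; \<open>bar_J\<close> acts on the letters of \<open>A\<close> and negates the left
  factor of the pair.\<close>

definition bq :: "'o list => 'o => 'o list => ('o bar_word \<Rightarrow>\<^sub>0 complex) set" where
 "bq A \<omega> B = (-1) ^ length A \<odot>[\<B>] bc (map BJ (w1 A) @ [(2, (-1) \<odot>[total \<Omega>] \<omega>)] @ w1 B)"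

lemma lin_bq:
 assumes "set A \<subseteq> D" "set B \<subseteq> D"
 shows "lin W2 \<B> (%\<omega>. bq A \<omega> B)"
 unfolding bq_def
 by (rule lin_smultf[OF vs_bar bc_letter_lin[OF BJ_BW w1_BWD _ lin_deg_scale]]) (use assms in auto)

lemma wdi_w1:
 assumes "i : D" "j : D"
 shows "(-1) ^ (length A + 1 + 1) \<odot>[\<B>] bc (wdi (length A + 1) (w1 (A @ [i, j] @ B))) = bq A (i \<cdot> j) B"
proof -
 have "wdi (length A + 1) (w1 (A @ [i, j] @ B)) = map BJ (w1 A) @ [(2, ((-1) \<odot>[total \<Omega>] i) \<cdot> j)] @ w1 B"
  by (simp add: wdi_def nth_append w1_Cons nth_Cons' numeral_2_eq_2 One_nat_def)
 moreover have "((-1) \<odot>[total \<Omega>] i) \<cdot> j = (-1) \<odot>[total \<Omega>] (i \<cdot> j)"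
  using lin_smult[OF bilin_right[OF wedge12, of j], of i "-1"] assms by simp
 ultimately show ?thesis by (simp add: bq_def power_add del: bar_simps)
qed

text \<open>A word with a position of merging is the same as a quadruple: the two letters that are
  merged and the words before and after them.\<close>

lemma bar_d_el:
 assumes \<Psi>: "lf \<B> \<Psi>" and x: "\<And>I. I \<notin> Wd N ==> x I = 0"
 shows "\<Psi> (bar_d \<Omega> (el N x)) = (\<Sum>A\<in>Wd N. \<Sum>B\<in>Wd N. \<Sum>i\<in>D. \<Sum>j\<in>D. \<Psi> (bq A (i \<cdot> j) B) * x (A @ [i, j] @ B))"
proof -
 have IBW: "w1 I : BW" if "I : Wd N" for I using that by (simp add: Wd_def)
 let ?h = "%I i. x I * \<Psi> ((-1) ^ (i + 1) \<odot>[\<B>] bc (wdi i (w1 I)))"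
 have l: "lf \<B> (%X. \<Psi> (bar_d \<Omega> X))" by (rule lin_comp[OF lin_bar_d \<Psi>])
 have "\<Psi> (bar_d \<Omega> (el N x)) = (\<Sum>I\<in>Wd N. \<Psi> (bar_d \<Omega> (x I \<odot>[\<B>] EB I)))"
  unfolding el_def by (intro lf_finsum[OF l vs_bar] vs_smult[OF vs_bar] EB_closed)
 also have "... = (\<Sum>I\<in>Wd N. \<Sum>i\<in>{1..<length I}. ?h I i)"
 proof (rule sum.cong[OF refl], goal_cases)
  case (1 I) note I = 1(1)
  have "\<Psi> (bar_d \<Omega> (x I \<odot>[\<B>] EB I)) = x I * \<Psi> (bar_d \<Omega> (EB I))"
   by (rule lf_smult[OF l EB_closed[OF I]])
  also have "\<Psi> (bar_d \<Omega> (EB I)) = (\<Sum>i\<in>{1..<length I}. \<Psi> ((-1) ^ (i + 1) \<odot>[\<B>] bc (wdi i (w1 I))))"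
   unfolding bar_d_bc[OF IBW[OF I]] bar_class_d_word[OF IBW[OF I]] w1_length
   by (rule lf_finsum[OF \<Psi> vs_bar]) (use wdi_BW[OF IBW[OF I]] in \<open>auto intro!: vs_smult[OF vs_bar] bc_closed simp del: bar_simps\<close>)
  finally show ?case
   by (simp add: sum_distrib_left)
 qed
 also have "... = (\<Sum>(I, i)\<in>(SIGMA I:Wd N. {1..<length I}). ?h I i)"
  by (subst sum.Sigma) auto
 also have "... = (\<Sum>(A, B, i, j)\<in>{(A, B, i, j). A : Wd N \<and> B : Wd N \<and> i : D \<and> j : D \<and> A @ [i, j] @ B : Wd N}.
   \<Psi> (bq A (i \<cdot> j) B) * x (A @ [i, j] @ B))"
 proof (rule sum.reindex_bij_witness[where
    i="%(A, B, i, j). (A @ [i, j] @ B, length A + 1)"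
    and j="%(I, i). (take (i - 1) I, drop (i + 1) I, I ! (i - 1), I ! i)"])
  fix p assume "p : (SIGMA I:Wd N. {1..<length I})"
  then obtain I i where p: "p = (I, i)" "I : Wd N" "1 \<le> i" "i < length I" by auto
  have s: "take (i - 1) I @ [I ! (i - 1), I ! i] @ drop (i + 1) I = I"
  proof -
   have "I = take (i - 1) I @ drop (i - 1) I" by simp
   also have "drop (i - 1) I = I ! (i - 1) # drop i I" using p Cons_nth_drop_Suc[of "i - 1" I] by simp
   also have "drop i I = I ! i # drop (i + 1) I" using p Cons_nth_drop_Suc[of i I] by (simp add: Suc_eq_plus1)
   finally show ?thesis by simp
  qed
  have ln: "length (take (i - 1) I) = i - 1" using p by simp
  have d: "I ! (i - 1) : D" "I ! i : D" using p nth_mem[of "i - 1" I] nth_mem[of i I] by (auto simp: Wd_def)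
  show "(case (case p of (I, i) => (take (i - 1) I, drop (i + 1) I, I ! (i - 1), I ! i)) of
    (A, B, i, j) => (A @ [i, j] @ B, length A + 1)) = p"
   using s ln p by simp
  show "(case p of (I, i) => (take (i - 1) I, drop (i + 1) I, I ! (i - 1), I ! i))
    : {(A, B, i, j). A : Wd N \<and> B : Wd N \<and> i : D \<and> j : D \<and> A @ [i, j] @ B : Wd N}"
   using s d p by (auto simp: Wd_def dest: in_set_takeD in_set_dropD)
  show "(case (case p of (I, i) => (take (i - 1) I, drop (i + 1) I, I ! (i - 1), I ! i)) of
    (A, B, i, j) => \<Psi> (bq A (i \<cdot> j) B) * x (A @ [i, j] @ B)) = (case p of (I, i) => ?h I i)"
  proof -
   have "i - 1 + 1 = i" using p by simp
   then have "(-1) ^ (i + 1) \<odot>[\<B>] bc (wdi i (w1 I)) = bq (take (i - 1) I) (I ! (i - 1) \<cdot> I ! i) (drop (i + 1) I)"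
    using wdi_w1[OF d, of "take (i - 1) I" "drop (i + 1) I"] unfolding s ln by simp
   then show ?thesis using p(1) s by (simp del: bar_simps)
  qed
 next
  fix q assume "q : {(A, B, i, j). A : Wd N \<and> B : Wd N \<and> i : D \<and> j : D \<and> A @ [i, j] @ B : Wd N}"
  then obtain A B i j where q: "q = (A, B, i, j)" "A @ [i, j] @ B : Wd N" by auto
  show "(case (case q of (A, B, i, j) => (A @ [i, j] @ B, length A + 1)) of
    (I, i) => (take (i - 1) I, drop (i + 1) I, I ! (i - 1), I ! i)) = q"
   using q(1) by (simp add: nth_append One_nat_def)
  show "(case q of (A, B, i, j) => (A @ [i, j] @ B, length A + 1)) : (SIGMA I:Wd N. {1..<length I})"
   using q by (simp add: One_nat_def)
 qed
 \<comment> \<open>Quadruples whose concatenation is too long contribute nothing, since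
   \<open>x\<close> vanishes there.\<close>
 also have "... = (\<Sum>(A, B, i, j)\<in>Wd N \<times> Wd N \<times> D \<times> D. \<Psi> (bq A (i \<cdot> j) B) * x (A @ [i, j] @ B))"
 proof -
  have x': "\<And>I. x I \<noteq> 0 ==> I : Wd N" using x by blast
  show ?thesis by (intro sum.mono_neutral_left) (auto dest: x')
 qed
 also have "... = (\<Sum>A\<in>Wd N. \<Sum>B\<in>Wd N. \<Sum>i\<in>D. \<Sum>j\<in>D. \<Psi> (bq A (i \<cdot> j) B) * x (A @ [i, j] @ B))"
  by (simp add: sum.cartesian_product)
 finally show ?thesis .
qed

lemma pf_fst: "pf fs w \<noteq> 0 ==> map fst fs = map fst w"
 by (induction fs w rule: pf.induct) (auto split: if_splits)

text \<open>Given the relations, every functional of the differential is a sum of instances of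
  \<open>Rel\<close>, because \<open>bq\<close> is linear in the two-form. Conversely the functional
  with factors \<open>l1 u\<close>, \<phi> and \<open>l1 v\<close> isolates one instance: it sees
  only a two-form placed exactly between \<open>u\<close> and \<open>v\<close>.\<close>

lemma bar_d_zero_iff:
 assumes X: "X : bar_part \<Omega> 0"
 shows "bar_d \<Omega> X = \<zero>[\<B>] \<longleftrightarrow> Rel (cfs X)"
proof -
 obtain N where N: "\<forall>M\<ge>N. X = el M (cfs X) \<and> (\<forall>I. I \<notin> Wd M --> cfs X I = 0)"
  using bar_part_cfs[OF X] by blast
 have Xc: "X : carrier \<B>" using bar_part_sub X unfolding submodule_iff[OF vs_bar] by blast
 show ?thesis
 proof
  assume R: "Rel (cfs X)"
  show "bar_d \<Omega> X = \<zero>[\<B>]"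
  proof (rule vs_sep[OF vs_bar lin_closed[OF lin_bar_d Xc]], goal_cases)
   case (1 \<Psi>) note \<Psi> = 1(1)
   have "\<Psi> (bar_d \<Omega> (el N (cfs X))) = (\<Sum>A\<in>Wd N. \<Sum>B\<in>Wd N. \<Sum>i\<in>D. \<Sum>j\<in>D. \<Psi> (bq A (i \<cdot> j) B) * cfs X (A @ [i, j] @ B))"
    by (rule bar_d_el[OF \<Psi>]) (use N in auto)
   also have "... = 0"
   proof (rule sum.neutral, rule ballI, rule sum.neutral, rule ballI, goal_cases)
    case (1 A B)
    then have AB: "set A \<subseteq> D" "set B \<subseteq> D" by (auto simp: Wd_def)
    from lin_comp[OF lin_bq[OF this] \<Psi>]
    show ?case
     using R AB unfolding Rel_def by blast
   qed
   finally show ?case using N by simp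
  qed
 next
  assume z: "bar_d \<Omega> X = \<zero>[\<B>]"
  show "Rel (cfs X)" unfolding Rel_def
  proof (intro allI impI)
   fix u v \<phi> assume uv: "set u \<subseteq> D" "set v \<subseteq> D" and \<phi>: "lf W2 \<phi>"
   let ?f = "l1 u @ [(2, \<phi>)] @ l1 v"
   have w: "wml complex_line (pf ?f)" by (rule wml_pf) (auto simp: l1_def lf_co \<phi>)
   define \<Psi> where "\<Psi> = lin_ext complex_line (pf ?f)"
   have \<Psi>: "lf \<B> \<Psi>" and \<Psi>v: "\<And>w. w : BW ==> \<Psi> (bc w) = pf ?f w"
    unfolding \<Psi>_def using bar_lift[OF vs_complex_line w] by auto
   \<comment> \<open>Large enough to expand \<open>X\<close> and to have \<open>u\<close> and
     \<open>v\<close> in \<open>Wd M\<close>, whose length bound is strict.\<close>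
   define M where "M = N + length u + length v + 1"
   have uvM: "u : Wd M" "v : Wd M" using uv by (auto simp: Wd_def M_def)
   have M: "X = el M (cfs X)" "\<And>I. I \<notin> Wd M ==> cfs X I = 0"
   proof -
    have "N \<le> M" by (simp add: M_def)
    with N show "X = el M (cfs X)" "\<And>I. I \<notin> Wd M ==> cfs X I = 0" by blast+
   qed
   \<comment> \<open>The involution contributes \<open>-1\<close> for each letter of degree one; the
     sign in \<open>bq\<close> will cancel this.\<close>
   have J: "set A \<subseteq> D ==> length A = length u ==> pf (l1 u) (map BJ (w1 A)) = (-1) ^ length u * (if u = A then 1 else 0)" for A
    using uv(1)
   proof (induction u arbitrary: A)
    case Nil then show ?case by (auto simp: l1_def w1_def)
   next
    case (Cons i u)
    then obtain a A' where A: "A = a # A'" "length A' = length u" by (cases A) auto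
    have "co i ((-1) ^ 1 \<odot>[total \<Omega>] a) = - co i a"
     using lf_smult[OF lf_co, where c="-1" and x=a] Cons.prems A by simp
    then show ?case using Cons A by (auto simp: l1_def w1_def co_delta)
   qed
   have val: "\<Psi> (bq A \<omega> B) = (if A = u \<and> B = v then - \<phi> \<omega> else 0)" if AB: "A : Wd M" "B : Wd M" and \<omega>: "\<omega> : part \<Omega> 2" for A B \<omega>
   proof -
    let ?w = "map BJ (w1 A) @ [(2, (-1) \<odot>[total \<Omega>] \<omega>)] @ w1 B"
    have wB: "?w : BW" using AB \<omega> by (auto simp: Wd_def)
    have 1: "\<Psi> (bq A \<omega> B) = (-1) ^ length A * pf ?f ?w"
     unfolding bq_def using lf_smult[OF \<Psi> bc_closed[OF wB]] \<Psi>v[OF wB] by (simp del: bar_simps)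
    show ?thesis
    proof (cases "length A = length u")
     case True
     have "pf ?f ?w = pf (l1 u) (map BJ (w1 A)) * (pf [(2, \<phi>)] [(2, (-1) \<odot>[total \<Omega>] \<omega>)] * pf (l1 v) (w1 B))"
      by (subst pf_append', simp add: True l1_def, subst pf_append') auto
     also have "... = (-1) ^ length u * (if u = A then 1 else 0) * (- \<phi> \<omega> * (if v = B then 1 else 0))"
      using J[of A] True AB uv lf_smult[OF \<phi>, of \<omega> "-1"] \<omega> by (simp add: Wd_def pf_l1_w1)
     finally have *: "pf ?f ?w = (-1) ^ length u * (if u = A then 1 else 0) * (- \<phi> \<omega> * (if v = B then 1 else 0))" .
     have "(-1 :: complex) ^ length u * (-1) ^ length u = 1" by (simp flip: power_add)
     then show ?thesis unfolding 1 * using True by auto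
    next
     case False
     \<comment> \<open>The letter of degree two stands at different positions, so the degree
       patterns differ and \<open>pf\<close> vanishes.\<close>
     have "map fst ?f \<noteq> map fst ?w"
     proof
      assume e: "map fst ?f = map fst ?w"
      have f1: "map fst (l1 I) = replicate (length I) 1" for I by (simp add: l1_def comp_def map_replicate_const)
      have f2: "map fst (w1 I) = replicate (length I) 1" for I by (simp add: w1_def comp_def map_replicate_const)
      have f3: "map fst (map BJ (w1 I)) = replicate (length I) 1" for I by (simp add: w1_def comp_def map_replicate_const)
      have "map fst ?f ! length u = 2" by (simp add: f1 nth_append)
      moreover have "length u < length ?f" by (simp add: l1_def)
      moreover have "length u < length ?w ==> map fst ?w ! length u = 1"
       using False by (auto simp add: f2 f3 nth_append simp del: map_map nth_map)
      moreover have "length ?f = length ?w" using arg_cong[OF e, of length] by simp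
      ultimately show False using e by simp
     qed
     then have "pf ?f ?w = 0" using pf_fst[of ?f ?w] by blast
     then show ?thesis using 1 False by auto
    qed
   qed
   have "0 = \<Psi> (bar_d \<Omega> (el M (cfs X)))" using z M(1) lf_zero[OF \<Psi> vs_bar] by simp
   also have "... = (\<Sum>A\<in>Wd M. \<Sum>B\<in>Wd M. \<Sum>i\<in>D. \<Sum>j\<in>D. \<Psi> (bq A (i \<cdot> j) B) * cfs X (A @ [i, j] @ B))"
    by (rule bar_d_el[OF \<Psi> M(2)])
   also have "... = (\<Sum>A\<in>Wd M. \<Sum>B\<in>Wd M. if A = u \<and> B = v then (\<Sum>i\<in>D. \<Sum>j\<in>D. - (\<phi> (i \<cdot> j) * cfs X (u @ [i, j] @ v))) else 0)"
    by (intro sum.cong refl) (auto simp: val)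
   also have "... = (\<Sum>A\<in>Wd M. if A = u then (\<Sum>i\<in>D. \<Sum>j\<in>D. - (\<phi> (i \<cdot> j) * cfs X (u @ [i, j] @ v))) else 0)"
    using uvM by (intro sum.cong refl) (auto simp: sum.delta)
   also have "... = - (\<Sum>i\<in>D. \<Sum>j\<in>D. \<phi> (i \<cdot> j) * cfs X (u @ [i, j] @ v))"
    using uvM by (simp add: sum_negf)
   finally show "(\<Sum>i\<in>D. \<Sum>j\<in>D. \<phi> (i \<cdot> j) * cfs X (u @ [i, j] @ v)) = 0" by simp
  qed
 qed
qed

subsection \<open>The space \<open>H\<^sup>0\<close>\<close>

lemma H0_sub: "submodule {X : bar_part \<Omega> 0. bar_d \<Omega> X = \<zero>[\<B>]} CC \<B>"
 using bar_part_sub lin_eq_submodule[OF vs_bar vs_bar lin_bar_d lin_zerof[OF vs_bar]]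
 unfolding submodule_iff[OF vs_bar] by blast

lemma vs_H0 [simp]: "vs (H0_bar \<Omega>)"
 unfolding H0_bar_def by (rule subspace_vs[OF vs_bar H0_sub])

lemma H0_simps: "\<zero>[H0_bar \<Omega>] = \<zero>[\<B>]" "x \<oplus>[H0_bar \<Omega>] y = x \<oplus>[\<B>] y" "c \<odot>[H0_bar \<Omega>] x = c \<odot>[\<B>] x"
 "x \<otimes>[H0_bar \<Omega>] y = x \<otimes>[\<B>] y" "\<one>[H0_bar \<Omega>] = \<one>[\<B>]"
 by (simp_all add: H0_bar_def)

lemma carrier_H0: "X : carrier (H0_bar \<Omega>) \<longleftrightarrow> X : bar_part \<Omega> 0 \<and> Rel (cfs X)"
 using bar_d_zero_iff by (auto simp: H0_bar_def)

lemma H0_bar_carrier: "X : carrier (H0_bar \<Omega>) ==> X : carrier \<B>"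
 using bar_part_sub unfolding carrier_H0 submodule_iff[OF vs_bar] by blast

lemma lin_H0_incl: "lin (H0_bar \<Omega>) \<B> (%x. x)"
 using H0_bar_carrier by (auto simp: lin_def H0_bar_def)

lemma H0_Uo: "X : carrier (H0_bar \<Omega>) ==> \<exists>N. \<forall>M\<ge>N. cfs X : carrier (Uo M) \<and> X = el M (cfs X)"
 using bar_part_cfs unfolding carrier_H0 carrier_Uo by blast

lemma Uo_cfs_el: "x : carrier (Uo N) ==> cfs (el N x) = x"
 by (rule cfs_el) (simp add: carrier_Uo)

lemma Uo_H0: "x : carrier (Uo N) ==> el N x : carrier (H0_bar \<Omega>)"
 using Uo_cfs_el unfolding carrier_H0 carrier_Uo by (simp add: el_part)

lemma cfs_add: "X : carrier \<B> ==> Y : carrier \<B> ==> cfs (X \<oplus>[\<B>] Y) I = cfs X I + cfs Y I"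
 and cfs_smult: "X : carrier \<B> ==> cfs (c \<odot>[\<B>] X) I = c * cfs X I"
 using lf_add[OF lf_cf, of X Y I] lf_smult[OF lf_cf, of X I c] by (auto simp: cfs_def)

lemma cfs_EB: "set I \<subseteq> D ==> cfs (EB I) J = (if J = I then 1 else 0)"
 by (auto simp: cfs_def cf_EB)

subsection \<open>Deconcatenation\<close>

lemma wml_counit: "wml complex_line (%w. if w = [] then 1 else 0)"
 by (intro wmlI linI) auto

lemma bar_counit_H0:
 assumes X: "X : bar_part \<Omega> 0"
 shows "bar_counit X = cfs X []"
proof -
 note l = bar_lift[OF vs_complex_line wml_counit, folded bar_counit_def]
 obtain N where N: "\<forall>M\<ge>N. X = el M (cfs X) \<and> (\<forall>I. I \<notin> Wd M --> cfs X I = 0)"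
  using bar_part_cfs[OF X] by blast
 \<comment> \<open>For \<open>N = 0\<close> there are no words in \<open>Wd N\<close>; the shift
   guarantees that the empty word is included.\<close>
 define M where "M = N + 1"
 have "X = el M (cfs X)" using N by (simp add: M_def)
 then have "bar_counit X = bar_counit (el M (cfs X))" by simp
 also have "... = (\<Sum>I\<in>Wd M. bar_counit (cfs X I \<odot>[\<B>] EB I))"
  unfolding el_def by (intro lf_finsum[OF l(1) vs_bar] vs_smult[OF vs_bar] EB_closed)
 also have "... = (\<Sum>I\<in>Wd M. if I = [] then cfs X I else 0)"
 proof (rule sum.cong[OF refl], goal_cases)
  case (1 I) note I = 1(1)
  from 1 have b: "w1 I : BW" by (simp add: Wd_def)
  show ?case
   using lf_smult[OF l(1) EB_closed[OF I]] l(2)[OF b] by (simp add: w1_def del: bar_simps)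
 qed
 also have "... = cfs X []"
 proof -
  have "[] : Wd M" by (simp add: Wd_def M_def)
  then show ?thesis by simp
 qed
 finally show ?thesis .
qed

abbreviation "BB \<equiv> tensor \<B> \<B>"
abbreviation "tB \<equiv> tens \<B> \<B>"

lemma vs_BB: "vs BB" by (rule vs_tensor[OF vs_bar vs_bar])

lemma tB_closed: "X : carrier \<B> ==> Y : carrier \<B> ==> tB X Y : carrier BB"
 by (rule tens_closed[OF vs_bar vs_bar])

lemma wml_comult: "wml BB (%w. \<Oplus>\<^bsub>BB\<^esub>i\<in>{..length w}. tB (bc (take i w)) (bc (drop i w)))"
proof (rule wml_finsum[where S="%n. {..n}" and F="%i w. tB (bc (take i w)) (bc (drop i w))", OF vs_BB])
 show "tB (bc (take i w)) (bc (drop i w)) : carrier BB" if "w : BW" for i w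
  using that by (intro tB_closed bc_closed) auto
 fix i and u v :: "'o bar_word" and p :: nat
 assume uv: "u : BW" "v : BW" "1 \<le> p" and i: "i : {..length u + 1 + length v}"
 show "lin (deg_part \<Omega> p) BB (%\<eta>. tB (bc (take i (u @ [(p, \<eta>)] @ v))) (bc (drop i (u @ [(p, \<eta>)] @ v))))"
 proof (cases "i \<le> length u")
  case True
  have e: "take i (u @ [(p, \<eta>)] @ v) = take i u" "drop i (u @ [(p, \<eta>)] @ v) = drop i u @ [(p, \<eta>)] @ v" for \<eta> :: 'o
   using True by simp_all
  show ?thesis unfolding e
   by (rule lin_comp[OF wml_lin[OF wml_bc BW_drop[OF uv(1)] uv(2,3)] bilin_left[OF bilin_tens[OF vs_bar vs_bar] bc_closed]])
    (use uv in simp)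
 next
  case False
  then obtain m where m: "i = length u + 1 + m" using le_Suc_ex[of "length u + 1" i] by auto
  have e: "take i (u @ [(p, \<eta>)] @ v) = u @ [(p, \<eta>)] @ take m v" "drop i (u @ [(p, \<eta>)] @ v) = drop m v" for \<eta> :: 'o
   using m by (simp_all add: take_Cons' drop_Cons')
  show ?thesis unfolding e
   by (rule lin_comp[OF wml_lin[OF wml_bc uv(1) BW_take[OF uv(2)] uv(3)] bilin_right[OF bilin_tens[OF vs_bar vs_bar] bc_closed]])
    (use uv in simp)
 qed
qed

text \<open>Cutting every word in two turns the coproduct into a double sum. The length restriction
  of \<open>sum_split_words\<close> disappears because \<open>x\<close> vanishes on longer
  words.\<close>

lemma bar_comult_el:
 assumes \<Psi>: "lf BB \<Psi>" and x: "\<And>I. I \<notin> Wd N ==> x I = 0"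
 shows "\<Psi> (bar_comult \<Omega> (el N x)) = (\<Sum>I\<in>Wd N. \<Sum>J\<in>Wd N. x (I @ J) * \<Psi> (tB (EB I) (EB J)))"
proof -
 note L = bar_lift[OF vs_BB wml_comult, folded bar_comult_def]
 have IBW: "w1 I : BW" if "I : Wd N" for I using that by (simp add: Wd_def)
 have l: "lf \<B> (%X. \<Psi> (bar_comult \<Omega> X))" by (rule lin_comp[OF L(1) \<Psi>])
 have wt: "take i (w1 I) = w1 (take i I)" "drop i (w1 I) = w1 (drop i I)" for i I
  by (simp_all add: w1_def take_map drop_map)
 have "\<Psi> (bar_comult \<Omega> (el N x)) = (\<Sum>I\<in>Wd N. \<Psi> (bar_comult \<Omega> (x I \<odot>[\<B>] EB I)))"
  unfolding el_def by (intro lf_finsum[OF l vs_bar] vs_smult[OF vs_bar] EB_closed)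
 also have "... = (\<Sum>I\<in>Wd N. \<Sum>i\<le>length I. x (take i I @ drop i I) * \<Psi> (tB (EB (take i I)) (EB (drop i I))))"
 proof (rule sum.cong[OF refl], goal_cases)
  case (1 I) note I = 1(1)
  have "\<Psi> (bar_comult \<Omega> (x I \<odot>[\<B>] EB I)) = x I * \<Psi> (bar_comult \<Omega> (EB I))"
   by (rule lf_smult[OF l EB_closed[OF I]])
  also have "\<Psi> (bar_comult \<Omega> (EB I)) = (\<Sum>i\<le>length I. \<Psi> (tB (EB (take i I)) (EB (drop i I))))"
   unfolding L(2)[OF IBW[OF I]] w1_length wt
  proof (rule lf_finsum[OF \<Psi> vs_BB], goal_cases)
   case (1 i)
   have "w1 (take i I) : BW" "w1 (drop i I) : BW"
    using BW_take[OF IBW[OF I], of i] BW_drop[OF IBW[OF I], of i] by (simp_all add: wt)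
   then show ?case by (intro tB_closed bc_closed)
  qed
  finally show ?case
   by (simp add: sum_distrib_left)
 qed
 also have "... = (\<Sum>I\<in>Wd N. \<Sum>J\<in>Wd N. if length I + length J < N then x (I @ J) * \<Psi> (tB (EB I) (EB J)) else 0)"
  unfolding Wd_def by (rule sum_split_words[OF finite_D])
 also have "... = (\<Sum>I\<in>Wd N. \<Sum>J\<in>Wd N. x (I @ J) * \<Psi> (tB (EB I) (EB J)))"
  using x by (intro sum.cong refl) (auto simp: Wd_def)
 finally show ?thesis .
qed

lemma lin_bar_comult: "lin \<B> BB (bar_comult \<Omega>)"
 unfolding bar_comult_def by (rule bar_lift(1)[OF vs_BB wml_comult])

end

subsection \<open>Shuffles and subsets of positions\<close>

lemma nths_filter: "nths K S = map ((!) K) (filter (%i. i : S) [0..<length K])"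
proof -
 have "zip K [0..<length K] = map (%i. (K ! i, i)) [0..<length K]"
  by (rule nth_equalityI) auto
 then show ?thesis by (simp add: nths_def filter_map comp_def)
qed

definition shw :: "(nat => nat) => 'x list => 'x list" where
 "shw \<sigma> w = map (%i. w ! \<sigma> i) [0..<length w]"

lemma length_shw [simp]: "length (shw \<sigma> w) = length w"
 by (simp add: shw_def)

lemma set_shw: "set (shw \<sigma> w) = (%i. w ! \<sigma> i) ` {..<length w}"
 by (simp add: shw_def atLeast0LessThan)

lemma shuffle_permsD:
 assumes "\<sigma> : shuffle_perms r s"
 shows "\<sigma> permutes {..<r + s}" "strict_mono_on {..<r} (inv_into UNIV \<sigma>)" "strict_mono_on {r..<r + s} (inv_into UNIV \<sigma>)"
 using assms by (auto simp: shuffle_perms_def)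

lemma finite_shuffle_perms [simp]: "finite (shuffle_perms r s)"
 by (rule finite_subset[OF _ finite_permutations[of "{..<r + s}"]]) (auto simp: shuffle_perms_def)

lemma permutes_lt: "\<sigma> permutes {..<n::nat} ==> \<sigma> i < n \<longleftrightarrow> i < n"
 using permutes_in_image[of \<sigma> "{..<n}" i] by simp

lemma strict_mono_sorted:
 fixes \<tau> :: "nat => nat"
 assumes "strict_mono_on {a..<b} \<tau>"
 shows "sorted (map \<tau> [a..<b :: nat])" "distinct (map \<tau> [a..<b])"
proof -
 have m: "\<tau> i < (\<tau> j :: nat)" if "i < j" "a \<le> i" "j < b" for i j
  using assms that by (auto simp: strict_mono_on_def)
 have "sorted_wrt (<) (map \<tau> [a..<b])"
  unfolding sorted_wrt_iff_nth_less using m by auto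
 then show "sorted (map \<tau> [a..<b])" "distinct (map \<tau> [a..<b])"
  by (simp_all add: strict_sorted_iff)
qed

text \<open>A shuffle with result \<open>K\<close> is determined by the set of positions that the
  letters of \<open>u\<close> occupy in \<open>K\<close>, the image of the first
  \<open>length u\<close> indices under the inverse permutation. As letters may repeat, several sets
  can give the same pair of words.\<close>

lemma card_shuffles:
 fixes u v K :: "'x list"
 shows "card {\<sigma> : shuffle_perms (length u) (length v). shw \<sigma> (u @ v) = K} =
  card {S. S \<subseteq> {..<length K} \<and> nths K S = u \<and> nths K (- S) = v}"
proof -
 define r s n where "r = length u" and "s = length v" and "n = r + s"
 let ?A = "{\<sigma> : shuffle_perms (length u) (length v). shw \<sigma> (u @ v) = K}"
 let ?B = "{S. S \<subseteq> {..<length K} \<and> nths K S = u \<and> nths K (- S) = v}"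
 let ?f = "%\<sigma>. inv_into UNIV \<sigma> ` {..<r}"
 have A: "inv_into UNIV \<sigma> permutes {..<n}" "map (inv_into UNIV \<sigma>) [0..<r] = filter (%i. i : ?f \<sigma>) [0..<n]"
   "map (inv_into UNIV \<sigma>) [r..<n] = filter (%i. i : - ?f \<sigma>) [0..<n]" "length K = n"
   "\<And>j. j < n ==> K ! (inv_into UNIV \<sigma> j) = (u @ v) ! j" "?f \<sigma> \<subseteq> {..<n}"
  if "\<sigma> : ?A" for \<sigma>
 proof -
  have sp: "\<sigma> : shuffle_perms r s" and K: "K = shw \<sigma> (u @ v)"
   using that unfolding r_def s_def by blast+
  note s = shuffle_permsD(1)[OF sp, folded n_def] and m = shuffle_permsD(2,3)[OF sp, folded n_def]
  show p: "inv_into UNIV \<sigma> permutes {..<n}" by (rule permutes_inv[OF s])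
  show "length K = n" using K by (simp add: n_def r_def s_def)
  show f: "?f \<sigma> \<subseteq> {..<n}"
  proof
   fix x assume "x : ?f \<sigma>"
   then obtain i where i: "i < r" "x = inv_into UNIV \<sigma> i" by blast
   then have "i < n" by (simp add: n_def)
   then show "x : {..<n}" using permutes_lt[OF p, of i] i(2) by simp
  qed
  have im: "inv_into UNIV \<sigma> ` {..<n} = {..<n}" by (rule permutes_image[OF p])
  have un: "{..<n} = {..<r} \<union> {r..<n}" by (auto simp: n_def)
  have ij: "inj (inv_into UNIV \<sigma>)" by (rule permutes_inj[OF p])
  show "map (inv_into UNIV \<sigma>) [0..<r] = filter (%i. i : ?f \<sigma>) [0..<n]"
  proof (rule sorted_distinct_set_unique)
   show "sorted (map (inv_into UNIV \<sigma>) [0..<r])" "distinct (map (inv_into UNIV \<sigma>) [0..<r])"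
    using strict_mono_sorted[of 0 r "inv_into UNIV \<sigma>"] m by (auto simp: atLeast0LessThan)
   have "set (filter (%i. i : ?f \<sigma>) [0..<n]) = {..<n} \<inter> ?f \<sigma>"
    by (simp add: Int_def)
   also have "... = ?f \<sigma>" using f by (rule Int_absorb1)
   finally show "set (map (inv_into UNIV \<sigma>) [0..<r]) = set (filter (%i. i : ?f \<sigma>) [0..<n])"
    by (simp add: atLeast0LessThan)
  qed (auto simp: sorted_wrt_filter)
  have "inv_into UNIV \<sigma> ` {r..<n} = {..<n} - ?f \<sigma>"
  proof -
   have "{r..<n} = {..<n} - {..<r}" by auto
   then show ?thesis using image_set_diff[OF ij, of "{..<n}" "{..<r}"] im by simp
  qed
  then show "map (inv_into UNIV \<sigma>) [r..<n] = filter (%i. i : - ?f \<sigma>) [0..<n]"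
   using strict_mono_sorted[OF m(2)]
   by (intro sorted_distinct_set_unique) (auto simp: sorted_wrt_filter)
  fix j assume j: "j < n"
  then have "inv_into UNIV \<sigma> j < length (u @ v)" using permutes_lt[OF p, of j] by (simp add: n_def r_def s_def)
  then show "K ! (inv_into UNIV \<sigma> j) = (u @ v) ! j" unfolding K shw_def by (simp add: permutes_inverses[OF s])
 qed
 have uv: "map ((!) (u @ v)) [0..<r] = u" "map ((!) (u @ v)) [r..<n] = v"
  by (rule nth_equalityI; simp add: r_def s_def n_def nth_append)+
 have "bij_betw ?f ?A ?B" unfolding bij_betw_def
 proof
  show "inj_on ?f ?A"
  proof (rule inj_onI)
   fix \<sigma> \<rho> assume s: "\<sigma> : ?A" and t: "\<rho> : ?A" and e: "?f \<sigma> = ?f \<rho>"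
   have e1: "map (inv_into UNIV \<sigma>) [0..<r] = map (inv_into UNIV \<rho>) [0..<r]" and e2: "map (inv_into UNIV \<sigma>) [r..<n] = map (inv_into UNIV \<rho>) [r..<n]"
    unfolding A(2,3)[OF s] A(2,3)[OF t] e by (rule refl)+
   have "inv_into UNIV \<sigma> j = inv_into UNIV \<rho> j" if "j < n" for j
   proof (cases "j < r")
    case True
    then show ?thesis using e1 by (simp add: map_eq_conv)
   next
    case False
    then show ?thesis using e2 that by (simp add: map_eq_conv)
   qed
   moreover have "inv_into UNIV \<sigma> j = inv_into UNIV \<rho> j" if "\<not> j < n" for j
    using that permutes_not_in[OF A(1)[OF s]] permutes_not_in[OF A(1)[OF t]] by simp
   ultimately have "inv_into UNIV \<sigma> = inv_into UNIV \<rho>" by blast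
   then have i: "inv_into UNIV (inv_into UNIV \<sigma>) = inv_into UNIV (inv_into UNIV \<rho>)" by simp
   then show "\<sigma> = \<rho>"
   proof -
    have "\<sigma> : shuffle_perms (length u) (length v)" "\<rho> : shuffle_perms (length u) (length v)"
     using s t by blast+
    note ii = this[THEN shuffle_permsD(1), THEN permutes_inv_inv]
    show ?thesis by (rule trans[OF ii(1)[symmetric] trans[OF i ii(2)]])
   qed
  qed
  show "?f ` ?A = ?B"
  proof
   show "?f ` ?A \<subseteq> ?B"
   proof
    fix S assume "S : ?f ` ?A"
    then obtain \<sigma> where s: "\<sigma> : ?A" "S = ?f \<sigma>" by auto
    note a = A[OF s(1), folded s(2)]
    have "nths K S = map ((!) K) (map (inv_into UNIV \<sigma>) [0..<r])" using a(2,4) by (simp add: nths_filter)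
    also have "... = map ((!) (u @ v)) [0..<r]" using a(5) by (auto simp: n_def)
    finally have 1: "nths K S = u" using uv by simp
    have "nths K (- S) = map ((!) K) (map (inv_into UNIV \<sigma>) [r..<n])" using a(3,4) by (simp add: nths_filter)
    also have "... = map ((!) (u @ v)) [r..<n]" using a(5) by auto
    finally have 2: "nths K (- S) = v" using uv by simp
    show "S : ?B" using 1 2 a(4,6) by simp
   qed
   show "?B \<subseteq> ?f ` ?A"
   proof
    fix S assume S: "S : ?B"
    \<comment> \<open>The two blocks of positions, each in increasing order. Their concatenation, as
      a function of the index, is the inverse of the required shuffle.\<close>
    define L1 L2 where "L1 = filter (%i. i : S) [0..<length K]" and "L2 = filter (%i. i : - S) [0..<length K]"
    have u: "u = map ((!) K) L1" and v: "v = map ((!) K) L2"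
     using S by (simp_all add: nths_filter L1_def L2_def)
    have l: "length L1 = r" "length L2 = s" using u v by (simp_all add: r_def s_def)
    have n: "length K = n"
     using sum_length_filter_compl[of "%i. i : S" "[0..<length K]"] l by (simp add: L1_def L2_def n_def)
    have sd: "sorted_wrt (<) L1" "sorted_wrt (<) L2"
     unfolding L1_def L2_def by (auto intro!: sorted_wrt_filter)
    let ?L = "L1 @ L2"
    have dL: "distinct ?L" and sL: "set ?L = {..<n}" using n by (auto simp: L1_def L2_def)
    have lL: "length ?L = n" using l by (simp add: n_def)
    define \<tau> where "\<tau> j = (if j < n then ?L ! j else j)" for j
    have "bij_betw ((!) ?L) {..<n} {..<n}" using bij_betw_nth[OF dL] lL sL by auto
    moreover have "bij_betw \<tau> {..<n} {..<n} \<longleftrightarrow> bij_betw ((!) ?L) {..<n} {..<n}"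
     by (rule bij_betw_cong) (simp add: \<tau>_def)
    ultimately have "bij_betw \<tau> {..<n} {..<n}" by simp
    then have \<tau>: "\<tau> permutes {..<n}" by (rule bij_imp_permutes) (simp add: \<tau>_def)
    define \<sigma> where "\<sigma> = inv_into UNIV \<tau>"
    have \<sigma>: "\<sigma> permutes {..<n}" unfolding \<sigma>_def by (rule permutes_inv[OF \<tau>])
    have i: "inv_into UNIV \<sigma> = \<tau>" unfolding \<sigma>_def by (rule permutes_inv_inv[OF \<tau>])
    have t1: "\<tau> j = L1 ! j" if "j < r" for j using that l by (simp add: \<tau>_def nth_append n_def)
    have t2: "\<tau> j = L2 ! (j - r)" if "r \<le> j" "j < n" for j using that l by (simp add: \<tau>_def nth_append)
    have "strict_mono_on {..<r} (inv_into UNIV \<sigma>)" unfolding i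
     by (rule strict_mono_onI) (simp add: t1 sorted_wrt_nth_less[OF sd(1)] l)
    moreover have "strict_mono_on {r..<r + s} (inv_into UNIV \<sigma>)" unfolding i
     by (rule strict_mono_onI) (auto simp: t2 n_def l intro!: sorted_wrt_nth_less[OF sd(2)])
    ultimately have "\<sigma> : shuffle_perms r s" using \<sigma> by (simp add: shuffle_perms_def n_def)
    moreover have "shw \<sigma> (u @ v) = K"
    proof (rule nth_equalityI)
     show "length (shw \<sigma> (u @ v)) = length K" using n by (simp add: n_def r_def s_def)
     fix k assume "k < length (shw \<sigma> (u @ v))"
     then have k: "k < n" by (simp add: n_def r_def s_def)
     have \<sigma>k: "\<sigma> k < n" using permutes_lt[OF \<sigma>] k by simp
     have "u @ v = map ((!) K) ?L" using u v by simp
     then have "(u @ v) ! \<sigma> k = K ! (?L ! \<sigma> k)" using nth_map[of "\<sigma> k" ?L "(!) K"] \<sigma>k lL by (simp only:)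
     also have "?L ! \<sigma> k = \<tau> (\<sigma> k)" using \<sigma>k by (simp add: \<tau>_def)
     also have "\<tau> (\<sigma> k) = k" unfolding \<sigma>_def by (rule permutes_inverses(1)[OF \<tau>])
     finally show "shw \<sigma> (u @ v) ! k = K ! k" using k by (simp add: shw_def n_def r_def s_def)
    qed
    moreover have "S = ?f \<sigma>"
    proof -
     have "\<tau> ` {..<r} = set L1" using l(1) by (force simp: t1 set_conv_nth)
     also have "... = S" using S n by (auto simp: L1_def)
     finally show ?thesis by (simp add: i)
    qed
    ultimately show "S : ?f ` ?A" by (auto simp: r_def s_def)
   qed
  qed
 qed
 then show ?thesis by (rule bij_betw_same_card)
qed

section \<open>The shuffle product on the bar construction\<close>

context form_algebra
begin

interpretation bp: presentation BW "bar_rels \<Omega>" by (rule bar_presentation)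

lemma shw_BW:
 assumes "w : BW" "\<sigma> permutes {..<length w}"
 shows "shw \<sigma> w : BW"
proof -
 have "w ! \<sigma> i : {(p, \<eta>). 1 \<le> p \<and> \<eta> : part \<Omega> p}" if "i < length w" for i
  using BW_nth[OF assms(1), of "\<sigma> i"] permutes_lt[OF assms(2), of i] that by (simp add: split_beta)
 note * = this
 show ?thesis unfolding bar_words_def in_lists_conv_set
 proof
  fix x assume "x : set (shw \<sigma> w)"
  then obtain i where "i < length w" "x = w ! \<sigma> i" unfolding set_shw by blast
  then show "x : {(p, \<eta>). 1 \<le> p \<and> \<eta> : part \<Omega> p}" using *[of i] by (simp only:)
 qed
qed

lemma shw_lin:
 assumes uv: "u : BW" "v : BW" "1 \<le> p" and \<sigma>: "\<sigma> permutes {..<length u + 1 + length v}"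
 shows "lin (deg_part \<Omega> p) \<B> (%\<eta>. bc (shw \<sigma> (u @ [(p, \<eta>)] @ v)))"
proof -
 let ?n = "length u + 1 + length v"
 \<comment> \<open>Zero serves as a placeholder in the varying slot. The surroundings
   \<open>?A\<close> and \<open>?B\<close> of the moved letter do not depend on that letter, so they
   can be read off from \<open>w0\<close>.\<close>
 define w0 where "w0 = u @ [(p, \<zero>[total \<Omega>])] @ v"
 have "\<zero>[total \<Omega>] : part \<Omega> p" using vs_zero[OF vs_deg_part[of p]] by simp
 then have w0: "w0 : BW" using uv by (simp add: w0_def)
 have lw0: "length w0 = ?n" by (simp add: w0_def)
 define j where "j = inv_into UNIV \<sigma> (length u)"
 have \<sigma>j: "\<sigma> j = length u" unfolding j_def by (rule permutes_inverses(1)[OF \<sigma>])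
 have j: "j < ?n" using permutes_lt[OF \<sigma>, of j] \<sigma>j by simp
 have ne: "\<sigma> i \<noteq> length u" if "i \<noteq> j" for i using that \<sigma>j permutes_inj[OF \<sigma>] by (metis injD)
 let ?A = "map (%i. w0 ! \<sigma> i) [0..<j]" and ?B = "map (%i. w0 ! \<sigma> i) [j + 1..<?n]"
 have up: "[0..<?n] = [0..<j] @ [j] @ [j + 1..<?n]"
  using j upt_add_eq_append[of 0 j "?n - j"] upt_conv_Cons[of j ?n] by (simp add: Suc_eq_plus1)
 have e: "shw \<sigma> (u @ [(p, \<eta>)] @ v) = ?A @ [(p, \<eta>)] @ ?B" for \<eta>
 proof -
  have l: "length (u @ [(p, \<eta>)] @ v) = ?n" by simp
  have q: "(u @ [(p, \<eta>)] @ v) ! \<sigma> i = w0 ! \<sigma> i" if "i \<noteq> j" for i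
   using ne[OF that] by (auto simp: w0_def nth_append nth_Cons')
  have qj: "(u @ [(p, \<eta>)] @ v) ! \<sigma> j = (p, \<eta>)" by (simp add: \<sigma>j)
  show ?thesis unfolding shw_def l up map_append using q qj by simp
 qed
 have "?A @ [(p, \<zero>[total \<Omega>])] @ ?B : BW"
  using shw_BW[OF w0, of \<sigma>] \<sigma> e[of "\<zero>[total \<Omega>]"] lw0 unfolding w0_def[symmetric] by simp
 then have AB: "?A : BW" "?B : BW" by auto
 show ?thesis unfolding e by (rule wml_lin[OF wml_bc AB uv(3)])
qed

text \<open>Only degrees enter, so the sign stays constant while a letter varies within its
  degree.\<close>

lemma shuffle_sign_cong:
 assumes "map fst w = map fst w'"
 shows "shuffle_sign w \<sigma> = shuffle_sign w' \<sigma>"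
proof -
 have l: "length w = length w'" using arg_cong[OF assms, of length] by simp
 have "fst (w ! i) = fst (w' ! i)" if "i < length w" for i
  using arg_cong[OF assms, of "%x. x ! i"] that l by simp
 then show ?thesis unfolding shuffle_sign_def l by (intro prod.cong) auto
qed

abbreviation "shT u v \<sigma> \<equiv> shuffle_sign (u @ v) \<sigma> \<odot>[\<B>] bc (shw \<sigma> (u @ v))"

lemma shT_closed: "u : BW ==> v : BW ==> \<sigma> : shuffle_perms (length u) (length v) ==> shT u v \<sigma> : carrier \<B>"
 using shuffle_permsD(1)[of \<sigma>] by (intro vs_smult[OF vs_bar] bc_closed shw_BW) auto

lemma bar_class_shuffle:
 assumes uv: "u : BW" "v : BW"
 shows "bar_class \<Omega> (shuffle u v) = (\<Oplus>\<^bsub>\<B>\<^esub>\<sigma>\<in>shuffle_perms (length u) (length v). shT u v \<sigma>)"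
proof -
 let ?P = "shuffle_perms (length u) (length v)"
 have c: "single (shw \<sigma> (u @ v)) k : carrier (free_module BW)" if "\<sigma> : ?P" for \<sigma> k
  using shuffle_permsD(1)[OF that] uv by (intro single_carrier shw_BW) auto
 have "shuffle u v = finsum (free_module BW) (%\<sigma>. single (shw \<sigma> (u @ v)) (shuffle_sign (u @ v) \<sigma>)) ?P"
  unfolding shuffle_def using finsum_free_module[OF c, symmetric, of ?P "%\<sigma>. \<sigma>"] by (simp add: shw_def)
 then have "bar_class \<Omega> (shuffle u v) = bar_class \<Omega> (finsum (free_module BW) (%\<sigma>. single (shw \<sigma> (u @ v)) (shuffle_sign (u @ v) \<sigma>)) ?P)"
  by simp
 also have "... = finsum \<B> (%\<sigma>. bar_class \<Omega> (single (shw \<sigma> (u @ v)) (shuffle_sign (u @ v) \<sigma>))) ?P"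
  by (rule lin_finsum[OF lin_bar_class vs_free_module vs_bar c])
 also have "... = finsum \<B> (%\<sigma>. shT u v \<sigma>) ?P"
 proof (rule vs_finsum_cong[OF vs_bar refl])
  fix \<sigma> assume s: "\<sigma> : ?P"
  show "shT u v \<sigma> : carrier \<B>" by (rule shT_closed[OF uv s])
  show "bar_class \<Omega> (single (shw \<sigma> (u @ v)) (shuffle_sign (u @ v) \<sigma>)) = shT u v \<sigma>"
   using lin_smult[OF lin_bar_class c[OF s, of 1], of "shuffle_sign (u @ v) \<sigma>"]
   by (simp only: free_module_simps pscale_single mult_1_right)
 qed
 finally show ?thesis .
qed

lemma shT_lin:
 assumes ab: "a : BW" "b : BW" "1 \<le> p" and \<sigma>: "\<sigma> permutes {..<length a + 1 + length b}"
 shows "lin (deg_part \<Omega> p) \<B> (%\<eta>. shuffle_sign (a @ [(p, \<eta>)] @ b) \<sigma> \<odot>[\<B>] bc (shw \<sigma> (a @ [(p, \<eta>)] @ b)))"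
proof -
 define c where "c = shuffle_sign (a @ [(p, undefined :: 'o)] @ b) \<sigma>"
 have e: "shuffle_sign (a @ [(p, \<eta>)] @ b) \<sigma> = c" for \<eta> :: 'o
  unfolding c_def by (rule shuffle_sign_cong) simp
 show ?thesis unfolding e by (rule lin_smultf[OF vs_bar shw_lin[OF ab \<sigma>]])
qed

lemma shuffle_lin_right:
 assumes u: "u : BW"
 shows "wml \<B> (%v. bar_class \<Omega> (shuffle u v))"
proof (rule iffD2[OF wml_cong], erule bar_class_shuffle[OF u],
  rule wml_finsum[where S="%n. shuffle_perms (length u) n", OF vs_bar])
 show "shT u w \<sigma> : carrier \<B>" if "w : BW" "\<sigma> : shuffle_perms (length u) (length w)" for w \<sigma>
  by (rule shT_closed[OF u that])
 fix \<sigma> and a b :: "'o bar_word" and p :: nat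
 assume ab: "a : BW" "b : BW" "1 \<le> p" and \<sigma>: "\<sigma> : shuffle_perms (length u) (length a + 1 + length b)"
 have "\<sigma> permutes {..<length (u @ a) + 1 + length b}" using shuffle_permsD(1)[OF \<sigma>] by (simp add: add.assoc)
 from shT_lin[OF _ ab(2,3) this] u ab(1)
 show "lin (deg_part \<Omega> p) \<B> (%\<eta>. shT u (a @ [(p, \<eta>)] @ b) \<sigma>)" by simp
qed

lemma shuffle_lin_left:
 assumes v: "v : BW"
 shows "wml \<B> (%u. bar_class \<Omega> (shuffle u v))"
proof (rule iffD2[OF wml_cong], erule bar_class_shuffle[OF _ v],
  rule wml_finsum[where S="%n. shuffle_perms n (length v)", OF vs_bar])
 show "shT w v \<sigma> : carrier \<B>" if "w : BW" "\<sigma> : shuffle_perms (length w) (length v)" for w \<sigma>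
  by (rule shT_closed[OF that(1) v that(2)])
 fix \<sigma> and a b :: "'o bar_word" and p :: nat
 assume ab: "a : BW" "b : BW" "1 \<le> p" and \<sigma>: "\<sigma> : shuffle_perms (length a + 1 + length b) (length v)"
 have "\<sigma> permutes {..<length a + 1 + length (b @ v)}" using shuffle_permsD(1)[OF \<sigma>] by (simp add: add.assoc)
 from shT_lin[OF ab(1) _ ab(3) this] v ab(2)
 show "lin (deg_part \<Omega> p) \<B> (%\<eta>. shT (a @ [(p, \<eta>)] @ b) v \<sigma>)" by simp
qed

lemma bar_mult_eq: "X \<otimes>[\<B>] Y = lin_ext \<B> (%u. lin_ext \<B> (%v. bar_class \<Omega> (shuffle u v)) Y) X"
 by (simp add: bar_def Let_def lin_ext_def finsum_def)

lemma bar_one: "\<one>[\<B>] = EB []"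
 by (simp add: bar_def Let_def w1_def)

text \<open>Linearity in a letter of the left word is an identity of linear maps in
  \<open>Y\<close>; on a single word in place of \<open>Y\<close> it is
  \<open>shuffle_lin_left\<close>.\<close>

lemma wml_mult_outer:
 assumes Y: "Y : carrier \<B>"
 shows "wml \<B> (%u. lin_ext \<B> (%v. bar_class \<Omega> (shuffle u v)) Y)"
proof (rule wmlI)
 note L = bar_lift[OF vs_bar shuffle_lin_right]
 show "lin_ext \<B> (%v. bar_class \<Omega> (shuffle w v)) Y : carrier \<B>" if "w : BW" for w
  by (rule lin_closed[OF L(1)[OF that] Y])
 fix u v :: "'o bar_word" and p :: nat assume uv: "u : BW" "v : BW" "1 \<le> p"
 note l = wml_lin[OF shuffle_lin_left uv]
 have b: "u @ [(p, \<eta>)] @ v : BW" if "\<eta> : carrier (deg_part \<Omega> p)" for \<eta> using uv that by simp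
 show "lin (deg_part \<Omega> p) \<B> (%\<eta>. lin_ext \<B> (%w. bar_class \<Omega> (shuffle (u @ [(p, \<eta>)] @ v) w)) Y)"
 proof (rule linI)
  fix \<eta> assume e: "\<eta> : carrier (deg_part \<Omega> p)"
  show "lin_ext \<B> (%w. bar_class \<Omega> (shuffle (u @ [(p, \<eta>)] @ v) w)) Y : carrier \<B>"
   by (rule lin_closed[OF L(1)[OF b[OF e]] Y])
  show "lin_ext \<B> (%w. bar_class \<Omega> (shuffle (u @ [(p, c \<odot>[deg_part \<Omega> p] \<eta>)] @ v) w)) Y =
    c \<odot>[\<B>] lin_ext \<B> (%w. bar_class \<Omega> (shuffle (u @ [(p, \<eta>)] @ v) w)) Y" for c
  proof (rule bar_eqI[OF vs_bar L(1)[OF b[OF vs_smult[OF vs_deg_part e]]] lin_smultf[OF vs_bar L(1)[OF b[OF e]]] _ Y], goal_cases)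
   case (1 w) note w = 1(1)
   show ?case
    unfolding L(2)[OF b[OF vs_smult[OF vs_deg_part e]] w] L(2)[OF b[OF e] w] by (rule lin_smult[OF l[OF w] e])
  qed
  fix \<zeta> assume z: "\<zeta> : carrier (deg_part \<Omega> p)"
  show "lin_ext \<B> (%w. bar_class \<Omega> (shuffle (u @ [(p, \<eta> \<oplus>[deg_part \<Omega> p] \<zeta>)] @ v) w)) Y =
    lin_ext \<B> (%w. bar_class \<Omega> (shuffle (u @ [(p, \<eta>)] @ v) w)) Y \<oplus>[\<B>]
    lin_ext \<B> (%w. bar_class \<Omega> (shuffle (u @ [(p, \<zeta>)] @ v) w)) Y"
  proof (rule bar_eqI[OF vs_bar L(1)[OF b[OF vs_add[OF vs_deg_part e z]]] lin_addf[OF vs_bar L(1)[OF b[OF e]] L(1)[OF b[OF z]]] _ Y], goal_cases)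
   case (1 w) note w = 1(1)
   show ?case
    unfolding L(2)[OF b[OF vs_add[OF vs_deg_part e z]] w] L(2)[OF b[OF e] w] L(2)[OF b[OF z] w]
    by (rule lin_add[OF l[OF w] e z])
  qed
 qed
qed

lemma bar_mult_bc: "u : BW ==> v : BW ==> bc u \<otimes>[\<B>] bc v = bar_class \<Omega> (shuffle u v)"
 unfolding bar_mult_eq
 by (simp add: bar_lift(2)[OF vs_bar wml_mult_outer[OF bc_closed]] bar_lift(2)[OF vs_bar shuffle_lin_right])

lemma bar_mult_bilin: "bilin \<B> \<B> \<B> (%X Y. X \<otimes>[\<B>] Y)"
proof -
 note L = bar_lift[OF vs_bar wml_mult_outer, folded bar_mult_eq]
 note R = bar_lift(1)[OF vs_bar shuffle_lin_right]
 show ?thesis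
 proof (rule bilinI)
  show "lin \<B> \<B> (%X. X \<otimes>[\<B>] Y)" if "Y : carrier \<B>" for Y
   using bar_lift(1)[OF vs_bar wml_mult_outer[OF that]] unfolding bar_mult_eq[abs_def] .
  then have lX: "lin \<B> \<B> (%X. X \<otimes>[\<B>] Y)" if "Y : carrier \<B>" for Y using that by blast
  have v: "bc u \<otimes>[\<B>] Y = lin_ext \<B> (%v. bar_class \<Omega> (shuffle u v)) Y" if "u : BW" "Y : carrier \<B>" for u Y
   unfolding bar_mult_eq by (rule bar_lift(2)[OF vs_bar wml_mult_outer[OF that(2)] that(1)])
  fix X assume X: "X : carrier \<B>"
  show "lin \<B> \<B> (%Y. X \<otimes>[\<B>] Y)"
  proof (rule linI)
   fix Y assume Y: "Y : carrier \<B>"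
   show "X \<otimes>[\<B>] Y : carrier \<B>" by (rule lin_closed[OF lX[OF Y] X])
   show "X \<otimes>[\<B>] (c \<odot>[\<B>] Y) = c \<odot>[\<B>] (X \<otimes>[\<B>] Y)" for c
    by (rule bar_eqI[OF vs_bar lX[OF vs_smult[OF vs_bar Y]] lin_smultf[OF vs_bar lX[OF Y]] _ X])
     (use Y vs_smult[OF vs_bar Y, of c] in \<open>simp add: v lin_smult[OF R] del: bar_simps\<close>)
   fix Z assume Z: "Z : carrier \<B>"
   show "X \<otimes>[\<B>] (Y \<oplus>[\<B>] Z) = X \<otimes>[\<B>] Y \<oplus>[\<B>] X \<otimes>[\<B>] Z"
    by (rule bar_eqI[OF vs_bar lX[OF vs_add[OF vs_bar Y Z]] lin_addf[OF vs_bar lX[OF Y] lX[OF Z]] _ X])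
     (use Y Z vs_add[OF vs_bar Y Z] in \<open>simp add: v lin_add[OF R] del: bar_simps\<close>)
  qed
 qed
qed

text \<open>Letters of degree one have weight zero, so every Koszul sign is \<open>1\<close> and the
  product of such words is the unsigned shuffle.\<close>

lemma EB_mult:
 assumes I: "set I \<subseteq> D" and J: "set J \<subseteq> D"
 shows "EB I \<otimes>[\<B>] EB J = (\<Oplus>\<^bsub>\<B>\<^esub>\<sigma>\<in>shuffle_perms (length I) (length J). EB (shw \<sigma> (I @ J)))"
  and "\<sigma> : shuffle_perms (length I) (length J) ==> set (shw \<sigma> (I @ J)) \<subseteq> D"
proof -
 have s: "set (shw \<sigma> (I @ J)) \<subseteq> D" if "\<sigma> : shuffle_perms (length I) (length J)" for \<sigma>
 proof -
  have p: "\<sigma> permutes {..<length (I @ J)}" using shuffle_permsD(1)[OF that] by simp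
  have "x : set (I @ J)" if xs: "x : set (shw \<sigma> (I @ J))" for x
  proof -
   obtain i where "i < length (I @ J)" "x = (I @ J) ! \<sigma> i" using xs unfolding set_shw by blast
   then show ?thesis using nth_mem[of "\<sigma> i" "I @ J"] permutes_lt[OF p, of i] by simp
  qed
  then show ?thesis using I J by auto
 qed
 show "\<sigma> : shuffle_perms (length I) (length J) ==> set (shw \<sigma> (I @ J)) \<subseteq> D" by (rule s)
 have "EB I \<otimes>[\<B>] EB J = (\<Oplus>\<^bsub>\<B>\<^esub>\<sigma>\<in>shuffle_perms (length I) (length J). shT (w1 I) (w1 J) \<sigma>)"
  using I J bar_mult_bc[of "w1 I" "w1 J"] bar_class_shuffle[of "w1 I" "w1 J"] by simp
 also have "... = (\<Oplus>\<^bsub>\<B>\<^esub>\<sigma>\<in>shuffle_perms (length I) (length J). EB (shw \<sigma> (I @ J)))"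
 proof (rule vs_finsum_cong[OF vs_bar refl])
  fix \<sigma> assume \<sigma>: "\<sigma> : shuffle_perms (length I) (length J)"
  show c: "EB (shw \<sigma> (I @ J)) : carrier \<B>" using s[OF \<sigma>] by (intro bc_closed) simp
  have p: "\<sigma> permutes {..<length I + length J}" using shuffle_permsD(1)[OF \<sigma>] .
  have "shw \<sigma> (w1 (I @ J)) = w1 (shw \<sigma> (I @ J))"
  proof (rule nth_equalityI)
   show "length (shw \<sigma> (w1 (I @ J))) = length (w1 (shw \<sigma> (I @ J)))" by simp
   fix i assume "i < length (shw \<sigma> (w1 (I @ J)))"
   then have i: "i < length (I @ J)" by simp
   then have "\<sigma> i < length (I @ J)" using permutes_lt[OF p, of i] by simp
   then show "shw \<sigma> (w1 (I @ J)) ! i = w1 (shw \<sigma> (I @ J)) ! i"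
    using i by (simp add: shw_def w1_def del: map_append length_append)
  qed
  moreover have "shuffle_sign (w1 (I @ J)) \<sigma> = 1"
  proof -
   have "fst (w1 (I @ J) ! a) = 1" if "a < length (w1 (I @ J))" for a
    using that by (simp add: w1_def del: map_append)
   then show ?thesis unfolding shuffle_sign_def by (intro prod.neutral) (auto simp del: w1_append)
  qed
  ultimately show "shT (w1 I) (w1 J) \<sigma> = EB (shw \<sigma> (I @ J))"
   using vs_one[OF vs_bar c] by (simp del: bar_simps)
 qed
 finally show "EB I \<otimes>[\<B>] EB J = (\<Oplus>\<^bsub>\<B>\<^esub>\<sigma>\<in>shuffle_perms (length I) (length J). EB (shw \<sigma> (I @ J)))" .
qed

lemma el_mult:
 "el N x \<otimes>[\<B>] el N y = (\<Oplus>\<^bsub>\<B>\<^esub>I\<in>Wd N. \<Oplus>\<^bsub>\<B>\<^esub>J\<in>Wd N. x I \<odot>[\<B>] (y J \<odot>[\<B>] (EB I \<otimes>[\<B>] EB J)))"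
proof -
 have "el N x \<otimes>[\<B>] el N y = (\<Oplus>\<^bsub>\<B>\<^esub>I\<in>Wd N. (x I \<odot>[\<B>] EB I) \<otimes>[\<B>] el N y)"
  unfolding el_def[of N x]
  by (rule lin_finsum[OF bilin_right[OF bar_mult_bilin el_closed] vs_bar vs_bar]) (intro vs_smult[OF vs_bar] EB_closed)
 also have "... = (\<Oplus>\<^bsub>\<B>\<^esub>I\<in>Wd N. \<Oplus>\<^bsub>\<B>\<^esub>J\<in>Wd N. x I \<odot>[\<B>] (y J \<odot>[\<B>] (EB I \<otimes>[\<B>] EB J)))"
 proof (rule vs_finsum_cong[OF vs_bar refl])
  fix I assume I: "I : Wd N"
  have c: "x I \<odot>[\<B>] EB I : carrier \<B>" by (rule vs_smult[OF vs_bar EB_closed[OF I]])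
  have m: "EB I \<otimes>[\<B>] EB J : carrier \<B>" if "J : Wd N" for J
   by (rule bilin_closed[OF bar_mult_bilin EB_closed[OF I] EB_closed[OF that]])
  show "(\<Oplus>\<^bsub>\<B>\<^esub>J\<in>Wd N. x I \<odot>[\<B>] (y J \<odot>[\<B>] (EB I \<otimes>[\<B>] EB J))) : carrier \<B>"
   by (intro vs_finsum vs_smult[OF vs_bar] vs_bar m)
  have "(x I \<odot>[\<B>] EB I) \<otimes>[\<B>] el N y = (\<Oplus>\<^bsub>\<B>\<^esub>J\<in>Wd N. (x I \<odot>[\<B>] EB I) \<otimes>[\<B>] (y J \<odot>[\<B>] EB J))"
   unfolding el_def
   by (rule lin_finsum[OF bilin_left[OF bar_mult_bilin c] vs_bar vs_bar]) (intro vs_smult[OF vs_bar] EB_closed)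
  also have "... = (\<Oplus>\<^bsub>\<B>\<^esub>J\<in>Wd N. x I \<odot>[\<B>] (y J \<odot>[\<B>] (EB I \<otimes>[\<B>] EB J)))"
  proof (rule vs_finsum_cong[OF vs_bar refl])
   fix J assume J: "J : Wd N"
   show "x I \<odot>[\<B>] (y J \<odot>[\<B>] (EB I \<otimes>[\<B>] EB J)) : carrier \<B>"
    by (intro vs_smult[OF vs_bar] m[OF J])
   show "(x I \<odot>[\<B>] EB I) \<otimes>[\<B>] (y J \<odot>[\<B>] EB J) = x I \<odot>[\<B>] (y J \<odot>[\<B>] (EB I \<otimes>[\<B>] EB J))"
    unfolding lin_smult[OF bilin_right[OF bar_mult_bilin vs_smult[OF vs_bar EB_closed[OF J]]] EB_closed[OF I]]
     lin_smult[OF bilin_left[OF bar_mult_bilin EB_closed[OF I]] EB_closed[OF J]] ..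
  qed
  finally show "(x I \<odot>[\<B>] EB I) \<otimes>[\<B>] el N y = (\<Oplus>\<^bsub>\<B>\<^esub>J\<in>Wd N. x I \<odot>[\<B>] (y J \<odot>[\<B>] (EB I \<otimes>[\<B>] EB J)))" .
 qed
 finally show ?thesis .
qed

text \<open>\<open>card_shuffles\<close> replaces the sum over shuffles by a sum over subsets of the
  positions of \<open>K\<close>. The same sum describes the action of \<open>K\<close> on a tensor
  product in \<open>tensor_word\<close>.\<close>

lemma bar_mult_H0:
 assumes X: "X : bar_part \<Omega> 0" and Y: "Y : bar_part \<Omega> 0"
 shows "X \<otimes>[\<B>] Y : bar_part \<Omega> 0"
  and "set K \<subseteq> D ==> cfs (X \<otimes>[\<B>] Y) K = (\<Sum>S\<in>Pow {..<length K}. cfs X (nths K S) * cfs Y (nths K (- S)))"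
proof -
 obtain N1 where N1: "\<forall>M\<ge>N1. X = el M (cfs X) \<and> (\<forall>I. I \<notin> Wd M --> cfs X I = 0)"
  using bar_part_cfs[OF X] by blast
 obtain N2 where N2: "\<forall>M\<ge>N2. Y = el M (cfs Y) \<and> (\<forall>I. I \<notin> Wd M --> cfs Y I = 0)"
  using bar_part_cfs[OF Y] by blast
 define N where "N = max N1 N2"
 define x y where "x = cfs X" and "y = cfs Y"
 have N: "X = el N x" "Y = el N y" "\<And>I. I \<notin> Wd N ==> x I = 0" "\<And>I. I \<notin> Wd N ==> y I = 0"
  using N1[rule_format, of N] N2[rule_format, of N] by (auto simp: N_def x_def y_def)
 have mp: "EB I \<otimes>[\<B>] EB J : bar_part \<Omega> 0" if "I : Wd N" "J : Wd N" for I J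
 proof -
  have IJ: "set I \<subseteq> D" "set J \<subseteq> D" using that by (auto simp: Wd_def)
  show ?thesis unfolding EB_mult(1)[OF IJ]
   by (rule submodule_finsum[OF vs_bar bar_part_sub EB_part[OF EB_mult(2)[OF IJ]]])
 qed
 have sm: "c \<odot>[\<B>] Z : bar_part \<Omega> 0" if "Z : bar_part \<Omega> 0" for c Z
  using bar_part_sub that unfolding submodule_iff[OF vs_bar] by blast
 show "X \<otimes>[\<B>] Y : bar_part \<Omega> 0" unfolding N(1,2) el_mult
  by (intro submodule_finsum[OF vs_bar bar_part_sub] sm mp)
 assume K: "set K \<subseteq> D"
 let ?B = "%u v. {S. S \<subseteq> {..<length K} \<and> nths K S = u \<and> nths K (- S) = v}"
 have mc: "EB I \<otimes>[\<B>] EB J : carrier \<B>" if "I : Wd N" "J : Wd N" for I J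
  by (rule bilin_closed[OF bar_mult_bilin EB_closed[OF that(1)] EB_closed[OF that(2)]])
 have cK: "cf K (EB I \<otimes>[\<B>] EB J) = of_nat (card (?B I J))" if "I : Wd N" "J : Wd N" for I J
 proof -
  have IJ: "set I \<subseteq> D" "set J \<subseteq> D" using that by (auto simp: Wd_def)
  have "cf K (EB I \<otimes>[\<B>] EB J) = (\<Sum>\<sigma>\<in>shuffle_perms (length I) (length J). cf K (EB (shw \<sigma> (I @ J))))"
   unfolding EB_mult(1)[OF IJ] using EB_mult(2)[OF IJ] by (intro lf_finsum[OF lf_cf vs_bar] bc_closed) simp
  also have "... = (\<Sum>\<sigma>\<in>shuffle_perms (length I) (length J). if shw \<sigma> (I @ J) = K then 1 else 0)"
   using cf_EB[OF K EB_mult(2)[OF IJ]] by (intro sum.cong refl) auto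
  also have "... = of_nat (card {\<sigma> : shuffle_perms (length I) (length J). shw \<sigma> (I @ J) = K})"
   by (simp add: sum.If_cases Int_def)
  finally show ?thesis unfolding card_shuffles .
 qed
 have "cfs (X \<otimes>[\<B>] Y) K = cf K (X \<otimes>[\<B>] Y)" using K by (simp add: cfs_def)
 also have "... = (\<Sum>I\<in>Wd N. \<Sum>J\<in>Wd N. x I * (y J * of_nat (card (?B I J))))"
  unfolding N(1,2) el_mult
 proof (subst lf_finsum[OF lf_cf vs_bar])
  show "(\<Oplus>\<^bsub>\<B>\<^esub>J\<in>Wd N. x I \<odot>[\<B>] (y J \<odot>[\<B>] (EB I \<otimes>[\<B>] EB J))) : carrier \<B>" if "I : Wd N" for I
   by (intro vs_finsum vs_smult[OF vs_bar] vs_bar mc that)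
  show "(\<Sum>I\<in>Wd N. cf K (\<Oplus>\<^bsub>\<B>\<^esub>J\<in>Wd N. x I \<odot>[\<B>] (y J \<odot>[\<B>] (EB I \<otimes>[\<B>] EB J)))) =
    (\<Sum>I\<in>Wd N. \<Sum>J\<in>Wd N. x I * (y J * of_nat (card (?B I J))))"
  proof (rule sum.cong[OF refl], goal_cases)
   case (1 I) note I = 1(1)
   have "cf K (\<Oplus>\<^bsub>\<B>\<^esub>J\<in>Wd N. x I \<odot>[\<B>] (y J \<odot>[\<B>] (EB I \<otimes>[\<B>] EB J))) =
     (\<Sum>J\<in>Wd N. cf K (x I \<odot>[\<B>] (y J \<odot>[\<B>] (EB I \<otimes>[\<B>] EB J))))"
    by (intro lf_finsum[OF lf_cf vs_bar] vs_smult[OF vs_bar] mc[OF I])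
   also have "... = (\<Sum>J\<in>Wd N. x I * (y J * of_nat (card (?B I J))))"
    using I by (intro sum.cong refl) (simp add: lf_smult[OF lf_cf] vs_smult[OF vs_bar] mc cK del: bar_simps)
   finally show ?case .
  qed
 qed
 also have "... = (\<Sum>I\<in>Wd N. \<Sum>J\<in>Wd N. \<Sum>S\<in>Pow {..<length K}. if nths K S = I \<and> nths K (- S) = J then x I * y J else 0)"
 proof (intro sum.cong refl)
  fix I J
  have "(\<Sum>S\<in>Pow {..<length K}. if nths K S = I \<and> nths K (- S) = J then x I * y J else 0) =
    (\<Sum>S\<in>?B I J. x I * y J)"
   by (rule sum.mono_neutral_cong_right) auto
  then show "x I * (y J * of_nat (card (?B I J))) =
    (\<Sum>S\<in>Pow {..<length K}. if nths K S = I \<and> nths K (- S) = J then x I * y J else 0)" by simp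
 qed
 also have "... = (\<Sum>S\<in>Pow {..<length K}. \<Sum>I\<in>Wd N. \<Sum>J\<in>Wd N. if nths K S = I \<and> nths K (- S) = J then x I * y J else 0)"
  by (subst (2) sum.swap, subst sum.swap) simp
 also have "... = (\<Sum>S\<in>Pow {..<length K}. x (nths K S) * y (nths K (- S)))"
 proof (rule sum.cong[OF refl], goal_cases)
  case (1 S)
  have "(\<Sum>I\<in>Wd N. \<Sum>J\<in>Wd N. if nths K S = I \<and> nths K (- S) = J then x I * y J else 0) =
    (\<Sum>I\<in>Wd N. if nths K S = I then x I * (\<Sum>J\<in>Wd N. if nths K (- S) = J then y J else 0) else 0)"
   by (intro sum.cong refl) (auto simp: sum_distrib_left intro!: sum.cong)
  also have "... = x (nths K S) * y (nths K (- S))"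
   using N(3)[of "nths K S"] N(4)[of "nths K (- S)"] by auto
  finally show ?case .
 qed
 finally show "cfs (X \<otimes>[\<B>] Y) K = (\<Sum>S\<in>Pow {..<length K}. cfs X (nths K S) * cfs Y (nths K (- S)))"
  by (simp add: x_def y_def)
qed

end

section \<open>Tropical forms\<close>

locale ext =
 fixes V :: "'a cmod"
 assumes V: "vs V"
begin

abbreviation "W \<equiv> lists (carrier V)"
abbreviation "ec w \<equiv> ext_class V (single w 1)"

lemma ext_presentation: "presentation W (ext_rels V)"
proof
 show "ext_rels V \<subseteq> carrier (free_module W)"
  unfolding ext_rels_def using V
  by (auto simp del: free_module_simps intro!: free_diff single_carrier)
qed

sublocale ep: presentation W "ext_rels V" by (rule ext_presentation)

text \<open>The functions on words that factor through the exterior algebra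
  (\<open>ext_lift\<close>).\<close>

definition emul :: "'b cmod => ('a list => 'b) => bool" where
 "emul M F \<longleftrightarrow> (\<forall>w\<in>W. F w : carrier M) \<and> (\<forall>u\<in>W. \<forall>v\<in>W. lin V M (%a. F (u @ [a] @ v))) \<and>
   (\<forall>u\<in>W. \<forall>v\<in>W. \<forall>a\<in>carrier V. F (u @ [a, a] @ v) = \<zero>[M])"

lemma emulD: "emul M F ==> w : W ==> F w : carrier M"
 "emul M F ==> u : W ==> v : W ==> lin V M (%a. F (u @ [a] @ v))"
 "emul M F ==> u : W ==> v : W ==> a : carrier V ==> F (u @ [a, a] @ v) = \<zero>[M]"
 by (auto simp: emul_def)

lemma emulI:
 assumes "\<And>w. w : W ==> F w : carrier M" "\<And>u v. u : W ==> v : W ==> lin V M (%a. F (u @ [a] @ v))"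
  "\<And>u v a. u : W ==> v : W ==> a : carrier V ==> F (u @ [a, a] @ v) = \<zero>[M]"
 shows "emul M F"
 using assms by (simp add: emul_def)

lemma emul_rels:
 assumes M: "vs M" and F: "emul M F" and r: "r : ext_rels V"
 shows "lincomb M F r = \<zero>[M]"
proof -
 let ?R1 = "{single (u @ [a \<oplus>[V] b] @ v) 1 - single (u @ [a] @ v) 1
    - single (u @ [b] @ v) 1 :: 'a list \<Rightarrow>\<^sub>0 complex
    | u v a b. u : W \<and> v : W \<and> a : carrier V \<and> b : carrier V}"
 let ?R2 = "{single (u @ [c \<odot>[V] a] @ v) 1 - single (u @ [a] @ v) c
    | u v a c. u : W \<and> v : W \<and> a : carrier V}"
 let ?R3 = "{single (u @ [a, a] @ v) 1 :: 'a list \<Rightarrow>\<^sub>0 complex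
    | u v a. u : W \<and> v : W \<and> a : carrier V}"
 have W: "u @ [a] @ v : W" "u @ [a, a] @ v : W" if "u : W" "v : W" "a : carrier V" for u v a
  using that by simp_all
 from r have "r : ?R1 \<or> r : ?R2 \<or> r : ?R3" unfolding ext_rels_def by (simp only: Un_iff disj_assoc)
 then show ?thesis
 proof (elim disjE)
  assume "r : ?R1"
  then obtain u v a b where 1: "u : W" "v : W" "a : carrier V" "b : carrier V"
   and e: "r = single (u @ [a \<oplus>[V] b] @ v) 1 - single (u @ [a] @ v) 1
    - single (u @ [b] @ v) 1" unfolding mem_Collect_eq by (elim exE conjE) (rule that)
  show ?thesis unfolding e
   by (rule lincomb_diff3[OF M W(1)[OF 1(1,2) vs_add[OF V 1(3,4)]] W(1)[OF 1(1-3)] W(1)[OF 1(1,2,4)] emulD(1)[OF F] lin_add[OF emulD(2)[OF F 1(1,2)] 1(3,4)]])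
 next
  assume "r : ?R2"
  then obtain u v a c where 2: "u : W" "v : W" "a : carrier V"
   and e: "r = single (u @ [c \<odot>[V] a] @ v) 1 - single (u @ [a] @ v) c"
   unfolding mem_Collect_eq by (elim exE conjE) (rule that)
  show ?thesis unfolding e
   by (rule lincomb_diff2[OF M W(1)[OF 2(1,2) vs_smult[OF V 2(3)]] W(1)[OF 2(1-3)] emulD(1)[OF F] lin_smult[OF emulD(2)[OF F 2(1,2)] 2(3)]])
 next
  assume "r : ?R3"
  then obtain u v a where 3: "u : W" "v : W" "a : carrier V" and e: "r = single (u @ [a, a] @ v) 1"
   unfolding mem_Collect_eq by (elim exE conjE) (rule that)
  show ?thesis unfolding e lincomb_single[of M F "u @ [a, a] @ v" 1, OF M emulD(1)[OF F W(2)[OF 3]]] emulD(3)[OF F 3]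
   using M by simp
 qed
qed

lemma ext_simps [simp]:
 "carrier (ext_algebra V) = carrier (presented W (ext_rels V))" "\<zero>[ext_algebra V] = \<zero>[presented W (ext_rels V)]"
 "x \<oplus>[ext_algebra V] y = x \<oplus>[presented W (ext_rels V)] y" "c \<odot>[ext_algebra V] x = c \<odot>[presented W (ext_rels V)] x"
 by (simp_all add: ext_algebra_def Let_def)

lemma vs_ext: "vs (ext_algebra V)"
 unfolding ext_algebra_def Let_def by (rule vs_update_mult[OF ep.vs_presented])

lemma lin_ext_iff: "lin (ext_algebra V) M f \<longleftrightarrow> lin (presented W (ext_rels V)) M f"
 "lin M' (ext_algebra V) g \<longleftrightarrow> lin M' (presented W (ext_rels V)) g"
 by (simp_all add: lin_def)

lemma lin_ext_class: "lin (free_module W) (ext_algebra V) (ext_class V)"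
 unfolding lin_ext_iff ext_class_def by (rule ep.lin_pclass)

lemma ec_closed: "w : W ==> ec w : carrier (ext_algebra V)"
 using lin_closed[OF lin_ext_class single_carrier] .

lemma ext_lift:
 assumes M: "vs M" and F: "emul M F"
 shows "lin (ext_algebra V) M (lin_ext M F)" "w : W ==> lin_ext M F (ec w) = F w"
proof -
 show "lin (ext_algebra V) M (lin_ext M F)" unfolding lin_ext_iff
  by (rule ep.lin_lin_ext[OF M emulD(1)[OF F] emul_rels[OF M F]])
 show "w : W ==> lin_ext M F (ec w) = F w" unfolding ext_class_def
  using ep.lin_ext_pclass[OF M emulD(1)[OF F] emul_rels[OF M F], of "single w 1"]
   emulD(1)[OF F] M by simp
qed

lemma ext_eqI:
 assumes "vs M" "lin (ext_algebra V) M f" "lin (ext_algebra V) M g" "\<And>w. w : W ==> f (ec w) = g (ec w)" "X : carrier (ext_algebra V)"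
 shows "f X = g X"
 using ep.presented_eqI[OF assms(1), of f g X] assms(2-5) by (simp add: lin_ext_iff ext_class_def)

lemma ext_class_lincomb: "x : carrier (free_module W) ==> ext_class V x = lincomb (ext_algebra V) ec x"
 using ep.pclass_lincomb[of x] unfolding ext_class_def lincomb_def
 by (simp add: ext_algebra_def Let_def finsum_def)

lemma emul_ec: "emul (ext_algebra V) ec"
proof (intro emulI linI)
 fix u v a assume uv: "u : W" "v : W" and a: "a : carrier V"
 then show "ec (u @ [a] @ v) : carrier (ext_algebra V)" by (intro ec_closed) auto
 show "ec (u @ [c \<odot>[V] a] @ v) = c \<odot>[ext_algebra V] ec (u @ [a] @ v)" for c
  unfolding ext_class_def ext_simps
 proof (rule ep.pclass_diff2)
  show "single (u @ [c \<odot>[V] a] @ v) 1 - single (u @ [a] @ v) c : ext_rels V"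
   unfolding ext_rels_def using uv a by (intro UnI1[OF UnI2]) blast
 qed (use uv a V in auto)
 show "ec (u @ [a, a] @ v) = \<zero>[ext_algebra V]"
  unfolding ext_class_def ext_simps
 proof (rule ep.pclass_rel)
  show "single (u @ [a, a] @ v) 1 : ext_rels V"
   unfolding ext_rels_def using uv a by (intro UnI2) blast
 qed
 fix b assume b: "b : carrier V"
 show "ec (u @ [a \<oplus>[V] b] @ v) = ec (u @ [a] @ v) \<oplus>[ext_algebra V] ec (u @ [b] @ v)"
  unfolding ext_class_def ext_simps
 proof (rule ep.pclass_diff3)
  show "single (u @ [a \<oplus>[V] b] @ v) 1 - single (u @ [a] @ v) 1
    - single (u @ [b] @ v) 1 : ext_rels V"
   unfolding ext_rels_def using uv a b by (intro UnI1[OF UnI1]) blast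
 qed (use uv a b V in auto)
qed (rule ec_closed)

lemma emul_append:
 assumes "u : W"
 shows "emul (ext_algebra V) (%v. ec (u @ v))" "emul (ext_algebra V) (%v. ec (v @ u))"
proof -
 show "emul (ext_algebra V) (%v. ec (u @ v))"
 proof (rule emulI)
  fix a b assume ab: "a : W" "b : W"
  then have "u @ a : W" using assms by simp
  from emulD(2,3)[OF emul_ec this ab(2)]
  show "lin V (ext_algebra V) (%x. ec (u @ a @ [x] @ b))" "x : carrier V ==> ec (u @ a @ [x, x] @ b) = \<zero>[ext_algebra V]" for x
   by (simp_all del: ext_simps)
 qed (use assms ec_closed in auto)
 show "emul (ext_algebra V) (%v. ec (v @ u))"
 proof (rule emulI)
  fix a b assume ab: "a : W" "b : W"
  then have "b @ u : W" using assms by simp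
  from emulD(2,3)[OF emul_ec ab(1) this]
  show "lin V (ext_algebra V) (%x. ec ((a @ [x] @ b) @ u))" "x : carrier V ==> ec ((a @ [x, x] @ b) @ u) = \<zero>[ext_algebra V]" for x
   by (simp_all del: ext_simps)
 qed (use assms ec_closed in auto)
qed

lemma ext_mult_eq: "X \<otimes>[ext_algebra V] Y = lin_ext (ext_algebra V) (%u. lin_ext (ext_algebra V) (%v. ec (u @ v)) Y) X"
 by (simp add: ext_algebra_def Let_def lin_ext_def finsum_def)

lemma emul_outer:
 assumes Y: "Y : carrier (ext_algebra V)"
 shows "emul (ext_algebra V) (%u. lin_ext (ext_algebra V) (%v. ec (u @ v)) Y)"
proof (rule emulI)
 note L = ext_lift[OF vs_ext emul_append(1)]
 note E = vs_ext
 show "lin_ext (ext_algebra V) (%v. ec (w @ v)) Y : carrier (ext_algebra V)" if "w : W" for w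
  by (rule lin_closed[OF L(1)[OF that] Y])
 fix u v assume uv: "u : W" "v : W"
 have b: "u @ [a] @ v : W" if "a : carrier V" for a using uv that by simp
 have l: "lin V (ext_algebra V) (%a. ec ((u @ [a] @ v) @ w))" if "w : W" for w
  by (rule emulD(2)[OF emul_append(2)[OF that] uv])
 show "lin V (ext_algebra V) (%a. lin_ext (ext_algebra V) (%w. ec ((u @ [a] @ v) @ w)) Y)"
 proof (rule linI)
  fix a assume a: "a : carrier V"
  show "lin_ext (ext_algebra V) (%w. ec ((u @ [a] @ v) @ w)) Y : carrier (ext_algebra V)"
   by (rule lin_closed[OF L(1)[OF b[OF a]] Y])
  show "lin_ext (ext_algebra V) (%w. ec ((u @ [c \<odot>[V] a] @ v) @ w)) Y =
    c \<odot>[ext_algebra V] lin_ext (ext_algebra V) (%w. ec ((u @ [a] @ v) @ w)) Y" for c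
  proof (rule ext_eqI[OF E L(1)[OF b[OF vs_smult[OF V a]]] lin_smultf[OF E L(1)[OF b[OF a]]] _ Y], goal_cases)
   case (1 w) note w = 1(1)
   show ?case
    unfolding L(2)[OF b[OF vs_smult[OF V a]] w] L(2)[OF b[OF a] w] by (rule lin_smult[OF l[OF w] a])
  qed
  fix d assume d: "d : carrier V"
  show "lin_ext (ext_algebra V) (%w. ec ((u @ [a \<oplus>[V] d] @ v) @ w)) Y =
    lin_ext (ext_algebra V) (%w. ec ((u @ [a] @ v) @ w)) Y \<oplus>[ext_algebra V]
    lin_ext (ext_algebra V) (%w. ec ((u @ [d] @ v) @ w)) Y"
  proof (rule ext_eqI[OF E L(1)[OF b[OF vs_add[OF V a d]]] lin_addf[OF E L(1)[OF b[OF a]] L(1)[OF b[OF d]]] _ Y], goal_cases)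
   case (1 w) note w = 1(1)
   show ?case
    unfolding L(2)[OF b[OF vs_add[OF V a d]] w] L(2)[OF b[OF a] w] L(2)[OF b[OF d] w]
    by (rule lin_add[OF l[OF w] a d])
  qed
 qed
 fix a assume a: "a : carrier V"
 have b2: "u @ [a, a] @ v : W" using uv a by simp
 show "lin_ext (ext_algebra V) (%w. ec ((u @ [a, a] @ v) @ w)) Y = \<zero>[ext_algebra V]"
 proof (rule ext_eqI[OF E L(1)[OF b2] lin_zerof[OF E] _ Y], goal_cases)
  case (1 w) note w = 1(1)
  show ?case
   unfolding L(2)[OF b2 w] by (rule emulD(3)[OF emul_append(2)[OF w] uv a])
 qed
qed

lemma ext_mult_ec: "u : W ==> v : W ==> ec u \<otimes>[ext_algebra V] ec v = ec (u @ v)"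
 unfolding ext_mult_eq
 by (simp add: ext_lift(2)[OF vs_ext emul_outer[OF ec_closed]] ext_lift(2)[OF vs_ext emul_append(1)])

lemma ext_mult_bilin: "bilin (ext_algebra V) (ext_algebra V) (ext_algebra V) (%X Y. X \<otimes>[ext_algebra V] Y)"
proof -
 note E = vs_ext
 note R = ext_lift(1)[OF vs_ext emul_append(1)]
 have lX: "lin (ext_algebra V) (ext_algebra V) (%X. X \<otimes>[ext_algebra V] Y)" if "Y : carrier (ext_algebra V)" for Y
  using ext_lift(1)[OF vs_ext emul_outer[OF that]] unfolding ext_mult_eq[abs_def] .
 have v: "ec u \<otimes>[ext_algebra V] Y = lin_ext (ext_algebra V) (%v. ec (u @ v)) Y" if "u : W" "Y : carrier (ext_algebra V)" for u Y
  unfolding ext_mult_eq by (rule ext_lift(2)[OF vs_ext emul_outer[OF that(2)] that(1)])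
 show ?thesis
 proof (rule bilinI, rule linI)
  fix X Y assume X: "X : carrier (ext_algebra V)" and Y: "Y : carrier (ext_algebra V)"
  show "X \<otimes>[ext_algebra V] Y : carrier (ext_algebra V)" by (rule lin_closed[OF lX[OF Y] X])
  show "X \<otimes>[ext_algebra V] (c \<odot>[ext_algebra V] Y) = c \<odot>[ext_algebra V] (X \<otimes>[ext_algebra V] Y)" for c
   by (rule ext_eqI[OF E lX[OF vs_smult[OF E Y]] lin_smultf[OF E lX[OF Y]] _ X])
    (use Y vs_smult[OF E Y, of c] in \<open>simp add: v lin_smult[OF R] del: ext_simps\<close>)
  fix Z assume Z: "Z : carrier (ext_algebra V)"
  show "X \<otimes>[ext_algebra V] (Y \<oplus>[ext_algebra V] Z) = X \<otimes>[ext_algebra V] Y \<oplus>[ext_algebra V] X \<otimes>[ext_algebra V] Z"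
   by (rule ext_eqI[OF E lX[OF vs_add[OF E Y Z]] lin_addf[OF E lX[OF Y] lX[OF Z]] _ X])
    (use Y Z vs_add[OF E Y Z] in \<open>simp add: v lin_add[OF R] del: ext_simps\<close>)
 qed (rule lX)
qed

lemma power_sub: "submodule (ext_power V p) CC (ext_algebra V)"
 unfolding ext_power_def
proof (rule lin_image_submodule[OF vs_free_module vs_ext lin_ext_class])
 show "submodule {x. keys x \<subseteq> {w : W. length w = p}} CC (free_module W)"
  unfolding submodule_iff[OF vs_free_module]
 proof (intro conjI ballI allI)
  fix x y :: "'a list \<Rightarrow>\<^sub>0 complex" and c
  assume x: "x : {x. keys x \<subseteq> {w : W. length w = p}}"
  show "c \<odot>[free_module W] x : {x. keys x \<subseteq> {w : W. length w = p}}"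
   using x subset_trans[OF keys_pscale[of c x]] by (simp only: free_module_simps mem_Collect_eq)
  assume y: "y : {x. keys x \<subseteq> {w : W. length w = p}}"
  show "x \<oplus>[free_module W] y : {x. keys x \<subseteq> {w : W. length w = p}}"
   using subset_trans[OF keys_add Un_least[OF x[unfolded mem_Collect_eq] y[unfolded mem_Collect_eq]]]
   by (simp only: free_module_simps mem_Collect_eq)
 qed auto
qed

lemma ec_power: "w : W ==> ec w : ext_power V (length w)"
 unfolding ext_power_def by (intro imageI) auto

lemma power_induct:
 assumes "X : ext_power V p" "submodule U CC (ext_algebra V)" "\<And>w. w : W ==> length w = p ==> ec w : U"
 shows "X : U"
proof -
 obtain x where x: "keys x \<subseteq> {w : W. length w = p}" "X = ext_class V x"
  using assms(1) by (auto simp: ext_power_def)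
 have "X = lincomb (ext_algebra V) ec x" unfolding x(2) using x(1) by (intro ext_class_lincomb) auto
 also have "... : U" unfolding lincomb_def
 proof (rule submodule_finsum[OF vs_ext assms(2)], goal_cases)
  case (1 w)
  then have "ec w : U" using x assms(3) by auto
  then show ?case using assms(2) unfolding submodule_iff[OF vs_ext] by blast
 qed
 finally show ?thesis .
qed

lemma power_mult:
 assumes X: "X : ext_power V p" and Y: "Y : ext_power V q"
 shows "X \<otimes>[ext_algebra V] Y : ext_power V (p + q)"
proof -
 note b = ext_mult_bilin
 have sub: "submodule {x : carrier (ext_algebra V). f x : U} CC (ext_algebra V)"
  if f: "lin (ext_algebra V) (ext_algebra V) f" and U: "submodule U CC (ext_algebra V)" for f U
  using U unfolding submodule_iff[OF vs_ext]
  by (auto simp: linD[OF f] vs_ext vs_zero[OF vs_ext] vs_add[OF vs_ext] vs_smult[OF vs_ext] simp del: ext_simps)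
 have Yc: "Y : carrier (ext_algebra V)" using Y power_sub unfolding submodule_iff[OF vs_ext] by blast
 have "X : {X : carrier (ext_algebra V). X \<otimes>[ext_algebra V] Y : ext_power V (p + q)}"
 proof (rule power_induct[OF X sub[OF bilin_right[OF b Yc] power_sub]], goal_cases)
  case (1 u) note u = 1(1-2)
  note uc = ec_closed[OF u(1)]
  have "Y : {Y : carrier (ext_algebra V). ec u \<otimes>[ext_algebra V] Y : ext_power V (p + q)}"
  proof (rule power_induct[OF Y sub[OF bilin_left[OF b uc] power_sub]], goal_cases)
   case (1 v) note v = 1(1-2)
   have "ec u \<otimes>[ext_algebra V] ec v = ec (u @ v)" by (rule ext_mult_ec[OF u(1) v(1)])
   moreover have "ec (u @ v) : ext_power V (p + q)" using ec_power[of "u @ v"] u v by simp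
   ultimately show ?case
    using ec_closed[OF v(1)] by simp
  qed
  then show ?case using uc by simp
 qed
 then show ?thesis by simp
qed

lemma lin_ec1: "lin V (ext_algebra V) (%a. ec [a])"
 using emulD(2)[OF emul_ec, of "[]" "[]"] by (simp del: ext_simps)

text \<open>Sums of one-letter words are again one-letter words, as the addition can be done inside
  the letter. So degree one is the image of \<open>V\<close>; this yields alternation and finite
  dimension for tropical one-forms.\<close>

lemma power_one: "X : ext_power V 1 \<longleftrightarrow> (\<exists>a\<in>carrier V. X = ec [a])"
proof
 assume X: "X : ext_power V 1"
 have s: "submodule ((%a. ec [a]) ` carrier V) CC (ext_algebra V)"
  using V by (intro lin_image_submodule[OF V vs_ext lin_ec1]) (simp add: submodule_iff)
 have "X : (%a. ec [a]) ` carrier V"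
 proof (rule power_induct[OF X s], goal_cases)
  case (1 w) note w = 1(1-2)
  from 1 obtain a where "w = [a]" by (cases w) (auto simp: One_nat_def)
  then show ?case using w by auto
 qed
 then show "\<exists>a\<in>carrier V. X = ec [a]" by auto
next
 assume "\<exists>a\<in>carrier V. X = ec [a]"
 then obtain a where "a : carrier V" "X = ec [a]" by blast
 then show "X : ext_power V 1" using ec_power[of "[a]"] by (simp add: One_nat_def)
qed

lemma power_one_square:
 assumes "X : ext_power V 1"
 shows "X \<otimes>[ext_algebra V] X = \<zero>[ext_algebra V]"
proof -
 obtain a where a: "a : carrier V" "X = ec [a]" using assms unfolding power_one by blast
 have "X \<otimes>[ext_algebra V] X = ec ([] @ [a, a] @ [])" unfolding a(2) using ext_mult_ec[of "[a]" "[a]"] a(1) by simp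
 also have "... = \<zero>[ext_algebra V]" by (rule emulD(3)[OF emul_ec]) (use a in auto)
 finally show ?thesis .
qed

end

lemma ext_map:
 assumes V: "vs V" and W: "vs W" and f: "lin V W f"
 shows "lin (ext_algebra V) (ext_algebra W) (ext_map W f)"
  and "X : carrier (ext_algebra V) ==> Y : carrier (ext_algebra V) ==>
   ext_map W f (X \<otimes>[ext_algebra V] Y) = ext_map W f X \<otimes>[ext_algebra W] ext_map W f Y"
proof -
 interpret V: ext V by (rule ext.intro[OF V])
 interpret W: ext W by (rule ext.intro[OF W])
 have m: "map f u : lists (carrier W)" if "u : lists (carrier V)" for u
  using that lin_closed[OF f] by (induction u) auto
 have em: "V.emul (ext_algebra W) (%w. W.ec (map f w))"
 proof (rule V.emulI)
  show "W.ec (map f w) : carrier (ext_algebra W)" if "w : lists (carrier V)" for w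
   by (rule W.ec_closed[OF m[OF that]])
  fix u v assume uv: "u : lists (carrier V)" "v : lists (carrier V)"
  show "lin V (ext_algebra W) (%a. W.ec (map f (u @ [a] @ v)))"
   using lin_comp[OF f W.emulD(2)[OF W.emul_ec m[OF uv(1)] m[OF uv(2)]]] by simp
  show "W.ec (map f (u @ [a, a] @ v)) = \<zero>[ext_algebra W]" if "a : carrier V" for a
   using W.emulD(3)[OF W.emul_ec m[OF uv(1)] m[OF uv(2)] lin_closed[OF f that]] by simp
 qed
 note L = V.ext_lift[OF W.vs_ext em, folded ext_map_def]
 show l: "lin (ext_algebra V) (ext_algebra W) (ext_map W f)" by (rule L(1))
 assume X: "X : carrier (ext_algebra V)" and Y: "Y : carrier (ext_algebra V)"
 note b = V.ext_mult_bilin and bw = W.ext_mult_bilin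
 show "ext_map W f (X \<otimes>[ext_algebra V] Y) = ext_map W f X \<otimes>[ext_algebra W] ext_map W f Y"
 proof (rule V.ext_eqI[OF W.vs_ext lin_comp[OF bilin_right[OF b Y] l] lin_comp[OF l bilin_right[OF bw lin_closed[OF l Y]]] _ X], goal_cases)
  case (1 u) note u = 1(1)
  note uc = V.ec_closed[OF u]
  show ?case
  proof (rule V.ext_eqI[OF W.vs_ext lin_comp[OF bilin_left[OF b uc] l] lin_comp[OF l bilin_left[OF bw lin_closed[OF l uc]]] _ Y], goal_cases)
   case (1 v) note v = 1(1)
   have uv: "u @ v : lists (carrier V)" using u v by simp
   show ?case
    unfolding V.ext_mult_ec[OF u v] L(2)[OF uv] L(2)[OF u] L(2)[OF v] W.ext_mult_ec[OF m[OF u] m[OF v]] by simp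
  qed
 qed
qed

section \<open>Products of algebras\<close>

lemma product_module_simps:
 "carrier (product_module I V) = (\<Pi>\<^sub>E i\<in>I. carrier (V i))" "\<zero>[product_module I V] = (\<lambda>i\<in>I. \<zero>[V i])"
 "x \<oplus>[product_module I V] y = (\<lambda>i\<in>I. x i \<oplus>[V i] y i)" "c \<odot>[product_module I V] x = (\<lambda>i\<in>I. c \<odot>[V i] x i)"
 "x \<otimes>[product_module I V] y = (\<lambda>i\<in>I. x i \<otimes>[V i] y i)"
 by (simp_all add: product_module_def)

lemma vs_product_module:
 assumes V: "\<And>i. i : I ==> vs (V i)"
 shows "vs (product_module I V)"
proof (rule vsI)
 show "x \<oplus>[product_module I V] y = y \<oplus>[product_module I V] x"
  if "x : carrier (product_module I V)" "y : carrier (product_module I V)" for x y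
 proof -
  have "x i \<oplus>[V i] y i = y i \<oplus>[V i] x i" if i: "i : I" for i
   using that V[OF i] \<open>x : _\<close> \<open>y : _\<close> unfolding product_module_simps by (intro vs_comm) auto
  then show ?thesis unfolding product_module_simps by (rule restrict_ext)
 qed
qed (use V in \<open>auto simp: product_module_simps restrict_def fun_eq_iff PiE_def extensional_def Pi_def
   vs_assoc vs_l_distr vs_r_distr vs_smult_smult\<close>)

lemma lin_product:
 assumes "\<And>i. i : I ==> lin U (V i) (f i)"
 shows "lin U (product_module I V) (%x. \<lambda>i\<in>I. f i x)"
 using assms by (auto simp: lin_def product_module_simps)

lemma bilin_product:
 assumes "\<And>i. i : I ==> bilin (V i) (V i) (V i) (%x y. x \<otimes>[V i] y)"
 shows "bilin (product_module I V) (product_module I V) (product_module I V) (%x y. x \<otimes>[product_module I V] y)"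
 using assms by (auto simp: bilin_def lin_def product_module_simps PiE_def Pi_def)

subsection \<open>Spaces of covectors\<close>

lemma MC_simps [simp]:
 "carrier MC = {m. linear m}" "\<zero>[MC] = (%_. 0)" "m \<oplus>[MC] m' = (%x. m x + m' x)" "c \<odot>[MC] m = (%x. c * m x)"
 by (simp_all add: MC_def)

lemma linear_cmult: "linear m ==> linear (%x. c * m x :: complex)"
 by (rule linearI) (simp_all add: linear_add linear_cmul distrib_left)

lemma vs_MC: "vs (MC :: ('n::real_vector => complex) cmod)"
 by (rule vsI) (auto simp: linear_compose_add linear_cmult linear_zero algebra_simps)

text \<open>The coordinate functions of a real basis generate over the complex numbers: the
  coefficients of a covector are its values on the basis.\<close>

lemma finite_dim_MC:
 assumes "finite B" "independent B" "span B = (UNIV :: 'n::real_vector set)"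
 shows "finite_dim (MC :: ('n => complex) cmod)"
proof (rule finite_dimI[OF vs_MC])
 let ?d = "%b (x :: 'n). complex_of_real (representation B x b)"
 have ld: "linear (?d b)" for b
  using assms by (intro linearI) (simp_all add: representation_add representation_scale scaleR_conv_of_real)
 show "finite (?d ` B)" using assms by simp
 show "?d ` B \<subseteq> carrier MC" using ld by auto
 fix U and m :: "'n => complex"
 assume U: "submodule U CC MC" and d: "?d ` B \<subseteq> U" and m: "m : carrier MC"
 have c: "m b \<odot>[MC] ?d b : carrier MC" for b using ld[of b] linear_cmult by auto
 have ev: "lf MC (%m. m x)" for x :: 'n by (rule linI) auto
 have "finsum MC (%b. m b \<odot>[MC] ?d b) B = m"
 proof
  fix x
  have lm: "linear m" using m by simp
  have "finsum MC (%b. m b \<odot>[MC] ?d b) B x = (\<Sum>b\<in>B. (m b \<odot>[MC] ?d b) x)"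
   by (rule lf_finsum[OF ev vs_MC c])
  also have "... = (\<Sum>b\<in>B. m (representation B x b *\<^sub>R b))"
   by (intro sum.cong refl) (simp add: linear_cmul[OF lm] scaleR_conv_of_real)
  also have "... = m (\<Sum>b\<in>B. representation B x b *\<^sub>R b)" by (simp add: linear_sum[OF lm])
  also have "(\<Sum>b\<in>B. representation B x b *\<^sub>R b) = x"
   using assms by (intro sum_representation_eq) auto
  finally show "finsum MC (%b. m b \<odot>[MC] ?d b) B x = m x" .
 qed
 moreover have "finsum MC (%b. m b \<odot>[MC] ?d b) B : U"
 proof (rule submodule_finsum[OF vs_MC U], goal_cases)
  case (1 b)
  then have "?d b : U" using d by blast
  then show ?case using U unfolding submodule_iff[OF vs_MC] by blast
 qed
 ultimately show "m : U" by simp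
qed

text \<open>The second fact carries two coefficients because a complex scalar mixes the real and the
  imaginary component in \<open>complexify\<close>.\<close>

lemma span_perp_facts:
 "(%_. 0) : span_perp \<pi> S"
 "f : span_perp \<pi> S ==> g : span_perp \<pi> S ==> (%x. a * f x + b * g x) : span_perp \<pi> S"
 "S \<subseteq> T ==> span_perp \<pi> T \<subseteq> span_perp \<pi> S"
 "linear \<pi> ==> f : span_perp \<pi> S ==> linear f"
proof -
 show "(%_. 0) : span_perp \<pi> S"
  unfolding span_perp_def by (auto intro!: exI[of _ "%_. 0"] simp: linear_zero)
 show "(%x. a * f x + b * g x) : span_perp \<pi> S" if f: "f : span_perp \<pi> S" and g: "g : span_perp \<pi> S"
 proof -
  obtain m m' where m: "f = m \<circ> \<pi>" "linear m" "\<forall>x\<in>span S. m x = 0" "g = m' \<circ> \<pi>" "linear m'" "\<forall>x\<in>span S. m' x = 0"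
   using f g unfolding span_perp_def by blast
  have "linear (%x. a * m x + b * m' x)"
   by (rule linearI) (simp_all add: linear_add[OF m(2)] linear_add[OF m(5)] linear_cmul[OF m(2)] linear_cmul[OF m(5)] algebra_simps)
  then show ?thesis unfolding span_perp_def using m by (auto intro!: exI[of _ "%x. a * m x + b * m' x"])
 qed
 show "S \<subseteq> T ==> span_perp \<pi> T \<subseteq> span_perp \<pi> S"
  using span_mono[of S T] unfolding span_perp_def by blast
 show "linear \<pi> ==> f : span_perp \<pi> S ==> linear f"
  unfolding span_perp_def using linear_compose[of \<pi>] by auto
qed

lemma complexifyI: "f : W ==> g : W ==> (%x. Complex (f x) (g x)) : complexify W"
 unfolding complexify_def by (intro CollectI exI[of _ f] exI[of _ g]) simp

lemma complexify_sub:
 assumes \<pi>: "linear \<pi>"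
 shows "submodule (complexify (span_perp \<pi> S)) CC MC"
 unfolding submodule_iff[OF vs_MC]
proof (intro conjI ballI allI subsetI)
 let ?W = "span_perp \<pi> S"
 show "\<zero>[MC] : complexify ?W"
  unfolding complexify_def using span_perp_facts(1)[of \<pi> S]
  by (auto intro!: exI[of _ "%_. 0"] simp: fun_eq_iff complex_eq_iff)
 fix m assume "m : complexify ?W"
 then obtain f g where m: "m = (%x. Complex (f x) (g x))" "f : ?W" "g : ?W" unfolding complexify_def by blast
 have lf: "linear f" "linear g" using span_perp_facts(4)[OF \<pi>] m by auto
 show "m : carrier MC"
  unfolding m(1) by (auto intro!: linearI simp: linear_add[OF lf(1)] linear_add[OF lf(2)] linear_cmul[OF lf(1)] linear_cmul[OF lf(2)] complex_eq_iff)
 show "c \<odot>[MC] m : complexify ?W" for c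
 proof -
  have "c \<odot>[MC] m = (%x. Complex (Re c * f x + (- Im c) * g x) (Re c * g x + Im c * f x))"
   by (auto simp: m(1) complex_eq_iff)
  then show ?thesis
   using span_perp_facts(2)[OF m(2,3), of "Re c" "- Im c"] span_perp_facts(2)[OF m(3,2), of "Re c" "Im c"]
   by (simp only:) (rule complexifyI)
 qed
 fix m' assume "m' : complexify ?W"
 then obtain f' g' where m': "m' = (%x. Complex (f' x) (g' x))" "f' : ?W" "g' : ?W" unfolding complexify_def by blast
 have "m \<oplus>[MC] m' = (%x. Complex (1 * f x + 1 * f' x) (1 * g x + 1 * g' x))"
  by (auto simp: m(1) m'(1) complex_eq_iff)
 then show "m \<oplus>[MC] m' : complexify ?W"
  using span_perp_facts(2)[OF m(2) m'(2), of 1 1] span_perp_facts(2)[OF m(3) m'(3), of 1 1]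
  by (simp only:) (rule complexifyI)
qed

lemma complexify_mono: "A \<subseteq> B ==> complexify A \<subseteq> complexify B"
 unfolding complexify_def by blast

lemma r_coset_update [simp]: "U +>\<^bsub>V\<lparr>carrier := C\<rparr>\<^esub> x = U +>\<^bsub>V\<^esub> x"
 by (simp add: a_r_coset_def')

lemma lin_codomain: "lin V W f ==> (\<And>x. x : carrier V ==> f x : U) ==> lin V (W\<lparr>carrier := U\<rparr>) f"
 by (simp add: lin_def)

text \<open>Restriction to all maximal cones is an algebra homomorphism from the exterior algebra of
  the global one-forms to a product of exterior algebras, and \<open>Omega\<close> is its image
  degree by degree. Products and alternation are inherited from the source, and finite dimension of
  degree one from the space of covectors.\<close>

lemma trop_form_algebra:
 fixes N :: "'n::real_vector set" and N' :: "'m::real_vector set"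
 assumes "enriched_fan N N' \<pi> \<Delta> R"
 shows "form_algebra (trop_deRham \<pi> \<Delta> R)"
proof -
 have \<pi>: "linear \<pi>" and "full_lattice N" using assms by (auto simp: enriched_fan_def)
 then obtain B :: "'n set" where B: "finite B" "independent B" "span B = UNIV" unfolding full_lattice_def by blast
 define Reg where "Reg = {m :: 'n => complex. linear m \<and> (\<forall>\<rho>\<in>R. \<pi> ` \<rho> \<subseteq> \<Union>\<Delta> --> (\<forall>x\<in>\<rho>. m x = 0))}"
 define U where "U = complexify (span_perp \<pi> (\<Union>\<Delta>))"
 have RegE: "regular_covectors \<pi> \<Delta> R = MC\<lparr>carrier := Reg\<rparr>" by (simp add: regular_covectors_def Reg_def)
 have Reg: "submodule Reg CC MC"
  unfolding submodule_iff[OF vs_MC] by (auto simp: Reg_def linear_compose_add linear_cmult linear_zero)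
 have vR: "vs (MC\<lparr>carrier := Reg\<rparr>)" by (rule subspace_vs[OF vs_MC Reg])
 have UMC: "submodule U CC MC" unfolding U_def by (rule complexify_sub[OF \<pi>])
 \<comment> \<open>A covector orthogonal to the span of the fan vanishes on every ray whose image
   lies in the support, so the quotient defining \<open>Omega1\<close> is one by a subspace.\<close>
 have URsub: "U \<subseteq> Reg"
 proof
  fix m assume m: "m : U"
  then have "linear m" using UMC unfolding submodule_iff[OF vs_MC] by auto
  moreover have "m x = 0" if "\<rho> : R" "\<pi> ` \<rho> \<subseteq> \<Union>\<Delta>" "x : \<rho>" for \<rho> x
  proof -
   have "\<pi> x : span (\<Union>\<Delta>)" using that by (intro span_base) auto
   then show ?thesis using m unfolding U_def complexify_def span_perp_def by (auto simp: complex_eq_iff)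
  qed
  ultimately show "m : Reg" by (simp add: Reg_def)
 qed
 have UR: "submodule U CC (MC\<lparr>carrier := Reg\<rparr>)"
  using UMC URsub unfolding submodule_iff[OF vs_MC] submodule_iff[OF vR] by simp
 interpret q: quot "MC\<lparr>carrier := Reg\<rparr>" U by (rule quot.intro[OF vR UR])
 define O1 where "O1 = Omega1 \<pi> \<Delta> R"
 have O1E: "O1 = quot_module (MC\<lparr>carrier := Reg\<rparr>) U" by (simp add: O1_def Omega1_def RegE U_def)
 have vO1: "vs O1" unfolding O1E by (rule q.vs_quot)
 have fdO1: "finite_dim O1" unfolding O1E
  by (rule finite_dim_image[OF vR q.vs_quot q.lin_coset q.carrier_quot[symmetric]
   finite_dim_subspace[OF vs_MC Reg finite_dim_MC[OF B]]])
 let ?I = "maximal_cones \<Delta>"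
 have vL: "vs (local_covectors \<pi> \<sigma>)" for \<sigma>
  unfolding local_covectors_def by (rule quot.vs_quot[OF quot.intro[OF vs_MC complexify_sub[OF \<pi>]]])
 \<comment> \<open>A cone lies in the support, so the orthogonal of the whole span is contained in
   that of the cone. The union in \<open>restrict_covector\<close> is therefore over equal
   cosets.\<close>
 have rc: "restrict_covector \<pi> \<sigma> (U +>\<^bsub>MC\<^esub> m) = complexify (span_perp \<pi> \<sigma>) +>\<^bsub>MC\<^esub> m"
  if s: "\<sigma> : ?I" and m: "m : carrier MC" for \<sigma> m
 proof -
  let ?C = "complexify (span_perp \<pi> \<sigma>)"
  interpret l: quot MC ?C by (rule quot.intro[OF vs_MC complexify_sub[OF \<pi>]])
  have UC: "U \<subseteq> ?C" unfolding U_def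
   using s by (intro complexify_mono span_perp_facts(3)) (auto simp: maximal_cones_def)
  have "?C +>\<^bsub>MC\<^esub> m' = ?C +>\<^bsub>MC\<^esub> m" if "m' : U +>\<^bsub>MC\<^esub> m" for m'
  proof -
   obtain u where u: "u : U" "m' = u \<oplus>[MC] m" using \<open>m' : U +>\<^bsub>MC\<^esub> m\<close> by (auto simp: a_r_coset_def')
   have uc: "u : carrier MC" using u(1) UMC unfolding submodule_iff[OF vs_MC] by blast
   have "m' : carrier MC" unfolding u(2) by (rule vs_add[OF vs_MC uc m])
   moreover have "m' \<oplus>[MC] (-1) \<odot>[MC] m = u" unfolding u(2) by (auto simp: fun_eq_iff)
   ultimately show ?thesis using l.coset_eq_iff[OF _ m] u(1) UC by auto
  qed
  moreover have "m : U +>\<^bsub>MC\<^esub> m"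
  proof -
   have "\<zero>[MC] : U" using UMC unfolding submodule_iff[OF vs_MC] by blast
   then show ?thesis unfolding a_r_coset_def' using vs_l_zero[OF vs_MC m] by force
  qed
  then have "U +>\<^bsub>MC\<^esub> m \<noteq> {}" by auto
  ultimately show ?thesis unfolding restrict_covector_def by (intro SUP_eq_const)
 qed
 have lrc: "lin O1 (local_covectors \<pi> \<sigma>) (restrict_covector \<pi> \<sigma>)" if s: "\<sigma> : ?I" for \<sigma>
 proof (rule linI)
  let ?C = "complexify (span_perp \<pi> \<sigma>)"
  interpret l: quot MC ?C by (rule quot.intro[OF vs_MC complexify_sub[OF \<pi>]])
  have RM: "m : carrier MC" if "m : Reg" for m using that by (simp add: Reg_def)
  fix X assume "X : carrier O1"
  then obtain m where m: "m : Reg" "X = U +>\<^bsub>MC\<^esub> m" unfolding O1E q.carrier_quot by auto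
  show "restrict_covector \<pi> \<sigma> X : carrier (local_covectors \<pi> \<sigma>)"
   unfolding m(2) rc[OF s RM[OF m(1)]] local_covectors_def by (rule lin_closed[OF l.lin_coset RM[OF m(1)]])
  show "restrict_covector \<pi> \<sigma> (c \<odot>[O1] X) = c \<odot>[local_covectors \<pi> \<sigma>] restrict_covector \<pi> \<sigma> X" for c
  proof -
   have cm: "c \<odot>[MC] m : carrier MC" by (rule vs_smult[OF vs_MC RM[OF m(1)]])
   have "c \<odot>[O1] X = U +>\<^bsub>MC\<^esub> (c \<odot>[MC] m)"
    using q.smult_quot[of m c] m(1) unfolding O1E m(2) by (simp del: MC_simps)
   then show ?thesis
    using l.smult_quot[OF RM[OF m(1)], of c] by (simp only: rc[OF s cm] m(2) rc[OF s RM[OF m(1)]] local_covectors_def)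
  qed
  fix Y assume "Y : carrier O1"
  then obtain n where n: "n : Reg" "Y = U +>\<^bsub>MC\<^esub> n" unfolding O1E q.carrier_quot by auto
  have mn: "m \<oplus>[MC] n : carrier MC" by (rule vs_add[OF vs_MC RM[OF m(1)] RM[OF n(1)]])
  have "X \<oplus>[O1] Y = U +>\<^bsub>MC\<^esub> (m \<oplus>[MC] n)"
   using q.add_quot[of m n] m(1) n(1) unfolding O1E m(2) n(2) by (simp del: MC_simps)
  then show "restrict_covector \<pi> \<sigma> (X \<oplus>[O1] Y) = restrict_covector \<pi> \<sigma> X \<oplus>[local_covectors \<pi> \<sigma>] restrict_covector \<pi> \<sigma> Y"
   using l.add_quot[OF RM[OF m(1)] RM[OF n(1)]]
   by (simp only: rc[OF s mn] m(2) n(2) rc[OF s RM[OF m(1)]] rc[OF s RM[OF n(1)]] local_covectors_def)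
 qed
 interpret E: ext O1 by (rule ext.intro[OF vO1])
 let ?A = "trop_ambient \<pi> \<Delta>"
 have vE: "vs (ext_algebra (local_covectors \<pi> \<sigma>))" for \<sigma>
  by (rule ext.vs_ext[OF ext.intro[OF vL]])
 have vA: "vs ?A" unfolding trop_ambient_def by (rule vs_product_module[OF vE])
 define \<Xi> where "\<Xi> \<xi> = (\<lambda>\<sigma>\<in>?I. ext_map (local_covectors \<pi> \<sigma>) (restrict_covector \<pi> \<sigma>) \<xi>)" for \<xi>
 note em = ext_map[OF vO1 vL lrc]
 have l\<Xi>: "lin (ext_algebra O1) ?A \<Xi>" unfolding \<Xi>_def trop_ambient_def by (rule lin_product[OF em(1)])
 have m\<Xi>: "\<Xi> (X \<otimes>[ext_algebra O1] Y) = \<Xi> X \<otimes>[?A] \<Xi> Y"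
  if "X : carrier (ext_algebra O1)" "Y : carrier (ext_algebra O1)" for X Y
  unfolding \<Xi>_def trop_ambient_def product_module_simps
  by (rule restrict_ext) (simp add: em(2)[OF _ that])
 have bA: "bilin ?A ?A ?A (%x y. x \<otimes>[?A] y)" unfolding trop_ambient_def
  by (rule bilin_product[OF ext.ext_mult_bilin[OF ext.intro[OF vL]]])
 have Om: "Omega \<pi> \<Delta> R p = \<Xi> ` ext_power O1 p" for p unfolding Omega_def \<Xi>_def O1_def ..
 have pc: "X : carrier (ext_algebra O1)" if "X : ext_power O1 p" for X p
  using E.power_sub that unfolding submodule_iff[OF E.vs_ext] by blast
 have OmA: "submodule (Omega \<pi> \<Delta> R p) CC ?A" for p
  unfolding Om by (rule lin_image_submodule[OF E.vs_ext vA l\<Xi> E.power_sub])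
 define G where "G = gen_submodule ?A (\<Union>p. Omega \<pi> \<Delta> R p)"
 have OG: "(\<Union>p. Omega \<pi> \<Delta> R p) \<subseteq> carrier ?A" using OmA unfolding submodule_iff[OF vA] by blast
 have G: "submodule G CC ?A" "(\<Union>p. Omega \<pi> \<Delta> R p) \<subseteq> G" unfolding G_def by (rule gen_submodule(1,2)[OF vA OG])+
 let ?Om = "trop_deRham \<pi> \<Delta> R"
 have tot: "total ?Om = ?A\<lparr>carrier := G\<rparr>" and prt: "part ?Om = Omega \<pi> \<Delta> R"
  by (simp_all add: trop_deRham_def G_def)
 have vT: "vs (total ?Om)" unfolding tot by (rule subspace_vs[OF vA G(1)])
 have wp: "\<eta> \<otimes>[?A] \<zeta> : Omega \<pi> \<Delta> R (p + q)" if "\<eta> : Omega \<pi> \<Delta> R p" "\<zeta> : Omega \<pi> \<Delta> R q" for \<eta> \<zeta> p q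
 proof -
  obtain X where X: "X : ext_power O1 p" "\<eta> = \<Xi> X" using \<open>\<eta> : _\<close> unfolding Om by blast
  obtain Y where Y: "Y : ext_power O1 q" "\<zeta> = \<Xi> Y" using \<open>\<zeta> : _\<close> unfolding Om by blast
  note XY = X Y
  have "\<eta> \<otimes>[?A] \<zeta> = \<Xi> (X \<otimes>[ext_algebra O1] Y)" unfolding XY(2,4) by (rule m\<Xi>[OF pc[OF XY(1)] pc[OF XY(3)], symmetric])
  then show ?thesis unfolding Om using E.power_mult[OF XY(1,3)] by blast
 qed
 have OmC: "\<eta> : carrier ?A" if "\<eta> : Omega \<pi> \<Delta> R p" for \<eta> p using OG that by blast
 show ?thesis
 proof (rule form_algebra.intro)
  show "vs (total ?Om)" by (rule vT)
  show "submodule (part ?Om p) CC (total ?Om)" for p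
  proof -
   have "Omega \<pi> \<Delta> R p \<subseteq> G" using G(2) by blast
   then show ?thesis using OmA[of p] unfolding tot prt submodule_iff[OF vT[unfolded tot]] submodule_iff[OF vA] by simp
  qed
  show "bilin (deg_part ?Om p) (deg_part ?Om q) (deg_part ?Om (p + q)) (monoid.mult (total ?Om))" for p q
  proof -
   have dp: "carrier (deg_part ?Om r) = Omega \<pi> \<Delta> R r" "x \<oplus>[deg_part ?Om r] y = x \<oplus>[?A] y"
    "c \<odot>[deg_part ?Om r] x = c \<odot>[?A] x" "x \<otimes>[total ?Om] y = x \<otimes>[?A] y" for r x y c
    by (simp_all add: deg_part_def tot prt)
   show ?thesis
   proof (intro bilinI linI; unfold dp)
    fix \<eta> assume n: "\<eta> : Omega \<pi> \<Delta> R p"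
    note l = bilin_left[OF bA OmC[OF n]]
    fix \<zeta> assume z: "\<zeta> : Omega \<pi> \<Delta> R q"
    show "\<eta> \<otimes>[?A] \<zeta> : Omega \<pi> \<Delta> R (p + q)" by (rule wp[OF n z])
    show "\<eta> \<otimes>[?A] (c \<odot>[?A] \<zeta>) = c \<odot>[?A] (\<eta> \<otimes>[?A] \<zeta>)" for c by (rule lin_smult[OF l OmC[OF z]])
    fix \<xi> assume x: "\<xi> : Omega \<pi> \<Delta> R q"
    show "\<eta> \<otimes>[?A] (\<zeta> \<oplus>[?A] \<xi>) = \<eta> \<otimes>[?A] \<zeta> \<oplus>[?A] \<eta> \<otimes>[?A] \<xi>" by (rule lin_add[OF l OmC[OF z] OmC[OF x]])
   next
    fix \<zeta> assume z: "\<zeta> : Omega \<pi> \<Delta> R q"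
    note l = bilin_right[OF bA OmC[OF z]]
    fix \<eta> assume n: "\<eta> : Omega \<pi> \<Delta> R p"
    show "\<eta> \<otimes>[?A] \<zeta> : Omega \<pi> \<Delta> R (p + q)" by (rule wp[OF n z])
    show "(c \<odot>[?A] \<eta>) \<otimes>[?A] \<zeta> = c \<odot>[?A] (\<eta> \<otimes>[?A] \<zeta>)" for c by (rule lin_smult[OF l OmC[OF n]])
    fix \<xi> assume x: "\<xi> : Omega \<pi> \<Delta> R p"
    show "(\<eta> \<oplus>[?A] \<xi>) \<otimes>[?A] \<zeta> = \<eta> \<otimes>[?A] \<zeta> \<oplus>[?A] \<xi> \<otimes>[?A] \<zeta>" by (rule lin_add[OF l OmC[OF n] OmC[OF x]])
   qed
  qed
  show "\<eta> \<otimes>[total ?Om] \<eta> = \<zero>[total ?Om]" if "\<eta> : part ?Om 1" for \<eta>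
  proof -
   obtain X where X: "X : ext_power O1 1" "\<eta> = \<Xi> X" using \<open>\<eta> : part ?Om 1\<close> unfolding prt Om by blast
   have "\<eta> \<otimes>[?A] \<eta> = \<Xi> (X \<otimes>[ext_algebra O1] X)" unfolding X(2) by (rule m\<Xi>[OF pc[OF X(1)] pc[OF X(1)], symmetric])
   also have "... = \<zero>[?A]" unfolding E.power_one_square[OF X(1)] by (rule lin_zero[OF l\<Xi> E.vs_ext vA])
   finally show ?thesis by (simp add: tot)
  qed
  show "finite_dim (deg_part ?Om 1)"
  proof -
   have dp: "deg_part ?Om 1 = ?A\<lparr>carrier := Omega \<pi> \<Delta> R 1\<rparr>" by (simp add: deg_part_def tot prt)
   have vd: "vs (?A\<lparr>carrier := Omega \<pi> \<Delta> R 1\<rparr>)" by (rule subspace_vs[OF vA OmA])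
   \<comment> \<open>By \<open>power_one\<close> this maps the one-forms onto the degree-one part of
     the image.\<close>
   let ?h = "%a. \<Xi> (E.ec [a])"
   have l: "lin O1 ?A ?h" by (rule lin_comp[OF E.lin_ec1 l\<Xi>])
   have "ext_power O1 1 = (%a. E.ec [a]) ` carrier O1" by (rule Set.set_eqI) (simp only: E.power_one image_iff)
   then have im: "?h ` carrier O1 = Omega \<pi> \<Delta> R 1" by (simp only: Om image_image)
   have h: "?h a : Omega \<pi> \<Delta> R 1" if "a : carrier O1" for a unfolding im[symmetric] by (rule imageI[OF that])
   have lh: "lin O1 (?A\<lparr>carrier := Omega \<pi> \<Delta> R 1\<rparr>) ?h" by (rule lin_codomain[OF l h])
   have "?h ` carrier O1 = carrier (?A\<lparr>carrier := Omega \<pi> \<Delta> R 1\<rparr>)" unfolding im by simp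
   then show ?thesis unfolding dp by (rule finite_dim_image[OF vO1 vd lh _ fdO1])
  qed
 qed
qed

section \<open>Points of the fundamental group\<close>

locale scalars = form_algebra \<Omega> for \<Omega> :: "'o graded_algebra" +
 fixes A :: "'u cmod"
 assumes alg: "Module.algebra CC A"
begin

lemma vA [simp]: "vs A" by (rule algebra.module[OF alg])

lemma cringA: "cring A" by (rule algebra.M_cring[OF alg])

lemma mA: "bilin A A A (%a b. a \<otimes>[A] b)"
proof -
 interpret A: Module.algebra CC A by (rule alg)
 show ?thesis
 proof (intro bilinI linI)
  show "a \<otimes>[A] (c \<odot>[A] b) = c \<odot>[A] (a \<otimes>[A] b)" if "a : carrier A" "b : carrier A" for a b c
   using A.smult_assoc2[of c b a] that by (simp add: A.m_comm)
 qed (simp_all add: A.l_distr A.r_distr A.smult_assoc2)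
qed

lemma one_closedA [simp]: "\<one>[A] : carrier A"
 and mult_closedA [simp]: "a : carrier A ==> b : carrier A ==> a \<otimes>[A] b : carrier A"
 and one_multA [simp]: "a : carrier A ==> \<one>[A] \<otimes>[A] a = a" "a : carrier A ==> a \<otimes>[A] \<one>[A] = a"
 and assocA: "a : carrier A ==> b : carrier A ==> c : carrier A ==> (a \<otimes>[A] b) \<otimes>[A] c = a \<otimes>[A] (b \<otimes>[A] c)"
 and commA: "a : carrier A ==> b : carrier A ==> a \<otimes>[A] b = b \<otimes>[A] a"
 and lcommA: "a : carrier A ==> b : carrier A ==> c : carrier A ==> a \<otimes>[A] (b \<otimes>[A] c) = b \<otimes>[A] (a \<otimes>[A] c)"
proof -
 interpret A: cring A by (rule cringA)
 show "\<one>[A] : carrier A" by simp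
 show "a : carrier A ==> b : carrier A ==> a \<otimes>[A] b : carrier A" by simp
 show "a : carrier A ==> \<one>[A] \<otimes>[A] a = a" "a : carrier A ==> a \<otimes>[A] \<one>[A] = a" by simp_all
 show "a : carrier A ==> b : carrier A ==> c : carrier A ==> (a \<otimes>[A] b) \<otimes>[A] c = a \<otimes>[A] (b \<otimes>[A] c)" by (rule A.m_assoc)
 show "a : carrier A ==> b : carrier A ==> a \<otimes>[A] b = b \<otimes>[A] a" by (rule A.m_comm)
 show "a : carrier A ==> b : carrier A ==> c : carrier A ==> a \<otimes>[A] (b \<otimes>[A] c) = b \<otimes>[A] (a \<otimes>[A] c)" by (rule A.m_lcomm)
qed

lemmas multA_l = bilin_left[OF mA] and multA_r = bilin_right[OF mA]

lemma smultA: "a : carrier A ==> b : carrier A ==> (c \<odot>[A] a) \<otimes>[A] b = c \<odot>[A] (a \<otimes>[A] b)"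
 "a : carrier A ==> b : carrier A ==> a \<otimes>[A] (c \<odot>[A] b) = c \<odot>[A] (a \<otimes>[A] b)"
 using lin_smult[OF multA_r, of b a c] lin_smult[OF multA_l, of a b c] by simp_all

subsection \<open>Scalar extension\<close>

abbreviation "amul E a \<equiv> tensor_map E A E A (%v. v) (%b. a \<otimes>[A] b)"

lemma amul:
 assumes E: "vs E" and a: "a : carrier A"
 shows "lin (tensor E A) (tensor E A) (amul E a)"
  and "e : carrier E ==> b : carrier A ==> amul E a (tens E A e b) = tens E A e (a \<otimes>[A] b)"
 by (rule lin_tensor_map[OF E vA E vA lin_id multA_l[OF a]], rule tensor_map_tens[OF E vA E vA lin_id multA_l[OF a]])

text \<open>Contracting the fibre leaves equations in \<open>A\<close>; identities of operators on
  scalar extensions are reduced to matrix coefficients this way.\<close>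

lemma scalar_eqI:
 assumes E: "vs E" and t: "t : carrier (tensor E A)" "s : carrier (tensor E A)"
  and e: "\<And>\<mu>. lf E \<mu> ==> ctr_l A \<mu> t = ctr_l A \<mu> s"
 shows "t = s"
 by (rule tensor_sep_eq[OF E vA t, where L="Collect (lf E)"]) (use e vs_sep[OF E] in auto)

lemma ctr_amul:
 assumes E: "vs E" and a: "a : carrier A" and \<mu>: "lf E \<mu>" and t: "t : carrier (tensor E A)"
 shows "ctr_l A \<mu> (amul E a t) = a \<otimes>[A] ctr_l A \<mu> t"
proof (rule tensor_eqI[OF E vA vA lin_comp[OF amul(1)[OF E a] ctr_l(1)[OF E vA \<mu>]] lin_comp[OF ctr_l(1)[OF E vA \<mu>] multA_l[OF a]] _ t], goal_cases)
 case (1 e b) note eb = 1(1-2)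
 show ?case
  unfolding amul(2)[OF E a eb] ctr_l(2)[OF E vA \<mu> eb(1) mult_closedA[OF a eb(2)]] ctr_l(2)[OF E vA \<mu> eb]
  by (rule smultA(2)[OF a eb(2), symmetric])
qed

text \<open>Every pure tensor \<open>e \<otimes> a\<close> is \<open>a\<close> times
  \<open>e \<otimes> 1\<close>.\<close>

lemma alin_eqI:
 assumes E: "vs E" and F: "vs F" and f: "lin (tensor E A) (tensor F A) f" and g: "lin (tensor E A) (tensor F A) g"
  and fa: "\<And>a u. a : carrier A ==> u : carrier (tensor E A) ==> f (amul E a u) = amul F a (f u)"
  and ga: "\<And>a u. a : carrier A ==> u : carrier (tensor E A) ==> g (amul E a u) = amul F a (g u)"
  and e: "\<And>e. e : carrier E ==> f (tens E A e \<one>[A]) = g (tens E A e \<one>[A])"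
  and u: "u : carrier (tensor E A)"
 shows "f u = g u"
proof (rule tensor_eqI[OF E vA vs_tensor[OF F vA] f g _ u], goal_cases)
 case (1 e a) note ea = 1(1-2)
 have t: "tens E A e \<one>[A] : carrier (tensor E A)" by (rule tens_closed[OF E vA ea(1) one_closedA])
 have eq: "tens E A e a = amul E a (tens E A e \<one>[A])" using amul(2)[OF E ea(2,1) one_closedA] ea by simp
 show ?case unfolding eq fa[OF ea(2) t] ga[OF ea(2) t] using assms(7)[OF ea(1)] by simp
qed

lemma ctr_tensor_map:
 assumes E: "vs E" and F: "vs F" and T: "lin E F T" and \<nu>: "lf F \<nu>" and t: "t : carrier (tensor E A)"
 shows "ctr_l A \<nu> (tensor_map E A F A T (%a. a) t) = ctr_l A (%e. \<nu> (T e)) t"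
proof -
 note l = lin_comp[OF T \<nu>]
 note tm = lin_tensor_map[OF E vA F vA T lin_id]
 show ?thesis
 proof (rule tensor_eqI[OF E vA vA lin_comp[OF tm ctr_l(1)[OF F vA \<nu>]] ctr_l(1)[OF E vA l] _ t], goal_cases)
  case (1 e b) note eb = 1(1-2)
  show ?case
   unfolding tensor_map_tens[OF E vA F vA T lin_id eb] ctr_l(2)[OF F vA \<nu> lin_closed[OF T eb(1)] eb(2)] ctr_l(2)[OF E vA l eb] ..
 qed
qed

subsection \<open>Families of coefficients\<close>

definition gam :: "('o list => 'u) => bool" where
 "gam \<gamma> \<longleftrightarrow> (\<forall>I. set I \<subseteq> D --> \<gamma> I : carrier A)"

text \<open>The pairing of a coefficient family with a finitely supported function on words. Summing
  over the support keeps the length bound out of the definition.\<close>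

definition pr :: "('o list => 'u) => ('o list => complex) => 'u" where
 "pr \<gamma> x = (\<Oplus>\<^bsub>A\<^esub>I\<in>{I. x I \<noteq> 0}. x I \<odot>[A] \<gamma> I)"

abbreviation wsupp :: "nat => ('o list => complex) => bool" where
 "wsupp N x \<equiv> \<forall>I. I \<notin> Wd N --> x I = 0"

lemma gamD: "gam \<gamma> ==> I : Wd N ==> \<gamma> I : carrier A"
 by (simp add: gam_def Wd_def)

lemma pr_Wd:
 assumes \<gamma>: "gam \<gamma>" and x: "wsupp N x"
 shows "pr \<gamma> x = (\<Oplus>\<^bsub>A\<^esub>I\<in>Wd N. x I \<odot>[A] \<gamma> I)"
proof -
 have c: "\<gamma> I : carrier A" if "I : Wd N" for I by (rule gamD[OF \<gamma> that])
 have s: "{I. x I \<noteq> 0} \<subseteq> Wd N" using x by blast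
 show ?thesis unfolding pr_def
  by (rule vs_finsum_neutral[OF vA finite_Wd s, symmetric]) (use c s in \<open>auto intro: vs_smult[OF vA]\<close>)
qed

lemma pr_closed: "gam \<gamma> ==> wsupp N x ==> pr \<gamma> x : carrier A"
 unfolding pr_Wd by (intro vs_finsum[OF vA] vs_smult[OF vA] gamD)

subsection \<open>Transport along words\<close>

text \<open>Unipotent objects with fibres in an arbitrary type; \<open>unipotent_objects\<close>
  contains only those with the fixed fibre type.\<close>

definition uni :: "('o, 'e) conn => bool" where
 "uni X \<longleftrightarrow> integrable_conn \<Omega> X \<and> (\<exists>n. nilp (fibre X) (act X) n)"

lemma uni_objects: "X : unipotent_objects \<Omega> \<longleftrightarrow> uni X"
 by (simp add: uni_def unipotent_objects_iff)

lemma uniD: "uni X ==> pre_conn X" "uni X ==> vs (fibre X)" "uni X ==> flat (fibre X) (act X)"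
 using pre_conn_vs by (auto simp: uni_def integrable_conn_iff)

definition nl :: "('o, 'e) conn => nat" where "nl X = (SOME n. nilp (fibre X) (act X) n)"

lemma nilp_nl: "uni X ==> nilp (fibre X) (act X) (nl X)"
 unfolding nl_def uni_def by (blast intro: someI_ex)

lemma lin_word: "uni X ==> set I \<subseteq> D ==> lin (fibre X) (fibre X) (aw (act X) I)"
 by (rule lin_aw[OF act_lin[OF uniD(1)]])

lemma word_zero: "uni X ==> set I \<subseteq> D ==> nl X \<le> length I ==> e : carrier (fibre X) ==> aw (act X) I e = \<zero>[fibre X]"
 by (rule nilp_ge[OF uniD(2) act_lin[OF uniD(1)] nilp_nl])

lemma cof_Uo_ge:
 assumes X: "uni X" and N: "nl X \<le> N" and \<mu>: "lf (fibre X) \<mu>" and e: "e : carrier (fibre X)"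
 shows "cof X \<mu> e : carrier (Uo N)"
proof (rule cof_Uo[OF uniD(1)[OF X] uniD(3)[OF X] _ \<mu> e])
 show "nilp (fibre X) (act X) N" unfolding nilp_def using word_zero[OF X] N by auto
qed

lemma cof_supp: "uni X ==> lf (fibre X) \<mu> ==> e : carrier (fibre X) ==> wsupp (nl X) (cof X \<mu> e)"
 using cof_Uo_ge[of X "nl X" \<mu> e] by (simp add: carrier_Uo)

lemma cof_nat:
 assumes X: "uni X" and Y: "uni Y" and T: "T : conn_hom \<Omega> X Y" and e: "e : carrier (fibre X)"
 shows "cof Y \<nu> (T e) = cof X (%x. \<nu> (T x)) e"
 using conn_hom_aw[OF uniD(1)[OF X] uniD(1)[OF Y] T _ e] by (auto simp: cof_def fun_eq_iff)

text \<open>Words of length at least \<open>nl X\<close> act as zero, so this finite sum is already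
  the whole series.\<close>

definition Lg :: "('o list => 'u) => ('o, 'e) conn => ('e \<times> 'u \<Rightarrow>\<^sub>0 complex) set => ('e \<times> 'u \<Rightarrow>\<^sub>0 complex) set" where
 "Lg \<gamma> X = (\<lambda>u\<in>carrier (tensor (fibre X) A). lin_ext (tensor (fibre X) A)
   (%(e, b). \<Oplus>\<^bsub>tensor (fibre X) A\<^esub>I\<in>Wd (nl X). tens (fibre X) A (aw (act X) I e) (\<gamma> I \<otimes>[A] b)) u)"

context
 fixes X :: "('o, 'e) conn" and \<gamma> :: "'o list => 'u"
 assumes X: "uni X" and \<gamma>: "gam \<gamma>"
begin

lemma Lg_bilin: "bilin (fibre X) A (tensor (fibre X) A)
  (%e b. \<Oplus>\<^bsub>tensor (fibre X) A\<^esub>I\<in>Wd (nl X). tens (fibre X) A (aw (act X) I e) (\<gamma> I \<otimes>[A] b))"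
proof -
 note E = uniD(2)[OF X]
 note T = vs_tensor[OF E vA]
 have l: "lin (fibre X) (fibre X) (aw (act X) I)" if "I : Wd N" for I N
  using lin_word[OF X] that by (simp add: Wd_def)
 show ?thesis
 proof (rule bilinI)
  fix e assume e: "e : carrier (fibre X)"
  show "lin A (tensor (fibre X) A) (%b. \<Oplus>\<^bsub>tensor (fibre X) A\<^esub>I\<in>Wd (nl X). tens (fibre X) A (aw (act X) I e) (\<gamma> I \<otimes>[A] b))"
  proof (rule lin_finsumf[OF vA T], goal_cases)
   case (1 I) note I = 1(1)
   show ?case
    by (rule lin_comp[OF multA_l[OF gamD[OF \<gamma> I]] bilin_left[OF bilin_tens[OF E vA] lin_closed[OF l[OF I] e]]])
  qed
 next
  fix b assume b: "b : carrier A"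
  show "lin (fibre X) (tensor (fibre X) A) (%e. \<Oplus>\<^bsub>tensor (fibre X) A\<^esub>I\<in>Wd (nl X). tens (fibre X) A (aw (act X) I e) (\<gamma> I \<otimes>[A] b))"
  proof (rule lin_finsumf[OF E T], goal_cases)
   case (1 I) note I = 1(1)
   show ?case
    by (rule lin_comp[OF l[OF I] bilin_right[OF bilin_tens[OF E vA] mult_closedA[OF gamD[OF \<gamma> I] b]]])
  qed
 qed
qed

lemma Lg_hom: "Lg \<gamma> X : lin_hom (tensor (fibre X) A) (tensor (fibre X) A)"
 unfolding Lg_def
 by (rule lin_restrict[OF vs_tensor[OF uniD(2)[OF X] vA] lin_tensor_lift[OF uniD(2)[OF X] vA vs_tensor[OF uniD(2)[OF X] vA] Lg_bilin]])

lemma Lg_tens: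
 assumes e: "e : carrier (fibre X)" and b: "b : carrier A"
 shows "Lg \<gamma> X (tens (fibre X) A e b) = (\<Oplus>\<^bsub>tensor (fibre X) A\<^esub>I\<in>Wd (nl X). tens (fibre X) A (aw (act X) I e) (\<gamma> I \<otimes>[A] b))"
 unfolding Lg_def using tens_closed[OF uniD(2)[OF X] vA e b]
  tensor_lift_tens[OF uniD(2)[OF X] vA vs_tensor[OF uniD(2)[OF X] vA] Lg_bilin e b] by simp

text \<open>The matrix coefficients of the operator are the pairings of \<gamma> with the matrix
  coefficients of \<open>X\<close>. Naturality and tensor compatibility of \<open>Lg\<close> are
  proved through this formula.\<close>

lemma Lg_ctr:
 assumes \<mu>: "lf (fibre X) \<mu>" and e: "e : carrier (fibre X)" and b: "b : carrier A"
 shows "ctr_l A \<mu> (Lg \<gamma> X (tens (fibre X) A e b)) = pr \<gamma> (cof X \<mu> e) \<otimes>[A] b"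
proof -
 note E = uniD(2)[OF X]
 note c = ctr_l[OF E vA \<mu>]
 have aI: "aw (act X) I e : carrier (fibre X)" if "I : Wd (nl X)" for I
  using lin_closed[OF lin_word[OF X] e] that by (simp add: Wd_def)
 note gI = gamD[OF \<gamma>]
 have "ctr_l A \<mu> (Lg \<gamma> X (tens (fibre X) A e b)) =
   (\<Oplus>\<^bsub>A\<^esub>I\<in>Wd (nl X). ctr_l A \<mu> (tens (fibre X) A (aw (act X) I e) (\<gamma> I \<otimes>[A] b)))"
  unfolding Lg_tens[OF e b]
  by (rule lin_finsum[OF c(1) vs_tensor[OF E vA] vA]) (rule tens_closed[OF E vA aI mult_closedA[OF gI b]])
 also have "... = (\<Oplus>\<^bsub>A\<^esub>I\<in>Wd (nl X). (cof X \<mu> e I \<odot>[A] \<gamma> I) \<otimes>[A] b)"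
 proof (rule vs_finsum_cong[OF vA refl])
  fix I assume I: "I : Wd (nl X)"
  show "(cof X \<mu> e I \<odot>[A] \<gamma> I) \<otimes>[A] b : carrier A" by (rule mult_closedA[OF vs_smult[OF vA gI[OF I]] b])
  show "ctr_l A \<mu> (tens (fibre X) A (aw (act X) I e) (\<gamma> I \<otimes>[A] b)) = (cof X \<mu> e I \<odot>[A] \<gamma> I) \<otimes>[A] b"
   unfolding c(2)[OF aI[OF I] mult_closedA[OF gI[OF I] b]] smultA(1)[OF gI[OF I] b]
   using I by (simp add: cof_def Wd_def)
 qed
 also have "... = (\<Oplus>\<^bsub>A\<^esub>I\<in>Wd (nl X). cof X \<mu> e I \<odot>[A] \<gamma> I) \<otimes>[A] b"
  by (rule lin_finsum[OF multA_r[OF b] vA vA vs_smult[OF vA gI], symmetric])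
 also have "... = pr \<gamma> (cof X \<mu> e) \<otimes>[A] b" unfolding pr_Wd[OF \<gamma> cof_supp[OF X \<mu> e]] ..
 finally show ?thesis .
qed

lemma Lg_alin:
 assumes a: "a : carrier A" and u: "u : carrier (tensor (fibre X) A)"
 shows "Lg \<gamma> X (amul (fibre X) a u) = amul (fibre X) a (Lg \<gamma> X u)"
proof -
 note E = uniD(2)[OF X]
 note l = lin_homD[OF Lg_hom] and m = amul[OF E a]
 show ?thesis
 proof (rule tensor_eqI[OF E vA vs_tensor[OF E vA] lin_comp[OF m(1) l] lin_comp[OF l m(1)] _ u], goal_cases)
  case (1 e b) note eb = 1(1-2)
  note t = tens_closed[OF E vA eb]
  show ?case
  proof (rule scalar_eqI[OF E lin_closed[OF l lin_closed[OF m(1) t]] lin_closed[OF m(1) lin_closed[OF l t]]], goal_cases)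
   case (1 \<mu>) note \<mu> = 1(1)
   show ?case
    unfolding ctr_amul[OF E a \<mu> lin_closed[OF l t]] m(2)[OF eb] Lg_ctr[OF \<mu> eb] Lg_ctr[OF \<mu> eb(1) mult_closedA[OF a eb(2)]]
    by (rule lcommA[OF pr_closed[OF \<gamma> cof_supp[OF X \<mu> eb(1)]] a eb(2)])
  qed
 qed
qed

end

text \<open>A morphism commutes with every word, so both sides have the same matrix coefficients,
  those of \<open>X\<close> for the functional \<nu> after \<open>T\<close>. This holds for any
  family \<gamma>.\<close>

lemma Lg_nat:
 assumes X: "uni X" and Y: "uni Y" and \<gamma>: "gam \<gamma>" and T: "T : conn_hom \<Omega> X Y" and u: "u : carrier (tensor (fibre X) A)"
 shows "Lg \<gamma> Y (scalar_ext_map X Y A T u) = scalar_ext_map X Y A T (Lg \<gamma> X u)"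
proof -
 note E = uniD(2)[OF X] and F = uniD(2)[OF Y]
 have lT: "lin (fibre X) (fibre Y) T" using T by (simp add: conn_hom_iff[OF uniD(1)[OF X] uniD(1)[OF Y]] lin_hom_iff)
 note tm = lin_tensor_map[OF E vA F vA lT lin_id]
 note lX = lin_homD[OF Lg_hom[OF X \<gamma>]] and lY = lin_homD[OF Lg_hom[OF Y \<gamma>]]
 show ?thesis
 proof (rule tensor_eqI[OF E vA vs_tensor[OF F vA] lin_comp[OF tm lY] lin_comp[OF lX tm] _ u], goal_cases)
  case (1 e b) note eb = 1(1-2)
  note t = tens_closed[OF E vA eb]
  show ?case
  proof (rule scalar_eqI[OF F lin_closed[OF lY lin_closed[OF tm t]] lin_closed[OF tm lin_closed[OF lX t]]], goal_cases)
   case (1 \<nu>) note \<nu> = 1(1)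
   show ?case
    unfolding ctr_tensor_map[OF E F lT \<nu> lin_closed[OF lX t]] tensor_map_tens[OF E vA F vA lT lin_id eb]
     Lg_ctr[OF Y \<gamma> \<nu> lin_closed[OF lT eb(1)] eb(2)] Lg_ctr[OF X \<gamma> lin_comp[OF lT \<nu>] eb] cof_nat[OF X Y T eb(1)] ..
  qed
 qed
qed

end

subsection \<open>Convolution of coefficient families\<close>

context scalars
begin

text \<open>Dual to deconcatenation: composing two operators \<open>Lg\<close> convolves their
  families (\<open>Lg_comp_ctr\<close>).\<close>

definition conv :: "('o list => 'u) => ('o list => 'u) => 'o list => 'u" where
 "conv \<gamma> \<gamma>' K = (\<Oplus>\<^bsub>A\<^esub>k\<in>{..length K}. \<gamma> (take k K) \<otimes>[A] \<gamma>' (drop k K))"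

lemma gam_term:
 assumes "gam \<gamma>" "gam \<gamma>'" "set K \<subseteq> D"
 shows "\<gamma> (take k K) \<otimes>[A] \<gamma>' (drop k K) : carrier A"
proof -
 have "set (take k K) \<subseteq> D" "set (drop k K) \<subseteq> D" using assms(3) set_take_subset[of k K] set_drop_subset[of k K] by blast+
 then show ?thesis using assms(1,2) by (intro mult_closedA) (simp_all add: gam_def)
qed

lemma gam_conv: "gam \<gamma> ==> gam \<gamma>' ==> gam (conv \<gamma> \<gamma>')"
 unfolding gam_def[of "conv \<gamma> \<gamma>'"] conv_def by (intro allI impI vs_finsum[OF vA] gam_term)

lemma lf_pr:
 assumes \<phi>: "lf A \<phi>" and \<gamma>: "gam \<gamma>" and x: "wsupp N x"
 shows "\<phi> (pr \<gamma> x) = (\<Sum>I\<in>Wd N. x I * \<phi> (\<gamma> I))"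
proof -
 note g = gamD[OF \<gamma>]
 have "\<phi> (pr \<gamma> x) = (\<Sum>I\<in>Wd N. \<phi> (x I \<odot>[A] \<gamma> I))"
  unfolding pr_Wd[OF \<gamma> x] by (rule lf_finsum[OF \<phi> vA vs_smult[OF vA g]])
 also have "... = (\<Sum>I\<in>Wd N. x I * \<phi> (\<gamma> I))" by (rule sum.cong[OF refl lf_smult[OF \<phi> g]])
 finally show ?thesis .
qed

text \<open>A double sum of the same shape as in \<open>bar_comult_el\<close>; comparing the two
  gives \<open>smul_eq\<close>.\<close>

lemma lf_pr_conv:
 assumes \<phi>: "lf A \<phi>" and \<gamma>: "gam \<gamma>" "gam \<gamma>'" and x: "wsupp N x"
 shows "\<phi> (pr (conv \<gamma> \<gamma>') x) = (\<Sum>I\<in>Wd N. \<Sum>J\<in>Wd N. x (I @ J) * \<phi> (\<gamma> I \<otimes>[A] \<gamma>' J))"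
proof -
 have "\<phi> (pr (conv \<gamma> \<gamma>') x) = (\<Sum>I\<in>Wd N. \<Sum>k\<le>length I. x (take k I @ drop k I) * \<phi> (\<gamma> (take k I) \<otimes>[A] \<gamma>' (drop k I)))"
  unfolding lf_pr[OF \<phi> gam_conv[OF \<gamma>] x]
 proof (rule sum.cong[OF refl], goal_cases)
  case (1 I) note I = 1(1)
  from 1 have D: "set I \<subseteq> D" by (simp add: Wd_def)
  have "\<phi> (conv \<gamma> \<gamma>' I) = (\<Sum>k\<le>length I. \<phi> (\<gamma> (take k I) \<otimes>[A] \<gamma>' (drop k I)))"
   unfolding conv_def by (rule lf_finsum[OF \<phi> vA gam_term[OF \<gamma> D]])
  then show ?case
   by (simp add: sum_distrib_left)
 qed
 also have "... = (\<Sum>I\<in>Wd N. \<Sum>J\<in>Wd N. if length I + length J < N then x (I @ J) * \<phi> (\<gamma> I \<otimes>[A] \<gamma>' J) else 0)"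
  unfolding Wd_def by (rule sum_split_words[OF finite_D])
 also have "... = (\<Sum>I\<in>Wd N. \<Sum>J\<in>Wd N. x (I @ J) * \<phi> (\<gamma> I \<otimes>[A] \<gamma>' J))"
  using x by (intro sum.cong refl) (auto simp: Wd_def)
 finally show ?thesis .
qed

text \<open>The coefficient of \<open>I\<close> at the vector \<open>aw (act X) J e\<close> is the
  coefficient of \<open>I @ J\<close> at \<open>e\<close>. The composite therefore runs over all
  factorisations of words, as convolution does.\<close>

lemma Lg_comp_ctr:
 assumes X: "uni X" and \<gamma>: "gam \<gamma>" "gam \<gamma>'" and \<mu>: "lf (fibre X) \<mu>" and e: "e : carrier (fibre X)" and b: "b : carrier A"
 shows "ctr_l A \<mu> (Lg \<gamma> X (Lg \<gamma>' X (tens (fibre X) A e b))) = pr (conv \<gamma> \<gamma>') (cof X \<mu> e) \<otimes>[A] b"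
proof -
 note E = uniD(2)[OF X]
 note t = tens_closed[OF E vA e b]
 note L = lin_homD[OF Lg_hom[OF X \<gamma>(1)]] and L' = lin_homD[OF Lg_hom[OF X \<gamma>(2)]]
 note c = lin_comp[OF L ctr_l(1)[OF E vA \<mu>]]
 note s = cof_supp[OF X \<mu> e]
 let ?n = "nl X"
 have aI: "aw (act X) I e : carrier (fibre X)" if "I : Wd ?n" for I
  using lin_closed[OF lin_word[OF X] e] that by (simp add: Wd_def)
 have g': "\<gamma>' J \<otimes>[A] b : carrier A" if "J : Wd ?n" for J by (rule mult_closedA[OF gamD[OF \<gamma>(2) that] b])
 show ?thesis
 proof (rule vs_eqI[OF vA lin_closed[OF c lin_closed[OF L' t]] mult_closedA[OF pr_closed[OF gam_conv[OF \<gamma>] s] b]], goal_cases)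
  case (1 \<phi>) note \<phi> = 1(1)
  note \<phi>b = lin_comp[OF multA_r[OF b] \<phi>]
  have "\<phi> (ctr_l A \<mu> (Lg \<gamma> X (Lg \<gamma>' X (tens (fibre X) A e b)))) =
    (\<Sum>J\<in>Wd ?n. \<phi> (ctr_l A \<mu> (Lg \<gamma> X (tens (fibre X) A (aw (act X) J e) (\<gamma>' J \<otimes>[A] b)))))"
   unfolding Lg_tens[OF X \<gamma>(2) e b]
   by (rule lf_finsum[OF lin_comp[OF c \<phi>] vs_tensor[OF E vA] tens_closed[OF E vA aI g']])
  also have "... = (\<Sum>J\<in>Wd ?n. \<Sum>I\<in>Wd ?n. cof X \<mu> e (I @ J) * \<phi> ((\<gamma> I \<otimes>[A] \<gamma>' J) \<otimes>[A] b))"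
  proof (rule sum.cong[OF refl], goal_cases)
   case (1 J) note J = 1(1)
   have cJ: "cof X \<mu> (aw (act X) J e) I = cof X \<mu> e (I @ J)" for I
    using J by (simp add: cof_def aw_append Wd_def)
   have "\<phi> (ctr_l A \<mu> (Lg \<gamma> X (tens (fibre X) A (aw (act X) J e) (\<gamma>' J \<otimes>[A] b)))) =
     \<phi> (pr \<gamma> (cof X \<mu> (aw (act X) J e)) \<otimes>[A] (\<gamma>' J \<otimes>[A] b))"
    unfolding Lg_ctr[OF X \<gamma>(1) \<mu> aI[OF J] g'[OF J]] ..
   also have "... = (\<Sum>I\<in>Wd ?n. cof X \<mu> (aw (act X) J e) I * \<phi> (\<gamma> I \<otimes>[A] (\<gamma>' J \<otimes>[A] b)))"
    by (rule lf_pr[OF lin_comp[OF multA_r[OF g'[OF J]] \<phi>] \<gamma>(1) cof_supp[OF X \<mu> aI[OF J]]])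
   also have "... = (\<Sum>I\<in>Wd ?n. cof X \<mu> e (I @ J) * \<phi> ((\<gamma> I \<otimes>[A] \<gamma>' J) \<otimes>[A] b))"
    unfolding cJ by (rule sum.cong[OF refl]) (simp only: assocA[OF gamD[OF \<gamma>(1)] gamD[OF \<gamma>(2) J] b])
   finally show ?case .
  qed
  also have "... = (\<Sum>I\<in>Wd ?n. \<Sum>J\<in>Wd ?n. cof X \<mu> e (I @ J) * \<phi> ((\<gamma> I \<otimes>[A] \<gamma>' J) \<otimes>[A] b))" by (rule sum.swap)
  also have "... = \<phi> (pr (conv \<gamma> \<gamma>') (cof X \<mu> e) \<otimes>[A] b)" by (rule lf_pr_conv[OF \<phi>b \<gamma> s, symmetric])
  finally show ?case .
 qed
qed

definition eps :: "'o list => 'u" where "eps K = (if K = [] then \<one>[A] else \<zero>[A])"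

lemma gam_eps: "gam eps" using vs_zero[OF vA] by (simp add: gam_def eps_def)

lemma pr_cong: "gam \<gamma> ==> gam \<gamma>' ==> wsupp N x ==> (\<And>I. set I \<subseteq> D ==> \<gamma> I = \<gamma>' I) ==> pr \<gamma> x = pr \<gamma>' x"
 unfolding pr_Wd by (rule vs_finsum_cong[OF vA refl]) (simp_all add: Wd_def gam_def vs_smult[OF vA])

lemma pr_delta:
 assumes \<gamma>: "gam \<gamma>" and x: "\<And>I. set I \<subseteq> D ==> I \<noteq> [] ==> x I \<odot>[A] \<gamma> I = \<zero>[A]" and s: "wsupp N x"
 shows "pr \<gamma> x = x [] \<odot>[A] \<gamma> []"
proof -
 \<comment> \<open>For \<open>N = 0\<close> the empty word would be missing from
   \<open>Wd N\<close>.\<close>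
 have s': "wsupp (Suc N) x" using s by (auto simp: Wd_def)
 have g: "\<gamma> [] : carrier A" using \<gamma> by (simp add: gam_def)
 have "pr \<gamma> x = (\<Oplus>\<^bsub>A\<^esub>I\<in>{[]}. x I \<odot>[A] \<gamma> I)" unfolding pr_Wd[OF \<gamma> s']
  by (rule vs_finsum_neutral[OF vA finite_Wd]) (use x g vs_smult[OF vA g] in \<open>auto simp: Wd_def\<close>)
 also have "... = x [] \<odot>[A] \<gamma> []" by (subst vs_finsum_insert[OF vA]) (use vs_smult[OF vA g, of "x []"] in \<open>auto simp: vs_finsum_empty[OF vA] vs_r_zero[OF vA]\<close>)
 finally show ?thesis .
qed

lemma Lg_inverse:
 assumes X: "uni X" and \<gamma>: "gam \<gamma>" "gam \<gamma>'" and eq: "\<And>K. set K \<subseteq> D ==> conv \<gamma> \<gamma>' K = eps K"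
  and u: "u : carrier (tensor (fibre X) A)"
 shows "Lg \<gamma> X (Lg \<gamma>' X u) = u"
proof -
 note E = uniD(2)[OF X]
 note L = lin_comp[OF lin_homD[OF Lg_hom[OF X \<gamma>(2)]] lin_homD[OF Lg_hom[OF X \<gamma>(1)]]]
 show ?thesis
 proof (rule tensor_eqI[OF E vA vs_tensor[OF E vA] L lin_id _ u], goal_cases)
  case (1 e b) note e = 1(1) and b = 1(2)
  note t = tens_closed[OF E vA e b]
  show ?case
  proof (rule scalar_eqI[OF E lin_closed[OF L t] t], goal_cases)
   case (1 \<mu>) note \<mu> = 1(1)
   note s = cof_supp[OF X \<mu> e]
   have "pr (conv \<gamma> \<gamma>') (cof X \<mu> e) = pr eps (cof X \<mu> e)" by (rule pr_cong[OF gam_conv[OF \<gamma>] gam_eps s eq])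
   also have "... = cof X \<mu> e [] \<odot>[A] eps []"
    by (rule pr_delta[OF gam_eps _ s]) (simp add: eps_def vs_smult_zero[OF vA])
   finally have p: "pr (conv \<gamma> \<gamma>') (cof X \<mu> e) = \<mu> e \<odot>[A] \<one>[A]" by (simp add: cof_def eps_def)
   show ?case
    unfolding Lg_comp_ctr[OF X \<gamma> \<mu> e b] p smultA(1)[OF one_closedA b] ctr_l(2)[OF E vA \<mu> e b] using b by simp
  qed
 qed
qed

text \<open>The right inverse for convolution, by recursion on the length of words; \<open>rv \<gamma> n\<close> is meaningful
  on words of length at most \<open>n\<close>.\<close>

primrec rv :: "('o list => 'u) => nat => 'o list => 'u" where
 "rv \<gamma> 0 = eps" |
 "rv \<gamma> (Suc n) = (%K. if K = [] then \<one>[A] else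
   (-1) \<odot>[A] (\<Oplus>\<^bsub>A\<^esub>k\<in>{Suc 0..length K}. \<gamma> (take k K) \<otimes>[A] rv \<gamma> n (drop k K)))"

lemma gam_rv: "gam \<gamma> ==> gam (rv \<gamma> n)"
proof (induction n)
 case 0 then show ?case by (simp add: gam_eps)
next
 case (Suc n)
 show ?case unfolding gam_def
 proof (intro allI impI)
  fix K :: "'o list" assume K: "set K \<subseteq> D"
  note c = vs_smult[OF vA vs_finsum[OF vA gam_term[OF Suc.prems Suc.IH[OF Suc.prems] K]]]
  show "rv \<gamma> (Suc n) K : carrier A" by (auto simp: one_closedA intro: c)
 qed
qed

lemma rv_stable:
 assumes \<gamma>: "gam \<gamma>"
 shows "set K \<subseteq> D ==> length K \<le> n ==> length K \<le> m ==> rv \<gamma> n K = rv \<gamma> m K"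
proof (induction n arbitrary: m K)
 case 0
 then show ?case by (cases m) (auto simp: eps_def)
next
 case (Suc n)
 show ?case
 proof (cases "K = []")
  case True then show ?thesis by (cases m) (auto simp: eps_def)
 next
  case K: False
  then obtain m' where m: "m = Suc m'" using Suc.prems by (cases m) auto
  have "(\<Oplus>\<^bsub>A\<^esub>k\<in>{Suc 0..length K}. \<gamma> (take k K) \<otimes>[A] rv \<gamma> n (drop k K)) = (\<Oplus>\<^bsub>A\<^esub>k\<in>{Suc 0..length K}. \<gamma> (take k K) \<otimes>[A] rv \<gamma> m' (drop k K))"
  proof (rule vs_finsum_cong[OF vA refl])
   fix k assume k: "k : {Suc 0..length K}"
   show "\<gamma> (take k K) \<otimes>[A] rv \<gamma> m' (drop k K) : carrier A" by (rule gam_term[OF \<gamma> gam_rv[OF \<gamma>] Suc.prems(1)])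
   have "set (drop k K) \<subseteq> D" using Suc.prems(1) set_drop_subset[of k K] by blast
   then have "rv \<gamma> n (drop k K) = rv \<gamma> m' (drop k K)" by (rule Suc.IH) (use k Suc.prems m in auto)
   then show "\<gamma> (take k K) \<otimes>[A] rv \<gamma> n (drop k K) = \<gamma> (take k K) \<otimes>[A] rv \<gamma> m' (drop k K)" by simp
  qed
  then show ?thesis using K by (simp add: m)
 qed
qed

text \<open>On a word \<open>K\<close> the recursion is taken to depth \<open>length K\<close>; by
  \<open>rv_stable\<close> deeper recursion gives the same value. The term of the convolution with
  empty first part is the new value itself, since \<gamma> is one there, and by the recursion it
  cancels all other terms.\<close>

lemma right_inverse_ex:
 assumes \<gamma>: "gam \<gamma>" "\<gamma> [] = \<one>[A]"
 shows "\<exists>\<gamma>'. gam \<gamma>' \<and> \<gamma>' [] = \<one>[A] \<and> (\<forall>K. set K \<subseteq> D --> conv \<gamma> \<gamma>' K = eps K)"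
proof (intro exI conjI allI impI)
 let ?r = "%K. rv \<gamma> (length K) K"
 show gr: "gam ?r" using gam_rv[OF \<gamma>(1)] by (simp add: gam_def)
 show "?r [] = \<one>[A]" by (simp add: eps_def)
 fix K :: "'o list" assume K: "set K \<subseteq> D"
 note t = gam_term[OF \<gamma>(1) gr K]
 have rK: "?r K : carrier A" using gr K by (simp add: gam_def)
 show "conv \<gamma> ?r K = eps K"
 proof (cases K)
  case Nil
  have "conv \<gamma> ?r [] = \<gamma> [] \<otimes>[A] ?r []" unfolding conv_def using \<gamma>(2) by (simp add: eps_def vs_r_zero[OF vA] vs_finsum_insert[OF vA])
  then show ?thesis using \<gamma>(2) Nil by (simp add: eps_def)
 next
  case (Cons i L)
  let ?S = "\<Oplus>\<^bsub>A\<^esub>k\<in>{Suc 0..length K}. \<gamma> (take k K) \<otimes>[A] ?r (drop k K)"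
  have S: "?S : carrier A" by (rule vs_finsum[OF vA t])
  have "{..length K} = insert 0 {Suc 0..length K}" by auto
  then have "conv \<gamma> ?r K = (\<gamma> (take 0 K) \<otimes>[A] ?r (drop 0 K)) \<oplus>[A] ?S"
   unfolding conv_def by (simp only:) (rule vs_finsum_insert[OF vA], use t t[of 0] in auto)
  also have "\<gamma> (take 0 K) \<otimes>[A] ?r (drop 0 K) = ?r K" using \<gamma>(2) rK by simp
  also have "?r K = (-1) \<odot>[A] ?S"
  proof -
   have "(\<Oplus>\<^bsub>A\<^esub>k\<in>{Suc 0..length K}. \<gamma> (take k K) \<otimes>[A] rv \<gamma> (length L) (drop k K)) = ?S"
   proof (rule vs_finsum_cong[OF vA refl t], goal_cases)
    case (1 k) note k = 1(1)
    have "set (drop k K) \<subseteq> D" using K set_drop_subset[of k K] by blast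
    then have "rv \<gamma> (length L) (drop k K) = ?r (drop k K)" by (rule rv_stable[OF \<gamma>(1)]) (use k Cons in auto)
    then show ?case by simp
   qed
   then show ?thesis using Cons by (simp del: take_Suc_Cons drop_Suc_Cons)
  qed
  also have "(-1) \<odot>[A] ?S \<oplus>[A] ?S = \<zero>[A]"
   using vs_neg_add[OF vA S] vs_comm[OF vA vs_smult[OF vA S] S, of "-1"] by simp
  finally show ?thesis using Cons by (simp add: eps_def)
 qed
qed

text \<open>Inverses for convolution are constructed on one side only. The right inverse of \<gamma>
  has a right inverse in turn, and comparing the three operators makes the first two mutually
  inverse.\<close>

lemma Lg_bij:
 assumes X: "uni X" and \<gamma>: "gam \<gamma>" "\<gamma> [] = \<one>[A]"
 shows "bij_betw (Lg \<gamma> X) (carrier (tensor (fibre X) A)) (carrier (tensor (fibre X) A))"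
proof -
 obtain \<gamma>' where g': "gam \<gamma>'" "\<gamma>' [] = \<one>[A]" "\<forall>K. set K \<subseteq> D --> conv \<gamma> \<gamma>' K = eps K" using right_inverse_ex[OF \<gamma>] by blast
 obtain \<gamma>'' where g'': "gam \<gamma>''" "\<forall>K. set K \<subseteq> D --> conv \<gamma>' \<gamma>'' K = eps K" using right_inverse_ex[OF g'(1,2)] by blast
 let ?C = "carrier (tensor (fibre X) A)"
 have 1: "Lg \<gamma> X (Lg \<gamma>' X u) = u" if "u : ?C" for u using Lg_inverse[OF X \<gamma>(1) g'(1) _ that] g'(3) by blast
 have 2: "Lg \<gamma>' X (Lg \<gamma>'' X u) = u" if "u : ?C" for u using Lg_inverse[OF X g'(1) g''(1) _ that] g''(2) by blast
 have c: "Lg \<gamma> X u : ?C" "Lg \<gamma>' X u : ?C" "Lg \<gamma>'' X u : ?C" if "u : ?C" for u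
  using that lin_hom_closed[OF Lg_hom[OF X \<gamma>(1)]] lin_hom_closed[OF Lg_hom[OF X g'(1)]] lin_hom_closed[OF Lg_hom[OF X g''(1)]] by blast+
 have 3: "Lg \<gamma>' X (Lg \<gamma> X u) = u" if u: "u : ?C" for u
 proof -
  have "Lg \<gamma> X u = Lg \<gamma>'' X u" using 1[OF c(3)[OF u]] 2[OF u] by simp
  then show ?thesis using 2[OF u] by simp
 qed
 show ?thesis by (rule bij_betw_byWitness[where f'="Lg \<gamma>' X"]) (use 1 3 c in auto)
qed

end

subsection \<open>Words acting on a tensor product\<close>

text \<open>Subsets of the positions of a nonempty word, sorted by whether the first position
  belongs to them; the other positions are shifted by \<open>Suc\<close>.\<close>

lemma sum_Pow_Suc:
 fixes F :: "nat set => 'b::comm_monoid_add"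
 shows "(\<Sum>S\<in>Pow {..<Suc n}. F S) = (\<Sum>S\<in>Pow {..<n}. F (insert 0 (Suc ` S)) + F (Suc ` S))"
proof -
 have inj: "inj_on (image Suc) A" for A by (rule inj_on_subset[of _ UNIV]) (auto simp: inj_image_eq_iff intro!: inj_onI)
 have inj2: "inj_on (%S. insert 0 (Suc ` S)) A" for A
 proof (rule inj_onI, goal_cases)
  case (1 S S')
  then have "Suc ` S = Suc ` S'" by (metis (no_types, lifting) insert_ident imageE old.nat.distinct(1))
  then show ?case by (simp add: inj_image_eq_iff)
 qed
 have P: "Pow {..<Suc n} = (%S. insert 0 (Suc ` S)) ` Pow {..<n} \<union> image Suc ` Pow {..<n}"
  unfolding lessThan_Suc_eq_insert_0 Pow_insert image_Pow_surj[OF refl, of Suc "{..<n}", symmetric] image_image by auto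
 have d: "(%S. insert 0 (Suc ` S)) ` Pow {..<n} \<inter> image Suc ` Pow {..<n} = {}" by auto
 show ?thesis unfolding P
  by (subst sum.union_disjoint) (use d in \<open>auto simp: sum.reindex[OF inj] sum.reindex[OF inj2] sum.distrib\<close>)
qed

lemma nths_Cons_Suc:
 "nths (i # K) (insert 0 (Suc ` S)) = i # nths K S" "nths (i # K) (Suc ` S) = nths K S"
 "nths (i # K) (- insert 0 (Suc ` S)) = nths K (- S)" "nths (i # K) (- (Suc ` S)) = i # nths K (- S)"
proof -
 have "{j. Suc j : insert 0 (Suc ` S)} = S" "{j. Suc j : Suc ` S} = S" "{j. Suc j : - insert 0 (Suc ` S)} = - S" "{j. Suc j : - (Suc ` S)} = - S" by auto
 then show "nths (i # K) (insert 0 (Suc ` S)) = i # nths K S" "nths (i # K) (Suc ` S) = nths K S"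
  "nths (i # K) (- insert 0 (Suc ` S)) = nths K (- S)" "nths (i # K) (- (Suc ` S)) = i # nths K (- S)"
  by (simp_all add: nths_Cons)
qed

lemma length_nths_compl: "length (nths K S) + length (nths K (- S)) = length K"
proof -
 have "card {i. i < length K \<and> i : S} + card {i. i < length K \<and> i : - S} = card ({i. i < length K \<and> i : S} \<union> {i. i < length K \<and> i : - S})"
  by (rule card_Un_disjoint[symmetric]) auto
 also have "{i. i < length K \<and> i : S} \<union> {i. i < length K \<and> i : - S} = {..<length K}" by auto
 finally show ?thesis by (simp add: length_nths)
qed

context form_algebra
begin

lemma set_nths_D: "set K \<subseteq> D ==> set (nths K S) \<subseteq> D"
 using set_nths_subset[of K S] by blast

text \<open>By the Leibniz rule each letter acts on one of the two factors; \<open>S\<close> records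
  the positions acting on the left. The functional \<Psi> varies in the induction because the first
  letter, which acts last, is absorbed into it.\<close>

lemma tensor_word:
 assumes X: "pre_conn X" and Y: "pre_conn Y" and e: "e : carrier (fibre X)" and f: "f : carrier (fibre Y)"
 shows "set K \<subseteq> D ==> lf (tensor (fibre X) (fibre Y)) \<Psi> ==>
  \<Psi> (aw (act (conn_tensor \<Omega> X Y)) K (tens (fibre X) (fibre Y) e f)) =
  (\<Sum>S\<in>Pow {..<length K}. \<Psi> (tens (fibre X) (fibre Y) (aw (act X) (nths K S) e) (aw (act Y) (nths K (- S)) f)))"
proof (induction K arbitrary: \<Psi>)
 case Nil
 then show ?case by simp
next
 case (Cons i K)
 let ?P = "conn_tensor \<Omega> X Y"
 let ?T = "tensor (fibre X) (fibre Y)" and ?t = "tens (fibre X) (fibre Y)"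
 note E = pre_conn_vs[OF X] and F = pre_conn_vs[OF Y]
 note \<Psi> = Cons.prems(2)
 have K: "set K \<subseteq> D" and i: "i : D" using Cons.prems by auto
 note P = pre_conn_tensor[OF X Y]
 have l: "lin ?T ?T (act ?P i)" using act_lin[OF P(1), of i] unfolding P(2) .
 have aX: "aw (act X) (nths K S) e : carrier (fibre X)" for S
  by (rule lin_closed[OF lin_aw[OF act_lin[OF X] set_nths_D[OF K]] e])
 have aY: "aw (act Y) (nths K S) f : carrier (fibre Y)" for S
  by (rule lin_closed[OF lin_aw[OF act_lin[OF Y] set_nths_D[OF K]] f])
 have "\<Psi> (aw (act ?P) (i # K) (?t e f)) = (\<Sum>S\<in>Pow {..<length K}. \<Psi> (act ?P i (?t (aw (act X) (nths K S) e) (aw (act Y) (nths K (- S)) f))))"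
  unfolding aw_simps by (rule Cons.IH[OF K lin_comp[OF l \<Psi>]])
 also have "... = (\<Sum>S\<in>Pow {..<length K}. \<Psi> (?t (act X i (aw (act X) (nths K S) e)) (aw (act Y) (nths K (- S)) f))
   + \<Psi> (?t (aw (act X) (nths K S) e) (act Y i (aw (act Y) (nths K (- S)) f))))"
  unfolding P(3)[OF aX aY]
  by (rule sum.cong[OF refl lf_add[OF \<Psi> tens_closed[OF E F lin_closed[OF act_lin[OF X] aX] aY] tens_closed[OF E F aX lin_closed[OF act_lin[OF Y] aY]]]])
 also have "... = (\<Sum>S\<in>Pow {..<Suc (length K)}. \<Psi> (?t (aw (act X) (nths (i # K) S) e) (aw (act Y) (nths (i # K) (- S)) f)))"
  unfolding sum_Pow_Suc by (simp only: nths_Cons_Suc aw_simps)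
 finally show ?case by simp
qed

end

section \<open>Matrix coefficients of tensor products\<close>

context scalars
begin

text \<open>In each summand a word of length \<open>nl X + nl Y\<close> falls into two complementary
  subwords, and one of them is long enough to kill its factor.\<close>

lemma uni_tensor:
 assumes X: "uni X" and Y: "uni Y"
 shows "uni (conn_tensor \<Omega> X Y)"
 unfolding uni_def integrable_conn_iff
proof (intro conjI exI)
 let ?P = "conn_tensor \<Omega> X Y"
 let ?T = "tensor (fibre X) (fibre Y)" and ?t = "tens (fibre X) (fibre Y)"
 note E = uniD(2)[OF X] and F = uniD(2)[OF Y]
 note P = pre_conn_tensor[OF uniD(1)[OF X] uniD(1)[OF Y]]
 show "pre_conn ?P" by (rule P)
 show "flat (fibre ?P) (act ?P)" by (rule flat_tensor[OF uniD(1)[OF X] uniD(3)[OF X] uniD(1)[OF Y] uniD(3)[OF Y]])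
 show "finite_dim (fibre ?P)" unfolding P(2)
  using finite_dim_tensor[OF E _ F] X Y by (simp add: uni_def integrable_conn_iff)
 show "nilp (fibre ?P) (act ?P) (nl X + nl Y)" unfolding nilp_def P(2)
 proof (intro allI impI ballI)
  fix K and t assume K: "set K \<subseteq> D" "length K = nl X + nl Y" and t: "t : carrier ?T"
  note vT = vs_tensor[OF E F]
  have l: "lin ?T ?T (aw (act ?P) K)" using lin_aw[OF act_lin[OF P(1)] K(1)] unfolding P(2) .
  show "aw (act ?P) K t = \<zero>[?T]"
  proof (rule tensor_eqI[OF E F vT l lin_zerof[OF vT] _ t], goal_cases)
   case (1 e f) note e = 1(1) and f = 1(2)
   show ?case
   proof (rule vs_sep[OF vT lin_closed[OF l tens_closed[OF E F e f]]], goal_cases)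
    case (1 \<Psi>) note \<Psi> = 1(1)
    show ?case
     unfolding tensor_word[OF uniD(1)[OF X] uniD(1)[OF Y] e f K(1) \<Psi>]
    proof (rule sum.neutral, rule ballI)
     fix S
     have KS: "set (nths K S) \<subseteq> D" "set (nths K (- S)) \<subseteq> D" by (rule set_nths_D[OF K(1)])+
     have "nl X \<le> length (nths K S) \<or> nl Y \<le> length (nths K (- S))" using length_nths_compl[of K S] K(2) by linarith
     then have "?t (aw (act X) (nths K S) e) (aw (act Y) (nths K (- S)) f) = \<zero>[?T]"
     proof
      assume a: "nl X \<le> length (nths K S)"
      show ?thesis unfolding word_zero[OF X KS(1) a e]
       by (rule tens_zero(2)[OF E F lin_closed[OF lin_word[OF Y KS(2)] f]])
     next
      assume a: "nl Y \<le> length (nths K (- S))"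
      show ?thesis unfolding word_zero[OF Y KS(2) a f]
       by (rule tens_zero(1)[OF E F lin_closed[OF lin_word[OF X KS(1)] e]])
     qed
     then show "\<Psi> (?t (aw (act X) (nths K S) e) (aw (act Y) (nths K (- S)) f)) = 0" using lf_zero[OF \<Psi> vT] by simp
    qed
   qed
  qed
 qed
qed

text \<open>The functional \<open>\<alpha> \<otimes> \<mu>\<close> on a tensor product.\<close>

abbreviation ctr2 :: "'f cmod => ('e => complex) => ('f => complex) => ('e \<times> 'f \<Rightarrow>\<^sub>0 complex) set => complex" where
 "ctr2 F \<alpha> \<mu> t \<equiv> \<mu> (ctr_l F \<alpha> t)"

lemma lf_ctr2:
 assumes "vs E" "vs F" "lf E \<alpha>" "lf F \<mu>"
 shows "lf (tensor E F) (ctr2 F \<alpha> \<mu>)" "e : carrier E ==> f : carrier F ==> ctr2 F \<alpha> \<mu> (tens E F e f) = \<alpha> e * \<mu> f"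
 using lin_comp[OF ctr_l(1)[OF assms(1-3)] assms(4)] ctr_l(2)[OF assms(1-3), of e f] lf_smult[OF assms(4), of f] by simp_all

lemma cof_tensor:
 assumes X: "uni X" and Y: "uni Y" and e: "e : carrier (fibre X)" and f: "f : carrier (fibre Y)"
  and \<alpha>: "lf (fibre X) \<alpha>" and \<mu>: "lf (fibre Y) \<mu>" and K: "set K \<subseteq> D"
 shows "cof (conn_tensor \<Omega> X Y) (ctr2 (fibre Y) \<alpha> \<mu>) (tens (fibre X) (fibre Y) e f) K =
  (\<Sum>S\<in>Pow {..<length K}. cof X \<alpha> e (nths K S) * cof Y \<mu> f (nths K (- S)))"
proof -
 note E = uniD(2)[OF X] and F = uniD(2)[OF Y]
 note c2 = lf_ctr2[OF E F \<alpha> \<mu>]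
 have "cof (conn_tensor \<Omega> X Y) (ctr2 (fibre Y) \<alpha> \<mu>) (tens (fibre X) (fibre Y) e f) K =
   (\<Sum>S\<in>Pow {..<length K}. ctr2 (fibre Y) \<alpha> \<mu> (tens (fibre X) (fibre Y) (aw (act X) (nths K S) e) (aw (act Y) (nths K (- S)) f)))"
  using tensor_word[OF uniD(1)[OF X] uniD(1)[OF Y] e f K c2(1)] K by (simp add: cof_def)
 also have "... = (\<Sum>S\<in>Pow {..<length K}. cof X \<alpha> e (nths K S) * cof Y \<mu> f (nths K (- S)))"
 proof (rule sum.cong[OF refl], goal_cases)
  case (1 S)
  note KS = set_nths_D[OF K, of S] set_nths_D[OF K, of "- S"]
  show ?case
   using c2(2)[OF lin_closed[OF lin_word[OF X KS(1)] e] lin_closed[OF lin_word[OF Y KS(2)] f]] KS by (simp add: cof_def)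
 qed
 finally show ?thesis .
qed

lemma tensor_sep2:
 assumes E: "vs E" and F: "vs F" and t: "t : carrier (tensor E F)"
  and 0: "\<And>\<alpha> \<mu>. lf E \<alpha> ==> lf F \<mu> ==> ctr2 F \<alpha> \<mu> t = 0"
 shows "t = \<zero>[tensor E F]"
 unfolding tensor_eq_zero_iff[OF E F t]
proof (intro allI impI)
 fix \<alpha> assume \<alpha>: "lf E \<alpha>"
 show "ctr_l F \<alpha> t = \<zero>[F]"
 proof (rule vs_sep[OF F lin_closed[OF ctr_l(1)[OF E F \<alpha>] t]], goal_cases)
  case (1 \<mu>)
  then show ?case by (rule 0[OF \<alpha>])
 qed
qed

end

subsection \<open>Coefficients of the zeroth cohomology\<close>

context form_algebra
begin

abbreviation "H0 \<equiv> H0_bar \<Omega>"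

text \<open>A linear projection onto \<open>H0\<close> extends a character of \<open>H0\<close> to the whole bar construction and
  so provides a coefficient for every single word (\<open>cg\<close> below), although words are rarely cocycles.\<close>

definition ret :: "('o bar_word \<Rightarrow>\<^sub>0 complex) set => ('o bar_word \<Rightarrow>\<^sub>0 complex) set" where
 "ret = (SOME r. lin \<B> H0 r \<and> (\<forall>c\<in>carrier H0. r c = c))"

lemma ret: "lin \<B> H0 ret" "c : carrier H0 ==> ret c = c"
proof -
 let ?C = "{X : bar_part \<Omega> 0. bar_d \<Omega> X = \<zero>[\<B>]}"
 have C: "carrier H0 = ?C" by (simp add: H0_bar_def)
 obtain r where r: "lin \<B> \<B> r" "\<forall>v\<in>carrier \<B>. r v : ?C" "\<forall>u\<in>?C. r u = u"
  by (rule lin_retraction[OF vs_bar H0_sub]) blast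
 have "lin \<B> H0 r" unfolding H0_bar_def
  by (rule lin_codomain[OF r(1)]) (rule bspec[OF r(2)])
 then have "lin \<B> H0 r \<and> (\<forall>c\<in>carrier H0. r c = c)" unfolding C using r(3) by (rule conjI)
 then have s: "lin \<B> H0 ret \<and> (\<forall>c\<in>carrier H0. ret c = c)" unfolding ret_def by (rule someI[where P="%r. lin \<B> H0 r \<and> (\<forall>c\<in>carrier H0. r c = c)"])
 show "lin \<B> H0 ret" using s by (rule conjunct1)
 show "c : carrier H0 ==> ret c = c" by (rule bspec[OF conjunct2[OF s]])
qed

lemma H0_part: "c : carrier H0 ==> c : bar_part \<Omega> 0"
 unfolding carrier_H0 by blast

lemma H0_common:
 assumes "c : carrier H0" "d : carrier H0"
 obtains N where "cfs c : carrier (Uo N)" "cfs d : carrier (Uo N)"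
proof -
 obtain n m where "\<forall>M\<ge>n. cfs c : carrier (Uo M)" "\<forall>M\<ge>m. cfs d : carrier (Uo M)"
  using H0_Uo[OF assms(1)] H0_Uo[OF assms(2)] by blast
 then show ?thesis using that[of "max n m"] by simp
qed

lemma H0_one: "EB [] : carrier H0" "cfs (EB []) = (%I. if I = [] then 1 else 0)"
proof -
 show c: "cfs (EB []) = (%I. if I = [] then 1 else 0)" using cfs_EB[of "[]"] by (auto simp: fun_eq_iff)
 show "EB [] : carrier H0" unfolding carrier_H0 c using EB_part[of "[]"] by (simp add: Rel_def)
qed

end

context scalars
begin

lemma uni_Uobj: "uni (Uobj N)"
 using Uobj_integrable Uobj_nilp by (auto simp: uni_def)

lemma lf_Uobj_eval: "lf (fibre (Uobj N)) (%x. x I)"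
 unfolding Uobj(2) by (rule lf_Uo_eval)

lemma cof_H0:
 assumes "uni X" "lf (fibre X) \<mu>" "e : carrier (fibre X)"
 shows "el (nl X) (cof X \<mu> e) : carrier H0" "cfs (el (nl X) (cof X \<mu> e)) = cof X \<mu> e"
 using Uo_H0[OF cof_Uo_ge[OF assms(1) le_refl assms(2,3)]] Uo_cfs_el[OF cof_Uo_ge[OF assms(1) le_refl assms(2,3)]] by blast+

text \<open>The shuffle product and the action on a tensor product distribute the letters of
  \<open>K\<close> by the same rule, compare \<open>bar_mult_H0\<close> and
  \<open>cof_tensor\<close>.\<close>

lemma cof_mult:
 assumes X: "uni X" and Y: "uni Y" and e: "e : carrier (fibre X)" and f: "f : carrier (fibre Y)"
  and \<alpha>: "lf (fibre X) \<alpha>" and \<mu>: "lf (fibre Y) \<mu>"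
  and c: "c : carrier H0" "cfs c = cof X \<alpha> e" and d: "d : carrier H0" "cfs d = cof Y \<mu> f"
 shows "cfs (c \<otimes>[\<B>] d) = cof (conn_tensor \<Omega> X Y) (ctr2 (fibre Y) \<alpha> \<mu>) (tens (fibre X) (fibre Y) e f)"
proof
 fix K
 show "cfs (c \<otimes>[\<B>] d) K = cof (conn_tensor \<Omega> X Y) (ctr2 (fibre Y) \<alpha> \<mu>) (tens (fibre X) (fibre Y) e f) K"
 proof (cases "set K \<subseteq> D")
  case True
  show ?thesis unfolding cof_tensor[OF X Y e f \<alpha> \<mu> True] bar_mult_H0(2)[OF H0_part[OF c(1)] H0_part[OF d(1)] True] c(2) d(2) ..
 next
  case False then show ?thesis by (simp add: cfs_def cof_def)
 qed
qed

text \<open>Both cocycles are matrix coefficients of a universal object, so their product is a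
  matrix coefficient of its tensor square. That square is unipotent, and coefficients of unipotent
  objects are cocycles.\<close>

lemma H0_mult_closed:
 assumes c: "c : carrier H0" and d: "d : carrier H0"
 shows "c \<otimes>[\<B>] d : carrier H0"
proof -
 obtain N where N: "cfs c : carrier (Uo N)" "cfs d : carrier (Uo N)" by (rule H0_common[OF c d])
 note U = uni_Uobj[of N]
 note l = lf_Uobj_eval[of N "[]"]
 have N': "cfs c : carrier (fibre (Uobj N))" "cfs d : carrier (fibre (Uobj N))" unfolding Uobj(2) by (rule N)+
 note P = pre_conn_tensor(2)[OF uniD(1)[OF U] uniD(1)[OF U]]
 have t: "tens (fibre (Uobj N)) (fibre (Uobj N)) (cfs c) (cfs d) : carrier (fibre (conn_tensor \<Omega> (Uobj N) (Uobj N)))"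
  unfolding P by (rule tens_closed[OF uniD(2)[OF U] uniD(2)[OF U] N'])
 have lf2: "lf (fibre (conn_tensor \<Omega> (Uobj N) (Uobj N))) (ctr2 (fibre (Uobj N)) (%x. x []) (%x. x []))"
  unfolding P by (rule lf_ctr2(1)[OF uniD(2)[OF U] uniD(2)[OF U] l l])
 have "cfs (c \<otimes>[\<B>] d) = cof (conn_tensor \<Omega> (Uobj N) (Uobj N)) (ctr2 (fibre (Uobj N)) (%x. x []) (%x. x []))
   (tens (fibre (Uobj N)) (fibre (Uobj N)) (cfs c) (cfs d))"
  by (rule cof_mult[OF U U N' l l c cof_Uobj[OF N(1), symmetric] d cof_Uobj[OF N(2), symmetric]])
 then have "cfs (c \<otimes>[\<B>] d) : carrier (Uo (nl (conn_tensor \<Omega> (Uobj N) (Uobj N))))"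
  using cof_Uo_ge[OF uni_tensor[OF U U] le_refl lf2 t] by (simp only:)
 then show ?thesis unfolding carrier_H0 carrier_Uo using bar_mult_H0(1)[OF H0_part[OF c] H0_part[OF d]] by blast
qed

text \<open>A relation and not a function of \<open>g\<close>: words need not be cocycles, so
  \<open>g\<close> need not determine \<gamma>.\<close>

definition extd :: "('o list => 'u) => (('o bar_word \<Rightarrow>\<^sub>0 complex) set => 'u) => bool" where
 "extd \<gamma> g \<longleftrightarrow> gam \<gamma> \<and> (\<forall>c\<in>carrier H0. g c = pr \<gamma> (cfs c))"

definition cg :: "(('o bar_word \<Rightarrow>\<^sub>0 complex) set => 'u) => 'o list => 'u" where
 "cg g I = g (ret (EB I))"

text \<open>Expand a cocycle in words and apply \<open>ret\<close> and \<open>g\<close>; on the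
  cocycle itself \<open>ret\<close> does nothing.\<close>

lemma extd_cg:
 assumes g: "lin H0 A g"
 shows "extd (cg g) g"
proof -
 note h = lin_comp[OF ret(1) g]
 have EBc: "EB I : carrier \<B>" if "set I \<subseteq> D" for I
  using that EB_closed[of I "Suc (length I)"] by (simp add: Wd_def del: bar_simps)
 have gam: "gam (cg g)" unfolding gam_def cg_def using lin_closed[OF h EBc] by blast
 have "g c = pr (cg g) (cfs c)" if c: "c : carrier H0" for c
 proof -
  obtain N where N: "cfs c : carrier (Uo N)" "c = el N (cfs c)" using H0_Uo[OF c] by blast
  have s: "wsupp N (cfs c)" using N(1) by (simp add: carrier_Uo)
  have "g c = g (ret (el N (cfs c)))" using ret(2)[OF c] N(2) by simp
  also have "... = (\<Oplus>\<^bsub>A\<^esub>I\<in>Wd N. g (ret (cfs c I \<odot>[\<B>] EB I)))"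
   unfolding el_def by (rule lin_finsum[OF h vs_bar vA vs_smult[OF vs_bar EB_closed]])
  also have "... = (\<Oplus>\<^bsub>A\<^esub>I\<in>Wd N. cfs c I \<odot>[A] cg g I)"
  proof (rule vs_finsum_cong[OF vA refl vs_smult[OF vA gamD[OF gam]]])
   fix I assume I: "I : Wd N"
   show "g (ret (cfs c I \<odot>[\<B>] EB I)) = cfs c I \<odot>[A] cg g I"
    unfolding cg_def by (rule lin_smult[OF h EB_closed[OF I]])
  qed
  finally show ?thesis unfolding pr_Wd[OF gam s] .
 qed
 then show ?thesis using gam by (simp add: extd_def)
qed

lemma extd_gam: "extd \<gamma> g ==> gam \<gamma>" and extd_eq: "extd \<gamma> g ==> c : carrier H0 ==> g c = pr \<gamma> (cfs c)"
 by (auto simp: extd_def)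

lemma extd_cof:
 assumes "extd \<gamma> g" "uni X" "lf (fibre X) \<mu>" "e : carrier (fibre X)"
 shows "pr \<gamma> (cof X \<mu> e) = g (el (nl X) (cof X \<mu> e))"
 using extd_eq[OF assms(1) cof_H0(1)[OF assms(2-4)]] cof_H0(2)[OF assms(2-4)] by simp

lemma alg_hom_iff: "g : alg_hom H0 A \<longleftrightarrow> g : lin_hom H0 A \<and>
  (\<forall>c\<in>carrier H0. \<forall>d\<in>carrier H0. g (c \<otimes>[\<B>] d) = g c \<otimes>[A] g d) \<and> g (EB []) = \<one>[A]"
proof -
 have "g : alg_hom H0 A" if g: "g : lin_hom H0 A" "\<forall>c\<in>carrier H0. \<forall>d\<in>carrier H0. g (c \<otimes>[\<B>] d) = g c \<otimes>[A] g d" "g (EB []) = \<one>[A]"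
  unfolding alg_hom_def
 proof (intro IntI g(1) ring_hom_memI)
  note l = lin_homD[OF g(1)]
  fix c d assume c: "c : carrier H0" and d: "d : carrier H0"
  show "g c : carrier A" by (rule lin_closed[OF l c])
  show "g (c \<otimes>[H0] d) = g c \<otimes>[A] g d" unfolding H0_simps using g(2) c d by blast
  show "g (c \<oplus>[H0] d) = g c \<oplus>[A] g d" by (rule lin_add[OF l c d])
 next
  show "g \<one>[H0] = \<one>[A]" unfolding H0_simps bar_one by (rule g(3))
 qed
 moreover have "g : lin_hom H0 A \<and>
  (\<forall>c\<in>carrier H0. \<forall>d\<in>carrier H0. g (c \<otimes>[\<B>] d) = g c \<otimes>[A] g d) \<and> g (EB []) = \<one>[A]" if "g : alg_hom H0 A"
 proof -
  have g: "g : lin_hom H0 A" "g : ring_hom H0 A" using that by (auto simp: alg_hom_def)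
  have "g (c \<otimes>[\<B>] d) = g c \<otimes>[A] g d" if "c : carrier H0" "d : carrier H0" for c d
   using ring_hom_mult[OF g(2) that] unfolding H0_simps .
  moreover have "g (EB []) = \<one>[A]" using ring_hom_one[OF g(2)] unfolding H0_simps bar_one .
  ultimately show ?thesis using g(1) by blast
 qed
 ultimately show ?thesis by blast
qed

text \<open>Multiplicativity of \<open>g\<close> expressed through \<gamma>. It concerns coefficient
  functions, which are cocycles; nothing is claimed about \<gamma> on single words.\<close>

lemma extd_mult:
 assumes g: "g : alg_hom H0 A" and \<gamma>: "extd \<gamma> g"
  and X: "uni X" and Y: "uni Y" and e: "e : carrier (fibre X)" and f: "f : carrier (fibre Y)"
  and \<alpha>: "lf (fibre X) \<alpha>" and \<mu>: "lf (fibre Y) \<mu>"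
 shows "pr \<gamma> (cof (conn_tensor \<Omega> X Y) (ctr2 (fibre Y) \<alpha> \<mu>) (tens (fibre X) (fibre Y) e f)) =
  pr \<gamma> (cof X \<alpha> e) \<otimes>[A] pr \<gamma> (cof Y \<mu> f)"
proof -
 let ?c = "el (nl X) (cof X \<alpha> e)" and ?d = "el (nl Y) (cof Y \<mu> f)"
 note c = cof_H0[OF X \<alpha> e] and d = cof_H0[OF Y \<mu> f]
 show ?thesis
  unfolding cof_mult[OF X Y e f \<alpha> \<mu> c d, symmetric] extd_eq[OF \<gamma> H0_mult_closed[OF c(1) d(1)], symmetric]
   extd_cof[OF \<gamma> X \<alpha> e] extd_cof[OF \<gamma> Y \<mu> f]
  using g c(1) d(1) unfolding alg_hom_iff by blast
qed

text \<open>The empty word is a cocycle, the unit of \<open>H0\<close>, so there \<gamma> is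
  determined by \<open>g\<close>.\<close>

lemma extd_one:
 assumes g: "g : alg_hom H0 A" and \<gamma>: "extd \<gamma> g"
 shows "\<gamma> [] = \<one>[A]"
proof -
 note G = extd_gam[OF \<gamma>]
 have c: "\<gamma> [] : carrier A" using G by (simp add: gam_def)
 have gI: "\<gamma> I : carrier A" if "I : Wd N" for I N by (rule gamD[OF G that])
 have "\<one>[A] = pr \<gamma> (cfs (EB []))" using g extd_eq[OF \<gamma> H0_one(1)] unfolding alg_hom_iff by simp
 also have "... = (\<Oplus>\<^bsub>A\<^esub>I\<in>{[]}. 1 \<odot>[A] \<gamma> I)"
  unfolding pr_def H0_one(2) by (rule vs_finsum_cong[OF vA]) (use c vs_smult[OF vA c] in auto)
 also have "... = \<gamma> []" by (subst vs_finsum_insert[OF vA]) (use c vs_smult[OF vA c] in \<open>auto simp: vs_finsum_empty[OF vA]\<close>)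
 finally show ?thesis by simp
qed

subsection \<open>The pairing of scalar extensions\<close>

context
 fixes E :: "'e cmod" and F :: "'f cmod"
 assumes E: "vs E" and F: "vs F"
begin

abbreviation "EF \<equiv> tensor (tensor E F) A"

lemma vs_EF: "vs EF" by (rule vs_tensor[OF vs_tensor[OF E F] vA])

lemma pair_inner:
 assumes x: "x : carrier E" and a: "a : carrier A"
 shows "bilin F A EF (%y b. tens (tensor E F) A (tens E F x y) (a \<otimes>[A] b))"
proof (rule bilinI)
 note T = bilin_tens[OF vs_tensor[OF E F] vA]
 show "lin A EF (%b. tens (tensor E F) A (tens E F x y) (a \<otimes>[A] b))" if "y : carrier F" for y
  by (rule lin_comp[OF multA_l[OF a] bilin_left[OF T tens_closed[OF E F x that]]])
 show "lin F EF (%y. tens (tensor E F) A (tens E F x y) (a \<otimes>[A] b))" if "b : carrier A" for b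
  by (rule lin_comp[OF bilin_left[OF bilin_tens[OF E F] x] bilin_right[OF T mult_closedA[OF a that]]])
qed

lemma pair_outer:
 assumes v: "v : carrier (tensor F A)"
 shows "bilin E A EF (%x a. lin_ext EF (%(y, b). tens (tensor E F) A (tens E F x y) (a \<otimes>[A] b)) v)"
proof (rule bilinI)
 note T = bilin_tens[OF vs_tensor[OF E F] vA]
 fix x assume x: "x : carrier E"
 show "lin A EF (%a. lin_ext EF (%(y, b). tens (tensor E F) A (tens E F x y) (a \<otimes>[A] b)) v)"
 proof (rule lin_tensor_lift_param[OF F vA vs_EF vA pair_inner[OF x] _ v])
  fix y b assume yb: "y : carrier F" "b : carrier A"
  show "lin A EF (%a. tens (tensor E F) A (tens E F x y) (a \<otimes>[A] b))"
   by (rule lin_comp[OF multA_r[OF yb(2)] bilin_left[OF T tens_closed[OF E F x yb(1)]]])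
 qed
next
 note T = bilin_tens[OF vs_tensor[OF E F] vA]
 fix a assume a: "a : carrier A"
 show "lin E EF (%x. lin_ext EF (%(y, b). tens (tensor E F) A (tens E F x y) (a \<otimes>[A] b)) v)"
 proof (rule lin_tensor_lift_param[OF F vA vs_EF E pair_inner[OF _ a] _ v])
  fix y b assume yb: "y : carrier F" "b : carrier A"
  show "lin E EF (%x. tens (tensor E F) A (tens E F x y) (a \<otimes>[A] b))"
   by (rule lin_comp[OF bilin_right[OF bilin_tens[OF E F] yb(1)] bilin_right[OF T mult_closedA[OF a yb(2)]]])
 qed
qed

lemma pairing_bilin: "bilin (tensor E A) (tensor F A) EF (scalar_pairing E F A)"
proof (rule bilinI)
 note TF = vs_tensor[OF F vA]
 show "lin (tensor E A) EF (%u. scalar_pairing E F A u v)" if "v : carrier (tensor F A)" for v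
  unfolding scalar_pairing_def Let_def by (rule lin_tensor_lift[OF E vA vs_EF pair_outer[OF that]])
 show "lin (tensor F A) EF (scalar_pairing E F A u)" if u: "u : carrier (tensor E A)" for u
  unfolding scalar_pairing_def[abs_def] Let_def
  by (rule lin_tensor_lift_param[OF E vA vs_EF TF pair_outer lin_tensor_lift[OF F vA vs_EF pair_inner] u])
qed

lemma pairing_tens:
 assumes e: "e : carrier E" and a: "a : carrier A" and f: "f : carrier F" and b: "b : carrier A"
 shows "scalar_pairing E F A (tens E A e a) (tens F A f b) = tens (tensor E F) A (tens E F e f) (a \<otimes>[A] b)"
 unfolding scalar_pairing_def Let_def tensor_lift_tens[OF E vA vs_EF pair_outer[OF tens_closed[OF F vA f b]] e a]
 by (rule tensor_lift_tens[OF F vA vs_EF pair_inner[OF e a] f b])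

lemma ctr_pairing:
 assumes \<alpha>: "lf E \<alpha>" and \<mu>: "lf F \<mu>" and u: "u : carrier (tensor E A)" and v: "v : carrier (tensor F A)"
 shows "ctr_l A (ctr2 F \<alpha> \<mu>) (scalar_pairing E F A u v) = ctr_l A \<alpha> u \<otimes>[A] ctr_l A \<mu> v"
proof -
 note T = vs_tensor[OF E F]
 note c2 = lf_ctr2[OF E F \<alpha> \<mu>]
 note C = ctr_l[OF T vA c2(1)] and c\<alpha> = ctr_l[OF E vA \<alpha>] and c\<mu> = ctr_l[OF F vA \<mu>]
 show ?thesis
 proof (rule tensor_eqI[OF E vA vA lin_comp[OF bilin_right[OF pairing_bilin v] C(1)] lin_comp[OF c\<alpha>(1) multA_r[OF lin_closed[OF c\<mu>(1) v]]] _ u], goal_cases)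
  case (1 e a) note e = 1(1) and a = 1(2)
  note t = tens_closed[OF E vA e a]
  show ?case
  proof (rule tensor_eqI[OF F vA vA lin_comp[OF bilin_left[OF pairing_bilin t] C(1)] lin_comp[OF c\<mu>(1) multA_l[OF lin_closed[OF c\<alpha>(1) t]]] _ v], goal_cases)
   case (1 f b) note f = 1(1) and b = 1(2)
   show ?case
    unfolding pairing_tens[OF e a f b] C(2)[OF tens_closed[OF E F e f] mult_closedA[OF a b]] c2(2)[OF e f] c\<alpha>(2)[OF e a] c\<mu>(2)[OF f b]
     smultA(1)[OF a vs_smult[OF vA b]] smultA(2)[OF a b] vs_smult_smult[OF vA mult_closedA[OF a b]] ..
  qed
 qed
qed

text \<open>Product functionals \<open>\<alpha> \<otimes> \<mu>\<close> already separate the points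
  of a tensor product.\<close>

lemma pairing_eqI:
 assumes t: "t : carrier EF" "s : carrier EF"
  and e: "\<And>\<alpha> \<mu>. lf E \<alpha> ==> lf F \<mu> ==> ctr_l A (ctr2 F \<alpha> \<mu>) t = ctr_l A (ctr2 F \<alpha> \<mu>) s"
 shows "t = s"
proof (rule tensor_sep_eq[OF vs_tensor[OF E F] vA t, where L="{ctr2 F \<alpha> \<mu> | \<alpha> \<mu>. lf E \<alpha> \<and> lf F \<mu>}"])
 show "lf (tensor E F) h" if "h : {ctr2 F \<alpha> \<mu> | \<alpha> \<mu>. lf E \<alpha> \<and> lf F \<mu>}" for h
  using that lf_ctr2(1)[OF E F] by blast
 show "ctr_l A h t = ctr_l A h s" if "h : {ctr2 F \<alpha> \<mu> | \<alpha> \<mu>. lf E \<alpha> \<and> lf F \<mu>}" for h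
  using that e by blast
 show "v = \<zero>[tensor E F]" if v: "v : carrier (tensor E F)" and 0: "\<And>h. h : {ctr2 F \<alpha> \<mu> | \<alpha> \<mu>. lf E \<alpha> \<and> lf F \<mu>} ==> h v = 0" for v
 proof (rule tensor_sep2[OF E F v], goal_cases)
  case (1 \<alpha> \<mu>)
  then show ?case by (intro 0) blast
 qed
qed

end

text \<open>On pure tensors, contraction with \<open>\<alpha> \<otimes> \<mu>\<close> turns the
  claim into \<open>extd_mult\<close>.\<close>

lemma Lg_pairing:
 assumes g: "g : alg_hom H0 A" and \<gamma>: "extd \<gamma> g" and X: "uni X" and Y: "uni Y"
  and u: "u : carrier (tensor (fibre X) A)" and v: "v : carrier (tensor (fibre Y) A)"
 shows "Lg \<gamma> (conn_tensor \<Omega> X Y) (scalar_pairing (fibre X) (fibre Y) A u v) =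
  scalar_pairing (fibre X) (fibre Y) A (Lg \<gamma> X u) (Lg \<gamma> Y v)"
proof -
 note E = uniD(2)[OF X] and F = uniD(2)[OF Y]
 note P = uni_tensor[OF X Y] and fP = pre_conn_tensor(2)[OF uniD(1)[OF X] uniD(1)[OF Y]]
 note G = extd_gam[OF \<gamma>]
 note LX = lin_homD[OF Lg_hom[OF X G]] and LY = lin_homD[OF Lg_hom[OF Y G]] and LP = lin_homD[OF Lg_hom[OF P G], unfolded fP]
 note B = pairing_bilin[OF E F] and M = vs_EF[OF E F]
 show ?thesis
 proof (rule tensor_eqI[OF E vA M lin_comp[OF bilin_right[OF B v] LP] lin_comp[OF LX bilin_right[OF B lin_closed[OF LY v]]] _ u], goal_cases)
  case (1 e a) note e = 1(1) and a = 1(2)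
  note t = tens_closed[OF E vA e a]
  show ?case
  proof (rule tensor_eqI[OF F vA M lin_comp[OF bilin_left[OF B t] LP] lin_comp[OF LY bilin_left[OF B lin_closed[OF LX t]]] _ v], goal_cases)
   case (1 f b) note f = 1(1) and b = 1(2)
   note s = tens_closed[OF F vA f b]
   have tef: "tens (fibre X) (fibre Y) e f : carrier (fibre (conn_tensor \<Omega> X Y))" unfolding fP by (rule tens_closed[OF E F e f])
   show ?case
   proof (rule pairing_eqI[OF E F lin_closed[OF LP bilin_closed[OF B t s]] bilin_closed[OF B lin_closed[OF LX t] lin_closed[OF LY s]]], goal_cases)
    case (1 \<alpha> \<mu>) note \<alpha> = 1(1) and \<mu> = 1(2)
    have l2: "lf (fibre (conn_tensor \<Omega> X Y)) (ctr2 (fibre Y) \<alpha> \<mu>)" unfolding fP by (rule lf_ctr2(1)[OF E F \<alpha> \<mu>])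
    note LC = Lg_ctr[OF P G l2 tef mult_closedA[OF a b], unfolded fP]
    have p: "pr \<gamma> (cof X \<alpha> e) : carrier A" "pr \<gamma> (cof Y \<mu> f) : carrier A"
     by (rule pr_closed[OF G cof_supp[OF X \<alpha> e]], rule pr_closed[OF G cof_supp[OF Y \<mu> f]])
    show ?case
     unfolding pairing_tens[OF E F e a f b] ctr_pairing[OF E F \<alpha> \<mu> lin_closed[OF LX t] lin_closed[OF LY s]]
      Lg_ctr[OF X G \<alpha> e a] Lg_ctr[OF Y G \<mu> f b] LC extd_mult[OF g \<gamma> X Y e f \<alpha> \<mu>]
     by (simp only: assocA[OF p mult_closedA[OF a b]] assocA[OF p(1) a mult_closedA[OF p(2) b]] lcommA[OF a p(2) b])
   qed
  qed
 qed
qed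

end

subsection \<open>Tensor automorphisms and characters\<close>

context scalars
begin

section \<open>The unit object\<close>

lemma unit_facts: "pre_conn (unit_conn \<Omega>)" "fibre (unit_conn \<Omega>) = complex_line" "act (unit_conn \<Omega>) i z = 0"
 using trivial_conn[OF vs_complex_line] unfolding unit_conn_def by simp_all

lemma finite_dim_line: "finite_dim complex_line"
proof (rule finite_dimI[OF vs_complex_line])
 show "finite {1 :: complex}" "{1} \<subseteq> carrier complex_line" by simp_all
 fix U and v :: complex assume "submodule U CC complex_line" "{1} \<subseteq> U"
 then have "v \<odot>[complex_line] 1 : U" unfolding submodule_iff[OF vs_complex_line] by blast
 then show "v : U" by simp
qed

lemma uni_unit: "uni (unit_conn \<Omega>)"
 unfolding uni_def integrable_conn_iff
proof (intro conjI exI)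
 show "pre_conn (unit_conn \<Omega>)" by (rule unit_facts)
 show "finite_dim (fibre (unit_conn \<Omega>))" unfolding unit_facts by (rule finite_dim_line)
 show "flat (fibre (unit_conn \<Omega>)) (act (unit_conn \<Omega>))"
  unfolding flat_def unit_facts
 proof (intro allI impI ballI)
  fix \<phi> \<mu> and e :: complex assume "lf W2 \<phi>" "lf complex_line \<mu>"
  then have "\<mu> 0 = 0" using lf_zero[OF _ vs_complex_line, of \<mu>] by simp
  then show "(\<Sum>i\<in>D. \<Sum>j\<in>D. \<phi> (i \<cdot> j) * \<mu> 0) = 0" by simp
 qed
 show "nilp (fibre (unit_conn \<Omega>)) (act (unit_conn \<Omega>)) 1"
 proof -
  have "aw (act (unit_conn \<Omega>)) I e = 0" if l: "length I = 1" for I e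
  proof -
   obtain i where "I = [i]" using l by (auto simp: One_nat_def length_Suc_conv)
   then show ?thesis by (simp add: unit_facts)
  qed
  then show ?thesis unfolding nilp_def by (simp add: unit_facts(2))
 qed
qed

lemma cof_unit:
 assumes \<mu>: "lf complex_line \<mu>"
 shows "cof (unit_conn \<Omega>) \<mu> e = (%I. if I = [] then \<mu> e else 0)"
proof
 fix I
 have "\<mu> 0 = 0" using lf_zero[OF \<mu> vs_complex_line] by simp
 then show "cof (unit_conn \<Omega>) \<mu> e I = (if I = [] then \<mu> e else 0)"
  by (cases I) (simp_all add: cof_def unit_facts)
qed

lemma Lg_unit:
 assumes \<gamma>: "gam \<gamma>" "\<gamma> [] = \<one>[A]" and u: "u : carrier (scalar_ext (unit_conn \<Omega>) A)"
 shows "Lg \<gamma> (unit_conn \<Omega>) u = u"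
proof -
 note X = uni_unit
 note E = uniD(2)[OF X]
 note L = lin_homD[OF Lg_hom[OF X \<gamma>(1)]]
 show ?thesis
 proof (rule tensor_eqI[OF E vA vs_tensor[OF E vA] L lin_id _ u], goal_cases)
  case (1 e b) note e = 1(1) and b = 1(2)
  note t = tens_closed[OF E vA e b]
  show ?case
  proof (rule scalar_eqI[OF E lin_closed[OF L t] t], goal_cases)
   case (1 \<mu>) note \<mu> = 1(1)
   have c: "cof (unit_conn \<Omega>) \<mu> e = (%I. if I = [] then \<mu> e else 0)" by (rule cof_unit[OF \<mu>[unfolded unit_facts]])
   have p: "pr \<gamma> (cof (unit_conn \<Omega>) \<mu> e) = \<mu> e \<odot>[A] \<one>[A]"
   proof -
    have "cof (unit_conn \<Omega>) \<mu> e I \<odot>[A] \<gamma> I = \<zero>[A]" if "set I \<subseteq> D" "I \<noteq> []" for I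
    proof -
     have "\<gamma> I : carrier A" using \<gamma>(1) that(1) by (simp add: gam_def)
     then show ?thesis using that by (simp add: c vs_null[OF vA])
    qed
    from pr_delta[OF \<gamma>(1) this cof_supp[OF X \<mu> e]] show ?thesis by (simp add: c \<gamma>(2))
   qed
   show ?case
    unfolding Lg_ctr[OF X \<gamma>(1) \<mu> e b] p smultA(1)[OF one_closedA b] ctr_l(2)[OF E vA \<mu> e b] using b by simp
  qed
 qed
qed

lemma conn_hom_lin: "uni X ==> uni Y ==> T : conn_hom \<Omega> X Y ==> lin (fibre X) (fibre Y) T"
 using conn_hom_iff[OF uniD(1) uniD(1), of X Y T] by (simp add: lin_hom_iff)

lemma conn_hom_comp:
 assumes X: "uni X" and Y: "uni Y" and Z: "uni Z" and f: "f : conn_hom \<Omega> X Y" and g: "g : conn_hom \<Omega> Y Z"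
 shows "compose (carrier (fibre X)) g f : conn_hom \<Omega> X Z"
proof -
 note p = uniD(1)[OF X] uniD(1)[OF Y] uniD(1)[OF Z]
 have f': "f : lin_hom (fibre X) (fibre Y)" "\<forall>i\<in>D. \<forall>e\<in>carrier (fibre X). act Y i (f e) = f (act X i e)"
  using f unfolding conn_hom_iff[OF p(1,2)] by blast+
 have g': "g : lin_hom (fibre Y) (fibre Z)" "\<forall>i\<in>D. \<forall>e\<in>carrier (fibre Y). act Z i (g e) = g (act Y i e)"
  using g unfolding conn_hom_iff[OF p(2,3)] by blast+
 have "act Z i (compose (carrier (fibre X)) g f e) = compose (carrier (fibre X)) g f (act X i e)"
  if "i : D" "e : carrier (fibre X)" for i e
  using that f'(2) g'(2) lin_hom_closed[OF f'(1) that(2)] lin_closed[OF act_lin[OF p(1)] that(2)]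
  by (simp add: compose_def)
 then show ?thesis unfolding conn_hom_iff[OF p(1,3)] using lin_hom_compose[OF uniD(2)[OF X] f'(1) g'(1)] by blast
qed

lemma cof_hom_uni:
 assumes X: "uni X" and N: "nl X \<le> N" and \<mu>: "lf (fibre X) \<mu>"
 shows "restrict (cof X \<mu>) (carrier (fibre X)) : conn_hom \<Omega> X (Uobj N)"
proof (rule cof_hom[OF uniD(1)[OF X] uniD(3)[OF X] _ \<mu>])
 show "nilp (fibre X) (act X) N" unfolding nilp_def using word_zero[OF X] N by auto
qed

lemma cof_cong:
 assumes X: "uni X" and e: "e : carrier (fibre X)" and \<mu>: "\<And>x. x : carrier (fibre X) ==> \<mu> x = \<nu> x"
 shows "cof X \<mu> e = cof X \<nu> e"
proof
 fix I
 show "cof X \<mu> e I = cof X \<nu> e I"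
  unfolding cof_def using \<mu>[OF lin_closed[OF lin_word[OF X] e]] by simp
qed

lemma ctr_cong:
 assumes E: "vs E" and \<mu>: "lf E \<mu>" and \<nu>: "lf E \<nu>" and eq: "\<And>x. x : carrier E ==> \<mu> x = \<nu> x" and t: "t : carrier (tensor E A)"
 shows "ctr_l A \<mu> t = ctr_l A \<nu> t"
proof (rule tensor_eqI[OF E vA vA ctr_l(1)[OF E vA \<mu>] ctr_l(1)[OF E vA \<nu>] _ t], goal_cases)
 case (1 e a) note ea = 1(1-2)
 show ?case
  unfolding ctr_l(2)[OF E vA \<mu> ea] ctr_l(2)[OF E vA \<nu> ea] eq[OF ea(1)] ..
qed

lemma model_iso:
 assumes X: "uni X"
 shows "\<exists>(Z :: 'o object) T S. uni Z \<and> T : conn_iso \<Omega> X Z \<and> T : conn_hom \<Omega> X Z \<and> S : conn_hom \<Omega> Z X \<and>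
  (\<forall>x\<in>carrier (fibre X). S (T x) = x)"
proof -
 obtain n where n: "integrable_conn \<Omega> X" "nilp (fibre X) (act X) n" using X unfolding uni_def by blast
 obtain Z :: "'o object" and T where Z: "Z : unipotent_objects \<Omega>" "T : conn_iso \<Omega> X Z" by (rule model_object[OF n])
 have Z': "uni Z" using Z(1) unfolding uni_objects .
 have "\<exists>S\<in>conn_iso \<Omega> Z X. \<forall>x\<in>carrier (fibre X). S (T x) = x"
  by (rule conn_iso_inverse[OF uniD(1)[OF X] uniD(1)[OF Z'] Z(2)]) blast
 then obtain S where S: "S : conn_iso \<Omega> Z X" "\<forall>x\<in>carrier (fibre X). S (T x) = x" by blast
 have "T : conn_hom \<Omega> X Z" "S : conn_hom \<Omega> Z X" using Z(2) S(1) by (simp_all add: conn_iso_def)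
 then show ?thesis using Z' Z(2) S(2) by blast
qed

text \<open>Vectors \<open>e \<otimes> 1\<close> suffice, as tensor automorphisms are linear over
  \<open>A\<close>.\<close>

definition val :: "('o, 'u) aut_family => 'o object => ((nat => complex) => complex) => (nat => complex) => 'u" where
 "val l X \<mu> e = ctr_l A \<mu> (l X (tens (fibre X) A e \<one>[A]))"

lemma autD:
 assumes l: "l : tensor_auts \<Omega> A" and X: "uni X"
 shows "l X : lin_hom (tensor (fibre X) A) (tensor (fibre X) A)"
  "bij_betw (l X) (carrier (tensor (fibre X) A)) (carrier (tensor (fibre X) A))"
  "a : carrier A ==> u : carrier (tensor (fibre X) A) ==> l X (amul (fibre X) a u) = amul (fibre X) a (l X u)"
proof -
 have "l X : scalar_aut (fibre X) A" using l X unfolding tensor_auts_def uni_objects[symmetric] by (auto dest: PiE_mem)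
 then show "l X : lin_hom (tensor (fibre X) A) (tensor (fibre X) A)"
  "bij_betw (l X) (carrier (tensor (fibre X) A)) (carrier (tensor (fibre X) A))"
  "a : carrier A ==> u : carrier (tensor (fibre X) A) ==> l X (amul (fibre X) a u) = amul (fibre X) a (l X u)"
  unfolding scalar_aut_def by simp_all
qed

lemma aut_ext: "l : tensor_auts \<Omega> A ==> l : extensional (unipotent_objects \<Omega>)"
 unfolding tensor_auts_def PiE_def by blast

lemma aut_nat:
 assumes "l : tensor_auts \<Omega> A" "uni X" "uni Y" "T : conn_hom \<Omega> X Y" "u : carrier (scalar_ext X A)"
 shows "l Y (scalar_ext_map X Y A T u) = scalar_ext_map X Y A T (l X u)"
 using assms unfolding tensor_auts_def uni_objects[symmetric] by blast

lemma aut_tensor: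
 assumes "l : tensor_auts \<Omega> A" "uni X" "uni Y" "uni Z" "T : conn_iso \<Omega> (conn_tensor \<Omega> X Y) Z"
  "u : carrier (scalar_ext X A)" "v : carrier (scalar_ext Y A)"
 shows "l Z (scalar_ext_map (conn_tensor \<Omega> X Y) Z A T (scalar_pairing (fibre X) (fibre Y) A u v)) =
     scalar_ext_map (conn_tensor \<Omega> X Y) Z A T (scalar_pairing (fibre X) (fibre Y) A (l X u) (l Y v))"
 using assms unfolding tensor_auts_def uni_objects[symmetric] by blast

lemma aut_unit:
 assumes "l : tensor_auts \<Omega> A" "uni Z" "T : conn_iso \<Omega> (unit_conn \<Omega>) Z" "u : carrier (scalar_ext (unit_conn \<Omega>) A)"
 shows "l Z (scalar_ext_map (unit_conn \<Omega>) Z A T u) = scalar_ext_map (unit_conn \<Omega>) Z A T u"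
 using assms unfolding tensor_auts_def uni_objects[symmetric] by blast

lemma autI:
 assumes "l : extensional (unipotent_objects \<Omega>)"
  and "\<And>X. uni X ==> l X : lin_hom (tensor (fibre X) A) (tensor (fibre X) A)"
  and "\<And>X. uni X ==> bij_betw (l X) (carrier (tensor (fibre X) A)) (carrier (tensor (fibre X) A))"
  and "\<And>X a u. uni X ==> a : carrier A ==> u : carrier (tensor (fibre X) A) ==> l X (amul (fibre X) a u) = amul (fibre X) a (l X u)"
  and "\<And>X Y T u. uni X ==> uni Y ==> T : conn_hom \<Omega> X Y ==> u : carrier (scalar_ext X A) ==>
   l Y (scalar_ext_map X Y A T u) = scalar_ext_map X Y A T (l X u)"
  and "\<And>X Y Z T u v. uni X ==> uni Y ==> uni Z ==> T : conn_iso \<Omega> (conn_tensor \<Omega> X Y) Z ==>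
   u : carrier (scalar_ext X A) ==> v : carrier (scalar_ext Y A) ==>
   l Z (scalar_ext_map (conn_tensor \<Omega> X Y) Z A T (scalar_pairing (fibre X) (fibre Y) A u v)) =
     scalar_ext_map (conn_tensor \<Omega> X Y) Z A T (scalar_pairing (fibre X) (fibre Y) A (l X u) (l Y v))"
  and "\<And>Z T u. uni Z ==> T : conn_iso \<Omega> (unit_conn \<Omega>) Z ==> u : carrier (scalar_ext (unit_conn \<Omega>) A) ==>
   l Z (scalar_ext_map (unit_conn \<Omega>) Z A T u) = scalar_ext_map (unit_conn \<Omega>) Z A T u"
 shows "l : tensor_auts \<Omega> A"
 unfolding tensor_auts_def uni_objects
proof (intro CollectI conjI ballI PiE_I)
 show "l X : scalar_aut (fibre X) A" if "X : unipotent_objects \<Omega>" for X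
  using assms(2-4)[OF that[unfolded uni_objects]] unfolding scalar_aut_def by blast
 show "l X = undefined" if "X \<notin> unipotent_objects \<Omega>" for X using assms(1) that by (simp add: extensional_def)
qed (use assms(5-7) in \<open>simp_all only: uni_objects\<close>)

lemma lin_val:
 assumes l: "l : tensor_auts \<Omega> A" and X: "uni X" and \<mu>: "lf (fibre X) \<mu>"
 shows "lin (fibre X) A (val l X \<mu>)"
 unfolding val_def[abs_def]
 by (rule lin_comp[OF bilin_right[OF bilin_tens[OF uniD(2)[OF X] vA] one_closedA] lin_comp[OF lin_homD[OF autD(1)[OF l X]] ctr_l(1)[OF uniD(2)[OF X] vA \<mu>]]])

lemma aut_closed: "l : tensor_auts \<Omega> A ==> uni X ==> u : carrier (tensor (fibre X) A) ==> l X u : carrier (tensor (fibre X) A)"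
 by (rule lin_hom_closed[OF autD(1)])

lemma val_nat:
 assumes l: "l : tensor_auts \<Omega> A" and X: "uni X" and Y: "uni Y" and T: "T : conn_hom \<Omega> X Y" and \<nu>: "lf (fibre Y) \<nu>"
  and \<mu>: "lf (fibre X) \<mu>" "\<And>x. x : carrier (fibre X) ==> \<nu> (T x) = \<mu> x" and e: "e : carrier (fibre X)"
 shows "val l Y \<nu> (T e) = val l X \<mu> e"
proof -
 note E = uniD(2)[OF X] and F = uniD(2)[OF Y]
 note lT = conn_hom_lin[OF X Y T]
 note t = tens_closed[OF E vA e one_closedA]
 have "val l Y \<nu> (T e) = ctr_l A \<nu> (l Y (scalar_ext_map X Y A T (tens (fibre X) A e \<one>[A])))"
  unfolding val_def tensor_map_tens[OF E vA F vA lT lin_id e one_closedA] ..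
 also have "... = ctr_l A (%x. \<nu> (T x)) (l X (tens (fibre X) A e \<one>[A]))"
  unfolding aut_nat[OF l X Y T t] by (rule ctr_tensor_map[OF E F lT \<nu> aut_closed[OF l X t]])
 also have "... = val l X \<mu> e" unfolding val_def
  by (rule ctr_cong[OF E lin_comp[OF lT \<nu>] \<mu> aut_closed[OF l X t]])
 finally show ?thesis .
qed

text \<open>Naturality along \<open>cof X \<mu>\<close> followed by the map to a model
  \<open>Z\<close> of the universal object. On the right-hand side \<open>X\<close>, \<mu> and
  \<open>e\<close> occur only through the coefficient function.\<close>

lemma val_Uobj:
 assumes l: "l : tensor_auts \<Omega> A" and X: "uni X" and N: "nl X \<le> N" and \<mu>: "lf (fibre X) \<mu>" and e: "e : carrier (fibre X)"
  and Z: "uni Z" and T: "T : conn_hom \<Omega> (Uobj N) Z" and S: "S : conn_hom \<Omega> Z (Uobj N)"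
  and ST: "\<And>x. x : carrier (fibre (Uobj N)) ==> S (T x) = x"
 shows "val l X \<mu> e = val l Z (%z. S z []) (T (cof X \<mu> e))"
proof -
 note U = uni_Uobj[of N]
 have c: "cof X \<mu> x : carrier (fibre (Uobj N))" if "x : carrier (fibre X)" for x
  unfolding Uobj(2) by (rule cof_Uo_ge[OF X N \<mu> that])
 let ?F = "compose (carrier (fibre X)) T (restrict (cof X \<mu>) (carrier (fibre X)))"
 have F: "?F : conn_hom \<Omega> X Z" by (rule conn_hom_comp[OF X U Z cof_hom_uni[OF X N \<mu>] T])
 have Fx: "?F x = T (cof X \<mu> x)" if "x : carrier (fibre X)" for x using that by (simp add: compose_def)
 have \<nu>: "lf (fibre Z) (%z. S z [])" by (rule lin_comp[OF conn_hom_lin[OF Z U S] lf_Uobj_eval])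
 have "val l Z (%z. S z []) (?F e) = val l X \<mu> e"
 proof (rule val_nat[OF l X Z F \<nu> \<mu> _ e], goal_cases)
  case (1 x) note x = 1(1)
  show ?case unfolding Fx[OF x] ST[OF c[OF x]] by (simp add: cof_def)
 qed
 then show ?thesis unfolding Fx[OF e] by simp
qed

text \<open>Both objects are mapped to the model of one universal object, taken for the larger
  nilpotency order; there the two vectors coincide.\<close>

lemma val_consistent:
 assumes l: "l : tensor_auts \<Omega> A" and X: "uni X" "lf (fibre X) \<mu>" "e : carrier (fibre X)"
  and Y: "uni Y" "lf (fibre Y) \<nu>" "f : carrier (fibre Y)" and eq: "cof X \<mu> e = cof Y \<nu> f"
 shows "val l X \<mu> e = val l Y \<nu> f"
proof -
 let ?N = "max (nl X) (nl Y)"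
 obtain Z :: "'o object" and T S where Z: "uni Z" "T : conn_hom \<Omega> (Uobj ?N) Z" "S : conn_hom \<Omega> Z (Uobj ?N)"
  and ST0: "\<forall>x\<in>carrier (fibre (Uobj ?N)). S (T x) = x" using model_iso[OF uni_Uobj] by blast
  note ST = bspec[OF ST0]
 show ?thesis
  using val_Uobj[OF l X(1) max.cobounded1 X(2,3) Z ST] val_Uobj[OF l Y(1) max.cobounded2 Y(2,3) Z ST] eq by simp
qed

text \<open>One object and one functional serve all cocycles on words shorter than \<open>N\<close>,
  linearly in the cocycle. The linearity of the character in \<open>aut_corr\<close> comes from
  here.\<close>

lemma model_H0:
 "\<exists>(Z :: 'o object) T \<nu>. uni Z \<and> lin (Uo N) (fibre Z) T \<and> lf (fibre Z) \<nu> \<and> (\<forall>x\<in>carrier (Uo N). cof Z \<nu> (T x) = x)"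
proof -
 note U = uni_Uobj[of N]
 obtain Z :: "'o object" and T S where Z: "uni Z" "T : conn_hom \<Omega> (Uobj N) Z" "S : conn_hom \<Omega> Z (Uobj N)"
  and ST0: "\<forall>x\<in>carrier (fibre (Uobj N)). S (T x) = x" using model_iso[OF U] by blast
  note ST = bspec[OF ST0]
 show ?thesis
 proof (intro exI conjI ballI)
  show "uni Z" by (rule Z(1))
  show "lin (Uo N) (fibre Z) T" using conn_hom_lin[OF U Z(1,2)] unfolding Uobj(2) .
  show "lf (fibre Z) (%z. S z [])" by (rule lin_comp[OF conn_hom_lin[OF Z(1) U Z(3)] lf_Uobj_eval])
  fix x assume x: "x : carrier (Uo N)"
  then have x': "x : carrier (fibre (Uobj N))" unfolding Uobj(2) .
  have "cof Z (%z. S z []) (T x) = cof (Uobj N) (%x. S (T x) []) x" by (rule cof_nat[OF U Z(1,2) x'])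
  also have "... = cof (Uobj N) (%x. x []) x" by (rule cof_cong[OF U x']) (simp only: ST)
  also have "... = x" by (rule cof_Uobj[OF x])
  finally show "cof Z (%z. S z []) (T x) = x" .
 qed
qed

text \<open>A character \<open>g\<close> of the zeroth cohomology and a tensor automorphism \<open>l\<close> correspond to each other
  when \<open>g\<close> sends the generating series of the matrix coefficients of \<open>e\<close> to the matrix coefficients
  of \<open>l\<close> at \<open>e\<close>.\<close>

definition corr :: "('o, 'u) aut_family => (('o bar_word \<Rightarrow>\<^sub>0 complex) set => 'u) => bool" where
 "corr l g \<longleftrightarrow> (\<forall>X \<mu> e c. uni X --> lf (fibre X) \<mu> --> e : carrier (fibre X) --> c : carrier H0 -->
   cof X \<mu> e = cfs c --> g c = val l X \<mu> e)"

lemma corrD: "corr l g ==> uni X ==> lf (fibre X) \<mu> ==> e : carrier (fibre X) ==> c : carrier H0 ==>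
  cof X \<mu> e = cfs c ==> g c = val l X \<mu> e"
 unfolding corr_def by blast

lemma corr_unique:
 assumes "corr l g" "corr l g'" "g : lin_hom H0 A" "g' : lin_hom H0 A"
 shows "g = g'"
proof (rule lin_hom_eqI[OF assms(3,4)])
 fix c assume c: "c : carrier H0"
 obtain N where N: "cfs c : carrier (Uo N)" using H0_Uo[OF c] by blast
 obtain Z :: "'o object" and T \<nu> where Z: "uni Z" "lin (Uo N) (fibre Z) T" "lf (fibre Z) \<nu>"
  and cT0: "\<forall>x\<in>carrier (Uo N). cof Z \<nu> (T x) = x" using model_H0[of N] by blast
  note cT = bspec[OF cT0]
 note Tc = lin_closed[OF Z(2) N]
 show "g c = g' c" using corrD[OF assms(1) Z(1,3) Tc c cT[OF N]] corrD[OF assms(2) Z(1,3) Tc c cT[OF N]] by simp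
qed

text \<open>A cocycle is realised as a matrix coefficient and sent to the corresponding value of
  \<open>l\<close>; by \<open>val_consistent\<close> the realisation does not matter. Linearity uses
  a common object for two cocycles, multiplicativity the tensor square of that object, and the value
  at the unit comes from the unit object.\<close>

lemma aut_corr:
 assumes l: "l : tensor_auts \<Omega> A"
 shows "\<exists>g\<in>alg_hom H0 A. corr l g"
proof -
 define Q where "Q c v \<longleftrightarrow> (\<exists>X \<mu> e. uni X \<and> lf (fibre X) \<mu> \<and> e : carrier (fibre X) \<and> cof X \<mu> e = cfs c \<and> v = val l X \<mu> e)" for c v
 define g where "g = (\<lambda>c\<in>carrier H0. SOME v. Q c v)"
 have gv: "g c = val l X \<mu> e" if X: "uni X" "lf (fibre X) \<mu>" "e : carrier (fibre X)" and c: "c : carrier H0" and eq: "cof X \<mu> e = cfs c" for X \<mu> e c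
 proof -
  have q: "Q c (val l X \<mu> e)" unfolding Q_def using X eq by blast
  have "v = val l X \<mu> e" if "Q c v" for v
  proof -
   obtain Y \<nu> f where Y: "uni Y" "lf (fibre Y) \<nu>" "f : carrier (fibre Y)" "cof Y \<nu> f = cfs c" "v = val l Y \<nu> f"
    using \<open>Q c v\<close> unfolding Q_def by blast
   have "cof Y \<nu> f = cof X \<mu> e" using Y(4) eq by simp
   then show ?thesis unfolding Y(5) by (rule val_consistent[OF l Y(1-3) X])
  qed
  then have "(SOME v. Q c v) = val l X \<mu> e" using q by (intro some_equality)
  then show ?thesis using c by (simp add: g_def)
 qed
 have corr: "corr l g" unfolding corr_def using gv by blast
 have "g : alg_hom H0 A" unfolding alg_hom_iff
 proof (intro conjI ballI)
  have "lin H0 A g"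
  proof (rule linI)
   fix c assume c: "c : carrier H0"
   obtain N where N: "cfs c : carrier (Uo N)" using H0_Uo[OF c] by blast
   obtain Z :: "'o object" and T \<nu> where Z: "uni Z" "lin (Uo N) (fibre Z) T" "lf (fibre Z) \<nu>"
    and cT0: "\<forall>x\<in>carrier (Uo N). cof Z \<nu> (T x) = x" using model_H0[of N] by blast
  note cT = bspec[OF cT0]
   note gc = gv[OF Z(1,3) lin_closed[OF Z(2) N] c cT[OF N]]
   note lv = lin_val[OF l Z(1,3)]
   show "g c : carrier A" unfolding gc by (rule lin_closed[OF lv lin_closed[OF Z(2) N]])
   show "g (k \<odot>[H0] c) = k \<odot>[A] g c" for k
   proof -
    have e: "cfs (k \<odot>[H0] c) = k \<odot>[Uo N] cfs c" unfolding H0_simps Uo_simps using cfs_smult[OF H0_bar_carrier[OF c]] by (simp only: fun_eq_iff) simp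
    note kN = vs_smult[OF vs_Uo N, of k]
    have "g (k \<odot>[H0] c) = val l Z \<nu> (T (k \<odot>[Uo N] cfs c))"
     by (rule gv[OF Z(1,3) lin_closed[OF Z(2) kN] vs_smult[OF vs_H0 c]]) (simp only: cT[OF kN] e)
    also have "... = k \<odot>[A] val l Z \<nu> (T (cfs c))"
     unfolding lin_smult[OF Z(2) N] by (rule lin_smult[OF lv lin_closed[OF Z(2) N]])
    finally show ?thesis unfolding gc .
   qed
  next
   fix c d assume c: "c : carrier H0" and d: "d : carrier H0"
   obtain N where N: "cfs c : carrier (Uo N)" "cfs d : carrier (Uo N)" by (rule H0_common[OF c d])
   obtain Z :: "'o object" and T \<nu> where Z: "uni Z" "lin (Uo N) (fibre Z) T" "lf (fibre Z) \<nu>"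
    and cT0: "\<forall>x\<in>carrier (Uo N). cof Z \<nu> (T x) = x" using model_H0[of N] by blast
  note cT = bspec[OF cT0]
   note lv = lin_val[OF l Z(1,3)]
   have e: "cfs (c \<oplus>[H0] d) = cfs c \<oplus>[Uo N] cfs d" unfolding H0_simps Uo_simps using cfs_add[OF H0_bar_carrier[OF c] H0_bar_carrier[OF d]] by (simp only: fun_eq_iff) simp
   note kN = vs_add[OF vs_Uo N]
   have "g (c \<oplus>[H0] d) = val l Z \<nu> (T (cfs c \<oplus>[Uo N] cfs d))"
    by (rule gv[OF Z(1,3) lin_closed[OF Z(2) kN] vs_add[OF vs_H0 c d]]) (simp only: cT[OF kN] e)
   also have "... = val l Z \<nu> (T (cfs c)) \<oplus>[A] val l Z \<nu> (T (cfs d))"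
    unfolding lin_add[OF Z(2) N] by (rule lin_add[OF lv lin_closed[OF Z(2) N(1)] lin_closed[OF Z(2) N(2)]])
   finally show "g (c \<oplus>[H0] d) = g c \<oplus>[A] g d"
    unfolding gv[OF Z(1,3) lin_closed[OF Z(2) N(1)] c cT[OF N(1)]] gv[OF Z(1,3) lin_closed[OF Z(2) N(2)] d cT[OF N(2)]] .
  qed
  then show "g : lin_hom H0 A" by (simp add: lin_hom_iff g_def)
 next
  fix c d assume c: "c : carrier H0" and d: "d : carrier H0"
  obtain N where N: "cfs c : carrier (Uo N)" "cfs d : carrier (Uo N)" by (rule H0_common[OF c d])
  obtain Z :: "'o object" and T \<nu> where Z: "uni Z" "lin (Uo N) (fibre Z) T" "lf (fibre Z) \<nu>"
   and cT0: "\<forall>x\<in>carrier (Uo N). cof Z \<nu> (T x) = x" using model_H0[of N] by blast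
  note cT = bspec[OF cT0]
  note x = lin_closed[OF Z(2) N(1)] and y = lin_closed[OF Z(2) N(2)]
  let ?P = "conn_tensor \<Omega> Z Z" and ?t = "tens (fibre Z) (fibre Z) (T (cfs c)) (T (cfs d))"
  note P = uni_tensor[OF Z(1) Z(1)] and fP = pre_conn_tensor(2)[OF uniD(1)[OF Z(1)] uniD(1)[OF Z(1)]]
  note E = uniD(2)[OF Z(1)]
  \<comment> \<open>The tensor square of \<open>Z\<close> has a fibre of another type.
    \<open>Y\<close> is its model, and tensor compatibility of \<open>l\<close> is applied to
    \<open>T2\<close>.\<close>
  obtain Y :: "'o object" and T2 S2 where Y: "uni Y" "T2 : conn_iso \<Omega> ?P Y" "T2 : conn_hom \<Omega> ?P Y" "S2 : conn_hom \<Omega> Y ?P"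
   and ST0: "\<forall>x\<in>carrier (fibre ?P). S2 (T2 x) = x" using model_iso[OF P] by blast
  note ST = bspec[OF ST0]
  note F = uniD(2)[OF Y(1)]
  have t: "?t : carrier (fibre ?P)" unfolding fP by (rule tens_closed[OF E E x y])
  let ?\<kappa> = "ctr2 (fibre Z) \<nu> \<nu>"
  have \<kappa>: "lf (fibre ?P) ?\<kappa>" unfolding fP by (rule lf_ctr2(1)[OF E E Z(3) Z(3)])
  let ?\<nu> = "%z. ?\<kappa> (S2 z)"
  have \<nu>: "lf (fibre Y) ?\<nu>" by (rule lin_comp[OF conn_hom_lin[OF Y(1) P Y(4)] \<kappa>])
  note T2 = conn_hom_lin[OF P Y(1,3)]
  let ?u = "tens (fibre Z) A (T (cfs c)) \<one>[A]" and ?v = "tens (fibre Z) A (T (cfs d)) \<one>[A]"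
  note u = tens_closed[OF E vA x one_closedA] and v = tens_closed[OF E vA y one_closedA]
  have cf: "cof Y ?\<nu> (T2 ?t) = cfs (c \<otimes>[\<B>] d)"
  proof -
   have "cof Y ?\<nu> (T2 ?t) = cof ?P (%z. ?\<kappa> (S2 (T2 z))) ?t" by (rule cof_nat[OF P Y(1,3) t])
   also have "... = cof ?P ?\<kappa> ?t" by (rule cof_cong[OF P t]) (simp only: ST)
   also have "... = cfs (c \<otimes>[\<B>] d)"
    by (rule cof_mult[OF Z(1) Z(1) x y Z(3) Z(3) c cT[OF N(1), symmetric] d cT[OF N(2), symmetric], symmetric])
   finally show ?thesis .
  qed
  have w: "scalar_pairing (fibre Z) (fibre Z) A (l Z ?u) (l Z ?v) : carrier (tensor (fibre ?P) A)"
   unfolding fP by (rule bilin_closed[OF pairing_bilin[OF E E] aut_closed[OF l Z(1) u] aut_closed[OF l Z(1) v]])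
  have "g (c \<otimes>[\<B>] d) = val l Y ?\<nu> (T2 ?t)" by (rule gv[OF Y(1) \<nu> lin_closed[OF T2 t] H0_mult_closed[OF c d] cf])
  also have "... = ctr_l A ?\<nu> (l Y (scalar_ext_map ?P Y A T2 (scalar_pairing (fibre Z) (fibre Z) A ?u ?v)))"
   unfolding pairing_tens[OF E E x one_closedA y one_closedA] one_multA(1)[OF one_closedA] val_def
    tensor_map_tens[OF uniD(2)[OF P] vA F vA T2 lin_id t one_closedA, unfolded fP, folded fP] fP[symmetric] ..
  also have "... = ctr_l A (%z. ?\<nu> (T2 z)) (scalar_pairing (fibre Z) (fibre Z) A (l Z ?u) (l Z ?v))"
   unfolding aut_tensor[OF l Z(1) Z(1) Y(1,2) u v] by (rule ctr_tensor_map[OF uniD(2)[OF P] F T2 \<nu> w])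
  also have "... = ctr_l A ?\<kappa> (scalar_pairing (fibre Z) (fibre Z) A (l Z ?u) (l Z ?v))"
   by (rule ctr_cong[OF uniD(2)[OF P] lin_comp[OF T2 \<nu>] \<kappa> _ w]) (simp only: ST)
  also have "... = val l Z \<nu> (T (cfs c)) \<otimes>[A] val l Z \<nu> (T (cfs d))"
   unfolding val_def by (rule ctr_pairing[OF E E Z(3) Z(3) aut_closed[OF l Z(1) u] aut_closed[OF l Z(1) v]])
  finally show "g (c \<otimes>[\<B>] d) = g c \<otimes>[A] g d"
   unfolding gv[OF Z(1,3) x c cT[OF N(1)]] gv[OF Z(1,3) y d cT[OF N(2)]] .
 next
  note X = uni_unit
  note E = uniD(2)[OF X]
  obtain Z :: "'o object" and T S where Z: "uni Z" "T : conn_iso \<Omega> (unit_conn \<Omega>) Z" "T : conn_hom \<Omega> (unit_conn \<Omega>) Z" "S : conn_hom \<Omega> Z (unit_conn \<Omega>)"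
   and ST0: "\<forall>x\<in>carrier (fibre (unit_conn \<Omega>)). S (T x) = x" using model_iso[OF X] by blast
  note ST = bspec[OF ST0]
  note F = uniD(2)[OF Z(1)]
  note lT = conn_hom_lin[OF X Z(1,3)]
  have S: "lf (fibre Z) S" using conn_hom_lin[OF Z(1) X Z(4)] unfolding unit_facts .
  have 1: "1 : carrier (fibre (unit_conn \<Omega>))" unfolding unit_facts by simp
  note t1 = lin_closed[OF lT 1]
  \<comment> \<open>The unit of \<open>H0\<close>, concentrated on the empty word, is the matrix
    coefficient of the vector \<open>1\<close> of the unit object.\<close>
  have "cof Z S (T 1) = cof (unit_conn \<Omega>) (%x. S (T x)) 1" by (rule cof_nat[OF X Z(1,3) 1])
  also have "... = cof (unit_conn \<Omega>) (%x. x) 1" by (rule cof_cong[OF X 1]) (simp only: ST)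
  also have "... = cfs (EB [])" unfolding cof_unit[OF lin_id] H0_one(2) ..
  finally have "g (EB []) = val l Z S (T 1)" by (rule gv[OF Z(1) S t1 H0_one(1)])
  also have "... = ctr_l A S (tens (fibre Z) A (T 1) \<one>[A])"
   using aut_unit[OF l Z(1,2) tens_closed[OF E vA 1 one_closedA]]
   unfolding val_def tensor_map_tens[OF E vA F vA lT lin_id 1 one_closedA] by simp
  also have "... = S (T 1) \<odot>[A] \<one>[A]" by (rule ctr_l(2)[OF F vA S t1 one_closedA])
  also have "... = \<one>[A]" using ST[OF 1] by (simp add: vs_one[OF vA])
  finally show "g (EB []) = \<one>[A]" .
 qed
 then show ?thesis using corr by blast
qed

section \<open>From characters to tensor automorphisms\<close>

definition Lfam :: "('o list => 'u) => ('o, 'u) aut_family" where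
 "Lfam \<gamma> = (\<lambda>X\<in>unipotent_objects \<Omega>. Lg \<gamma> X)"

lemma Lfam_apply: "uni X ==> Lfam \<gamma> X = Lg \<gamma> X"
 by (simp add: Lfam_def uni_objects)

text \<open>Linearity over \<open>A\<close> and naturality hold for any family. Invertibility rests
  on \<gamma> being one at the empty word, and compatibility with tensor products on the
  multiplicativity of \<open>g\<close>.\<close>

lemma Lfam_aut:
 assumes g: "g : alg_hom H0 A" and \<gamma>: "extd \<gamma> g"
 shows "Lfam \<gamma> : tensor_auts \<Omega> A"
proof (rule autI)
 note G = extd_gam[OF \<gamma>] and one = extd_one[OF g \<gamma>]
 show "Lfam \<gamma> : extensional (unipotent_objects \<Omega>)" by (simp add: Lfam_def)
 fix X :: "'o object" assume X: "uni X"
 show "Lfam \<gamma> X : lin_hom (tensor (fibre X) A) (tensor (fibre X) A)" unfolding Lfam_apply[OF X] by (rule Lg_hom[OF X G])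
 show "bij_betw (Lfam \<gamma> X) (carrier (tensor (fibre X) A)) (carrier (tensor (fibre X) A))" unfolding Lfam_apply[OF X] by (rule Lg_bij[OF X G one])
 show "Lfam \<gamma> X (amul (fibre X) a u) = amul (fibre X) a (Lfam \<gamma> X u)" if "a : carrier A" "u : carrier (tensor (fibre X) A)" for a u
  unfolding Lfam_apply[OF X] by (rule Lg_alin[OF X G that])
 fix Y :: "'o object" assume Y: "uni Y"
 show "Lfam \<gamma> Y (scalar_ext_map X Y A T u) = scalar_ext_map X Y A T (Lfam \<gamma> X u)" if "T : conn_hom \<Omega> X Y" "u : carrier (scalar_ext X A)" for T u
  unfolding Lfam_apply[OF X] Lfam_apply[OF Y] by (rule Lg_nat[OF X Y G that])
 fix Z :: "'o object" and T u v
 assume Z: "uni Z" and T: "T : conn_iso \<Omega> (conn_tensor \<Omega> X Y) Z" and u: "u : carrier (scalar_ext X A)" and v: "v : carrier (scalar_ext Y A)"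
 have T': "T : conn_hom \<Omega> (conn_tensor \<Omega> X Y) Z" using T by (simp add: conn_iso_def)
 have w: "scalar_pairing (fibre X) (fibre Y) A u v : carrier (scalar_ext (conn_tensor \<Omega> X Y) A)"
  unfolding pre_conn_tensor(2)[OF uniD(1)[OF X] uniD(1)[OF Y]] by (rule bilin_closed[OF pairing_bilin[OF uniD(2)[OF X] uniD(2)[OF Y]] u v])
 show "Lfam \<gamma> Z (scalar_ext_map (conn_tensor \<Omega> X Y) Z A T (scalar_pairing (fibre X) (fibre Y) A u v)) =
     scalar_ext_map (conn_tensor \<Omega> X Y) Z A T (scalar_pairing (fibre X) (fibre Y) A (Lfam \<gamma> X u) (Lfam \<gamma> Y v))"
  unfolding Lfam_apply[OF X] Lfam_apply[OF Y] Lfam_apply[OF Z] Lg_nat[OF uni_tensor[OF X Y] Z G T' w] Lg_pairing[OF g \<gamma> X Y u v] ..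
next
 note G = extd_gam[OF \<gamma>] and one = extd_one[OF g \<gamma>]
 fix Z :: "'o object" and T u
 assume Z: "uni Z" and T: "T : conn_iso \<Omega> (unit_conn \<Omega>) Z" and u: "u : carrier (scalar_ext (unit_conn \<Omega>) A)"
 have T': "T : conn_hom \<Omega> (unit_conn \<Omega>) Z" using T by (simp add: conn_iso_def)
 show "Lfam \<gamma> Z (scalar_ext_map (unit_conn \<Omega>) Z A T u) = scalar_ext_map (unit_conn \<Omega>) Z A T u"
  unfolding Lfam_apply[OF Z] Lg_nat[OF uni_unit Z G T' u] Lg_unit[OF G one u] ..
qed

lemma corr_Lfam:
 assumes \<gamma>: "extd \<gamma> g"
 shows "corr (Lfam \<gamma>) g"
 unfolding corr_def
proof (intro allI impI)
 note G = extd_gam[OF \<gamma>]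
 fix X :: "'o object" and \<mu> e c
 assume X: "uni X" and \<mu>: "lf (fibre X) \<mu>" and e: "e : carrier (fibre X)" and c: "c : carrier H0" and eq: "cof X \<mu> e = cfs c"
 have "g c = pr \<gamma> (cof X \<mu> e)" unfolding extd_eq[OF \<gamma> c] eq ..
 also have "... = pr \<gamma> (cof X \<mu> e) \<otimes>[A] \<one>[A]" using pr_closed[OF G cof_supp[OF X \<mu> e]] by simp
 finally show "g c = val (Lfam \<gamma>) X \<mu> e" unfolding val_def Lfam_apply[OF X] Lg_ctr[OF X G \<mu> e one_closedA] .
qed

text \<open>Each matrix coefficient of an object is a cocycle (\<open>cof_H0\<close>), so
  \<open>g\<close> prescribes all matrix coefficients of the automorphism at vectors
  \<open>e \<otimes> 1\<close>, and these determine it.\<close>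

lemma corr_aut_unique:
 assumes l: "l : tensor_auts \<Omega> A" "l' : tensor_auts \<Omega> A" and c: "corr l g" "corr l' g"
 shows "l = l'"
proof (rule extensionalityI[OF aut_ext[OF l(1)] aut_ext[OF l(2)]], goal_cases)
 case (1 X)
 then have X: "uni X" unfolding uni_objects .
 note E = uniD(2)[OF X]
 note a = autD[OF l(1) X] and b = autD[OF l(2) X]
 show ?case
 proof (rule lin_hom_eqI[OF a(1) b(1)], goal_cases)
  case (1 u) note u = 1(1)
  show ?case
  proof (rule alin_eqI[OF E E lin_homD[OF a(1)] lin_homD[OF b(1)] a(3) b(3) _ u])
   fix e assume e: "e : carrier (fibre X)"
   note t = tens_closed[OF E vA e one_closedA]
   show "l X (tens (fibre X) A e \<one>[A]) = l' X (tens (fibre X) A e \<one>[A])"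
   proof (rule scalar_eqI[OF E aut_closed[OF l(1) X t] aut_closed[OF l(2) X t]], goal_cases)
    case (1 \<mu>) note \<mu> = 1(1)
    note h = cof_H0[OF X \<mu> e]
    show ?case
     using corrD[OF c(1) X \<mu> e h(1) h(2)[symmetric]] corrD[OF c(2) X \<mu> e h(1) h(2)[symmetric]] by (simp add: val_def)
   qed
  qed
 qed
qed

end

subsection \<open>The group of tensor automorphisms\<close>

context scalars
begin

lemma map_closed:
 assumes "uni X" "uni Y" "T : conn_hom \<Omega> X Y" "u : carrier (scalar_ext X A)"
 shows "scalar_ext_map X Y A T u : carrier (scalar_ext Y A)"
 by (rule lin_closed[OF lin_tensor_map[OF uniD(2)[OF assms(1)] vA uniD(2)[OF assms(2)] vA conn_hom_lin[OF assms(1-3)] lin_id] assms(4)])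

lemma pair_closed:
 assumes "uni X" "uni Y" "u : carrier (scalar_ext X A)" "v : carrier (scalar_ext Y A)"
 shows "scalar_pairing (fibre X) (fibre Y) A u v : carrier (scalar_ext (conn_tensor \<Omega> X Y) A)"
 unfolding pre_conn_tensor(2)[OF uniD(1)[OF assms(1)] uniD(1)[OF assms(2)]]
 by (rule bilin_closed[OF pairing_bilin[OF uniD(2)[OF assms(1)] uniD(2)[OF assms(2)]] assms(3,4)])

lemma iso_hom: "T : conn_iso \<Omega> X Y ==> T : conn_hom \<Omega> X Y"
 by (simp add: conn_iso_def)

lemma aut_eqI:
 assumes l: "l : tensor_auts \<Omega> A" "l' : tensor_auts \<Omega> A"
  and e: "\<And>X u. uni X ==> u : carrier (tensor (fibre X) A) ==> l X u = l' X u"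
 shows "l = l'"
proof (rule extensionalityI[OF aut_ext[OF l(1)] aut_ext[OF l(2)]], goal_cases)
 case (1 X)
 then have X: "uni X" unfolding uni_objects .
 show ?case by (rule lin_hom_eqI[OF autD(1)[OF l(1) X] autD(1)[OF l(2) X] e[OF X]])
qed

definition acomp :: "('o, 'u) aut_family => ('o, 'u) aut_family => ('o, 'u) aut_family" where
 "acomp l l' = (\<lambda>X\<in>unipotent_objects \<Omega>. compose (carrier (scalar_ext X A)) (l X) (l' X))"

lemma acomp_apply: "uni X ==> u : carrier (scalar_ext X A) ==> acomp l l' X u = l X (l' X u)"
 by (simp add: acomp_def uni_objects compose_def)

lemma acomp_aut:
 assumes l: "l : tensor_auts \<Omega> A" and l': "l' : tensor_auts \<Omega> A"
 shows "acomp l l' : tensor_auts \<Omega> A"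
proof (rule autI)
 show "acomp l l' : extensional (unipotent_objects \<Omega>)" by (simp add: acomp_def)
 fix X :: "'o object" assume X: "uni X"
 have aX: "acomp l l' X = compose (carrier (scalar_ext X A)) (l X) (l' X)" using X by (simp add: acomp_def uni_objects)
 note E = uniD(2)[OF X]
 show "acomp l l' X : lin_hom (tensor (fibre X) A) (tensor (fibre X) A)"
  unfolding aX by (rule lin_hom_compose[OF vs_tensor[OF E vA] autD(1)[OF l' X] autD(1)[OF l X]])
 show "bij_betw (acomp l l' X) (carrier (tensor (fibre X) A)) (carrier (tensor (fibre X) A))"
  unfolding aX by (rule bij_betw_compose[OF autD(2)[OF l' X] autD(2)[OF l X]])
 note c = aut_closed[OF l' X]
 show "acomp l l' X (amul (fibre X) a u) = amul (fibre X) a (acomp l l' X u)"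
  if "a : carrier A" "u : carrier (tensor (fibre X) A)" for a u
  unfolding acomp_apply[OF X that(2)] acomp_apply[OF X lin_closed[OF amul(1)[OF E that(1)] that(2)]] autD(3)[OF l' X that] autD(3)[OF l X that(1) c[OF that(2)]] ..
 fix Y :: "'o object" assume Y: "uni Y"
 show "acomp l l' Y (scalar_ext_map X Y A T u) = scalar_ext_map X Y A T (acomp l l' X u)"
  if T: "T : conn_hom \<Omega> X Y" and u: "u : carrier (scalar_ext X A)" for T u
  unfolding acomp_apply[OF X u] acomp_apply[OF Y map_closed[OF X Y T u]] aut_nat[OF l' X Y T u] aut_nat[OF l X Y T c[OF u]] ..
 fix Z :: "'o object" and T u v
 assume Z: "uni Z" and T: "T : conn_iso \<Omega> (conn_tensor \<Omega> X Y) Z" and u: "u : carrier (scalar_ext X A)" and v: "v : carrier (scalar_ext Y A)"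
 note w = map_closed[OF uni_tensor[OF X Y] Z iso_hom[OF T] pair_closed[OF X Y u v]]
 show "acomp l l' Z (scalar_ext_map (conn_tensor \<Omega> X Y) Z A T (scalar_pairing (fibre X) (fibre Y) A u v)) =
     scalar_ext_map (conn_tensor \<Omega> X Y) Z A T (scalar_pairing (fibre X) (fibre Y) A (acomp l l' X u) (acomp l l' Y v))"
  unfolding acomp_apply[OF Z w] acomp_apply[OF X u] acomp_apply[OF Y v] aut_tensor[OF l' X Y Z T u v]
   aut_tensor[OF l X Y Z T c[OF u] aut_closed[OF l' Y v]] ..
next
 fix Z :: "'o object" and T u
 assume Z: "uni Z" and T: "T : conn_iso \<Omega> (unit_conn \<Omega>) Z" and u: "u : carrier (scalar_ext (unit_conn \<Omega>) A)"
 show "acomp l l' Z (scalar_ext_map (unit_conn \<Omega>) Z A T u) = scalar_ext_map (unit_conn \<Omega>) Z A T u"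
  unfolding acomp_apply[OF Z map_closed[OF uni_unit Z iso_hom[OF T] u]] aut_unit[OF l' Z T u] aut_unit[OF l Z T u] ..
qed

definition aone :: "('o, 'u) aut_family" where
 "aone = (\<lambda>X\<in>unipotent_objects \<Omega>. \<lambda>u\<in>carrier (scalar_ext X A). u)"

lemma aone_apply: "uni X ==> u : carrier (scalar_ext X A) ==> aone X u = u"
 by (simp add: aone_def uni_objects)

lemma aone_aut: "aone : tensor_auts \<Omega> A"
proof (rule autI)
 show "aone : extensional (unipotent_objects \<Omega>)" by (simp add: aone_def)
 fix X :: "'o object" assume X: "uni X"
 have aX: "aone X = restrict (%u. u) (carrier (scalar_ext X A))" using X by (simp add: aone_def uni_objects)
 note E = uniD(2)[OF X]
 show "aone X : lin_hom (tensor (fibre X) A) (tensor (fibre X) A)" unfolding aX by (rule lin_restrict[OF vs_tensor[OF E vA] lin_id])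
 show "bij_betw (aone X) (carrier (tensor (fibre X) A)) (carrier (tensor (fibre X) A))"
  unfolding aX by (auto simp: bij_betw_def inj_on_def)
 show "aone X (amul (fibre X) a u) = amul (fibre X) a (aone X u)"
  if "a : carrier A" "u : carrier (tensor (fibre X) A)" for a u
  unfolding aone_apply[OF X that(2)] aone_apply[OF X lin_closed[OF amul(1)[OF E that(1)] that(2)]] ..
 fix Y :: "'o object" assume Y: "uni Y"
 show "aone Y (scalar_ext_map X Y A T u) = scalar_ext_map X Y A T (aone X u)"
  if T: "T : conn_hom \<Omega> X Y" and u: "u : carrier (scalar_ext X A)" for T u
  unfolding aone_apply[OF X u] aone_apply[OF Y map_closed[OF X Y T u]] ..
 fix Z :: "'o object" and T u v
 assume Z: "uni Z" and T: "T : conn_iso \<Omega> (conn_tensor \<Omega> X Y) Z" and u: "u : carrier (scalar_ext X A)" and v: "v : carrier (scalar_ext Y A)"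
 note w = map_closed[OF uni_tensor[OF X Y] Z iso_hom[OF T] pair_closed[OF X Y u v]]
 show "aone Z (scalar_ext_map (conn_tensor \<Omega> X Y) Z A T (scalar_pairing (fibre X) (fibre Y) A u v)) =
     scalar_ext_map (conn_tensor \<Omega> X Y) Z A T (scalar_pairing (fibre X) (fibre Y) A (aone X u) (aone Y v))"
  unfolding aone_apply[OF Z w] aone_apply[OF X u] aone_apply[OF Y v] ..
next
 fix Z :: "'o object" and T u
 assume Z: "uni Z" and T: "T : conn_iso \<Omega> (unit_conn \<Omega>) Z" and u: "u : carrier (scalar_ext (unit_conn \<Omega>) A)"
 show "aone Z (scalar_ext_map (unit_conn \<Omega>) Z A T u) = scalar_ext_map (unit_conn \<Omega>) Z A T u"
  by (rule aone_apply[OF Z map_closed[OF uni_unit Z iso_hom[OF T] u]])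
qed

text \<open>The inverses of the components inherit every compatibility from \<open>l\<close>: apply
  \<open>l\<close> to the claimed equation and cancel. The fact \<open>can\<close> is this
  cancellation.\<close>

lemma aut_inverse:
 assumes l: "l : tensor_auts \<Omega> A"
 shows "\<exists>l'\<in>tensor_auts \<Omega> A. acomp l' l = aone"
proof -
 let ?P = "%X S. S : lin_hom (tensor (fibre X) A) (tensor (fibre X) A) \<and> bij_betw S (carrier (tensor (fibre X) A)) (carrier (tensor (fibre X) A)) \<and>
  (\<forall>u\<in>carrier (tensor (fibre X) A). S (l X u) = u \<and> l X (S u) = u)"
 have "\<exists>S. ?P X S" if X: "uni X" for X
  by (rule bij_lin_inverse[OF vs_tensor[OF uniD(2)[OF X] vA] vs_tensor[OF uniD(2)[OF X] vA] autD(1,2)[OF l X]]) blast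
 then have "\<forall>X\<in>unipotent_objects \<Omega>. \<exists>S. ?P X S" unfolding uni_objects[symmetric] by blast
 from bchoice[OF this] obtain l0 where l0: "\<forall>X\<in>unipotent_objects \<Omega>. ?P X (l0 X)" by blast
 define l' where "l' = restrict l0 (unipotent_objects \<Omega>)"
 have P: "?P X (l' X)" if "uni X" for X
 proof -
  have X: "X : unipotent_objects \<Omega>" using that unfolding uni_objects .
  then have e: "l' X = l0 X" by (simp add: l'_def)
  show ?thesis unfolding e by (rule bspec[OF l0 X])
 qed
 have h: "l' X : lin_hom (tensor (fibre X) A) (tensor (fibre X) A)" if "uni X" for X using P[OF that] by blast
 have c: "l' X u : carrier (tensor (fibre X) A)" if "uni X" "u : carrier (tensor (fibre X) A)" for X u
  by (rule lin_hom_closed[OF h[OF that(1)] that(2)])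
 have r: "l X (l' X u) = u" if "uni X" "u : carrier (tensor (fibre X) A)" for X u using P[OF that(1)] that(2) by blast
 have can: "l' X w = v" if "uni X" "v : carrier (tensor (fibre X) A)" "l X v = w" for X v w
  using P[OF that(1)] that(2,3) by blast
 have "l' : tensor_auts \<Omega> A"
 proof (rule autI)
  show "l' : extensional (unipotent_objects \<Omega>)" by (simp add: l'_def)
  fix X :: "'o object" assume X: "uni X"
  show "l' X : lin_hom (tensor (fibre X) A) (tensor (fibre X) A)" by (rule h[OF X])
  show "bij_betw (l' X) (carrier (tensor (fibre X) A)) (carrier (tensor (fibre X) A))" using P[OF X] by blast
  note E = uniD(2)[OF X]
  show "l' X (amul (fibre X) a u) = amul (fibre X) a (l' X u)" if a: "a : carrier A" and u: "u : carrier (tensor (fibre X) A)" for a u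
   by (rule can[OF X lin_closed[OF amul(1)[OF E a] c[OF X u]]]) (simp only: autD(3)[OF l X a c[OF X u]] r[OF X u])
  fix Y :: "'o object" assume Y: "uni Y"
  show "l' Y (scalar_ext_map X Y A T u) = scalar_ext_map X Y A T (l' X u)"
   if T: "T : conn_hom \<Omega> X Y" and u: "u : carrier (scalar_ext X A)" for T u
   by (rule can[OF Y map_closed[OF X Y T c[OF X u]]]) (simp only: aut_nat[OF l X Y T c[OF X u]] r[OF X u])
  fix Z :: "'o object" and T u v
  assume Z: "uni Z" and T: "T : conn_iso \<Omega> (conn_tensor \<Omega> X Y) Z" and u: "u : carrier (scalar_ext X A)" and v: "v : carrier (scalar_ext Y A)"
  show "l' Z (scalar_ext_map (conn_tensor \<Omega> X Y) Z A T (scalar_pairing (fibre X) (fibre Y) A u v)) =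
      scalar_ext_map (conn_tensor \<Omega> X Y) Z A T (scalar_pairing (fibre X) (fibre Y) A (l' X u) (l' Y v))"
   by (rule can[OF Z map_closed[OF uni_tensor[OF X Y] Z iso_hom[OF T] pair_closed[OF X Y c[OF X u] c[OF Y v]]]])
    (simp only: aut_tensor[OF l X Y Z T c[OF X u] c[OF Y v]] r[OF X u] r[OF Y v])
 next
  fix Z :: "'o object" and T u
  assume Z: "uni Z" and T: "T : conn_iso \<Omega> (unit_conn \<Omega>) Z" and u: "u : carrier (scalar_ext (unit_conn \<Omega>) A)"
  show "l' Z (scalar_ext_map (unit_conn \<Omega>) Z A T u) = scalar_ext_map (unit_conn \<Omega>) Z A T u"
   by (rule can[OF Z map_closed[OF uni_unit Z iso_hom[OF T] u] aut_unit[OF l Z T u]])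
 qed
 moreover from this have "acomp l' l = aone"
 proof (rule aut_eqI[OF acomp_aut[OF _ l] aone_aut], goal_cases)
  case (1 X u) note X = 1(1) and u = 1(2)
  show ?case unfolding acomp_apply[OF X u] aone_apply[OF X u] by (rule can[OF X u refl])
 qed
 ultimately show ?thesis by blast
qed

lemma pi1_simps: "carrier (pi1_un \<Omega> A) = tensor_auts \<Omega> A" "l \<otimes>[pi1_un \<Omega> A] l' = acomp l l'" "\<one>[pi1_un \<Omega> A] = aone"
 by (simp_all add: pi1_un_def acomp_def aone_def)

lemma group_pi1: "group (pi1_un \<Omega> A)"
proof (rule groupI; (unfold pi1_simps)?)
 show "aone : tensor_auts \<Omega> A" by (rule aone_aut)
 fix l assume l: "l : tensor_auts \<Omega> A"
 show "acomp aone l = l"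
  by (rule aut_eqI[OF acomp_aut[OF aone_aut l] l]) (simp only: acomp_apply aone_apply aut_closed[OF l])
 show "\<exists>l'\<in>tensor_auts \<Omega> A. acomp l' l = aone" by (rule aut_inverse[OF l])
 fix l' assume l': "l' : tensor_auts \<Omega> A"
 show "acomp l l' : tensor_auts \<Omega> A" by (rule acomp_aut[OF l l'])
 fix l'' assume l'': "l'' : tensor_auts \<Omega> A"
 show "acomp (acomp l l') l'' = acomp l (acomp l' l'')"
  by (rule aut_eqI[OF acomp_aut[OF acomp_aut[OF l l'] l''] acomp_aut[OF l acomp_aut[OF l' l'']]])
   (simp only: acomp_apply aut_closed[OF l''])
qed

subsection \<open>The coproduct\<close>

lemma tensor_eqI2:
 assumes E: "vs E" and F: "vs F" and t: "t : carrier (tensor E F)" "s : carrier (tensor E F)"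
  and e: "\<And>\<alpha> \<mu>. lf E \<alpha> ==> lf F \<mu> ==> ctr2 F \<alpha> \<mu> t = ctr2 F \<alpha> \<mu> s"
 shows "t = s"
proof -
 note T = vs_tensor[OF E F]
 note m = vs_smult[OF T t(2), of "-1"]
 have "t \<oplus>[tensor E F] (-1) \<odot>[tensor E F] s = \<zero>[tensor E F]"
 proof (rule tensor_sep2[OF E F vs_add[OF T t(1) m]], goal_cases)
  case (1 \<alpha> \<mu>) note a = 1(1-2)
  note c = lf_ctr2(1)[OF E F a]
  show ?case
   unfolding lf_add[OF c t(1) m] lf_smult[OF c t(2)] e[OF a] by simp
 qed
 then show ?thesis using vs_eq_iff[OF T t] by simp
qed

lemma Uo_suffix: "set J \<subseteq> D ==> x : carrier (Uo N) ==> (%I. x (I @ J)) : carrier (Uo N)"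
 using aw_Uobj[of J x N] by auto

text \<open>\<open>Rel\<close> quantifies over the words on both sides of the relation, so it
  survives fixing an initial piece. Together with \<open>Uo_suffix\<close> this places both legs of
  the coproduct of a cocycle in cocycles.\<close>

lemma Uo_prefix:
 assumes J: "set J \<subseteq> D" and x: "x : carrier (Uo N)"
 shows "(%I. x (J @ I)) : carrier (Uo N)"
 unfolding carrier_Uo
proof (intro conjI allI impI)
 have x0: "\<And>I. I \<notin> Wd N ==> x I = 0" and R: "Rel x" using x unfolding carrier_Uo by blast+
 show "x (J @ I) = 0" if "I \<notin> Wd N" for I using that J by (intro x0) (auto simp: Wd_def)
 show "Rel (%I. x (J @ I))" unfolding Rel_def
 proof (intro allI impI)
  fix u v \<phi> assume uv: "set u \<subseteq> D" "set v \<subseteq> D" "lf W2 \<phi>"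
  have "set (J @ u) \<subseteq> D" using J uv(1) by simp
  then have "(\<Sum>i\<in>D. \<Sum>j\<in>D. \<phi> (i \<cdot> j) * x ((J @ u) @ [i, j] @ v)) = 0" using R uv(2,3) unfolding Rel_def by blast
  then show "(\<Sum>i\<in>D. \<Sum>j\<in>D. \<phi> (i \<cdot> j) * x (J @ u @ [i, j] @ v)) = 0" by simp
 qed
qed

lemma lf_el:
 assumes F: "lf \<B> F"
 shows "F (el N y) = (\<Sum>I\<in>Wd N. y I * F (EB I))"
proof -
 have "F (el N y) = (\<Sum>I\<in>Wd N. F (y I \<odot>[\<B>] EB I))"
  unfolding el_def by (rule lf_finsum[OF F vs_bar vs_smult[OF vs_bar EB_closed]])
 also have "... = (\<Sum>I\<in>Wd N. y I * F (EB I))" by (rule sum.cong[OF refl lf_smult[OF F EB_closed]])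
 finally show ?thesis .
qed

lemma ret_bar: "lin \<B> \<B> ret"
 by (rule lin_comp[OF ret(1) lin_H0_incl])

text \<open>\<open>ret\<close> fixes cocycles, so it may be inserted at the words of a sum whose
  coefficients form a cocycle.\<close>

lemma ret_sum:
 assumes F: "lf \<B> F" and y: "y : carrier (Uo N)"
 shows "(\<Sum>I\<in>Wd N. y I * F (ret (EB I))) = (\<Sum>I\<in>Wd N. y I * F (EB I))"
 using lf_el[OF lin_comp[OF ret_bar F], of N y] lf_el[OF F, of N y] ret(2)[OF Uo_H0[OF y]] by simp

text \<open>The retraction is removed from one leg at a time. For fixed \<open>I\<close> the
  function \<open>J \<mapsto> x (I @ J)\<close> is a cocycle, which frees the second leg; for fixed
  \<open>J\<close> the function \<open>I \<mapsto> x (I @ J)\<close> is one, which frees the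
  first.\<close>

lemma ret_comult:
 assumes c: "c : carrier H0" and f: "lf \<B> f" and \<psi>: "lf \<B> \<psi>"
 shows "ctr2 \<B> (%x. f (ret x)) (%x. \<psi> (ret x)) (bar_comult \<Omega> c) = ctr2 \<B> f \<psi> (bar_comult \<Omega> c)"
proof -
 obtain N where N: "cfs c : carrier (Uo N)" "c = el N (cfs c)" using H0_Uo[OF c] by blast
 let ?x = "cfs c"
 have s: "\<And>I. I \<notin> Wd N ==> ?x I = 0" using N(1) unfolding carrier_Uo by blast
 note rf = lin_comp[OF ret_bar f] and r\<psi> = lin_comp[OF ret_bar \<psi>]
 have ex: "ctr2 \<B> f \<psi> (bar_comult \<Omega> c) = (\<Sum>I\<in>Wd N. \<Sum>J\<in>Wd N. ?x (I @ J) * (f (EB I) * \<psi> (EB J)))"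
  if f: "lf \<B> f" and \<psi>: "lf \<B> \<psi>" for f \<psi>
 proof -
  note c2 = lf_ctr2[OF vs_bar vs_bar f \<psi>]
  have "ctr2 \<B> f \<psi> (bar_comult \<Omega> c) = ctr2 \<B> f \<psi> (bar_comult \<Omega> (el N ?x))" using N(2) by simp
  also have "... = (\<Sum>I\<in>Wd N. \<Sum>J\<in>Wd N. ?x (I @ J) * ctr2 \<B> f \<psi> (tB (EB I) (EB J)))" by (rule bar_comult_el[OF c2(1) s])
  also have "... = (\<Sum>I\<in>Wd N. \<Sum>J\<in>Wd N. ?x (I @ J) * (f (EB I) * \<psi> (EB J)))"
   by (intro sum.cong refl) (simp only: c2(2)[OF EB_closed EB_closed])
  finally show ?thesis .
 qed
 have J: "set J \<subseteq> D" if "J : Wd N" for J using that by (simp add: Wd_def)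
 have "ctr2 \<B> (%x. f (ret x)) (%x. \<psi> (ret x)) (bar_comult \<Omega> c) = (\<Sum>I\<in>Wd N. \<Sum>J\<in>Wd N. ?x (I @ J) * (f (ret (EB I)) * \<psi> (ret (EB J))))"
  by (rule ex[OF rf r\<psi>])
 also have "... = (\<Sum>I\<in>Wd N. f (ret (EB I)) * (\<Sum>J\<in>Wd N. ?x (I @ J) * \<psi> (ret (EB J))))"
  by (simp add: sum_distrib_left mult.left_commute)
 also have "... = (\<Sum>I\<in>Wd N. f (ret (EB I)) * (\<Sum>J\<in>Wd N. ?x (I @ J) * \<psi> (EB J)))"
  by (rule sum.cong[OF refl]) (simp only: ret_sum[OF \<psi> Uo_prefix[OF J N(1)]])
 also have "... = (\<Sum>J\<in>Wd N. \<psi> (EB J) * (\<Sum>I\<in>Wd N. ?x (I @ J) * f (ret (EB I))))"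
  unfolding sum_distrib_left by (subst sum.swap) (simp add: mult.left_commute mult.commute)
 also have "... = (\<Sum>J\<in>Wd N. \<psi> (EB J) * (\<Sum>I\<in>Wd N. ?x (I @ J) * f (EB I)))"
  by (rule sum.cong[OF refl]) (simp only: ret_sum[OF f Uo_suffix[OF J N(1)]])
 also have "... = (\<Sum>I\<in>Wd N. \<Sum>J\<in>Wd N. ?x (I @ J) * (f (EB I) * \<psi> (EB J)))"
  unfolding sum_distrib_left by (subst sum.swap) (simp add: mult.left_commute mult.commute)
 also have "... = ctr2 \<B> f \<psi> (bar_comult \<Omega> c)" by (rule ex[OF f \<psi>, symmetric])
 finally show ?thesis .
qed

text \<open>The tensor square of \<open>ret\<close> is a left inverse of the map from
  \<open>H0 \<otimes> H0\<close> to the tensor square of the bar construction, which gives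
  uniqueness in the definition of \<open>H0_comult\<close>. By \<open>ret_comult\<close> it sends
  the coproduct to a preimage, which gives existence.\<close>

lemma H0_comult_eq:
 assumes c: "c : carrier H0"
 shows "H0_comult \<Omega> c = tensor_map \<B> \<B> H0 H0 ret ret (bar_comult \<Omega> c)"
proof -
 let ?R = "tensor_map \<B> \<B> H0 H0 ret ret" and ?J = "tensor_map H0 H0 \<B> \<B> (%x. x) (%x. x)"
 note R = lin_tensor_map[OF vs_bar vs_bar vs_H0 vs_H0 ret(1) ret(1)] and Rt = tensor_map_tens[OF vs_bar vs_bar vs_H0 vs_H0 ret(1) ret(1)]
 note J = lin_tensor_map[OF vs_H0 vs_H0 vs_bar vs_bar lin_H0_incl lin_H0_incl] and Jt = tensor_map_tens[OF vs_H0 vs_H0 vs_bar vs_bar lin_H0_incl lin_H0_incl]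
 note HH = vs_tensor[OF vs_H0 vs_H0]
 have dc: "bar_comult \<Omega> c : carrier BB" by (rule lin_closed[OF lin_bar_comult H0_bar_carrier[OF c]])
 note rc = lin_closed[OF R dc]
 have ctr: "ctr2 \<B> f \<psi> (?J (?R s)) = ctr2 \<B> (%x. f (ret x)) (%x. \<psi> (ret x)) s"
  if f: "lf \<B> f" and \<psi>: "lf \<B> \<psi>" and s: "s : carrier BB" for f \<psi> s
 proof (rule tensor_eqI[OF vs_bar vs_bar vs_complex_line lin_comp[OF lin_comp[OF R J] lf_ctr2(1)[OF vs_bar vs_bar f \<psi>]]
    lf_ctr2(1)[OF vs_bar vs_bar lin_comp[OF ret_bar f] lin_comp[OF ret_bar \<psi>]] _ s], goal_cases)
  case (1 x y) note x = 1(1) and y = 1(2)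
  note hx = lin_closed[OF ret(1) x] and hy = lin_closed[OF ret(1) y]
  show ?case
   unfolding Rt[OF x y] Jt[OF hx hy] lf_ctr2(2)[OF vs_bar vs_bar f \<psi> H0_bar_carrier[OF hx] H0_bar_carrier[OF hy]]
    lf_ctr2(2)[OF vs_bar vs_bar lin_comp[OF ret_bar f] lin_comp[OF ret_bar \<psi>] x y] ..
 qed
 have ex: "?J (?R (bar_comult \<Omega> c)) = bar_comult \<Omega> c"
 proof (rule tensor_eqI2[OF vs_bar vs_bar lin_closed[OF J rc] dc], goal_cases)
  case (1 f \<psi>) note f = 1(1) and \<psi> = 1(2)
  show ?case
   unfolding ctr[OF f \<psi> dc] by (rule ret_comult[OF c f \<psi>])
 qed
 have RJ: "?R (?J t) = t" if t: "t : carrier (tensor H0 H0)" for t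
 proof (rule tensor_eqI[OF vs_H0 vs_H0 HH lin_comp[OF J R] lin_id _ t], goal_cases)
  case (1 x y) note x = 1(1) and y = 1(2)
  show ?case
   unfolding Jt[OF x y] Rt[OF H0_bar_carrier[OF x] H0_bar_carrier[OF y]] ret(2)[OF x] ret(2)[OF y] ..
 qed
 show ?thesis unfolding H0_comult_def
 proof (rule the_equality)
  show "?R (bar_comult \<Omega> c) : carrier (tensor H0 H0) \<and> ?J (?R (bar_comult \<Omega> c)) = bar_comult \<Omega> c" using rc ex by (rule conjI)
  fix t assume t: "t : carrier (tensor H0 H0) \<and> ?J t = bar_comult \<Omega> c"
  show "t = ?R (bar_comult \<Omega> c)" using RJ[OF conjunct1[OF t]] conjunct2[OF t] by simp
 qed
qed

definition smul :: "(('o bar_word \<Rightarrow>\<^sub>0 complex) set => 'u) => (('o bar_word \<Rightarrow>\<^sub>0 complex) set => 'u) => ('o bar_word \<Rightarrow>\<^sub>0 complex) set => 'u" where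
 "smul g g' = (\<lambda>c\<in>carrier H0. lin_ext A (%(a, b). a \<otimes>[A] b) (tensor_map H0 H0 A A g g' (H0_comult \<Omega> c)))"

text \<open>By \<open>H0_comult_eq\<close> the coproduct is taken in the bar construction and both
  legs are retracted. So \<open>g\<close> and \<open>g'\<close> are evaluated at retracted words,
  which are the values \<open>cg g\<close> and \<open>cg g'\<close>.\<close>

lemma smul_eq:
 assumes g: "lin H0 A g" and g': "lin H0 A g'" and c: "c : carrier H0"
 shows "smul g g' c = pr (conv (cg g) (cg g')) (cfs c)"
proof -
 let ?G = "%x. g (ret x)" and ?G' = "%x. g' (ret x)"
 let ?m = "lin_ext A (%(a, b). a \<otimes>[A] b)"
 let ?h = "%t. ?m (tensor_map \<B> \<B> A A ?G ?G' t)"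
 note G = lin_comp[OF ret(1) g] and G' = lin_comp[OF ret(1) g']
 note R = lin_tensor_map[OF vs_bar vs_bar vs_H0 vs_H0 ret(1) ret(1)] and Rt = tensor_map_tens[OF vs_bar vs_bar vs_H0 vs_H0 ret(1) ret(1)]
 note gg = lin_tensor_map[OF vs_H0 vs_H0 vA vA g g'] and ggt = tensor_map_tens[OF vs_H0 vs_H0 vA vA g g']
 note GG = lin_tensor_map[OF vs_bar vs_bar vA vA G G'] and GGt = tensor_map_tens[OF vs_bar vs_bar vA vA G G']
 have dc: "bar_comult \<Omega> c : carrier BB" by (rule lin_closed[OF lin_bar_comult H0_bar_carrier[OF c]])
 have "tensor_map H0 H0 A A g g' (tensor_map \<B> \<B> H0 H0 ret ret (bar_comult \<Omega> c)) = tensor_map \<B> \<B> A A ?G ?G' (bar_comult \<Omega> c)"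
 proof (rule tensor_eqI[OF vs_bar vs_bar vs_tensor[OF vA vA] lin_comp[OF R gg] GG _ dc], goal_cases)
  case (1 x y) note x = 1(1) and y = 1(2)
  show ?case
   unfolding Rt[OF x y] GGt[OF x y] ggt[OF lin_closed[OF ret(1) x] lin_closed[OF ret(1) y]] ..
 qed
 then have e: "smul g g' c = ?h (bar_comult \<Omega> c)" using c by (simp add: smul_def H0_comult_eq)
 note h = lin_comp[OF GG lin_tensor_lift[OF vA vA vA mA]]
 obtain N where N: "cfs c : carrier (Uo N)" "c = el N (cfs c)" using H0_Uo[OF c] by blast
 have s: "wsupp N (cfs c)" and s': "\<And>I. I \<notin> Wd N ==> cfs c I = 0" using N(1) unfolding carrier_Uo by blast+
 note gg1 = extd_gam[OF extd_cg[OF g]] extd_gam[OF extd_cg[OF g']]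
 have hE: "?h (tB (EB I) (EB J)) = cg g I \<otimes>[A] cg g' J" if "I : Wd N" "J : Wd N" for I J
  unfolding GGt[OF EB_closed[OF that(1)] EB_closed[OF that(2)]] cg_def
  by (rule tensor_lift_tens[OF vA vA vA mA lin_closed[OF G EB_closed[OF that(1)]] lin_closed[OF G' EB_closed[OF that(2)]]])
 show ?thesis unfolding e
 proof (rule vs_eqI[OF vA lin_closed[OF h dc] pr_closed[OF gam_conv[OF gg1] s]], goal_cases)
  case (1 \<phi>) note \<phi> = 1(1)
  have "\<phi> (?h (bar_comult \<Omega> c)) = \<phi> (?h (bar_comult \<Omega> (el N (cfs c))))" using N(2) by simp
  also have "... = (\<Sum>I\<in>Wd N. \<Sum>J\<in>Wd N. cfs c (I @ J) * \<phi> (?h (tB (EB I) (EB J))))" by (rule bar_comult_el[OF lin_comp[OF h \<phi>] s'])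
  also have "... = (\<Sum>I\<in>Wd N. \<Sum>J\<in>Wd N. cfs c (I @ J) * \<phi> (cg g I \<otimes>[A] cg g' J))" by (intro sum.cong refl) (simp only: hE)
  also have "... = \<phi> (pr (conv (cg g) (cg g')) (cfs c))" by (rule lf_pr_conv[OF \<phi> gg1 s, symmetric])
  finally show ?case .
 qed
qed

subsection \<open>The isomorphism\<close>

definition Phi :: "('o, 'u) aut_family => ('o bar_word \<Rightarrow>\<^sub>0 complex) set => 'u" where
 "Phi l = (THE g. g : alg_hom H0 A \<and> corr l g)"

lemma alg_hom_hom: "g : alg_hom H0 A ==> g : lin_hom H0 A"
 by (simp add: alg_hom_def)

lemma Phi_eq:
 assumes "g : alg_hom H0 A" "corr l g"
 shows "Phi l = g"
 unfolding Phi_def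
proof (rule the_equality)
 show "g : alg_hom H0 A \<and> corr l g" using assms by (rule conjI)
 fix g' assume g': "g' : alg_hom H0 A \<and> corr l g'"
 show "g' = g" by (rule corr_unique[OF conjunct2[OF g'] assms(2) alg_hom_hom[OF conjunct1[OF g']] alg_hom_hom[OF assms(1)]])
qed

lemma Phi:
 assumes "l : tensor_auts \<Omega> A"
 shows "Phi l : alg_hom H0 A" "corr l (Phi l)"
proof -
 obtain g where g: "g : alg_hom H0 A" "corr l g" using aut_corr[OF assms] by blast
 show "Phi l : alg_hom H0 A" "corr l (Phi l)" unfolding Phi_eq[OF g] by (rule g)+
qed

lemma Phi_cg:
 assumes g: "g : alg_hom H0 A"
 shows "extd (cg g) g" "Lfam (cg g) : tensor_auts \<Omega> A" "corr (Lfam (cg g)) g"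
proof -
 show e: "extd (cg g) g" by (rule extd_cg[OF lin_homD[OF alg_hom_hom[OF g]]])
 show "Lfam (cg g) : tensor_auts \<Omega> A" by (rule Lfam_aut[OF g e])
 show "corr (Lfam (cg g)) g" by (rule corr_Lfam[OF e])
qed

text \<open>Every tensor automorphism is a word operator, so that products of automorphisms can be
  computed by convolution.\<close>

lemma aut_Lfam:
 assumes l: "l : tensor_auts \<Omega> A"
 shows "l = Lfam (cg (Phi l))"
 by (rule corr_aut_unique[OF l Phi_cg(2)[OF Phi(1)[OF l]] Phi(2)[OF l] Phi_cg(3)[OF Phi(1)[OF l]]])

lemma Phi_bij: "bij_betw Phi (tensor_auts \<Omega> A) (alg_hom H0 A)"
 unfolding bij_betw_def
proof (intro conjI inj_onI equalityI subsetI)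
 fix l l' assume l: "l : tensor_auts \<Omega> A" and l': "l' : tensor_auts \<Omega> A" and e: "Phi l = Phi l'"
 show "l = l'" by (rule corr_aut_unique[OF l l' Phi(2)[OF l] Phi(2)[OF l', folded e]])
next
 fix g assume "g : Phi ` tensor_auts \<Omega> A"
 then show "g : alg_hom H0 A" using Phi(1) by blast
next
 fix g assume g: "g : alg_hom H0 A"
 show "g : Phi ` tensor_auts \<Omega> A" using Phi_eq[OF g Phi_cg(3)[OF g]] Phi_cg(2)[OF g] by (metis imageI)
qed

lemma Phi_model:
 assumes l: "l : tensor_auts \<Omega> A" and c: "c : carrier H0"
 shows "\<exists>(Z :: 'o object) \<nu> e. uni Z \<and> lf (fibre Z) \<nu> \<and> e : carrier (fibre Z) \<and> cof Z \<nu> e = cfs c \<and> Phi l c = val l Z \<nu> e"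
proof -
 obtain N where N: "cfs c : carrier (Uo N)" using H0_Uo[OF c] by blast
 obtain Z :: "'o object" and T \<nu> where Z: "uni Z" "lin (Uo N) (fibre Z) T" "lf (fibre Z) \<nu>"
  and cT: "\<forall>x\<in>carrier (Uo N). cof Z \<nu> (T x) = x" using model_H0[of N] by blast
 note e = lin_closed[OF Z(2) N] and eq = bspec[OF cT N]
 show ?thesis using Z(1,3) e eq corrD[OF Phi(2)[OF l] Z(1,3) e c eq] by blast
qed

text \<open>Composition of automorphisms and multiplication of characters both become the
  convolution of \<open>cg (Phi l)\<close> and \<open>cg (Phi l')\<close>, by
  \<open>Lg_comp_ctr\<close> and \<open>smul_eq\<close>.\<close>

lemma Phi_mult:
 assumes l: "l : tensor_auts \<Omega> A" and l': "l' : tensor_auts \<Omega> A"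
 shows "Phi (acomp l l') = smul (Phi l) (Phi l')"
proof (rule extensionalityI[where A="carrier H0"])
 note ll = acomp_aut[OF l l']
 show "Phi (acomp l l') : extensional (carrier H0)" using alg_hom_hom[OF Phi(1)[OF ll]] by (simp add: lin_hom_iff)
 show "smul (Phi l) (Phi l') : extensional (carrier H0)" by (simp add: smul_def)
 fix c assume c: "c : carrier H0"
 obtain Z :: "'o object" and \<nu> e where Z: "uni Z" "lf (fibre Z) \<nu>" "e : carrier (fibre Z)" "cof Z \<nu> e = cfs c"
  and v: "Phi (acomp l l') c = val (acomp l l') Z \<nu> e" using Phi_model[OF ll c] by blast
 let ?g = "cg (Phi l)" and ?g' = "cg (Phi l')"
 note gam = extd_gam[OF Phi_cg(1)[OF Phi(1)[OF l]]] extd_gam[OF Phi_cg(1)[OF Phi(1)[OF l']]]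
 note t = tens_closed[OF uniD(2)[OF Z(1)] vA Z(3) one_closedA]
 have lZ: "l Z = Lg ?g Z" "l' Z = Lg ?g' Z" using fun_cong[OF aut_Lfam[OF l], of Z] fun_cong[OF aut_Lfam[OF l'], of Z] by (simp_all add: Lfam_apply[OF Z(1)])
 have "val (acomp l l') Z \<nu> e = pr (conv ?g ?g') (cof Z \<nu> e) \<otimes>[A] \<one>[A]"
  unfolding val_def acomp_apply[OF Z(1) t] lZ by (rule Lg_comp_ctr[OF Z(1) gam Z(2,3) one_closedA])
 also have "... = pr (conv ?g ?g') (cfs c)" using pr_closed[OF gam_conv[OF gam] cof_supp[OF Z(1-3)]] by (simp add: Z(4))
 also have "... = smul (Phi l) (Phi l') c"
  by (rule smul_eq[OF lin_homD[OF alg_hom_hom[OF Phi(1)[OF l]]] lin_homD[OF alg_hom_hom[OF Phi(1)[OF l']]] c, symmetric])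
 finally show "Phi (acomp l l') c = smul (Phi l) (Phi l') c" unfolding v .
qed

text \<open>The identity has the matrix coefficients \<nu> e of the fibre itself. This number is the
  coefficient of the empty word, which is the counit.\<close>

lemma Phi_one: "Phi aone = (\<lambda>c\<in>carrier H0. bar_counit c \<odot>[A] \<one>[A])"
proof (rule extensionalityI[where A="carrier H0"])
 show "Phi aone : extensional (carrier H0)" using alg_hom_hom[OF Phi(1)[OF aone_aut]] by (simp add: lin_hom_iff)
 fix c assume c: "c : carrier H0"
 obtain Z :: "'o object" and \<nu> e where Z: "uni Z" "lf (fibre Z) \<nu>" "e : carrier (fibre Z)" "cof Z \<nu> e = cfs c"
  and v: "Phi aone c = val aone Z \<nu> e" using Phi_model[OF aone_aut c] by blast
 note t = tens_closed[OF uniD(2)[OF Z(1)] vA Z(3) one_closedA]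
 have "val aone Z \<nu> e = \<nu> e \<odot>[A] \<one>[A]"
  unfolding val_def aone_apply[OF Z(1) t] by (rule ctr_l(2)[OF uniD(2)[OF Z(1)] vA Z(2,3) one_closedA])
 also have "\<nu> e = bar_counit c" using fun_cong[OF Z(4), of "[]"] bar_counit_H0[OF H0_part[OF c]] by (simp add: cof_def)
 finally show "Phi aone c = (\<lambda>c\<in>carrier H0. bar_counit c \<odot>[A] \<one>[A]) c" using c by (simp add: v)
qed simp

abbreviation "SG \<equiv> Spec_group H0 (H0_comult \<Omega>) bar_counit A"

lemma SG_simps: "carrier SG = alg_hom H0 A" "g \<otimes>[SG] g' = smul g g'" "\<one>[SG] = (\<lambda>c\<in>carrier H0. bar_counit c \<odot>[A] \<one>[A])"
 by (simp_all add: Spec_group_def smul_def)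

lemma Phi_iso: "Phi : iso (pi1_un \<Omega> A) SG"
 by (rule isoI) (auto simp: hom_def pi1_simps SG_simps Phi(1) Phi_mult Phi_bij)

text \<open>The image of a group under a multiplicative map is a group, and \<open>Phi\<close> is
  onto the characters with \<open>Phi aone\<close> as the counit. No Hopf algebra axiom is verified
  directly.\<close>

lemma group_SG: "group SG"
proof -
 have "Phi : hom (pi1_un \<Omega> A) SG" using Phi_iso by (simp add: iso_def)
 from group.hom_imp_img_group[OF group_pi1 this]
 have "group (SG\<lparr>carrier := alg_hom H0 A, one := \<one>[SG]\<rparr>)"
  unfolding pi1_simps Phi_one SG_simps(3)[symmetric] using bij_betw_imp_surj_on[OF Phi_bij] by simp
 moreover have "SG\<lparr>carrier := alg_hom H0 A, one := \<one>[SG]\<rparr> = SG" by (simp add: Spec_group_def)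
 ultimately show ?thesis by simp
qed

end

subsection \<open>Base change\<close>

text \<open>\<open>pi1_un_map\<close> is a unique description, so an automorphism over
  \<open>A'\<close> satisfying it has to be exhibited and shown to be the only one. Both parts go
  through the character \<open>g2\<close>, the composite of \<open>f\<close> with the character of
  \<open>l\<close>.\<close>

lemma (in form_algebra) Phi_natural:
 fixes A A' :: "'u cmod"
 assumes A: "Module.algebra CC A" and A': "Module.algebra CC A'" and f: "f : alg_hom A A'" and l: "l : tensor_auts \<Omega> A"
 shows "scalars.Phi \<Omega> A' (pi1_un_map \<Omega> A A' f l) = compose (carrier H0) f (scalars.Phi \<Omega> A l)"
proof -
 interpret a: scalars \<Omega> A by (rule scalars.intro[OF form_algebra_axioms scalars_axioms.intro[OF A]])
 interpret b: scalars \<Omega> A' by (rule scalars.intro[OF form_algebra_axioms scalars_axioms.intro[OF A']])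
 have f1: "lin A A' f" and f2: "f : ring_hom A A'" using f by (auto simp: alg_hom_def lin_hom_iff)
 note fm = ring_hom_mult[OF f2] and fo = ring_hom_one[OF f2]
 define g where "g = a.Phi l"
 have g: "g : alg_hom H0 A" "a.corr l g" unfolding g_def by (rule a.Phi[OF l])+
 define g2 where "g2 = compose (carrier H0) f g"
 note gl = lin_homD[OF a.alg_hom_hom[OF g(1)]]
 have g2c: "g2 c = f (g c)" if "c : carrier H0" for c using that by (simp add: g2_def compose_def)
 have g2: "g2 : alg_hom H0 A'" unfolding b.alg_hom_iff
 proof (intro conjI ballI)
  have "g2 = restrict (%c. f (g c)) (carrier H0)" by (simp add: g2_def compose_def)
  then show "g2 : lin_hom H0 A'" using lin_restrict[OF vs_H0 lin_comp[OF gl f1]] by simp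
  show "g2 (c \<otimes>[\<B>] d) = g2 c \<otimes>[A'] g2 d" if c: "c : carrier H0" and d: "d : carrier H0" for c d
  proof -
   have "g (c \<otimes>[\<B>] d) = g c \<otimes>[A] g d" using g(1) c d unfolding a.alg_hom_iff by blast
   then show ?thesis unfolding g2c[OF c] g2c[OF d] g2c[OF a.H0_mult_closed[OF c d]] using fm[OF lin_closed[OF gl c] lin_closed[OF gl d]] by simp
  qed
  have "g (EB []) = \<one>[A]" using g(1) unfolding a.alg_hom_iff by blast
  then show "g2 (EB []) = \<one>[A']" unfolding g2c[OF H0_one(1)] using fo by simp
 qed
 let ?f = "%E. tensor_map E A E A' (%e. e) f"
 have ff: "lin (tensor E A) (tensor E A') (?f E)" "e : carrier E ==> x : carrier A ==> ?f E (tens E A e x) = tens E A' e (f x)"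
  if "vs E" for E :: "(nat => complex) cmod" and e x
  by (rule lin_tensor_map[OF that a.vA that b.vA lin_id f1], rule tensor_map_tens[OF that a.vA that b.vA lin_id f1])
 have fctr: "ctr_l A' \<mu> (?f E w) = f (ctr_l A \<mu> w)"
  if E: "vs E" and \<mu>: "lf E \<mu>" and w: "w : carrier (tensor E A)" for E :: "(nat => complex) cmod" and \<mu> w
 proof (rule tensor_eqI[OF E a.vA b.vA lin_comp[OF ff(1)[OF E] ctr_l(1)[OF E b.vA \<mu>]] lin_comp[OF ctr_l(1)[OF E a.vA \<mu>] f1] _ w], goal_cases)
  case (1 e x) note e = 1(1) and x = 1(2)
  show ?case
   unfolding ff(2)[OF E e x] ctr_l(2)[OF E b.vA \<mu> e lin_closed[OF f1 x]] ctr_l(2)[OF E a.vA \<mu> e x] lin_smult[OF f1 x] ..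
 qed
 let ?prop = "%l'. l' : tensor_auts \<Omega> A' \<and> (\<forall>X\<in>unipotent_objects \<Omega>. \<forall>u\<in>carrier (scalar_ext X A). l' X (?f (fibre X) u) = ?f (fibre X) (l X u))"
 \<comment> \<open>Uniqueness: as \<open>f\<close> preserves the unit, it carries
   \<open>e \<otimes> 1\<close> to \<open>e \<otimes> 1\<close>, so compatibility with
   \<open>l\<close> forces \<open>l'\<close> to correspond to \<open>g2\<close>.\<close>
 have pc: "b.corr l' g2" if p: "?prop l'" for l'
  unfolding b.corr_def
 proof (intro allI impI)
  fix X :: "'o object" and \<mu> e c
  assume X: "b.uni X" and \<mu>: "lf (fibre X) \<mu>" and e: "e : carrier (fibre X)" and c: "c : carrier H0" and eq: "cof X \<mu> e = cfs c"
  have Xa: "a.uni X" using X by (simp add: a.uni_def b.uni_def)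
  note E = b.uniD(2)[OF X]
  note t = tens_closed[OF E a.vA e a.one_closedA]
  have "g2 c = f (a.val l X \<mu> e)" unfolding g2c[OF c] a.corrD[OF g(2) Xa \<mu> e c eq] ..
  also have "... = ctr_l A' \<mu> (?f (fibre X) (l X (tens (fibre X) A e \<one>[A])))"
   unfolding a.val_def by (rule fctr[OF E \<mu> a.aut_closed[OF l Xa t], symmetric])
  also have "?f (fibre X) (l X (tens (fibre X) A e \<one>[A])) = l' X (?f (fibre X) (tens (fibre X) A e \<one>[A]))"
   using p X t unfolding b.uni_objects[symmetric] by metis
  also have "?f (fibre X) (tens (fibre X) A e \<one>[A]) = tens (fibre X) A' e \<one>[A']"
   unfolding ff(2)[OF E e a.one_closedA] fo ..
  finally show "g2 c = b.val l' X \<mu> e" unfolding b.val_def .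
 qed
 define \<gamma> where "\<gamma> = a.cg g"
 have \<gamma>: "a.extd \<gamma> g" unfolding \<gamma>_def by (rule a.Phi_cg(1)[OF g(1)])
 note G = a.extd_gam[OF \<gamma>]
 have lL: "l = a.Lfam \<gamma>" unfolding \<gamma>_def g_def by (rule a.aut_Lfam[OF l])
 \<comment> \<open>Existence: the word operator over \<open>A'\<close> whose coefficients are the
   images under \<open>f\<close> of those of \<open>l\<close>.\<close>
 define \<gamma>2 where "\<gamma>2 I = f (\<gamma> I)" for I
 have G2: "b.gam \<gamma>2" using G lin_closed[OF f1] by (simp add: a.gam_def b.gam_def \<gamma>2_def)
 have f_pr: "f (a.pr \<gamma> x) = b.pr \<gamma>2 x" if x: "\<forall>I. I \<notin> Wd N --> x I = 0" for x N
 proof -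
  note gI = a.gamD[OF G]
  have "f (a.pr \<gamma> x) = (\<Oplus>\<^bsub>A'\<^esub>I\<in>Wd N. f (x I \<odot>[A] \<gamma> I))"
   unfolding a.pr_Wd[OF G x] by (rule lin_finsum[OF f1 a.vA b.vA vs_smult[OF a.vA gI]])
  also have "... = (\<Oplus>\<^bsub>A'\<^esub>I\<in>Wd N. x I \<odot>[A'] \<gamma>2 I)"
  proof (rule vs_finsum_cong[OF b.vA refl vs_smult[OF b.vA b.gamD[OF G2]]])
   fix I assume I: "I : Wd N"
   show "f (x I \<odot>[A] \<gamma> I) = x I \<odot>[A'] \<gamma>2 I" unfolding \<gamma>2_def by (rule lin_smult[OF f1 gI[OF I]])
  qed
  finally show ?thesis unfolding b.pr_Wd[OF G2 x] .
 qed
 have e2: "b.extd \<gamma>2 g2" unfolding b.extd_def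
 proof (intro conjI ballI G2)
  fix c assume c: "c : carrier H0"
  obtain N where N: "cfs c : carrier (Uo N)" using H0_Uo[OF c] by blast
  then have s: "\<forall>I. I \<notin> Wd N --> cfs c I = 0" unfolding carrier_Uo by blast
  show "g2 c = b.pr \<gamma>2 (cfs c)" unfolding g2c[OF c] a.extd_eq[OF \<gamma> c] by (rule f_pr[OF s])
 qed
 define l2 where "l2 = b.Lfam \<gamma>2"
 have l2: "l2 : tensor_auts \<Omega> A'" "b.corr l2 g2" unfolding l2_def by (rule b.Lfam_aut[OF g2 e2], rule b.corr_Lfam[OF e2])
 have P2: "?prop l2"
 proof (intro conjI ballI l2(1))
  fix X :: "'o object" and u assume "X : unipotent_objects \<Omega>" and u: "u : carrier (scalar_ext X A)"
  then have X: "b.uni X" and Xa: "a.uni X" unfolding b.uni_objects a.uni_objects by auto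
  note E = b.uniD(2)[OF X]
  note L = lin_homD[OF a.Lg_hom[OF Xa G]] and L2 = lin_homD[OF b.Lg_hom[OF X G2]]
  have "b.Lg \<gamma>2 X (?f (fibre X) u) = ?f (fibre X) (a.Lg \<gamma> X u)"
  proof (rule tensor_eqI[OF E a.vA vs_tensor[OF E b.vA] lin_comp[OF ff(1)[OF E] L2] lin_comp[OF L ff(1)[OF E]] _ u], goal_cases)
   case (1 e x) note e = 1(1) and x = 1(2)
   note t = tens_closed[OF E a.vA e x]
   show ?case
   proof (rule b.scalar_eqI[OF E lin_closed[OF L2 lin_closed[OF ff(1)[OF E] t]] lin_closed[OF ff(1)[OF E] lin_closed[OF L t]]], goal_cases)
    case (1 \<mu>) note \<mu> = 1(1)
    note s = a.cof_supp[OF Xa \<mu> e]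
    show ?case
     unfolding fctr[OF E \<mu> lin_closed[OF L t]] ff(2)[OF E e x] b.Lg_ctr[OF X G2 \<mu> e lin_closed[OF f1 x]] a.Lg_ctr[OF Xa G \<mu> e x]
      fm[OF a.pr_closed[OF G s] x] f_pr[OF s] ..
   qed
  qed
  then show "l2 X (?f (fibre X) u) = ?f (fibre X) (l X u)" unfolding l2_def lL a.Lfam_apply[OF Xa] b.Lfam_apply[OF X] .
 qed
 have "pi1_un_map \<Omega> A A' f l = l2" unfolding pi1_un_map_def
 proof (rule the_equality)
  show "?prop l2" by (rule P2)
  fix l' assume p: "?prop l'"
  show "l' = l2" by (rule b.corr_aut_unique[OF conjunct1[OF p] l2(1) pc[OF p] l2(2)])
 qed
 then show ?thesis using b.Phi_eq[OF g2 l2(2)] by (simp add: g2_def g_def)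
qed

theorem theorem4p3p1:
  fixes N :: "'n::real_vector set" and N' :: "'m::real_vector set"
    and \<pi> :: "'n \<Rightarrow> 'm" and \<Delta> :: "'m set set" and R :: "'n set set"
  assumes "enriched_fan N N' \<pi> \<Delta> R"
  defines "\<Omega> \<equiv> trop_deRham \<pi> \<Delta> R"
  shows "isomorphic_group_functors
           (pi1_un \<Omega> :: 'u cmod \<Rightarrow> (('n, 'm) trop_form, 'u) aut_family monoid)
           (pi1_un_map \<Omega>)
           (Spec_group (H0_bar \<Omega>) (H0_comult \<Omega>) bar_counit)
           (Spec_map (H0_bar \<Omega>))"
proof -
 interpret form_algebra \<Omega> unfolding \<Omega>_def by (rule trop_form_algebra[OF assms(1)])
 have sc: "scalars \<Omega> A" if "Module.algebra CC A" for A :: "'u cmod"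
  by (rule scalars.intro[OF form_algebra_axioms scalars_axioms.intro[OF that]])
 show ?thesis unfolding isomorphic_group_functors_def
 proof (intro exI[of _ "scalars.Phi \<Omega>"] conjI allI impI ballI)
  fix A :: "'u cmod" assume A: "Module.algebra CC A"
  show "group (pi1_un \<Omega> A)" by (rule scalars.group_pi1[OF sc[OF A]])
  show "group (Spec_group (H0_bar \<Omega>) (H0_comult \<Omega>) bar_counit A)" by (rule scalars.group_SG[OF sc[OF A]])
  show "scalars.Phi \<Omega> A : iso (pi1_un \<Omega> A) (Spec_group (H0_bar \<Omega>) (H0_comult \<Omega>) bar_counit A)"
   by (rule scalars.Phi_iso[OF sc[OF A]])
 next
  fix A A' :: "'u cmod" and f and l :: "(('n, 'm) trop_form, 'u) aut_family"
  assume "Module.algebra CC A \<and> Module.algebra CC A' \<and> f : alg_hom A A'" and l: "l : carrier (pi1_un \<Omega> A)"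
  then show "scalars.Phi \<Omega> A' (pi1_un_map \<Omega> A A' f l) = Spec_map (H0_bar \<Omega>) A A' f (scalars.Phi \<Omega> A l)"
   using Phi_natural[of A A' f l] by (simp add: Spec_map_def scalars.pi1_simps[OF sc])
 qed
qed

end
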